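(* Let $w=w_{81}$ be the Atkin-Lehner involution of $X_0(81)$ attached to $81$. There exist $x,y,t\in\mathbb{Q}(X_0(81))$ such that $\mathbb{Q}(X_0(81))=\mathbb{Q}(x,y,t)$, the subfield of functions invariant under $w^*$ is $\mathbb{Q}(x,y)$, $w^*(t)=-t$, and $$y^2+y=x^3,$$ $$\begin{aligned}t^2={}&-968+132x+837x^2-3213x^3+4107x^4-2223x^5+510x^6-21x^7-9x^8+x^9\\&-3(-1+x)(-29+27x-9x^2+x^3)(11+24x-15x^2+2x^3)y.\end{aligned}$$ In particular these two equations are equations for $X_0(81)$ over $\mathbb{Q}$ (up to birational equivalence over $\mathbb{Q}$).
   Context: $X_0(N)$ denotes the smooth projective curve over $\mathbb{Q}$ attached to $\Gamma_0(N)$, where $\mathbb{Q}(X_0(N))$ is the subfield of $\mathbb{C}(X_0(N))$ of functions with rational $q$-expansion at the cusp $\infty$, $q=e^{2\pi i z}$. For a positive divisor $d$ of $N$ coprime to $N/d$, the Atkin-Lehner involution $w_d$ of $X_0(N)$ is induced by any matrix $\frac{1}{\sqrt d}\begin{pmatrix} A d & B\\ N C & D d\end{pmatrix}$ of determinant $1$ with $A,B,C,D\in\mathbb{Z}$; it is defined over $\mathbb{Q}$. *)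

theory Defs
  imports "HOL-Complex_Analysis.Complex_Analysis"
begin

section \<open>The field of meromorphic functions on the upper half plane\<close>

definition uhp :: "complex set" where
  "uhp = {z. Im z > 0}"

text \<open>
  A meromorphic function is represented by its unique representative that has no removable
  singularities, takes the value 0 at its poles, and is 0 outside the upper half plane. Hence
  equality in this type is equality of meromorphic functions.
\<close>

typedef mero_uhp = "{f. f nicely_meromorphic_on uhp \<and> (\<forall>z. z \<notin> uhp \<longrightarrow> f z = 0)}"
  morphisms eval_mero Abs_mero
  by (rule exI[of _ "\<lambda>_. 0"]) auto

definition mero :: "(complex \<Rightarrow> complex) \<Rightarrow> mero_uhp" where
  "mero f = Abs_mero (\<lambda>z. if z \<in> uhp \<and> f meromorphic_on uhp then remove_sings f z else 0)"

lemma open_uhp [simp, intro]: "open uhp"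
  unfolding uhp_def by (simp add: open_halfspace_Im_gt)

lemma connected_uhp [simp, intro]: "connected uhp"
  unfolding uhp_def by (simp add: convex_connected convex_halfspace_Im_gt)

lemma ii_in_uhp [simp]: "\<i> \<in> uhp"
  by (simp add: uhp_def)

lemma nicely_meromorphic_on_cong_open:
  assumes "f nicely_meromorphic_on A" "open A" "\<And>z. z \<in> A \<Longrightarrow> f z = g z"
  shows   "g nicely_meromorphic_on A"
proof -
  have ev: "eventually (\<lambda>w. f w = g w) (at z)" if "z \<in> A" for z
    using eventually_at_in_open'[OF assms(2) that] by eventually_elim (use assms(3) in auto)
  have "g meromorphic_on A"
    using meromorphic_on_cong[of A f g A] ev assms(1)
    by (auto simp: nicely_meromorphic_on_def)
  moreover have "(is_pole g z \<and> g z = 0) \<or> g \<midarrow>z\<rightarrow> g z" if z: "z \<in> A" for z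
  proof -
    have "is_pole f z \<longleftrightarrow> is_pole g z"
      by (intro is_pole_cong ev z refl)
    moreover have "f \<midarrow>z\<rightarrow> f z \<longleftrightarrow> g \<midarrow>z\<rightarrow> f z"
      by (intro tendsto_cong ev z)
    ultimately show ?thesis
      using assms(1,3) z by (auto simp: nicely_meromorphic_on_def)
  qed
  ultimately show ?thesis
    by (auto simp: nicely_meromorphic_on_def)
qed

lemma eval_mero_mero:
  "eval_mero (mero f) = (\<lambda>z. if z \<in> uhp \<and> f meromorphic_on uhp then remove_sings f z else 0)"
proof (cases "f meromorphic_on uhp")
  case True
  have "(\<lambda>z. if z \<in> uhp \<and> f meromorphic_on uhp then remove_sings f z else 0) nicely_meromorphic_on uhp"
    by (rule nicely_meromorphic_on_cong_open[OF remove_sings_nicely_meromorphic[OF True]])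
       (use True in auto)
  thus ?thesis
    unfolding mero_def by (subst Abs_mero_inverse) auto
next
  case False
  thus ?thesis
    unfolding mero_def by (subst Abs_mero_inverse) auto
qed

lemma nicely_meromorphic_eval_mero: "eval_mero f nicely_meromorphic_on uhp"
  using eval_mero[of f] by auto

lemma meromorphic_eval_mero [meromorphic_intros]: "eval_mero f meromorphic_on uhp"
  using nicely_meromorphic_eval_mero[of f] by (auto simp: nicely_meromorphic_on_def)

lemma eval_mero_outside: "z \<notin> uhp \<Longrightarrow> eval_mero f z = 0"
  using eval_mero[of f] by auto

lemma eval_mero_mero_ae:
  assumes "f meromorphic_on uhp"
  shows   "\<forall>\<^sub>\<approx>z\<in>uhp. eval_mero (mero f) z = f z"
proof -
  have "\<forall>\<^sub>\<approx>z\<in>uhp. z \<in> uhp"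
    by (simp add: eventually_in_cosparse)
  thus ?thesis
    using eventually_remove_sings_eq[OF assms]
    by eventually_elim (use assms in \<open>auto simp: eval_mero_mero\<close>)
qed

lemma mero_uhp_eqI_ae:
  assumes "\<forall>\<^sub>\<approx>z\<in>uhp. eval_mero f z = eval_mero g z"
  shows   "f = g"
proof -
  have "eval_mero f z = eval_mero g z" for z
  proof (cases "z \<in> uhp")
    case True
    have ev: "eventually (\<lambda>w. eval_mero f w = eval_mero g w) (at z)"
      using assms True by (auto simp: eventually_cosparse_open_eq)
    have 1: "remove_sings (eval_mero h) z = eval_mero h z" for h
    proof -
      have "(is_pole (eval_mero h) z \<and> eval_mero h z = 0) \<or> eval_mero h \<midarrow>z\<rightarrow> eval_mero h z"
        using nicely_meromorphic_eval_mero[of h] True by (auto simp: nicely_meromorphic_on_def)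
      thus ?thesis
        by (metis remove_sings_at_pole remove_sings_eqI)
    qed
    have "remove_sings (eval_mero f) z = remove_sings (eval_mero g) z"
      by (intro remove_sings_cong ev refl)
    thus ?thesis
      by (simp add: 1)
  qed (auto simp: eval_mero_outside)
  thus ?thesis
    by (metis eval_mero_inject ext)
qed

lemma mero_eval_mero [simp]: "mero (eval_mero f) = f"
  by (rule mero_uhp_eqI_ae, rule eval_mero_mero_ae, rule meromorphic_eval_mero)

instantiation mero_uhp :: field
begin

definition "0 = mero (\<lambda>_. 0)"
definition "1 = mero (\<lambda>_. 1)"
definition "f + g = mero (\<lambda>z. eval_mero f z + eval_mero g z)"
definition "f - g = mero (\<lambda>z. eval_mero f z - eval_mero g z)"
definition "- f = mero (\<lambda>z. - eval_mero f z)"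
definition "f * g = mero (\<lambda>z. eval_mero f z * eval_mero g z)"
definition "inverse f = mero (\<lambda>z. inverse (eval_mero f z))"
definition "f div g = mero (\<lambda>z. eval_mero f z / eval_mero g z)"

lemma eval_mero_ops_ae:
  "\<forall>\<^sub>\<approx>z\<in>uhp. eval_mero 0 z = 0"
  "\<forall>\<^sub>\<approx>z\<in>uhp. eval_mero 1 z = 1"
  "\<forall>\<^sub>\<approx>z\<in>uhp. eval_mero (f + g) z = eval_mero f z + eval_mero g z"
  "\<forall>\<^sub>\<approx>z\<in>uhp. eval_mero (f - g) z = eval_mero f z - eval_mero g z"
  "\<forall>\<^sub>\<approx>z\<in>uhp. eval_mero (- f) z = - eval_mero f z"
  "\<forall>\<^sub>\<approx>z\<in>uhp. eval_mero (f * g) z = eval_mero f z * eval_mero g z"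
  "\<forall>\<^sub>\<approx>z\<in>uhp. eval_mero (inverse f) z = inverse (eval_mero f z)"
  "\<forall>\<^sub>\<approx>z\<in>uhp. eval_mero (f div g) z = eval_mero f z / eval_mero g z"
  unfolding zero_mero_uhp_def one_mero_uhp_def plus_mero_uhp_def minus_mero_uhp_def
    uminus_mero_uhp_def times_mero_uhp_def inverse_mero_uhp_def divide_mero_uhp_def
  by (rule eval_mero_mero_ae; intro meromorphic_intros)+

lemma eval_mero_nonzero_ae:
  assumes "f \<noteq> 0"
  shows   "\<forall>\<^sub>\<approx>z\<in>uhp. eval_mero f z \<noteq> 0"
proof (rule ccontr)
  assume "\<not> ?thesis"
  hence "\<forall>\<^sub>\<approx>z\<in>uhp. eval_mero f z = 0"
    using meromorphic_imp_constant_or_avoid[OF meromorphic_eval_mero open_uhp connected_uhp, of f 0]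
    by auto
  hence "\<forall>\<^sub>\<approx>z\<in>uhp. eval_mero f z = eval_mero 0 z"
    using eval_mero_ops_ae(1) by eventually_elim auto
  hence "f = 0"
    by (rule mero_uhp_eqI_ae)
  with assms show False
    by contradiction
qed

instance proof
  fix f g h :: mero_uhp
  show "f * g * h = f * (g * h)"
    using eval_mero_ops_ae(6)[of "f * g" h] eval_mero_ops_ae(6)[of f "g * h"]
      eval_mero_ops_ae(6)[of f g] eval_mero_ops_ae(6)[of g h]
    by (intro mero_uhp_eqI_ae, eventually_elim) auto
  show "f * g = g * f"
    using eval_mero_ops_ae(6)[of f g] eval_mero_ops_ae(6)[of g f]
    by (intro mero_uhp_eqI_ae, eventually_elim) auto
  show "1 * f = f"
    using eval_mero_ops_ae(6)[of 1 f] eval_mero_ops_ae(2)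
    by (intro mero_uhp_eqI_ae, eventually_elim) auto
  show "f + g + h = f + (g + h)"
    using eval_mero_ops_ae(3)[of "f + g" h] eval_mero_ops_ae(3)[of f "g + h"]
      eval_mero_ops_ae(3)[of f g] eval_mero_ops_ae(3)[of g h]
    by (intro mero_uhp_eqI_ae, eventually_elim) auto
  show "f + g = g + f"
    using eval_mero_ops_ae(3)[of f g] eval_mero_ops_ae(3)[of g f]
    by (intro mero_uhp_eqI_ae, eventually_elim) auto
  show "0 + f = f"
    using eval_mero_ops_ae(3)[of 0 f] eval_mero_ops_ae(1)
    by (intro mero_uhp_eqI_ae, eventually_elim) auto
  show "- f + f = 0"
    using eval_mero_ops_ae(3)[of "-f" f] eval_mero_ops_ae(1) eval_mero_ops_ae(5)[of f]
    by (intro mero_uhp_eqI_ae, eventually_elim) auto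
  show "f - g = f + - g"
    using eval_mero_ops_ae(3)[of f "-g"] eval_mero_ops_ae(4)[of f g] eval_mero_ops_ae(5)[of g]
    by (intro mero_uhp_eqI_ae, eventually_elim) auto
  show "(f + g) * h = f * h + g * h"
    using eval_mero_ops_ae(6)[of "f + g" h] eval_mero_ops_ae(3)[of f g]
      eval_mero_ops_ae(6)[of f h] eval_mero_ops_ae(6)[of g h] eval_mero_ops_ae(3)[of "f * h" "g * h"]
    by (intro mero_uhp_eqI_ae, eventually_elim) (auto simp: algebra_simps)
  show "f div g = f * inverse g"
    using eval_mero_ops_ae(8)[of f g] eval_mero_ops_ae(6)[of f "inverse g"] eval_mero_ops_ae(7)[of g]
    by (intro mero_uhp_eqI_ae, eventually_elim) (auto simp: field_simps)
  show "inverse f * f = 1" if "f \<noteq> 0"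
    using eval_mero_ops_ae(6)[of "inverse f" f] eval_mero_ops_ae(7)[of f] eval_mero_ops_ae(2)
      eval_mero_nonzero_ae[OF that]
    by (intro mero_uhp_eqI_ae, eventually_elim) auto
  show "inverse 0 = (0 :: mero_uhp)"
    using eval_mero_ops_ae(7)[of 0] eval_mero_ops_ae(1)
    by (intro mero_uhp_eqI_ae, eventually_elim) auto
  show "(0 :: mero_uhp) \<noteq> 1"
  proof
    assume eq: "(0 :: mero_uhp) = 1"
    have "\<forall>\<^sub>\<approx>z\<in>uhp. False"
      using eval_mero_ops_ae(1)[unfolded eq] eval_mero_ops_ae(2) by eventually_elim auto
    hence "cosparse uhp = bot"
      by (simp only: trivial_limit_def)
    thus False
      using ii_in_uhp unfolding cosparse_eq_bot_iff' by blast
  qed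
qed

end

lemma eval_mero_of_nat_ae: "\<forall>\<^sub>\<approx>z\<in>uhp. eval_mero (of_nat n) z = of_nat n"
proof (induction n)
  case 0
  show ?case using eval_mero_ops_ae(1) by simp
next
  case (Suc n)
  from eval_mero_ops_ae(3)[of 1 "of_nat n"] eval_mero_ops_ae(2) Suc show ?case
    by eventually_elim auto
qed

instance mero_uhp :: field_char_0
proof
  show "inj (of_nat :: nat \<Rightarrow> mero_uhp)"
  proof (rule injI)
    fix m n :: nat
    assume eq: "(of_nat m :: mero_uhp) = of_nat n"
    have "\<forall>\<^sub>\<approx>z\<in>uhp. m = n"
      using eval_mero_of_nat_ae[of m, unfolded eq] eval_mero_of_nat_ae[of n]
      by eventually_elim auto
    moreover have "cosparse uhp \<noteq> bot"
      using ii_in_uhp unfolding cosparse_eq_bot_iff' by blast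
    ultimately show "m = n"
      by (simp add: eventually_const)
  qed
qed


section \<open>The function field of the modular curve\<close>

text \<open>An integer quadruple \<open>(a, b, c, d)\<close> stands for the 2 by 2 matrix with rows
  \<open>(a, b)\<close> and \<open>(c, d)\<close>.\<close>

type_synonym mat2 = "int \<times> int \<times> int \<times> int"

definition SL2Z :: "mat2 set" where
  "SL2Z = {(a, b, c, d). a * d - b * c = 1}"

definition Gamma0 :: "nat \<Rightarrow> mat2 set" where
  "Gamma0 N = {(a, b, c, d). (a, b, c, d) \<in> SL2Z \<and> int N dvd c}"

definition moeb :: "mat2 \<Rightarrow> complex \<Rightarrow> complex" where
  "moeb M z = (case M of (a, b, c, d) \<Rightarrow> moebius (of_int a) (of_int b) (of_int c) (of_int d) z)"

text \<open>The pullback of a meromorphic function along a matrix of positive determinant.\<close>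

definition pullback :: "mat2 \<Rightarrow> mero_uhp \<Rightarrow> mero_uhp" where
  "pullback M f = mero (\<lambda>z. eval_mero f (moeb M z))"

text \<open>The function \<open>f\<close> has the expansion \<open>L\<close>, a Laurent series with finite principal part and
  positive radius of convergence, in \<open>exp (2 \<pi> i z / h)\<close> as \<open>Im z\<close> tends to infinity.\<close>

definition has_q_expansion :: "nat \<Rightarrow> mero_uhp \<Rightarrow> complex fls \<Rightarrow> bool" where
  "has_q_expansion h f L \<longleftrightarrow> fls_conv_radius L > 0 \<and>
     (\<forall>\<^sub>F z in filtercomap Im at_top. eval_mero f z = eval_fls L (exp (2 * of_real pi * \<i> * z / of_nat h)))"

text \<open>
  The cusps are the points \<open>\<gamma> \<infinity>\<close> for \<open>\<gamma>\<close> in \<^term>\<open>SL2Z\<close>, and all their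
  widths divide \<open>N\<close>; meromorphy at a cusp does not depend on which multiple of the width is used.
\<close>

definition X0_functions_C :: "nat \<Rightarrow> mero_uhp set" where
  "X0_functions_C N = {f.
     (\<forall>\<gamma>\<in>Gamma0 N. pullback \<gamma> f = f) \<and>
     (\<forall>\<gamma>\<in>SL2Z. \<exists>L. has_q_expansion N (pullback \<gamma> f) L)}"

definition X0_functions_Q :: "nat \<Rightarrow> mero_uhp set" where
  "X0_functions_Q N =
     {f \<in> X0_functions_C N. \<exists>L. has_q_expansion 1 f L \<and> (\<forall>n. fls_nth L n \<in> \<rat>)}"

text \<open>
  The matrices below are \<open>sqrt d\<close> times the ones of determinant 1 that induce the
  Atkin-Lehner involution; the scalar does not change the Moebius transformation.
\<close>

definition atkin_lehner_matrices :: "nat \<Rightarrow> nat \<Rightarrow> mat2 set" where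
  "atkin_lehner_matrices N d =
     {(A * int d, B, int N * C, D * int d) | A B C D.
        (A * int d) * (D * int d) - B * (int N * C) = int d}"

definition atkin_lehner :: "nat \<Rightarrow> nat \<Rightarrow> mero_uhp \<Rightarrow> mero_uhp" where
  "atkin_lehner N d f = pullback (SOME M. M \<in> atkin_lehner_matrices N d) f"

text \<open>We check that the choice of the matrix is possible and irrelevant.\<close>

lemma atkin_lehner_matrices_nonempty:
  assumes "d dvd N" "d > 0" "coprime d (N div d)"
  shows   "atkin_lehner_matrices N d \<noteq> {}"
proof -
  obtain k where k: "N = d * k"
    using assms(1) by blast
  have "coprime (int d) (int k)"
    using assms k by simp
  then obtain u v where uv: "u * int d + v * int k = 1"
    by (metis bezout_int coprime_iff_gcd_eq_1)
  have "(u * int d) * (1 * int d) - (- v) * (int N * 1) = int d * (u * int d + v * int k)"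
    by (simp add: k algebra_simps)
  also have "\<dots> = int d"
    by (simp add: uv)
  finally have "(u * int d, - v, int N * 1, 1 * int d) \<in> atkin_lehner_matrices N d"
    unfolding atkin_lehner_matrices_def by blast
  thus ?thesis
    by blast
qed

lemma moeb_denom_nonzero:
  assumes "a * d - b * c > 0" "z \<in> uhp"
  shows   "of_int c * z + of_int d \<noteq> (0 :: complex)"
proof
  assume eq: "of_int c * z + of_int d = (0 :: complex)"
  from arg_cong[OF eq, of Im] assms(2) have "c = 0"
    by (auto simp: uhp_def)
  moreover from this and eq have "d = 0"
    by simp
  ultimately show False
    using assms(1) by simp
qed

lemma moeb_in_uhp:
  assumes "a * d - b * c > 0" "z \<in> uhp"
  shows   "moeb (a, b, c, d) z \<in> uhp"
proof -
  define w where "w = of_int c * z + (of_int d :: complex)"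
  have w: "w \<noteq> 0"
    unfolding w_def by (rule moeb_denom_nonzero[OF assms])
  have "(of_int a * z + of_int b) / w = (of_int a * z + of_int b) * cnj w / of_real ((cmod w)\<^sup>2)"
    by (subst complex_div_cnj) (simp only: of_real_power)
  hence "Im ((of_int a * z + of_int b) / w) = Im ((of_int a * z + of_int b) * cnj w) / (cmod w)\<^sup>2"
    by (simp only: Im_divide_of_real)
  also have "Im ((of_int a * z + of_int b) * cnj w) = of_int (a * d - b * c) * Im z"
    by (simp add: w_def algebra_simps)
  also have "\<dots> / (cmod w)\<^sup>2 > 0"
    using assms w by (auto simp: uhp_def simp del: of_int_diff of_int_mult)
  finally show ?thesis
    by (simp add: uhp_def moeb_def moebius_def w_def)
qed

lemma moeb_mult:
  assumes "a * d - b * c > 0" "z \<in> uhp"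
    and "k \<noteq> 0" "k * a'' = a' * a + b' * c" "k * b'' = a' * b + b' * d"
    and "k * c'' = c' * a + d' * c" "k * d'' = c' * b + d' * d"
  shows "moeb (a'', b'', c'', d'') z = moeb (a', b', c', d') (moeb (a, b, c, d) z)"
proof -
  let ?i = "of_int :: int \<Rightarrow> complex"
  define w where "w = ?i c * z + ?i d"
  define m where "m = ?i a * z + ?i b"
  have w: "w \<noteq> 0"
    unfolding w_def by (rule moeb_denom_nonzero[OF assms(1,2)])
  have k: "?i k \<noteq> 0"
    using assms(3) by simp
  have e: "?i k * ?i a'' = ?i a' * ?i a + ?i b' * ?i c"
    "?i k * ?i b'' = ?i a' * ?i b + ?i b' * ?i d"
    "?i k * ?i c'' = ?i c' * ?i a + ?i d' * ?i c"
    "?i k * ?i d'' = ?i c' * ?i b + ?i d' * ?i d"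
    using assms(4-7) by (metis of_int_add of_int_mult)+
  have n: "?i k * (?i a'' * z + ?i b'') = ?i a' * m + ?i b' * w"
    using e(1,2) by (simp add: m_def w_def ring_distribs flip: mult.assoc)
  have d: "?i k * (?i c'' * z + ?i d'') = ?i c' * m + ?i d' * w"
    using e(3,4) by (simp add: m_def w_def ring_distribs flip: mult.assoc)
  have "moeb (a'', b'', c'', d'') z = (?i k * (?i a'' * z + ?i b'')) / (?i k * (?i c'' * z + ?i d''))"
    using k by (simp add: moeb_def moebius_def)
  also have "\<dots> = (?i a' * m + ?i b' * w) / (?i c' * m + ?i d' * w)"
    by (simp only: n d)
  also have "\<dots> = ((?i a' * m + ?i b' * w) / w) / ((?i c' * m + ?i d' * w) / w)"
    using w by simp
  also have "\<dots> = (?i a' * (m / w) + ?i b') / (?i c' * (m / w) + ?i d')"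
    using w by (simp only: add_divide_distrib times_divide_eq_right nonzero_mult_div_cancel_right not_False_eq_True)
  also have "\<dots> = moeb (a', b', c', d') (moeb (a, b, c, d) z)"
    by (simp only: moeb_def moebius_def m_def w_def prod.case)
  finally show ?thesis .
qed

lemma moeb_inj:
  assumes "a * d - b * c > 0" "z \<in> uhp" "w \<in> uhp" "moeb (a, b, c, d) z = moeb (a, b, c, d) w"
  shows   "z = w"
proof -
  have *: "moeb (1, 0, 0, 1) u = moeb (d, -b, -c, a) (moeb (a, b, c, d) u)" if "u \<in> uhp" for u
    by (rule moeb_mult[OF assms(1) that, of "a * d - b * c"])
       (use assms(1) in \<open>auto simp: algebra_simps\<close>)
  have "moeb (1, 0, 0, 1) z = moeb (1, 0, 0, 1) w"
    using *[OF assms(2)] *[OF assms(3)] assms(4) by simp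
  thus ?thesis
    by (simp add: moeb_def moebius_def)
qed

lemma moeb_analytic:
  assumes "a * d - b * c > 0"
  shows   "moeb (a, b, c, d) analytic_on uhp"
proof -
  have "(\<lambda>z. (of_int a * z + of_int b) / (of_int c * z + of_int d)) analytic_on uhp"
    by (intro analytic_intros) (use moeb_denom_nonzero[OF assms] in auto)
  thus ?thesis
    by (simp add: moeb_def[abs_def] moebius_def)
qed

lemma eval_mero_pullback:
  assumes "a * d - b * c > 0" "z \<in> uhp"
  shows   "eval_mero (pullback (a, b, c, d) f) z = eval_mero f (moeb (a, b, c, d) z)"
proof -
  let ?m = "moeb (a, b, c, d)"
  have mero: "(\<lambda>w. eval_mero f (?m w)) meromorphic_on uhp"
    by (rule meromorphic_on_compose[OF meromorphic_eval_mero moeb_analytic[OF assms(1)]])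
       (use moeb_in_uhp[OF assms(1)] in auto)
  have z': "?m z \<in> uhp"
    using moeb_in_uhp[OF assms] .
  have "isCont ?m z"
    using moeb_analytic[OF assms(1)] assms(2)
    by (metis analytic_at_imp_isCont analytic_on_analytic_at)
  moreover have "eventually (\<lambda>w. ?m w \<noteq> ?m z) (at z)"
    using eventually_at_in_open[OF open_uhp assms(2)]
    by eventually_elim (use moeb_inj[OF assms(1)] assms(2) in auto)
  ultimately have lim: "filterlim ?m (at (?m z)) (at z)"
    by (auto simp: filterlim_at isCont_def)
  consider "is_pole (eval_mero f) (?m z)" "eval_mero f (?m z) = 0"
    | "eval_mero f \<midarrow>?m z\<rightarrow> eval_mero f (?m z)"
    using nicely_meromorphic_eval_mero[of f] z' unfolding nicely_meromorphic_on_def by blast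
  hence "remove_sings (\<lambda>w. eval_mero f (?m w)) z = eval_mero f (?m z)"
  proof cases
    case 1
    hence "is_pole (\<lambda>w. eval_mero f (?m w)) z"
      unfolding is_pole_def using filterlim_compose[OF _ lim] by blast
    with 1 show ?thesis
      by simp
  next
    case 2
    have "((\<lambda>w. eval_mero f (?m w)) \<longlongrightarrow> eval_mero f (?m z)) (at z)"
      by (rule filterlim_compose[OF 2 lim])
    thus ?thesis
      by (rule remove_sings_eqI)
  qed
  thus ?thesis
    using mero assms(2) by (simp add: pullback_def eval_mero_mero)
qed

lemma pullback_atkin_lehner_unique:
  assumes "d dvd N" "d > 0" and f: "f \<in> X0_functions_C N"
    and M: "M \<in> atkin_lehner_matrices N d" and M': "M' \<in> atkin_lehner_matrices N d"
  shows   "pullback M f = pullback M' f"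
proof -
  obtain k where k: "N = d * k"
    using assms(1) by blast
  have d0: "int d > 0"
    using assms(2) by simp
  let ?d = "int d"
  obtain A B C D where M: "M = (A * ?d, B, int N * C, D * ?d)"
    "(A * ?d) * (D * ?d) - B * (int N * C) = ?d"
    using M unfolding atkin_lehner_matrices_def by blast
  obtain A' B' C' D' where M': "M' = (A' * ?d, B', int N * C', D' * ?d)"
    "(A' * ?d) * (D' * ?d) - B' * (int N * C') = ?d"
    using M' unfolding atkin_lehner_matrices_def by blast
  from M(2) have "?d * (A * D * ?d - B * C * int k) = ?d * 1"
    by (simp add: k algebra_simps)
  hence e: "A * D * ?d - B * C * int k = 1"
    using d0 mult_left_cancel by (metis less_irrefl)
  from M'(2) have "?d * (A' * D' * ?d - B' * C' * int k) = ?d * 1"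
    by (simp add: k algebra_simps)
  hence e': "A' * D' * ?d - B' * C' * int k = 1"
    using d0 mult_left_cancel by (metis less_irrefl)
  define g1 where "g1 = A' * D * ?d - B' * C * int k"
  define g2 where "g2 = B' * A - A' * B"
  define g3 where "g3 = int N * (C' * D - D' * C)"
  define g4 where "g4 = D' * A * ?d - C' * B * int k"
  have "g1 * g4 - g2 * g3 = (A * D * ?d - B * C * int k) * (A' * D' * ?d - B' * C' * int k)"
    unfolding g1_def g2_def g3_def g4_def k by (simp add: algebra_simps)
  hence det: "g1 * g4 - g2 * g3 = 1"
    by (simp add: e e')
  hence g: "(g1, g2, g3, g4) \<in> Gamma0 N"
    by (simp add: Gamma0_def SL2Z_def g3_def)
  have detM: "(A * ?d) * (D * ?d) - B * (int N * C) > 0"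
    and detM': "(A' * ?d) * (D' * ?d) - B' * (int N * C') > 0"
    using M(2) M'(2) d0 by simp_all
  have "eval_mero (pullback M' f) z = eval_mero (pullback M f) z" for z
  proof (cases "z \<in> uhp")
    case z: True
    have "moeb M' z = moeb (g1, g2, g3, g4) (moeb M z)"
      unfolding M(1) M'(1)
    proof (rule moeb_mult[OF detM z, of 1])
      have "g1 * (A * ?d) + g2 * (int N * C) = A' * ?d * (A * D * ?d - B * C * int k)"
        by (simp add: g1_def g2_def k algebra_simps)
      thus "1 * (A' * ?d) = g1 * (A * ?d) + g2 * (int N * C)"
        by (simp add: e)
      have "g1 * B + g2 * (D * ?d) = B' * (A * D * ?d - B * C * int k)"
        by (simp add: g1_def g2_def k algebra_simps)
      thus "1 * B' = g1 * B + g2 * (D * ?d)"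
        by (simp add: e)
      have "g3 * (A * ?d) + g4 * (int N * C) = int N * C' * (A * D * ?d - B * C * int k)"
        by (simp add: g3_def g4_def k algebra_simps)
      thus "1 * (int N * C') = g3 * (A * ?d) + g4 * (int N * C)"
        by (simp add: e)
      have "g3 * B + g4 * (D * ?d) = D' * ?d * (A * D * ?d - B * C * int k)"
        by (simp add: g3_def g4_def k algebra_simps)
      thus "1 * (D' * ?d) = g3 * B + g4 * (D * ?d)"
        by (simp add: e)
    qed auto
    hence "eval_mero (pullback M' f) z = eval_mero f (moeb (g1, g2, g3, g4) (moeb M z))"
      unfolding M'(1) by (simp add: eval_mero_pullback[OF detM' z])
    also have "\<dots> = eval_mero (pullback (g1, g2, g3, g4) f) (moeb M z)"
      using det moeb_in_uhp[OF detM z] by (simp add: eval_mero_pullback M(1))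
    also have "pullback (g1, g2, g3, g4) f = f"
      using f g by (auto simp: X0_functions_C_def)
    also have "eval_mero f (moeb M z) = eval_mero (pullback M f) z"
      unfolding M(1) by (simp add: eval_mero_pullback[OF detM z])
    finally show ?thesis .
  qed (auto simp: eval_mero_outside)
  thus ?thesis
    by (metis eval_mero_inject ext)
qed

lemma atkin_lehner_eq:
  assumes "d dvd N" "d > 0" "f \<in> X0_functions_C N" "M \<in> atkin_lehner_matrices N d"
  shows   "atkin_lehner N d f = pullback M f"
  unfolding atkin_lehner_def
  using pullback_atkin_lehner_unique[OF assms(1-3) _ assms(4)] assms(4) by (metis someI)


section \<open>Generated fields and equations for a function field\<close>

inductive_set rat_adjoin :: "'a :: field_char_0 set \<Rightarrow> 'a set" for S where
  rat: "of_rat c \<in> rat_adjoin S"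
| gen: "s \<in> S \<Longrightarrow> s \<in> rat_adjoin S"
| add: "a \<in> rat_adjoin S \<Longrightarrow> b \<in> rat_adjoin S \<Longrightarrow> a + b \<in> rat_adjoin S"
| uminus: "a \<in> rat_adjoin S \<Longrightarrow> - a \<in> rat_adjoin S"
| mult: "a \<in> rat_adjoin S \<Longrightarrow> b \<in> rat_adjoin S \<Longrightarrow> a * b \<in> rat_adjoin S"
| inverse: "a \<in> rat_adjoin S \<Longrightarrow> inverse a \<in> rat_adjoin S"

text \<open>
  Polynomials in three variables \<open>X\<close>, \<open>Y\<close>, \<open>T\<close> over the rationals are iterated univariate
  polynomials: \<open>X\<close> is the innermost variable and \<open>T\<close> the outermost one.
\<close>

type_synonym rat_poly3 = "rat poly poly poly"

definition X3 :: rat_poly3 where "X3 = [:[:[:0, 1:]:]:]"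
definition Y3 :: rat_poly3 where "Y3 = [:[:0, 1:]:]"
definition T3 :: rat_poly3 where "T3 = [:0, 1:]"

definition eval3 :: "'a :: field_char_0 \<Rightarrow> 'a \<Rightarrow> 'a \<Rightarrow> rat_poly3 \<Rightarrow> 'a" where
  "eval3 x y t P =
     poly (map_poly (\<lambda>p. poly (map_poly (\<lambda>r. poly (map_poly of_rat r) x) p) y) P) t"

lemma eval3_variables [simp]: "eval3 x y t X3 = x" "eval3 x y t Y3 = y" "eval3 x y t T3 = t"
  by (simp_all add: eval3_def X3_def Y3_def T3_def map_poly_pCons)

definition ideal_generated2 :: "rat_poly3 \<Rightarrow> rat_poly3 \<Rightarrow> rat_poly3 set" where
  "ideal_generated2 E F = {U * E + V * F | U V. True}"

text \<open>
  The homomorphism \<open>\<phi>\<close> induces an embedding of \<open>\<rat>[X,Y,T]/I\<close> which makes the field \<open>K\<close> its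
  field of fractions. In particular \<open>I\<close> is prime, and \<open>K\<close> is the function field of the integral
  affine variety over the rationals with vanishing ideal \<open>I\<close>. (A ring homomorphism between
  rational algebras is automatically linear over the rationals.)
\<close>

definition is_function_field_via :: "(rat_poly3 \<Rightarrow> 'a :: field_char_0) \<Rightarrow> rat_poly3 set \<Rightarrow> 'a set \<Rightarrow> bool" where
  "is_function_field_via \<phi> I K \<longleftrightarrow>
     \<phi> 1 = 1 \<and> (\<forall>P Q. \<phi> (P + Q) = \<phi> P + \<phi> Q) \<and> (\<forall>P Q. \<phi> (P * Q) = \<phi> P * \<phi> Q) \<and>
     {P. \<phi> P = 0} = I \<and>
     K = {\<phi> P / \<phi> Q | P Q. \<phi> Q \<noteq> 0}"

end

theory Submission
  imports Defs
begin

text \<open>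
  Quotients of Klein forms of level three give functions \<open>W\<close> and \<open>F\<close> without zeros on the
  upper half plane. They satisfy \<open>F\<^sup>3 = W\<^sup>6 + 9 W\<^sup>3 + 27\<close> and are transformed by
  \<open>z \<mapsto> - 1 / z\<close> into \<open>3 / W\<close> and \<open>3 F / W\<^sup>2\<close>. By a Liouville argument every
  function on \<open>X(3)\<close> is a rational function of \<open>W\<^sup>3\<close>. The group
  \<open>\<Gamma>\<^sub>0(81)\<close> is conjugate by \<open>z \<mapsto> 9 z\<close> to the matrices whose off-diagonal
  entries are divisible by 9, and up to signs these form a subgroup of \<open>\<Gamma>(3)\<close> with the abelian quotient
  \<open>(\<int>/3)\<^sup>2\<close>; decomposing a function into eigenfunctions of this quotient shows that \<open>W(9 z)\<close>
  and \<open>F(9 z)\<close> generate the function field of \<open>X\<^sub>0(81)\<close> over the complex numbers.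
  Since both have rational expansions, applying a rational linear functional to the coefficients of
  a linear relation shows that they also generate the field over the rationals.

  The Fricke involution fixes \<open>p = W + 3 / W\<close> and \<open>g = F / W\<close> (at \<open>9 z\<close>), which
  satisfy \<open>g\<^sup>3 = p\<^sup>3 - 9 p + 9\<close>, a curve of genus one with Weierstrass equation
  \<open>y\<^sup>2 + y = x\<^sup>3\<close>. It changes the sign of \<open>W - 3 / W\<close>, whose square is
  \<open>p\<^sup>2 - 12\<close>; a suitable multiple of this is \<open>t\<close>.
\<close>

section \<open>Theta products\<close>

text \<open>No genus, divisor or dimension formula enters: the function field of X(3), and with it
  everything above it, rests on one maximum modulus argument on the discs around the cusps.
  Explicitly \<open>W_fun\<close> is eta(t/3) / eta(3t) and \<open>F_fun\<close> is eta(t)^4 /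
  (eta(t/3) eta(3t)^3). They are built from Klein forms because these are permuted by all of SL2(Z)
  with no multipliers beyond signs and cube roots of unity, whereas eta would bring in 24th roots.
  Meromorphy at the cusps is treated as an exponential growth bound, since the substitution 9z does
  not come from SL2(Z) and changes the local parameters. The obstacle in the descent is that a
  function with rational expansion is at first only a quotient of two polynomials with complex
  coefficients. The rational functional is therefore normalised at a nonzero coefficient of the
  denominator, so that the denominator survives.\<close>

definition qprod :: "complex \<Rightarrow> complex \<Rightarrow> complex" where
  "qprod a q = (\<Prod>n. 1 - a * q ^ n)"

lemma convergent_prod_qprod:
  assumes "norm q < 1"
  shows "convergent_prod (\<lambda>n. 1 - a * q ^ n :: complex)"
proof -
  have "summable (\<lambda>n. norm a * norm q ^ n)"
    using assms by (intro summable_mult summable_geometric) auto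
  hence "summable (\<lambda>n. norm ((1 - a * q ^ n) - 1))"
    by (simp add: norm_mult norm_power)
  thus ?thesis
    by (intro abs_convergent_prod_imp_convergent_prod summable_imp_abs_convergent_prod)
qed

lemma qprod_step:
  assumes "norm q < 1"
  shows "qprod a q = (1 - a) * qprod (a * q) q"
proof -
  have "(\<lambda>N. \<Prod>n<N. 1 - a * q ^ n) \<longlonglongrightarrow> qprod a q" for a
    unfolding qprod_def using convergent_prod_has_prod[OF convergent_prod_qprod[OF assms]]
    by (rule has_prod_imp_tendsto')
  note lim = this
  have "(\<lambda>N. \<Prod>n<Suc N. 1 - a * q ^ n) \<longlonglongrightarrow> qprod a q"
    using lim[of a] by (rule LIMSEQ_Suc)
  moreover have "(\<Prod>n<Suc N. 1 - a * q ^ n) = (1 - a) * (\<Prod>n<N. 1 - (a * q) * q ^ n)" for N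
    by (subst prod.lessThan_Suc_shift) (simp add: mult.assoc)
  ultimately have "(\<lambda>N. (1 - a) * (\<Prod>n<N. 1 - (a * q) * q ^ n)) \<longlonglongrightarrow> qprod a q"
    by simp
  moreover have "(\<lambda>N. (1 - a) * (\<Prod>n<N. 1 - (a * q) * q ^ n)) \<longlonglongrightarrow> (1 - a) * qprod (a * q) q"
    by (intro tendsto_intros lim)
  ultimately show ?thesis
    by (rule LIMSEQ_unique)
qed

lemma qprod_nonzero:
  assumes "norm q < 1" "\<And>n. a * q ^ n \<noteq> 1"
  shows "qprod a q \<noteq> 0"
  unfolding qprod_def by (rule prodinf_nonzero[OF convergent_prod_qprod[OF assms(1)]]) (use assms(2) in force)

lemma qprod_nonzero':
  assumes "norm q < 1" "norm a < 1"
  shows "qprod a q \<noteq> 0"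
proof (rule qprod_nonzero[OF assms(1)])
  fix n
  have "norm (a * q ^ n) \<le> norm a * 1"
    unfolding norm_mult norm_power by (intro mult_left_mono power_le_one) (use assms in auto)
  thus "a * q ^ n \<noteq> 1" using assms by (metis less_le_not_le mult.right_neutral norm_one order_le_less_trans)
qed

lemma qprod_0 [simp]: "qprod 0 q = 1"
  by (simp add: qprod_def)

text \<open>The terms a q^n are dominated by M r^n on a compact set. Besides holomorphy of the
  limit, the uniform convergence later gives convergence of the Taylor coefficients, which is how
  their integrality is obtained.\<close>

lemma uniform_limit_qprod:
  assumes K: "compact K" and a: "continuous_on K a" and q: "continuous_on K q"
    and lt: "\<And>z. z \<in> K \<Longrightarrow> norm (q z) < 1"
  shows "uniform_limit K (\<lambda>N z. \<Prod>n<N. 1 - a z * q z ^ n) (\<lambda>z. qprod (a z) (q z)) sequentially"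
proof -
  obtain M where M: "norm (a z) \<le> M" if "z \<in> K" for z
    using compact_imp_bounded[OF compact_continuous_image[OF a K]] by (auto simp: bounded_iff)
  obtain r where r: "r < 1" "0 \<le> r" "\<And>z. z \<in> K \<Longrightarrow> norm (q z) \<le> r"
  proof (cases "K = {}")
    case False
    obtain w where "w \<in> K" "\<And>z. z \<in> K \<Longrightarrow> norm (q z) \<le> norm (q w)"
      using continuous_attains_sup[OF K False continuous_on_norm[OF q]] by blast
    thus ?thesis using that[of "norm (q w)"] lt by auto
  qed (use that[of 0] in auto)
  have "uniformly_convergent_on K (\<lambda>N z. \<Sum>n<N. norm (- (a z * q z ^ n)))"
  proof (rule Weierstrass_m_test')
    fix n z assume z: "z \<in> K"
    have "norm (a z) * norm (q z) ^ n \<le> M * r ^ n"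
      using M[OF z] r(2,3) z order_trans[OF norm_ge_zero M[OF z]] by (intro mult_mono power_mono) auto
    thus "norm (norm (- (a z * q z ^ n))) \<le> M * r ^ n"
      by (simp add: norm_mult norm_power)
  next
    show "summable (\<lambda>n. M * r ^ n)"
      using r by (intro summable_mult summable_geometric) auto
  qed
  hence "uniformly_convergent_on K (\<lambda>N z. \<Prod>n<N. 1 + - (a z * q z ^ n))"
    by (intro uniformly_convergent_on_prod K continuous_intros a q)
  then obtain l where l: "uniform_limit K (\<lambda>N z. \<Prod>n<N. 1 + - (a z * q z ^ n)) l sequentially"
    by (auto simp: uniformly_convergent_on_def)
  have "l z = qprod (a z) (q z)" if z: "z \<in> K" for z
  proof -
    have "(\<lambda>N. \<Prod>n<N. 1 - a z * q z ^ n) \<longlonglongrightarrow> qprod (a z) (q z)"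
      unfolding qprod_def using convergent_prod_has_prod[OF convergent_prod_qprod[OF lt[OF z]]]
      by (rule has_prod_imp_tendsto')
    with tendsto_uniform_limitI[OF l z] show ?thesis
      by (intro LIMSEQ_unique) auto
  qed
  with l show ?thesis
    by (auto intro: uniform_limit_cong'[THEN iffD1, rotated -1])
qed

lemma holomorphic_qprod [holomorphic_intros]:
  assumes S: "open S" and a: "a holomorphic_on S" and q: "q holomorphic_on S"
    and lt: "\<And>z. z \<in> S \<Longrightarrow> norm (q z) < 1"
  shows "(\<lambda>z. qprod (a z) (q z)) holomorphic_on S"
proof (rule holomorphic_uniform_sequence[OF S])
  show "(\<lambda>z. \<Prod>n<N. 1 - a z * q z ^ n) holomorphic_on S" for N
    by (intro holomorphic_intros a q)
  fix x assume "x \<in> S"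
  then obtain d where d: "d > 0" "cball x d \<subseteq> S"
    using S open_contains_cball by blast
  moreover have "uniform_limit (cball x d) (\<lambda>N z. \<Prod>n<N. 1 - a z * q z ^ n)
                  (\<lambda>z. qprod (a z) (q z)) sequentially"
    using d a q lt
    by (intro uniform_limit_qprod) (auto intro: continuous_on_subset holomorphic_on_imp_continuous_on)
  ultimately show "\<exists>d>0. cball x d \<subseteq> S \<and> uniform_limit (cball x d)
      (\<lambda>N z. \<Prod>n<N. 1 - a z * q z ^ n) (\<lambda>z. qprod (a z) (q z)) sequentially"
    by blast
qed

text \<open>Factor by factor this is (1 - u)(1 - w u)(1 - w^2 u) = 1 - u^3. It later removes the
  cube roots of unity from the products for \<open>W_fun\<close> and \<open>F_fun\<close>, so that
  their coefficients become rational.\<close>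

lemma qprod_cube:
  assumes "norm q < 1" "w \<noteq> 1" "w ^ 3 = 1"
  shows "qprod a q * qprod (w * a) q * qprod (w ^ 2 * a) q = qprod (a ^ 3) (q ^ 3)"
proof -
  have w: "1 + w + w ^ 2 = 0"
  proof -
    have "(w - 1) * (1 + w + w ^ 2) = w ^ 3 - 1" by algebra
    thus ?thesis using assms by auto
  qed
  have "(1 - x) * (1 - w * x) * (1 - w ^ 2 * x) = 1 - x ^ 3" for x
    using w by algebra
  from this[of "a * q ^ n" for n]
  have *: "(1 - a * q ^ n) * (1 - w * a * q ^ n) * (1 - w ^ 2 * a * q ^ n) = 1 - a ^ 3 * (q ^ 3) ^ n" for n
    by (simp add: power_mult_distrib mult.assoc flip: power_mult) (simp add: mult.commute)
  note c = convergent_prod_qprod[OF assms(1)]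
  show ?thesis
    unfolding qprod_def by (simp add: prodinf_mult c convergent_prod_mult *)
qed

section \<open>The exponential with period 1\<close>

definition ee :: "complex \<Rightarrow> complex" where
  "ee z = exp (2 * of_real pi * \<i> * z)"

lemma ee_add: "ee (x + y) = ee x * ee y"
  by (simp add: ee_def ring_distribs exp_add)
lemma ee_minus: "ee (- x) = inverse (ee x)"
  by (simp add: ee_def exp_minus)
lemma ee_diff: "ee (x - y) = ee x / ee y"
  by (simp add: ee_def right_diff_distrib exp_diff)
lemma ee_nz [simp]: "ee x \<noteq> 0"
  by (simp add: ee_def)
lemma ee_0 [simp]: "ee 0 = 1"
  by (simp add: ee_def)
lemma ee_of_int [simp]: "ee (of_int n) = 1"
  using exp_integer_2pi[of "of_int n"] by (simp add: ee_def mult_ac)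
lemma ee_1 [simp]: "ee 1 = 1" using ee_of_int[of 1] by simp
lemma ee_half [simp]: "ee (1 / 2) = - 1"
  by (simp add: ee_def)
lemma ee_power: "ee z ^ n = ee (of_nat n * z)"
  by (simp add: ee_def exp_of_nat_mult[symmetric] mult_ac)
lemma ee_eq_1_iff: "ee z = 1 \<longleftrightarrow> (\<exists>n::int. z = of_int n)"
proof
  assume "ee z = 1"
  then obtain n :: int where "Im z = 0" "Re z = of_int n"
    by (auto simp: ee_def exp_eq_1)
  thus "\<exists>n::int. z = of_int n" by (intro exI[of _ n]) (auto simp: complex_eq_iff)
qed auto
lemma norm_ee: "norm (ee z) = exp (- 2 * pi * Im z)"
  by (simp add: ee_def)
lemma norm_ee_less_1: "Im z > 0 \<Longrightarrow> norm (ee z) < 1"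
  by (simp add: norm_ee)
lemma holomorphic_ee [holomorphic_intros]: "f holomorphic_on A \<Longrightarrow> (\<lambda>z. ee (f z)) holomorphic_on A"
  unfolding ee_def by (intro holomorphic_intros)
lemma ee_plus_1 [simp]: "ee (z + 1) = ee z" by (simp add: ee_add)

text \<open>The odd Jacobi theta function divided by \<open>\<eta>\<^sup>3\<close>, up to a constant.\<close>

definition theta :: "complex \<Rightarrow> complex \<Rightarrow> complex" where
  "theta z t = - ee (- z / 2) * qprod (ee z) (ee t) * qprod (ee (t - z)) (ee t) / qprod (ee t) (ee t) ^ 2"

lemma theta_plus_1: "theta (z + 1) t = - theta z t"
proof -
  have "ee (- (z + 1) / 2) = ee (- z / 2) * ee (- 1 / 2)"
    by (simp add: ee_add[symmetric] field_simps)
  also have "ee (- 1 / 2) = - 1"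
    using ee_minus[of "1/2"] by simp
  finally show ?thesis
    using ee_plus_1[of "t - (z + 1)"] by (simp add: theta_def ee_plus_1)
qed

text \<open>Splitting the factor 1 - ee z off the first product leaves two products that z -> -z
  exchanges; the remaining ee(-z/2) (1 - ee z) is a multiple of sin(pi z), hence odd.\<close>

lemma theta_minus:
  assumes "t \<in> uhp"
  shows "theta (- z) t = - theta z t"
proof -
  have q: "norm (ee t) < 1" using assms by (simp add: uhp_def norm_ee_less_1)
  have 1: "qprod (ee z) (ee t) = (1 - ee z) * qprod (ee (t + z)) (ee t)"
    by (subst qprod_step[OF q]) (simp add: ee_add mult.commute)
  have 2: "qprod (ee (- z)) (ee t) = (1 - ee (- z)) * qprod (ee (t - z)) (ee t)"
    by (subst qprod_step[OF q]) (simp add: ee_diff ee_minus field_simps)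
  have 3: "ee (z / 2) * (1 - ee (- z)) = - (ee (- z / 2) * (1 - ee z))"
  proof -
    have "ee (z / 2) * ee (- z) = ee (- z / 2)" "ee (- z / 2) * ee z = ee (z / 2)"
      by (simp_all add: ee_add[symmetric])
    thus ?thesis by (simp add: algebra_simps)
  qed
  have "theta (- z) t = - (ee (z / 2) * (1 - ee (- z))) * qprod (ee (t - z)) (ee t) * qprod (ee (t + z)) (ee t) / qprod (ee t) (ee t) ^ 2"
    by (simp add: theta_def 2)
  also have "\<dots> = - theta z t"
    unfolding 3 by (simp add: theta_def 1)
  finally show ?thesis .
qed

text \<open>Translation by t moves one linear factor from one product to the other; comparing the
  exponential prefactors leaves the automorphy factor.\<close>

lemma theta_plus_tau:
  assumes "t \<in> uhp"
  shows "theta (z + t) t = - ee (- z - t / 2) * theta z t"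
proof -
  have q: "norm (ee t) < 1" using assms by (simp add: uhp_def norm_ee_less_1)
  have 1: "qprod (ee z) (ee t) = (1 - ee z) * qprod (ee (t + z)) (ee t)"
    by (subst qprod_step[OF q]) (simp add: ee_add mult.commute)
  have 2: "qprod (ee (- z)) (ee t) = (1 - ee (- z)) * qprod (ee (t - z)) (ee t)"
    by (subst qprod_step[OF q]) (simp add: ee_diff ee_minus field_simps)
  have 3: "ee (- (z + t) / 2) * (1 - ee (- z)) = - (ee (- z - t / 2) * ee (- z / 2) * (1 - ee z))"
  proof -
    have "ee (- (z + t) / 2) = ee (- z - t / 2 + - z / 2 + z)"
      "ee (- (z + t) / 2 + - z) = ee (- z - t / 2 + - z / 2)"
      by (rule arg_cong[where f = ee], simp add: field_simps)+
    hence "ee (- (z + t) / 2) = ee (- z - t / 2) * ee (- z / 2) * ee z"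
      "ee (- (z + t) / 2) * ee (- z) = ee (- z - t / 2) * ee (- z / 2)"
      by (simp_all only: ee_add)
    thus ?thesis by (simp only: right_diff_distrib mult_1_right minus_diff_eq)
  qed
  have "theta (z + t) t = - (ee (- (z + t) / 2) * (1 - ee (- z))) * qprod (ee (t + z)) (ee t) * qprod (ee (t - z)) (ee t) / qprod (ee t) (ee t) ^ 2"
    by (simp add: theta_def 2 add.commute)
  thus ?thesis
    unfolding 3 by (simp add: theta_def 1)
qed

lemma theta_period [simp]: "theta z (t + 1) = theta z t"
proof -
  have "ee (t + 1 - z) = ee (t - z)"
    using ee_plus_1[of "t - z"] by (simp only: diff_add_eq)
  thus ?thesis
    by (simp only: theta_def ee_plus_1)
qed

text \<open>A product vanishes only through one of its factors, which places the zeros in the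
  lattice. Conversely the zero at the origin comes from oddness and is transported to all lattice
  points by the two quasi-periods.\<close>

lemma theta_eq_0_iff:
  assumes t: "t \<in> uhp"
  shows "theta z t = 0 \<longleftrightarrow> (\<exists>m n::int. z = of_int m + of_int n * t)"
proof -
  have q: "norm (ee t) < 1" using assms by (simp add: uhp_def norm_ee_less_1)
  have nz: "qprod (ee t) (ee t) \<noteq> 0" using q by (intro qprod_nonzero')
  have shift: "qprod a (ee t) = 0 \<Longrightarrow> \<exists>n. a * ee t ^ n = 1" for a using qprod_nonzero[OF q] by blast
  have kap0: "theta 0 t = 0" using theta_minus[OF t, of 0] by simp
  show ?thesis
  proof
    assume "theta z t = 0"
    then consider "qprod (ee z) (ee t) = 0" | "qprod (ee (t - z)) (ee t) = 0"
      using nz by (auto simp: theta_def)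
    thus "\<exists>m n::int. z = of_int m + of_int n * t"
    proof cases
      case 1
      then obtain n where "ee (z + of_nat n * t) = 1" using shift by (auto simp: ee_add ee_power)
      then obtain m :: int where "z + of_nat n * t = of_int m" using ee_eq_1_iff by blast
      thus ?thesis by (intro exI[of _ m] exI[of _ "- int n"]) (simp add: algebra_simps)
    next
      case 2
      then obtain n where "ee (t - z + of_nat n * t) = 1" using shift by (auto simp: ee_add ee_power)
      then obtain m :: int where "t - z + of_nat n * t = of_int m" using ee_eq_1_iff by blast
      thus ?thesis by (intro exI[of _ "-m"] exI[of _ "int n + 1"]) (simp add: algebra_simps)
    qed
  next
    assume "\<exists>m n::int. z = of_int m + of_int n * t"
    then obtain m n :: int where z: "z = of_int m + of_int n * t" by blast
    have a: "theta (of_int n * t) t = 0" for n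
    proof (induction n rule: int_induct[where k = 0])
      case (step1 i) thus ?case using theta_plus_tau[OF t, of "of_int i * t"] by (simp add: algebra_simps)
    next
      case (step2 i) thus ?case using theta_plus_tau[OF t, of "of_int (i - 1) * t"] by (simp add: algebra_simps)
    qed (use kap0 in simp)
    have "theta (of_int n * t + of_int m) t = 0" for m
    proof (induction m rule: int_induct[where k = 0])
      case (step1 i) thus ?case using theta_plus_1[of "of_int n * t + of_int i" t] by (simp add: algebra_simps)
    next
      case (step2 i) thus ?case using theta_plus_1[of "of_int n * t + of_int (i - 1)" t] by (simp add: algebra_simps)
    qed (use a in simp)
    thus "theta z t = 0" by (simp add: z add.commute)
  qed
qed

lemma holomorphic_theta [holomorphic_intros]:
  assumes "open S" "f holomorphic_on S" "g holomorphic_on S" "\<And>z. z \<in> S \<Longrightarrow> g z \<in> uhp"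
  shows "(\<lambda>z. theta (f z) (g z)) holomorphic_on S"
proof -
  have q: "norm (ee (g z)) < 1" if "z \<in> S" for z using assms(4)[OF that] by (simp add: uhp_def norm_ee_less_1)
  show ?thesis unfolding theta_def
    by (intro holomorphic_intros assms) (use q qprod_nonzero' in auto)
qed

text \<open>Dividing by the square of the eta product makes the derivative at the origin independent
  of t. This normalisation is what forces the constant in \<open>theta_S\<close> to be exactly 1 /
  t.\<close>

lemma theta_deriv_0:
  assumes t: "t \<in> uhp"
  shows "((\<lambda>z. theta z t) has_field_derivative (2 * of_real pi * \<i>)) (at 0)"
proof -
  have q: "norm (ee t) < 1" using assms by (simp add: uhp_def norm_ee_less_1)
  have nz: "qprod (ee t) (ee t) \<noteq> 0" using q by (intro qprod_nonzero')
  define G where "G = (\<lambda>z. - ee (- z / 2) * qprod (ee (t + z)) (ee t) * qprod (ee (t - z)) (ee t) / qprod (ee t) (ee t) ^ 2)"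
  have k: "theta z t = (1 - ee z) * G z" for z
    unfolding theta_def G_def by (subst qprod_step[OF q]) (simp add: ee_add mult.commute mult.left_commute)
  have "G holomorphic_on UNIV" unfolding G_def
    by (intro holomorphic_intros) (use q nz in auto)
  then obtain G' where G': "(G has_field_derivative G') (at 0)"
    using holomorphic_on_imp_differentiable_at[of G UNIV 0] by (auto simp: field_differentiable_def)
  have "((\<lambda>z. (1 - ee z) * G z) has_field_derivative ((1 - ee 0) * G' + (- (2 * of_real pi * \<i>)) * G 0)) (at 0)"
    unfolding ee_def by (rule derivative_eq_intros G' refl | simp)+
  moreover have "G 0 = -1" using nz by (simp add: G_def power2_eq_square)
  ultimately show ?thesis by (simp add: k[abs_def])
qed

lemma theta_tendsto_0:
  assumes t: "t \<in> uhp"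
  shows "((\<lambda>z. theta z t / z) \<longlongrightarrow> 2 * of_real pi * \<i>) (at 0)"
proof -
  have "theta 0 t = 0" using theta_minus[OF t, of 0] by simp
  with theta_deriv_0[OF t] show ?thesis
    by (simp add: has_field_derivative_iff)
qed

text \<open>Liouville's theorem in \<open>z\<close>: the quotient of the two sides is elliptic without zeros and poles.\<close>

lemma theta_S:
  assumes t: "t \<in> uhp"
  shows "theta (z / t) (- 1 / t) = ee (z ^ 2 / (2 * t)) / t * theta z t"
proof -
  have t0: "t \<noteq> 0" using t by (auto simp: uhp_def)
  have t': "- 1 / t \<in> uhp"
    using moeb_in_uhp[of 0 0 "-1" 1 t] t by (simp add: moeb_def moebius_def)
  define N where "N = (\<lambda>z. theta (z / t) (- 1 / t) * t * ee (- (z ^ 2) / (2 * t)))"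
  define L where "L = {z. \<exists>m n::int. z = of_int m + of_int n * t}"
  \<comment> \<open>At lattice points numerator and denominator both vanish. The limit of the
    quotient at 0 is 1 because \<open>theta\<close> has the same derivative there for every modulus,
    and periodicity carries this value to the other lattice points.\<close>
  define h where "h = (\<lambda>z. if z \<in> L then 1 else N z / theta z t)"
  have k0: "theta z t = 0 \<longleftrightarrow> z \<in> L" for z
    by (simp add: L_def theta_eq_0_iff[OF t])
  \<comment> \<open>The Gaussian factor in \<open>N\<close> trades the quasi-periods for modulus
    -1/t against those for modulus t, so \<open>N\<close> and \<open>theta\<close> pick up the same
    factors under z + t and z + 1.\<close>
  have N1: "N (z + t) = - ee (- z - t / 2) * N z" for z
  proof -
    have "ee (- ((z + t) ^ 2) / (2 * t)) = ee (- (z ^ 2) / (2 * t) + (- z - t / 2))"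
      by (rule arg_cong[where f = ee]) (use t0 in \<open>simp add: field_simps power2_eq_square\<close>)
    hence "ee (- ((z + t) ^ 2) / (2 * t)) = ee (- (z ^ 2) / (2 * t)) * ee (- z - t / 2)"
      by (simp only: ee_add)
    thus ?thesis
      using theta_plus_1[of "z / t" "- 1 / t"] t0 by (simp add: N_def add_divide_distrib mult_ac)
  qed
  have N2: "N (z + 1) = - N z" for z
  proof -
    have "theta (z / t) (- 1 / t) = - ee (- (z / t + 1 / t) - (- 1 / t) / 2) * theta (z / t + 1 / t) (- 1 / t)"
      using theta_plus_tau[OF t', of "z / t + 1 / t"] by simp
    moreover have "ee (- (z ^ 2) / (2 * t)) * ee (- (z / t + 1 / t) - (- 1 / t) / 2) = ee (- ((z + 1) ^ 2) / (2 * t))"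
      unfolding ee_add[symmetric]
      by (rule arg_cong[where f = ee]) (use t0 in \<open>simp add: field_simps power2_eq_square\<close>)
    ultimately show ?thesis
      by (simp add: N_def add_divide_distrib mult_ac)
  qed
  have L1: "z + t \<in> L \<longleftrightarrow> z \<in> L" and L2: "z + 1 \<in> L \<longleftrightarrow> z \<in> L" for z
    using theta_plus_tau[OF t, of z] theta_plus_1[of z t] by (simp_all flip: k0)
  have h1: "h (z + t) = h z" and h2: "h (z + 1) = h z" for z
    unfolding h_def L1 L2 N1 N2 theta_plus_tau[OF t] theta_plus_1 by auto
  have hm: "h (z + of_int m) = h z" for z m
  proof (induction m rule: int_induct[where k = 0])
    case (step1 i) thus ?case using h2[of "z + of_int i"] by (simp add: add.assoc)
  next
    case (step2 i) thus ?case using h2[of "z + of_int (i - 1)"] by (simp add: algebra_simps)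
  qed auto
  have hn: "h (z + of_int n * t) = h z" for z n
  proof (induction n rule: int_induct[where k = 0])
    case (step1 i) thus ?case using h1[of "z + of_int i * t"] by (simp add: algebra_simps)
  next
    case (step2 i) thus ?case using h1[of "z + of_int (i - 1) * t"] by (simp add: algebra_simps)
  qed auto
  have hmn: "h (z + (of_int m + of_int n * t)) = h z" for z m n
    using hm[of "z + of_int n * t" m] hn[of z n] by (simp add: add_ac)
  have dist: "norm w \<ge> 1 / 2 * min 1 (Im t) \<or> w = 0" if wL: "w \<in> L" for w
  proof -
    obtain m n :: int where w: "w = of_int m + of_int n * t" using wL unfolding L_def by blast
    show ?thesis
    proof (cases "n = 0")
      case True
      thus ?thesis using w by (cases "m = 0") (auto simp: min_def)
    next
      case False
      have "norm w \<ge> \<bar>Im w\<bar>" by (rule abs_Im_le_cmod)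
      also have "\<bar>Im w\<bar> = \<bar>of_int n\<bar> * Im t" using t by (simp add: w abs_mult uhp_def)
      finally have "norm w \<ge> \<bar>of_int n\<bar> * Im t" .
      moreover have "\<bar>of_int n\<bar> * Im t \<ge> 1 * Im t"
        using False t by (intro mult_right_mono) (auto simp: uhp_def)
      ultimately have "norm w \<ge> Im t" by linarith
      thus ?thesis using t by (auto simp: min_def uhp_def)
    qed
  qed
  define r where "r = 1 / 2 * min 1 (Im t)"
  have r: "r > 0" using t by (simp add: r_def uhp_def)
  have ball: "w \<notin> L" if w: "w \<in> ball 0 r - {0}" for w
  proof
    assume "w \<in> L"
    hence "r \<le> norm w \<or> w = 0" unfolding r_def by (rule dist)
    moreover have "norm w < r" "w \<noteq> 0" using w by simp_all
    ultimately show False by linarith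
  qed
  have Nhol: "N holomorphic_on UNIV" unfolding N_def
    by (intro holomorphic_intros) (use t0 t' in auto)
  have kaphol: "(\<lambda>z. theta z t) holomorphic_on UNIV"
    by (intro holomorphic_intros) (use t in auto)
  have "((\<lambda>z. theta (z / t) (- 1 / t) / (z / t)) \<longlongrightarrow> 2 * of_real pi * \<i>) (at 0)"
  proof (rule filterlim_compose[OF theta_tendsto_0[OF t']])
    show "filterlim (\<lambda>z. z / t) (at 0) (at 0)"
      using t0 by (auto simp: filterlim_at eventually_at_filter intro!: tendsto_eq_intros)
  qed
  moreover have "((\<lambda>z. ee (- (z ^ 2) / (2 * t))) \<longlongrightarrow> ee (- (0 ^ 2) / (2 * t))) (at 0)"
    unfolding ee_def using t0 by (intro tendsto_intros) auto
  ultimately have "((\<lambda>z. (theta (z / t) (- 1 / t) / (z / t)) * ee (- (z ^ 2) / (2 * t)) / (theta z t / z)) \<longlongrightarrow>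
      (2 * of_real pi * \<i>) * ee (- (0 ^ 2) / (2 * t)) / (2 * of_real pi * \<i>)) (at 0)"
    by (intro tendsto_intros theta_tendsto_0[OF t]) auto
  hence "(h \<longlongrightarrow> (2 * of_real pi * \<i>) * ee (- (0 ^ 2) / (2 * t)) / (2 * of_real pi * \<i>)) (at 0)"
  proof (rule Lim_transform_within_open)
    show "open (ball (0::complex) r)" "0 \<in> ball (0::complex) r" using r by auto
    fix z :: complex assume "z \<in> ball 0 r" "z \<noteq> 0"
    hence "z \<notin> L" using ball[of z] by auto
    thus "theta (z / t) (- 1 / t) / (z / t) * ee (- (z ^ 2) / (2 * t)) / (theta z t / z) = h z"
      using t0 \<open>z \<noteq> 0\<close> by (simp add: h_def N_def)
  qed
  moreover have "h 0 = 1"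
  proof -
    have "0 \<in> L" unfolding L_def by (intro CollectI exI[of _ 0]) simp
    thus ?thesis by (simp add: h_def)
  qed
  ultimately have lim: "isCont h 0" by (simp add: isCont_def)
  have oL: "open (- L)"
  proof -
    have "- L = (\<lambda>z. theta z t) -` (- {0})" using k0 by auto
    thus ?thesis using open_vimage[of "- {0}" "\<lambda>z. theta z t"] kaphol holomorphic_on_imp_continuous_on by auto
  qed
  have hol1: "h holomorphic_on (- L)"
  proof -
    have "(\<lambda>z. N z / theta z t) holomorphic_on (- L)"
      by (rule holomorphic_on_divide[OF holomorphic_on_subset[OF Nhol] holomorphic_on_subset[OF kaphol]])
         (simp_all add: k0)
    thus ?thesis by (rule holomorphic_transform) (auto simp: h_def)
  qed
  have hol0: "h holomorphic_on ball 0 r"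
  proof (rule no_isolated_singularity)
    show hol: "h holomorphic_on ball 0 r - {0}"
      by (rule holomorphic_on_subset[OF hol1]) (use ball in auto)
    show "continuous_on (ball 0 r) h"
    proof (rule continuous_at_imp_continuous_on, rule ballI)
      fix x :: complex assume x: "x \<in> ball 0 r"
      show "isCont h x"
      proof (cases "x = 0")
        case False
        thus ?thesis using holomorphic_on_imp_continuous_on[OF hol] x
          by (metis Diff_iff continuous_on_eq_continuous_at empty_iff insert_iff open_ball open_Diff closed_singleton)
      qed (use lim in simp)
    qed
  qed auto
  \<comment> \<open>At the origin the singularity is removable by continuity; near any other lattice
    point the function is a translate of its germ at the origin.\<close>
  have "h field_differentiable (at z)" for z
  proof (cases "z \<in> L")
    case False
    thus ?thesis using hol1 oL by (auto intro: holomorphic_on_imp_differentiable_at)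
  next
    case True
    then obtain m n :: int where z: "z = of_int m + of_int n * t" unfolding L_def by blast
    have "h field_differentiable (at (z - z))"
      using hol0 r by (auto intro: holomorphic_on_imp_differentiable_at)
    hence "(h \<circ> (\<lambda>w. w - z)) field_differentiable (at z)"
      by (intro field_differentiable_compose) (auto intro!: derivative_intros)
    moreover have "h \<circ> (\<lambda>w. w - z) = h"
      using hmn[of "w - z" m n for w] by (auto simp: z fun_eq_iff)
    ultimately show ?thesis by simp
  qed
  hence hol: "h holomorphic_on UNIV"
    by (simp add: holomorphic_on_def field_differentiable_at_within)
  \<comment> \<open>A period parallelogram: by periodicity it carries all values of
    \<open>h\<close>, so \<open>h\<close> is bounded.\<close>
  define K where "K = (\<lambda>(x, y). of_real x + of_real y * t) ` (cbox (0::real, 0::real) (1, 1))"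
  have "compact K" unfolding K_def
    by (intro compact_continuous_image compact_cbox) (auto simp: case_prod_unfold intro!: continuous_intros)
  hence "compact (h ` K)"
    using hol by (intro compact_continuous_image) (auto intro: continuous_on_subset holomorphic_on_imp_continuous_on)
  hence "bounded (h ` K)" by (rule compact_imp_bounded)
  moreover have "range h \<subseteq> h ` K"
  proof safe
    fix z :: complex
    define y where "y = Im z / Im t"
    define x where "x = Re z - y * Re t"
    have it: "Im t > 0" using t by (simp add: uhp_def)
    have z: "z = of_real x + of_real y * t"
      using it by (auto simp: complex_eq_iff x_def y_def)
    have "h (of_real (frac x) + of_real (frac y) * t + (of_int \<lfloor>x\<rfloor> + of_int \<lfloor>y\<rfloor> * t)) = h (of_real (frac x) + of_real (frac y) * t)"
      by (rule hmn)
    moreover have "of_real (frac x) + of_real (frac y) * t + (of_int \<lfloor>x\<rfloor> + of_int \<lfloor>y\<rfloor> * t) = z"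
      by (simp add: z frac_def algebra_simps)
    ultimately have "h z = h (of_real (frac x) + of_real (frac y) * t)" by simp
    moreover have "of_real (frac x) + of_real (frac y) * t \<in> K"
      unfolding K_def by (rule image_eqI[of _ _ "(frac x, frac y)"]) (auto simp: less_imp_le[OF frac_lt_1])
    ultimately show "h z \<in> h ` K" by blast
  qed
  ultimately have "bounded (range h)" by (rule bounded_subset)
  hence "h constant_on UNIV" by (rule Liouville_theorem[OF hol])
  then obtain c where c0: "\<forall>z\<in>UNIV. h z = c"
    unfolding constant_on_def by (elim exE)
  have c: "h z = c" for z by (rule bspec[OF c0 UNIV_I])
  have c1: "c = 1" using c[of 0] \<open>h 0 = 1\<close> by (rule trans[OF sym])
  have N: "N z = theta z t" for z
  proof (cases "z \<in> L")
    case False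
    have "N z / theta z t = 1" using c[of z] unfolding c1 h_def if_not_P[OF False] .
    thus ?thesis by (simp only: divide_eq_1_iff)
  next
    case True
    then obtain m n :: int where z: "z = of_int m + of_int n * t" unfolding L_def by blast
    have "z / t = of_int n + of_int (- m) * (- 1 / t)" unfolding z using t0 by (simp add: field_simps)
    hence "theta (z / t) (- 1 / t) = 0" unfolding theta_eq_0_iff[OF t'] by blast
    hence "N z = 0" by (simp only: N_def mult_zero_left)
    moreover have "theta z t = 0" using True by (rule k0[THEN iffD2])
    ultimately show ?thesis by (rule trans[OF _ sym])
  qed
  have "ee (- (z ^ 2) / (2 * t)) = inverse (ee (z ^ 2 / (2 * t)))"
    unfolding ee_minus[symmetric] by simp
  with N[of z] have "theta z t = theta (z / t) (- 1 / t) * t * inverse (ee (z ^ 2 / (2 * t)))"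
    by (simp only: N_def)
  hence "ee (z ^ 2 / (2 * t)) / t * theta z t = (ee (z ^ 2 / (2 * t)) * inverse (ee (z ^ 2 / (2 * t)))) * (t / t) * theta (z / t) (- 1 / t)"
    by (simp only: divide_inverse mult_ac)
  also have "\<dots> = theta (z / t) (- 1 / t)"
    using t0 by (simp only: right_inverse[OF ee_nz] divide_self_if if_False mult_1_left)
  finally show ?thesis by (rule sym)
qed

section \<open>Klein forms of level three\<close>

definition omega :: complex where "omega = ee (1 / 3)"

lemma omega_cube [simp]: "omega ^ 3 = 1"
  by (simp add: omega_def ee_power)
lemma omega_neq_1: "omega \<noteq> 1"
proof
  assume "omega = 1"
  then obtain n :: int where "(1 / 3 :: complex) = of_int n" by (auto simp: omega_def ee_eq_1_iff)
  hence "of_int (3 * n) = 3 * (1 / 3 :: complex)" by (simp only: of_int_mult of_int_numeral)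
  hence "of_int (3 * n) = (of_int 1 :: complex)" by simp
  hence "3 * n = 1" by (rule of_int_eq_iff[THEN iffD1])
  thus False by presburger
qed
lemma omega_sum: "1 + omega + omega ^ 2 = 0"
proof -
  have "(omega - 1) * (1 + omega + omega ^ 2) = omega ^ 3 - 1" by algebra
  thus ?thesis using omega_neq_1 by auto
qed
lemma omega_nz [simp]: "omega \<noteq> 0" by (simp add: omega_def)
lemma norm_omega [simp]: "norm omega = 1" by (simp add: omega_def norm_ee)

text \<open>The Klein form of characteristic (2r/3, 2s/3), up to a constant: the prefactor is ee(a u
  / 2) with a = 2r/3 and u the first argument of \<open>theta\<close>. Because the index is doubled,
  raising s by 3 moves u by 2, so the signs of \<open>theta_plus_1\<close> cancel and shifts of the
  index by 3 cost only cube roots of unity.\<close>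

definition klein :: "int \<Rightarrow> int \<Rightarrow> complex \<Rightarrow> complex" where
  "klein r s t = ee (2 * of_int r * (of_int r * t + of_int s) / 9) * theta (2 * (of_int r * t + of_int s) / 3) t"

lemma klein_T: "klein r s (t + 1) = klein r (r + s) t"
proof -
  have "of_int r * (t + 1) + of_int s = of_int r * t + (of_int (r + s) :: complex)"
    by (simp add: algebra_simps)
  thus ?thesis by (simp only: klein_def theta_period)
qed

text \<open>The Gaussian factor of \<open>theta_S\<close> and the old prefactor add up to the
  prefactor belonging to the index (s, -r), so only the weight factor 1 / t remains.\<close>

lemma klein_S:
  assumes t: "t \<in> uhp"
  shows "klein r s (- 1 / t) = klein s (- r) t / t"
proof -
  have t0: "t \<noteq> 0" using t by (auto simp: uhp_def)
  have 1: "2 * (of_int r * (- 1 / t) + of_int s) / 3 = (2 * (of_int s * t - of_int r) / 3) / t"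
    using t0 by (simp add: field_simps)
  have "klein r s (- 1 / t) = ee (2 * of_int r * (of_int r * (- 1 / t) + of_int s) / 9 +
      (2 * (of_int s * t - of_int r) / 3) ^ 2 / (2 * t)) * theta (2 * (of_int s * t - of_int r) / 3) t / t"
    unfolding klein_def 1 theta_S[OF t] ee_add by simp
  also have "2 * of_int r * (of_int r * (- 1 / t) + of_int s) / 9 +
      (2 * (of_int s * t - of_int r) / 3) ^ 2 / (2 * t) = 2 * of_int s * (of_int s * t + of_int (- r)) / 9"
    using t0 by (simp add: field_simps power2_eq_square)
  finally show ?thesis by (simp add: klein_def)
qed

lemma klein_minus: "t \<in> uhp \<Longrightarrow> klein (- r) (- s) t = - klein r s t"
proof -
  assume t: "t \<in> uhp"
  have 1: "of_int (- r) * t + of_int (- s) = - (of_int r * t + (of_int s :: complex))" by simp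
  have 2: "2 * - x / 3 = - (2 * x / 3)" for x :: complex by simp
  have 3: "2 * of_int (- r) * - x / 9 = 2 * of_int r * x / 9" for x :: complex by simp
  show "klein (- r) (- s) t = - klein r s t"
    unfolding klein_def 1 2 3 theta_minus[OF t] by simp
qed

lemma theta_plus_2: "theta (z + 2) t = theta z t"
  using theta_plus_1[of "z + 1" t] theta_plus_1[of z t] by (simp add: add.assoc)

lemma omega_powi: "omega powi n = ee (of_int n / 3)"
proof (cases n)
  case (nonneg k) thus ?thesis by (simp add: omega_def ee_power)
next
  case (neg k)
  hence "omega powi n = inverse (ee (of_nat (Suc k) / 3))"
    by (simp add: omega_def ee_power power_int_minus del: of_nat_Suc power_Suc)
  also have "\<dots> = ee (of_int n / 3)" by (simp add: neg ee_minus[symmetric] minus_divide_left)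
  finally show ?thesis .
qed

lemma omega_powi_cong:
  assumes "(3::int) dvd m - n" shows "omega powi m = omega powi n"
proof -
  obtain k where k: "m = n + 3 * k" using assms by (auto elim!: dvdE simp: algebra_simps)
  have "ee (of_int m / 3) = ee (of_int n / 3 + of_int k)"
    by (rule arg_cong[where f = ee]) (simp add: k field_simps)
  thus ?thesis by (simp add: omega_powi ee_add)
qed

lemma klein_shift_3: "klein r (s + 3) t = omega powi (- r) * klein r s t"
proof -
  have "2 * (of_int r * t + of_int (s + 3)) / 3 = 2 * (of_int r * t + of_int s) / 3 + 2"
    by (simp add: field_simps)
  moreover have "ee (2 * of_int r * (of_int r * t + of_int (s + 3)) / 9) =
     ee (2 * of_int r * (of_int r * t + of_int s) / 9 + of_int (- r) / 3 + of_int r)"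
    by (rule arg_cong[where f = ee]) (simp add: field_simps)
  hence "ee (2 * of_int r * (of_int r * t + of_int (s + 3)) / 9) =
     omega powi (- r) * ee (2 * of_int r * (of_int r * t + of_int s) / 9)"
    by (simp only: omega_powi ee_add ee_of_int mult_1_right mult_1_left mult.commute)
  ultimately show ?thesis by (simp only: klein_def theta_plus_2 mult.assoc)
qed

lemma klein_shift_snd: "klein r (s + 3 * n) t = omega powi (- n * r) * klein r s t"
proof (induction n rule: int_induct[where k = 0])
  case (step1 i)
  have "klein r (s + 3 * (i + 1)) t = omega powi (- r) * klein r (s + 3 * i) t"
    using klein_shift_3[of r "s + 3 * i"] by (simp add: algebra_simps)
  also have "\<dots> = (omega powi (- r) * omega powi (- i * r)) * klein r s t"
    by (simp only: step1 mult.assoc)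
  also have "omega powi (- r) * omega powi (- i * r) = omega powi (- (i + 1) * r)"
    by (subst power_int_add[symmetric]) (simp_all add: algebra_simps)
  finally show ?case .
next
  case (step2 i)
  have "klein r (s + 3 * i) t = omega powi (- r) * klein r (s + 3 * (i - 1)) t"
    using klein_shift_3[of r "s + 3 * (i - 1)"] by (simp add: algebra_simps)
  hence "klein r (s + 3 * (i - 1)) t = omega powi r * klein r (s + 3 * i) t"
    by (simp add: power_int_minus field_simps)
  also have "\<dots> = (omega powi r * omega powi (- i * r)) * klein r s t"
    by (simp only: step2 mult.assoc)
  also have "omega powi r * omega powi (- i * r) = omega powi (- (i - 1) * r)"
    by (subst power_int_add[symmetric]) (simp_all add: algebra_simps)
  finally show ?case .
qed auto

lemma uhp_S: "t \<in> uhp \<Longrightarrow> - 1 / t \<in> uhp"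
  using moeb_in_uhp[of 0 0 "-1" 1 t] by (simp add: moeb_def moebius_def)

lemma uhp_nz: "t \<in> uhp \<Longrightarrow> t \<noteq> 0"
  by (auto simp: uhp_def)

text \<open>This is the shift of the second index conjugated by t -> -1/t, which exchanges the two
  indices up to sign.\<close>

lemma klein_shift_fst:
  assumes t: "t \<in> uhp"
  shows "klein (r + 3 * n) s t = omega powi (n * s) * klein r s t"
proof -
  have *: "klein r s t = - t * klein s (- r) (- 1 / t)" for r s
    using klein_S[OF uhp_S[OF t], of r s] uhp_nz[OF t] by simp
  have "klein (r + 3 * n) s t = - t * klein s (- r + 3 * (- n)) (- 1 / t)"
    using *[of "r + 3 * n" s] by simp
  also have "\<dots> = omega powi (n * s) * klein r s t"
    unfolding klein_shift_snd *[of r s] by simp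
  finally show ?thesis .
qed

text \<open>The exponent is the determinant of (m, n) and (r, s). The extra term -3 m n, which
  arises from doing the two shifts one after the other, disappears modulo 3.\<close>

lemma klein_shift:
  assumes t: "t \<in> uhp"
  shows "klein (r + 3 * m) (s + 3 * n) t = omega powi (m * s - n * r) * klein r s t"
proof -
  have "klein (r + 3 * m) (s + 3 * n) t = (omega powi (- n * (r + 3 * m)) * omega powi (m * s)) * klein r s t"
    by (simp only: klein_shift_snd klein_shift_fst[OF t] mult.assoc)
  also have "omega powi (- n * (r + 3 * m)) * omega powi (m * s) = omega powi (m * s - n * r)"
    by (subst power_int_add[symmetric]) (auto intro!: omega_powi_cong simp: algebra_simps)
  finally show ?thesis .
qed

text \<open>Euclid's algorithm on the lower row. The steps multiply on the right by T, its inverse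
  and S, because right multiplication corresponds to a substitution in the argument of the Moebius
  map, as needed in \<open>klein_moeb\<close>.\<close>

lemma SL2Z_induct [consumes 1, case_names one T T' S]:
  assumes "M \<in> SL2Z" and one: "P (1, 0, 0, 1)"
    and T: "\<And>a b c d. (a, b, c, d) \<in> SL2Z \<Longrightarrow> P (a, b, c, d) \<Longrightarrow> P (a, a + b, c, c + d)"
    and T': "\<And>a b c d. (a, b, c, d) \<in> SL2Z \<Longrightarrow> P (a, b, c, d) \<Longrightarrow> P (a, b - a, c, d - c)"
    and S: "\<And>a b c d. (a, b, c, d) \<in> SL2Z \<Longrightarrow> P (a, b, c, d) \<Longrightarrow> P (b, - a, d, - c)"
  shows "P M"
proof -
  have Tn: "P (a, b + n * a, c, d + n * c)" if M: "(a, b, c, d) \<in> SL2Z" "P (a, b, c, d)" for a b c d n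
  proof (induction n rule: int_induct[where k = 0])
    case (step1 i) thus ?case using T[of a "b + i * a" c "d + i * c"] M by (simp add: SL2Z_def algebra_simps)
  next
    case (step2 i) thus ?case using T'[of a "b + i * a" c "d + i * c"] M by (simp add: SL2Z_def algebra_simps)
  qed (use M in auto)
  have neg: "P (- a, - b, - c, - d)" if M: "(a, b, c, d) \<in> SL2Z" "P (a, b, c, d)" for a b c d
    using S[OF _ S[OF M]] M(1) by (simp add: SL2Z_def algebra_simps)
  have "P (a, b, c, d)" if "a * d - b * c = 1" for a b c d
    using that
  proof (induction "nat \<bar>c\<bar>" arbitrary: a b c d rule: less_induct)
    case less
    show ?case
    proof (cases "c = 0")
      case True
      hence "a * d = 1" using less.prems by simp
      hence "a = 1 \<and> d = 1 \<or> a = -1 \<and> d = -1" by (rule zmult_eq_1_iff[THEN iffD1])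
      moreover have "P (1, n, 0, 1)" for n using Tn[of 1 0 0 1 n] one by (simp add: SL2Z_def)
      moreover from this have "P (- 1, n, 0, - 1)" for n using neg[of 1 "-n" 0 1] by (simp add: SL2Z_def)
      ultimately show ?thesis using True by auto
    next
      case False
      \<comment> \<open>After d has been divided by c, one application of S puts the remainder d mod
        c into the position of c, so the induction hypothesis applies.\<close>
      define n where "n = d div c"
      have d: "d - n * c = d mod c" by (simp add: n_def minus_div_mult_eq_mod)
      have "\<bar>d mod c\<bar> < \<bar>c\<bar>" using False by (rule abs_mod_less)
      hence "nat \<bar>d - n * c\<bar> < nat \<bar>c\<bar>" unfolding d using False by linarith
      hence 1: "P (b - n * a, - a, d - n * c, - c)"
        by (rule less.hyps) (use less.prems in \<open>simp add: algebra_simps\<close>)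
      have M1: "(b - n * a, - a, d - n * c, - c) \<in> SL2Z" "(- (b - n * a), a, - (d - n * c), c) \<in> SL2Z"
        "(a, b - n * a, c, d - n * c) \<in> SL2Z"
        using less.prems by (simp_all add: SL2Z_def algebra_simps)
      have "P (- (b - n * a), a, - (d - n * c), c)" using neg[OF M1(1) 1] by simp
      hence "P (a, b - n * a, c, d - n * c)" using S[OF M1(2)] by simp
      from Tn[OF M1(3) this, of n] show ?thesis by simp
    qed
  qed
  thus ?thesis using assms(1) by (cases M) (auto simp: SL2Z_def)
qed

text \<open>The index behaves as a row vector multiplied by the matrix. Both generators act without
  a constant (\<open>klein_T\<close>, \<open>klein_S\<close>), so the factor of weight -1 is the
  only one.\<close>

lemma klein_moeb:
  assumes "M \<in> SL2Z" "M = (a, b, c, d)" "t \<in> uhp"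
  shows "klein r s (moeb M t) = klein (r * a + s * c) (r * b + s * d) t / (of_int c * t + of_int d)"
  using assms
proof (induction arbitrary: a b c d t rule: SL2Z_induct)
  case one
  thus ?case by (simp add: moeb_def moebius_def)
next
  case (T a b c d a' b' c' d' t)
  have m: "moeb (a, a + b, c, c + d) t = moeb (a, b, c, d) (t + 1)"
    by (simp add: moeb_def moebius_def algebra_simps)
  have "t + 1 \<in> uhp" using T.prems by (simp add: uhp_def)
  from T.IH[OF refl this] T.prems show ?case
    unfolding m klein_T by (auto simp: klein_T algebra_simps)
next
  case (T' a b c d a' b' c' d' t)
  have m: "moeb (a, b - a, c, d - c) t = moeb (a, b, c, d) (t - 1)"
    by (simp add: moeb_def moebius_def algebra_simps)
  have k: "klein r s (t - 1) = klein r (s - r) t" for r s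
    using klein_T[of r "s - r" "t - 1"] by simp
  have "t - 1 \<in> uhp" using T'.prems by (simp add: uhp_def)
  from T'.IH[OF refl this] T'.prems show ?case
    unfolding m by (auto simp: k algebra_simps)
next
  case (S a b c d a' b' c' d' t)
  have t0: "t \<noteq> 0" using S.prems uhp_nz by auto
  have m: "moeb (b, - a, d, - c) t = moeb (a, b, c, d) (- 1 / t)"
    using t0 by (simp add: moeb_def moebius_def divide_simps)
  from S.IH[OF refl uhp_S] S.prems have "klein r s (moeb (a, b, c, d) (- 1 / t)) =
      klein (r * a + s * c) (r * b + s * d) (- 1 / t) / (of_int c * (- 1 / t) + of_int d)"
    by blast
  also have "\<dots> = klein (r * b + s * d) (- (r * a + s * c)) t / (t * (of_int c * (- 1 / t) + of_int d))"
    using S.prems by (simp only: klein_S divide_divide_eq_left)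
  also have "t * (of_int c * (- 1 / t) + of_int d) = of_int d * t + of_int (- c)"
    using t0 by (simp add: field_simps)
  moreover have "a' = b" "b' = - a" "c' = d" "d' = - c" using S.prems by auto
  ultimately show ?case by (simp add: m)
qed

text \<open>Up to a power of \<open>ee (t / 9)\<close> and a constant, \<open>klein 1 s t\<close> and \<open>klein 0 1 t\<close>
  are the following products at \<open>X = ee (t / 3)\<close>.\<close>

definition klein_1_prod :: "nat \<Rightarrow> complex \<Rightarrow> complex" where
  "klein_1_prod s X = qprod (omega ^ (2 * s) * X ^ 2) (X ^ 3) * qprod (omega ^ s * X) (X ^ 3) / qprod (X ^ 3) (X ^ 3) ^ 2"

definition klein_0_prod :: "complex \<Rightarrow> complex" where
  "klein_0_prod X = qprod (omega ^ 2 * X ^ 3) (X ^ 3) * qprod (omega * X ^ 3) (X ^ 3) / qprod (X ^ 3) (X ^ 3) ^ 2"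

lemma norm_power_less_1: "norm (X :: complex) < 1 \<Longrightarrow> n > 0 \<Longrightarrow> norm (X ^ n) < 1"
  by (simp add: norm_power power_less_one_iff)

lemma norm_omega_power_less_1: "norm (X :: complex) < 1 \<Longrightarrow> n > 0 \<Longrightarrow> norm (omega ^ k * X ^ n) < 1"
  by (simp add: norm_mult norm_power power_less_one_iff)

lemma klein_1_prod_nonzero: "norm X < 1 \<Longrightarrow> klein_1_prod s X \<noteq> 0"
  using norm_omega_power_less_1[of X 1 s] norm_omega_power_less_1[of X 2 "2 * s"]
  unfolding klein_1_prod_def by (simp add: qprod_nonzero' norm_power_less_1)
lemma klein_0_prod_nonzero: "norm X < 1 \<Longrightarrow> klein_0_prod X \<noteq> 0"
  using norm_omega_power_less_1[of X 3 1] norm_omega_power_less_1[of X 3 2]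
  unfolding klein_0_prod_def by (simp add: qprod_nonzero' norm_power_less_1)

lemma holomorphic_klein_1_prod: "klein_1_prod s holomorphic_on ball 0 1"
  unfolding klein_1_prod_def[abs_def]
  by (intro holomorphic_intros) (simp_all add: qprod_nonzero' norm_power_less_1)
lemma holomorphic_klein_0_prod: "klein_0_prod holomorphic_on ball 0 1"
  unfolding klein_0_prod_def[abs_def]
  by (intro holomorphic_intros) (simp_all add: qprod_nonzero' norm_power_less_1)

lemma klein_1_prod_0 [simp]: "klein_1_prod s 0 = 1" by (simp add: klein_1_prod_def)
lemma klein_0_prod_0 [simp]: "klein_0_prod 0 = 1" by (simp add: klein_0_prod_def)

lemma ee_third_power: "ee (t / 3) ^ 3 = ee t" "ee (t / 3) ^ 2 = ee (2 * t / 3)"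
  by (simp_all add: ee_power)

text \<open>The leading exponent -1/9 in t is 2/9 from the prefactor of the Klein form minus 1/3
  from the prefactor of \<open>theta\<close>; the powers of \<open>omega\<close> come from the
  second index.\<close>

lemma klein_1:
  "klein 1 (int s) t = - ee (- of_nat s / 9) * ee (- t / 9) * klein_1_prod s (ee (t / 3))"
proof -
  have 1: "ee (2 * (t + of_nat s) / 9) * - ee (- (2 * (t + of_nat s) / 3) / 2) = - ee (- of_nat s / 9) * ee (- t / 9)"
  proof -
    have "ee (2 * (t + of_nat s) / 9 + - (2 * (t + of_nat s) / 3) / 2) = ee (- of_nat s / 9 + - t / 9)"
      by (rule arg_cong[where f = ee]) (simp add: field_simps)
    thus ?thesis by (simp only: ee_add mult_minus_left mult_minus_right)
  qed
  have 2: "ee (2 * (t + of_nat s) / 3) = omega ^ (2 * s) * ee (t / 3) ^ 2"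
    unfolding omega_def ee_power ee_add[symmetric] by (rule arg_cong[where f = ee]) (simp add: field_simps)
  have "ee (t - 2 * (t + of_nat s) / 3) = ee (of_nat s * (1 / 3) + t / 3 + of_int (- int s))"
    by (rule arg_cong[where f = ee]) (simp add: field_simps)
  hence 3: "ee (t - 2 * (t + of_nat s) / 3) = omega ^ s * ee (t / 3)"
    unfolding ee_add ee_of_int omega_def ee_power by simp
  have "klein 1 (int s) t = (ee (2 * (t + of_nat s) / 9) * - ee (- (2 * (t + of_nat s) / 3) / 2)) * klein_1_prod s (ee (t / 3))"
    unfolding klein_def theta_def klein_1_prod_def ee_third_power(1) of_int_1 mult_1 mult_1_right of_int_of_nat_eq 2 3 by simp
  thus ?thesis unfolding 1 .
qed

text \<open>With first index 0 no power of ee t is left over: at the cusp this Klein form tends to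
  the nonzero constant omega - omega^2.\<close>

lemma klein_0_1: "klein 0 1 t = (omega - omega ^ 2) * klein_0_prod (ee (t / 3))" if "t \<in> uhp"
proof -
  have q: "norm (ee t) < 1" using that by (simp add: uhp_def norm_ee_less_1)
  have 1: "ee (2 / 3) = omega ^ 2" by (simp add: omega_def ee_power)
  have 2: "ee (- (2 / 3) / 2) = omega ^ 2"
  proof -
    have "ee (- (2 / 3) / 2) = ee (2 / 3 - 1)" by (rule arg_cong[where f = ee]) simp
    thus ?thesis by (simp only: ee_diff 1 ee_1 div_by_1)
  qed
  have "ee (t - 2 / 3) = ee (t + 1 / 3 - 1)" by (rule arg_cong[where f = ee]) simp
  hence 3: "ee (t - 2 / 3) = omega * ee t" by (simp only: ee_diff ee_add ee_1 div_by_1 omega_def mult.commute)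
  have 4: "qprod (omega ^ 2) (ee t) = (1 - omega ^ 2) * qprod (omega ^ 2 * ee t) (ee t)" by (rule qprod_step[OF q])
  have 5: "- (omega ^ 2) * (1 - omega ^ 2) = omega - omega ^ 2"
    using omega_cube by algebra
  have "klein 0 1 t = theta (2 / 3) t" by (simp add: klein_def)
  also have "\<dots> = (- (omega ^ 2) * (1 - omega ^ 2)) * klein_0_prod (ee (t / 3))"
    unfolding theta_def klein_0_prod_def 1 2 3 4 ee_third_power(1) by simp
  finally show ?thesis unfolding 5 .
qed

lemma omega_diff_sq: "(omega - omega ^ 2) ^ 2 = - 3" using omega_sum by algebra
lemma omega_diff_nz: "omega - omega ^ 2 \<noteq> 0" using omega_diff_sq by auto

section \<open>Holomorphic functions invariant under the principal congruence subgroup of level three\<close>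

fun mat_mul :: "mat2 \<Rightarrow> mat2 \<Rightarrow> mat2" where
  "mat_mul (a, b, c, d) (a', b', c', d') = (a * a' + b * c', a * b' + b * d', c * a' + d * c', c * b' + d * d')"

fun mat_inv :: "mat2 \<Rightarrow> mat2" where
  "mat_inv (a, b, c, d) = (d, - b, - c, a)"

definition Gamma_3 :: "mat2 set" where
  "Gamma_3 = {(a, b, c, d). (a, b, c, d) \<in> SL2Z \<and> 3 dvd a - 1 \<and> 3 dvd b \<and> 3 dvd c \<and> 3 dvd d - 1}"

lemma Gamma_3_SL2Z: "M \<in> Gamma_3 \<Longrightarrow> M \<in> SL2Z"
  by (auto simp: Gamma_3_def)

lemma mat_mul_SL2Z: "M \<in> SL2Z \<Longrightarrow> N \<in> SL2Z \<Longrightarrow> mat_mul M N \<in> SL2Z"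
proof -
  have "(a * a' + b * c') * (c * b' + d * d') - (a * b' + b * d') * (c * a' + d * c') = 1"
    if "a * d - b * c = 1" "a' * d' - b' * c' = 1" for a b c d a' b' c' d' :: int
    using that by algebra
  thus "M \<in> SL2Z \<Longrightarrow> N \<in> SL2Z \<Longrightarrow> mat_mul M N \<in> SL2Z" by (cases M; cases N) (simp add: SL2Z_def)
qed

lemma mat_inv_SL2Z: "M \<in> SL2Z \<Longrightarrow> mat_inv M \<in> SL2Z"
  by (cases M) (auto simp: SL2Z_def algebra_simps)

lemma moeb_uhp: "M \<in> SL2Z \<Longrightarrow> t \<in> uhp \<Longrightarrow> moeb M t \<in> uhp"
  by (cases M) (auto simp: SL2Z_def intro!: moeb_in_uhp)

lemma moeb_mat_mul: "N \<in> SL2Z \<Longrightarrow> t \<in> uhp \<Longrightarrow> moeb (mat_mul M N) t = moeb M (moeb N t)"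
  by (cases M; cases N) (auto simp: SL2Z_def intro!: moeb_mult[where k = 1])

lemma moeb_id [simp]: "moeb (1, 0, 0, 1) t = t"
  by (simp add: moeb_def moebius_def)

lemma moeb_mat_inv:
  assumes "M \<in> SL2Z" "t \<in> uhp"
  shows "moeb (mat_inv M) (moeb M t) = t" "moeb M (moeb (mat_inv M) t) = t"
proof -
  have "mat_mul (mat_inv M) M = (1, 0, 0, 1)" "mat_mul M (mat_inv M) = (1, 0, 0, 1)"
    using assms(1) by (cases M; auto simp: SL2Z_def algebra_simps)+
  thus "moeb (mat_inv M) (moeb M t) = t" "moeb M (moeb (mat_inv M) t) = t"
    using moeb_mat_mul[OF assms, of "mat_inv M"] moeb_mat_mul[OF mat_inv_SL2Z[OF assms(1)] assms(2), of M] by simp_all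
qed

section \<open>Reduction of points of the half plane by SL2(Z)\<close>

lemma finite_small_denominators:
  assumes t: "t \<in> uhp"
  shows "finite {(c::int, d::int). norm (of_int c * t + of_int d) \<le> 1}"
proof (rule finite_subset)
  have it: "Im t > 0" using t by (simp add: uhp_def)
  define B where "B = \<lceil>1 / Im t\<rceil>"
  define B' where "B' = \<lceil>1 + of_int B * norm t\<rceil>"
  show "finite ({- B..B} \<times> {- B'..B'})" by simp
  show "{(c::int, d::int). norm (of_int c * t + of_int d) \<le> 1} \<subseteq> {- B..B} \<times> {- B'..B'}"
  proof safe
    fix c d :: int assume le: "norm (of_int c * t + of_int d) \<le> 1"
    have "\<bar>of_int c * Im t\<bar> \<le> 1"
      using abs_Im_le_cmod[of "of_int c * t + of_int d"] le by simp
    hence "\<bar>of_int c\<bar> \<le> 1 / Im t" using it by (simp add: abs_mult field_simps)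
    hence c: "\<bar>c\<bar> \<le> B" unfolding B_def by linarith
    thus "c \<in> {- B..B}" by auto
    have "norm (of_int d :: complex) \<le> norm (of_int c * t + of_int d) + norm (of_int c * t)"
      using norm_triangle_ineq4[of "of_int c * t + of_int d" "of_int c * t"] by simp
    also have "\<dots> \<le> 1 + of_int B * norm t"
      unfolding norm_mult using le c by (intro add_mono mult_right_mono) auto
    finally have "\<bar>of_int d\<bar> \<le> 1 + of_int B * norm t" by simp
    hence "\<bar>d\<bar> \<le> B'" unfolding B'_def by linarith
    thus "d \<in> {- B'..B'}" by auto
  qed
qed

text \<open>A lower row minimising |c t + d| maximises the imaginary part. After a translation into
  |Re v| <= 1/2, minimality against S forces |v| >= 1, hence Im v >= sqrt(3)/2; the rounder bound
  1/2 is carried through all later estimates.\<close>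

lemma fundamental_domain:
  assumes t: "t \<in> uhp"
  obtains M where "M \<in> SL2Z" "Im (moeb M t) \<ge> 1 / 2"
proof -
  define f where "f = (\<lambda>(c, d). norm (of_int c * t + of_int d :: complex))"
  \<comment> \<open>Restricting to values at most 1 makes the set finite, and since the row (0, 1)
    has value 1 the minimum over all rows is found there.\<close>
  define D where "D = {p. f p \<le> 1 \<and> (\<exists>a b. (a, b, fst p, snd p) \<in> SL2Z)}"
  have "finite D"
    by (rule finite_subset[OF _ finite_small_denominators[OF t]]) (auto simp: D_def f_def)
  moreover have "(0, 1) \<in> D" by (auto simp: D_def f_def SL2Z_def)
  ultimately obtain p where p: "p \<in> D" "\<And>q. q \<in> D \<Longrightarrow> f p \<le> f q"
    using ex_min_if_finite[of "f ` D"] by (metis empty_iff finite_imageI image_eqI image_iff leI)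
  obtain c d a b where cd: "p = (c, d)" and M: "(a, b, c, d) \<in> SL2Z"
    using p(1) by (cases p) (auto simp: D_def)
  have min: "f (c, d) \<le> f (c', d')" if "(a', b', c', d') \<in> SL2Z" for a' b' c' d'
  proof (cases "f (c', d') \<le> 1")
    case True
    with that have "(c', d') \<in> D" by (auto simp: D_def)
    thus ?thesis using p(2) cd by auto
  next
    case False
    thus ?thesis using p(1) cd by (auto simp: D_def)
  qed
  define M where "M = (a, b, c, d)"
  define w where "w = moeb M t"
  define n where "n = round (Re w)"
  define N where "N = mat_mul (1, - n, 0, 1) M"
  have TN: "(1, - n, 0, 1) \<in> SL2Z" by (simp add: SL2Z_def)
  have N: "N \<in> SL2Z" using M TN by (simp add: N_def M_def mat_mul_SL2Z del: mat_mul.simps)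
  have w: "w \<in> uhp" unfolding w_def M_def by (rule moeb_uhp[OF M t])
  define v where "v = moeb N t"
  have v: "v = w - of_int n"
    unfolding v_def N_def w_def using M t by (simp add: moeb_mat_mul M_def del: mat_mul.simps) (simp add: moeb_def moebius_def)
  have v_uhp: "v \<in> uhp" unfolding v_def using N t by (rule moeb_uhp)
  have rv: "\<bar>Re v\<bar> \<le> 1 / 2" using of_int_round_abs_le[of "Re w"] by (simp add: v n_def abs_minus_commute)
  obtain a' b' c' d' where N': "N = (a', b', c', d')" by (cases N)
  have "c' = c" "d' = d" using N' by (simp_all add: N_def M_def)
  \<comment> \<open>The lower row of S N competes with (c, d), and its denominator is |v| times the
    old one.\<close>
  have S: "mat_mul (0, - 1, 1, 0) N = (- c, - d, a', b')" using N' \<open>c' = c\<close> \<open>d' = d\<close> by simp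
  have "(- c, - d, a', b') \<in> SL2Z" unfolding S[symmetric] by (intro mat_mul_SL2Z N) (simp add: SL2Z_def)
  hence le: "f (c, d) \<le> f (a', b')" by (rule min)
  have "of_int c * t + of_int d \<noteq> (0 :: complex)"
    by (rule moeb_denom_nonzero[of a d b c]) (use M t in \<open>auto simp: SL2Z_def\<close>)
  hence pos: "f (c, d) > 0" by (simp add: f_def)
  have "v = (of_int a' * t + of_int b') / (of_int c * t + of_int d)"
    unfolding v_def N' \<open>c' = c\<close> \<open>d' = d\<close> by (simp add: moeb_def moebius_def)
  hence "norm v = f (a', b') / f (c, d)" by (simp add: f_def norm_divide)
  hence "norm v \<ge> 1" using le pos by simp
  hence "1 \<le> (Re v)\<^sup>2 + (Im v)\<^sup>2" unfolding cmod_def by simp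
  moreover have "(Re v)\<^sup>2 \<le> (1 / 2)\<^sup>2" using rv by (simp add: abs_le_square_iff[symmetric])
  ultimately have "(1 / 2)\<^sup>2 \<le> (Im v)\<^sup>2" by (simp add: power2_eq_square)
  hence "1 / 2 \<le> \<bar>Im v\<bar>" by (simp add: abs_le_square_iff[symmetric])
  hence "Im v \<ge> 1 / 2" using v_uhp by (simp add: uhp_def)
  with N show ?thesis using that by (simp add: v_def)
qed

section \<open>Periodic functions as functions of the local parameter at a cusp\<close>

lemma periodic_int:
  assumes "\<And>t. Im t > R \<Longrightarrow> h (t + of_nat n) = (h t :: complex)" "Im t > R"
  shows "h (t + of_int k * of_nat n) = h t"
proof (induction k rule: int_induct[where k = 0])
  case (step1 i) thus ?case using assms(1)[of "t + of_int i * of_nat n"] assms(2) by (simp add: algebra_simps)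
next
  case (step2 i) thus ?case using assms(1)[of "t + of_int (i - 1) * of_nat n"] assms(2) by (simp add: algebra_simps)
qed auto

text \<open>In the parameter ee(t/n) the function is single valued on a punctured disc, and the
  bound makes the singularity at the centre removable.\<close>

lemma periodic_extension:
  fixes h :: "complex \<Rightarrow> complex" and n :: nat
  assumes n: "n > 0" and hol: "h holomorphic_on {t. Im t > R}"
    and per: "\<And>t. Im t > R \<Longrightarrow> h (t + of_nat n) = h t"
    and bdd: "\<And>t. Im t > R' \<Longrightarrow> norm (h t) \<le> C"
  obtains \<phi> where "\<phi> holomorphic_on ball 0 (exp (- 2 * pi * R / n))"
    "\<And>t. Im t > R \<Longrightarrow> h t = \<phi> (ee (t / of_nat n))"
proof -
  define S where "S = ball (0::complex) (exp (- 2 * pi * R / n))"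
  define l where "l = (\<lambda>w. of_nat n * Ln w / (2 * of_real pi * \<i>))"
  have ee_l: "ee (l w / of_nat n) = w" if "w \<noteq> 0" for w
    using that n by (simp add: l_def ee_def)
  have Im_n: "Im (t / of_nat n) = Im t / n" for t by (simp add: Im_divide power2_eq_square)
  have Im_iff: "Im t > Q \<longleftrightarrow> norm (ee (t / of_nat n)) < exp (- 2 * pi * Q / n)" for t Q
    using n by (simp add: norm_ee Im_n field_simps)
  have eq: "h t = h s" if "ee (t / of_nat n) = ee (s / of_nat n)" "Im t > R" for s t
  proof -
    have "ee (s / of_nat n - t / of_nat n) = 1" using that by (simp add: ee_diff)
    then obtain k :: int where "s / of_nat n - t / of_nat n = of_int k" using ee_eq_1_iff by blast
    hence "s = t + of_int k * of_nat n" using n by (simp add: field_simps)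
    thus ?thesis using periodic_int[of R h n t k] per that(2) by simp
  qed
  define \<phi> where "\<phi> = (\<lambda>w. h (l w))"
  have h: "h t = \<phi> (ee (t / of_nat n))" if "Im t > R" for t
    unfolding \<phi>_def by (rule eq) (use that in \<open>simp_all add: ee_l\<close>)
  have "\<phi> field_differentiable (at w)" if w: "w \<in> S - {0}" for w
  proof -
    \<comment> \<open>A local holomorphic section of t -> ee(t/n): the principal logarithm serves
      off the negative axis, and Ln(-v) + pi i on it.\<close>
    have "\<exists>g. g analytic_on {w} \<and> (\<forall>v. v \<noteq> 0 \<longrightarrow> ee (g v / of_nat n) = v)"
    proof (cases "w \<in> \<real>\<^sub>\<le>\<^sub>0")
      case False
      thus ?thesis using n ee_l by (intro exI[of _ l]) (auto simp: l_def[abs_def] intro!: analytic_intros)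
    next
      case True
      have "- w \<notin> \<real>\<^sub>\<le>\<^sub>0" using w True by (auto simp: complex_nonpos_Reals_iff complex_eq_iff)
      moreover have "ee ((of_nat n * (Ln (- v) + of_real pi * \<i>) / (2 * of_real pi * \<i>)) / of_nat n) = v" if "v \<noteq> 0" for v
        using that n by (simp add: ee_def exp_add)
      ultimately show ?thesis
        by (intro exI[of _ "\<lambda>v. of_nat n * (Ln (- v) + of_real pi * \<i>) / (2 * of_real pi * \<i>)"])
           (auto intro!: analytic_intros)
    qed
    then obtain g where g: "g analytic_on {w}" "\<And>v. v \<noteq> 0 \<Longrightarrow> ee (g v / of_nat n) = v" by blast
    have Im_g: "Im (g v) > R" if "v \<in> S - {0}" for v
      using that g(2)[of v] Im_iff[of R "g v"] by (simp add: S_def)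
    have "(h \<circ> g) field_differentiable (at w)"
    proof (rule field_differentiable_compose)
      show "g field_differentiable (at w)" using g(1) by (rule analytic_on_imp_differentiable_at) simp
      show "h field_differentiable (at (g w))"
        using hol Im_g[OF w] by (auto intro!: holomorphic_on_imp_differentiable_at open_halfspace_Im_gt)
    qed
    moreover have "eventually (\<lambda>v. (h \<circ> g) v = \<phi> v) (nhds w)"
    proof -
      have "eventually (\<lambda>v. v \<in> S - {0}) (nhds w)"
        using w by (intro eventually_nhds_in_open) (auto simp: S_def)
      thus ?thesis
      proof eventually_elim
        case (elim v)
        thus ?case using h[OF Im_g[OF elim]] g(2)[of v] by simp
      qed
    qed
    ultimately show ?thesis
      unfolding field_differentiable_def using DERIV_cong_ev[OF refl _ refl, of "h \<circ> g" \<phi> w] by blast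
  qed
  hence holphi: "\<phi> holomorphic_on (S - {0})"
    by (auto simp: holomorphic_on_def intro: field_differentiable_at_within)
  have "eventually (\<lambda>w. norm (\<phi> w) \<le> C) (at 0)"
  proof -
    have "eventually (\<lambda>w. w \<in> ball 0 (exp (- 2 * pi * R' / n)) - {0}) (at (0::complex))"
      by (rule eventually_at_in_open) auto
    thus ?thesis
    proof eventually_elim
      case (elim w)
      have "Im (l w) > R'" using Im_iff[of R' "l w"] ee_l[of w] elim by simp
      thus ?case unfolding \<phi>_def by (rule bdd)
    qed
  qed
  then obtain g where g: "g holomorphic_on S" "\<And>w. w \<in> S - {0} \<Longrightarrow> g w = \<phi> w"
    using holomorphic_on_extend_bounded[OF holphi] by (auto simp: S_def)
  show ?thesis
  proof (rule that)
    show "g holomorphic_on ball 0 (exp (- 2 * pi * R / n))" using g(1) by (simp add: S_def)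
    fix t assume "Im t > R"
    thus "h t = g (ee (t / of_nat n))"
      using h[of t] g(2)[of "ee (t / of_nat n)"] Im_iff[of R t] by (simp add: S_def)
  qed
qed

text \<open>Two matrices with the same reduction modulo 3 differ by a left factor in Gamma(3), so
  one chosen matrix for each of the finitely many reductions is enough.\<close>

lemma finite_representatives:
  obtains Rep where "finite Rep" "Rep \<subseteq> SL2Z"
    "\<And>M. M \<in> SL2Z \<Longrightarrow> \<exists>N\<in>Rep. \<exists>G\<in>Gamma_3. M = mat_mul G N"
proof -
  define \<rho> :: "mat2 \<Rightarrow> mat2" where "\<rho> = (\<lambda>(a, b, c, d). (a mod 3, b mod 3, c mod 3, d mod 3))"
  have "\<rho> ` SL2Z \<subseteq> {0..2} \<times> {0..2} \<times> {0..2} \<times> {0..2}"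
    by (auto simp: \<rho>_def)
  hence fin: "finite (\<rho> ` SL2Z)" by (rule finite_subset) simp
  define sel where "sel = (\<lambda>v. SOME M. M \<in> SL2Z \<and> \<rho> M = v)"
  have sel: "sel (\<rho> M) \<in> SL2Z" "\<rho> (sel (\<rho> M)) = \<rho> M" if "M \<in> SL2Z" for M
    using someI[of "\<lambda>N. N \<in> SL2Z \<and> \<rho> N = \<rho> M" M] that by (auto simp: sel_def)
  show ?thesis
  proof (rule that)
    show "finite (sel ` \<rho> ` SL2Z)" using fin by simp
    show "sel ` \<rho> ` SL2Z \<subseteq> SL2Z" using sel by auto
    fix M assume M: "M \<in> SL2Z"
    define N where "N = sel (\<rho> M)"
    have N: "N \<in> SL2Z" "\<rho> N = \<rho> M" using sel[OF M] by (auto simp: N_def)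
    obtain a b c d where Me: "M = (a, b, c, d)" by (cases M)
    obtain a' b' c' d' where Ne: "N = (a', b', c', d')" by (cases N)
    have det: "a * d - b * c = 1" "a' * d' - b' * c' = 1" using M N Me Ne by (auto simp: SL2Z_def)
    have "3 dvd a - a'" "3 dvd b - b'" "3 dvd c - c'" "3 dvd d - d'"
      using N(2) by (auto simp: \<rho>_def Me Ne mod_eq_dvd_iff) (metis mod_eq_dvd_iff)+
    then obtain k1 k2 k3 k4 where k: "a = a' + 3 * k1" "b = b' + 3 * k2" "c = c' + 3 * k3" "d = d' + 3 * k4"
      by (auto elim!: dvdE simp: algebra_simps)
    define G where "G = mat_mul M (mat_inv N)"
    have "3 dvd a * d' - b * c' - 1" "3 dvd - a * b' + b * a'" "3 dvd c * d' - d * c'" "3 dvd - c * b' + d * a' - 1"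
    proof -
      have "a * d' - b * c' - 1 = 3 * (k1 * d' - k2 * c')" "- a * b' + b * a' = 3 * (k2 * a' - k1 * b')"
        "c * d' - d * c' = 3 * (k3 * d' - k4 * c')" "- c * b' + d * a' - 1 = 3 * (k4 * a' - k3 * b')"
        using det(2) unfolding k by (simp_all add: algebra_simps)
      thus "3 dvd a * d' - b * c' - 1" "3 dvd - a * b' + b * a'" "3 dvd c * d' - d * c'" "3 dvd - c * b' + d * a' - 1"
        by (simp_all only: dvd_triv_left)
    qed
    moreover have "G \<in> SL2Z" unfolding G_def by (intro mat_mul_SL2Z M mat_inv_SL2Z N)
    ultimately have "G \<in> Gamma_3" by (simp add: G_def Me Ne Gamma_3_def)
    moreover have "M = mat_mul G N"
    proof -
      have "(a * d' - b * c') * a' + (b * a' - a * b') * c' = a * (a' * d' - b' * c')"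
        "(a * d' - b * c') * b' + (b * a' - a * b') * d' = b * (a' * d' - b' * c')"
        "(c * d' - d * c') * a' + (d * a' - c * b') * c' = c * (a' * d' - b' * c')"
        "(c * d' - d * c') * b' + (d * a' - c * b') * d' = d * (a' * d' - b' * c')"
        by (simp_all add: algebra_simps)
      thus ?thesis by (simp add: G_def Me Ne det)
    qed
    ultimately show "\<exists>N\<in>sel ` \<rho> ` SL2Z. \<exists>G\<in>Gamma_3. M = mat_mul G N"
      using M by (auto simp: N_def)
  qed
qed

text \<open>Gamma(3) is normal, so it contains M T^3 M^(-1). Hence h o M has period 3 for every
  invariant h and every M.\<close>

lemma Gamma_3_conj_T:
  assumes "M \<in> SL2Z"
  obtains G where "G \<in> Gamma_3" "mat_mul M (1, 3, 0, 1) = mat_mul G M"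
proof -
  obtain a b c d where M: "M = (a, b, c, d)" by (cases M)
  have det: "a * d - b * c = 1" using assms by (simp add: M SL2Z_def)
  define G where "G = (1 - 3 * a * c, 3 * a * a, - (3 * c * c), 1 + 3 * a * c)"
  have "(1 - 3 * a * c) * (1 + 3 * a * c) - (3 * a * a) * (- (3 * c * c)) = 1"
    by (simp add: algebra_simps)
  hence "G \<in> Gamma_3" unfolding Gamma_3_def SL2Z_def G_def by simp
  moreover have "mat_mul M (1, 3, 0, 1) = mat_mul G M"
  proof -
    have "(1 - 3 * a * c) * a + 3 * a * a * c = a" "(1 - 3 * a * c) * b + 3 * a * a * d = b + 3 * a * (a * d - b * c)"
      "- (3 * c * c) * a + (1 + 3 * a * c) * c = c" "- (3 * c * c) * b + (1 + 3 * a * c) * d = d + 3 * c * (a * d - b * c)"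
      by (simp_all add: algebra_simps)
    thus ?thesis unfolding det by (simp add: M G_def algebra_simps)
  qed
  ultimately show ?thesis using that by blast
qed

lemma moeb_T: "moeb (1, n, 0, 1) t = t + of_int n"
  by (simp add: moeb_def moebius_def)

text \<open>For each M, h o M is a holomorphic function of ee(t/3) on the unit disc, the centre
  included. By reduction theory every value of h is taken by one of finitely many of these functions
  on a fixed smaller closed disc. So |h| is bounded by a value attained inside a disc, and the
  maximum modulus principle applies.\<close>

theorem modular_Liouville:
  assumes hol: "h holomorphic_on uhp"
    and inv: "\<And>M t. M \<in> Gamma_3 \<Longrightarrow> t \<in> uhp \<Longrightarrow> h (moeb M t) = h t"
    and bdd: "\<And>M. M \<in> SL2Z \<Longrightarrow> \<exists>C R. \<forall>t. Im t > R \<longrightarrow> norm (h (moeb M t)) \<le> C"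
  obtains c where "\<And>t. t \<in> uhp \<Longrightarrow> h t = c"
proof -
  have "\<exists>\<phi>. \<phi> holomorphic_on ball 0 1 \<and> (\<forall>t\<in>uhp. h (moeb M t) = \<phi> (ee (t / 3)))" if M: "M \<in> SL2Z" for M
  proof -
    obtain C R where C: "\<And>t. Im t > R \<Longrightarrow> norm (h (moeb M t)) \<le> C" using bdd[OF M] by blast
    obtain G where G: "G \<in> Gamma_3" "mat_mul M (1, 3, 0, 1) = mat_mul G M" using Gamma_3_conj_T[OF M] .
    have T3: "(1, 3, 0, 1) \<in> SL2Z" by (simp add: SL2Z_def)
    have "h (moeb M (t + of_nat 3)) = h (moeb M t)" if "Im t > 0" for t
    proof -
      have t: "t \<in> uhp" using that by (simp add: uhp_def)
      have "moeb M (t + of_nat 3) = moeb (mat_mul M (1, 3, 0, 1)) t"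
        by (simp add: moeb_mat_mul[OF T3 t] moeb_T)
      also have "\<dots> = moeb G (moeb M t)" unfolding G(2) by (rule moeb_mat_mul[OF M t])
      finally show ?thesis using inv[OF G(1) moeb_uhp[OF M t]] by simp
    qed
    moreover have "(\<lambda>t. h (moeb M t)) holomorphic_on {t. Im t > 0}"
    proof -
      have "(\<lambda>t. moeb M t) holomorphic_on uhp"
        using M moeb_analytic by (cases M) (auto simp: SL2Z_def intro!: analytic_imp_holomorphic)
      hence "(h \<circ> moeb M) holomorphic_on uhp"
        using moeb_uhp[OF M] by (intro holomorphic_on_compose_gen[OF _ hol]) auto
      thus ?thesis by (simp add: o_def uhp_def)
    qed
    ultimately obtain \<phi> where "\<phi> holomorphic_on ball 0 (exp (- 2 * pi * 0 / real 3))"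
        "\<And>t. Im t > 0 \<Longrightarrow> h (moeb M t) = \<phi> (ee (t / of_nat 3))"
      using periodic_extension[of 3 "\<lambda>t. h (moeb M t)" 0 R C] C by (auto simp del: of_nat_numeral)
    thus ?thesis by (auto simp: uhp_def)
  qed
  then obtain \<phi> where \<phi>: "\<And>M. M \<in> SL2Z \<Longrightarrow> \<phi> M holomorphic_on ball 0 1"
      "\<And>M t. M \<in> SL2Z \<Longrightarrow> t \<in> uhp \<Longrightarrow> h (moeb M t) = \<phi> M (ee (t / 3))"
    by metis
  obtain Rep where Rep: "finite Rep" "Rep \<subseteq> SL2Z"
    "\<And>M. M \<in> SL2Z \<Longrightarrow> \<exists>N\<in>Rep. \<exists>G\<in>Gamma_3. M = mat_mul G N"
    using finite_representatives by metis
  \<comment> \<open>The height bound Im s >= 1/2 means |ee(s/3)| <= exp(-pi/3).\<close>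
  define r where "r = exp (- pi / 3)"
  have r: "0 \<le> r" "r < 1" by (simp_all add: r_def)
  have "\<exists>w\<in>cball 0 r. \<forall>v\<in>cball 0 r. norm (\<phi> M v) \<le> norm (\<phi> M w)" if "M \<in> SL2Z" for M
    using r \<phi>(1)[OF that]
    by (intro continuous_attains_sup continuous_on_norm)
       (auto intro!: holomorphic_on_imp_continuous_on intro: holomorphic_on_subset)
  then obtain w where w: "\<And>M. M \<in> SL2Z \<Longrightarrow> w M \<in> cball 0 r"
     "\<And>M v. M \<in> SL2Z \<Longrightarrow> v \<in> cball 0 r \<Longrightarrow> norm (\<phi> M v) \<le> norm (\<phi> M (w M))"
    by metis
  have I: "(1, 0, 0, 1) \<in> SL2Z" by (simp add: SL2Z_def)
  have "Rep \<noteq> {}" using Rep(3)[OF I] by auto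
  define f where "f = (\<lambda>N. norm (\<phi> N (w N)))"
  have "Max (f ` Rep) \<in> f ` Rep"
    by (rule Max_in) (use Rep(1) \<open>Rep \<noteq> {}\<close> in auto)
  then obtain N0 where N0: "N0 \<in> Rep" "f N0 = Max (f ` Rep)" by (metis imageE)
  have N0_max: "norm (\<phi> N (w N)) \<le> norm (\<phi> N0 (w N0))" if "N \<in> Rep" for N
    using Max_ge[of "f ` Rep" "f N"] Rep(1) that N0(2) by (simp add: f_def)
  have le: "norm (h t) \<le> norm (\<phi> N0 (w N0))" if t: "t \<in> uhp" for t
  proof -
    obtain M where M: "M \<in> SL2Z" "Im (moeb M t) \<ge> 1 / 2" using fundamental_domain[OF t] .
    define s where "s = moeb M t"
    have s: "s \<in> uhp" using moeb_uhp M t by (simp add: s_def)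
    obtain N G where NG: "N \<in> Rep" "G \<in> Gamma_3" "mat_inv M = mat_mul G N"
      using Rep(3)[OF mat_inv_SL2Z[OF M(1)]] by blast
    have N: "N \<in> SL2Z" using NG Rep by auto
    have "h t = h (moeb (mat_inv M) s)" using moeb_mat_inv(1)[OF M(1) t] by (simp add: s_def)
    also have "\<dots> = h (moeb N s)"
      unfolding NG(3) using inv[OF NG(2) moeb_uhp[OF N s]] by (simp add: moeb_mat_mul[OF N s])
    also have "\<dots> = \<phi> N (ee (s / 3))" by (rule \<phi>(2)[OF N s])
    finally have ht: "h t = \<phi> N (ee (s / 3))" .
    have "norm (ee (s / 3)) \<le> r"
      using M(2) by (simp add: norm_ee r_def s_def[symmetric] field_simps)
    hence "norm (\<phi> N (ee (s / 3))) \<le> norm (\<phi> N (w N))" by (intro w N) auto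
    with N0_max[OF NG(1)] ht show ?thesis by simp
  qed
  have N0': "N0 \<in> SL2Z" using N0(1) Rep(2) by (rule subsetD[rotated])
  have "\<phi> N0 constant_on ball 0 1"
  proof (rule maximum_modulus_principle[OF \<phi>(1)[OF N0']])
    \<comment> \<open>The centre corresponds to no point of the half plane, so the bound is known
      only off 0. The centre is therefore taken out of the open set, unless the maximum itself sits
      there.\<close>
    show "w N0 \<in> ball 0 1 - ({0} - {w N0})" using w(1)[OF N0'] r by auto
    show "open (ball 0 1 - ({0} - {w N0}))" by (intro open_Diff finite_imp_closed) auto
    fix z assume z: "z \<in> ball 0 1 - ({0} - {w N0})"
    show "norm (\<phi> N0 z) \<le> norm (\<phi> N0 (w N0))"
    proof (cases "z = w N0")
      case False
      hence z0: "z \<noteq> 0" using z by auto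
      define t where "t = 3 * Ln z / (2 * of_real pi * \<i>)"
      have e: "ee (t / 3) = z" using z0 by (simp add: t_def ee_def)
      have "norm (ee (t / 3)) < 1" unfolding e using z by auto
      hence t: "t \<in> uhp" by (simp add: norm_ee uhp_def zero_less_mult_iff)
      show ?thesis using le[OF moeb_uhp[OF N0' t]] \<phi>(2)[OF N0' t] e by simp
    qed auto
  qed auto
  then obtain c where c: "\<And>z. z \<in> ball 0 1 \<Longrightarrow> \<phi> N0 z = c" by (auto simp: constant_on_def)
  show ?thesis
  proof (rule that)
    fix t assume t: "t \<in> uhp"
    define s where "s = moeb (mat_inv N0) t"
    have s: "s \<in> uhp" using moeb_uhp mat_inv_SL2Z N0' t by (simp add: s_def)
    have "h t = \<phi> N0 (ee (s / 3))"
      using \<phi>(2)[OF N0' s] moeb_mat_inv(2)[OF N0' t] by (simp add: s_def)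
    also have "\<dots> = c" using s by (intro c) (simp add: norm_ee uhp_def)
    finally show "h t = c" .
  qed
qed

section \<open>The functions \<open>W\<close> and \<open>F\<close>\<close>

definition sqrt_m3 :: complex where "sqrt_m3 = omega - omega ^ 2"

lemma sqrt_m3_sq: "sqrt_m3 ^ 2 = - 3" and sqrt_m3_nz [simp]: "sqrt_m3 \<noteq> 0"
  using omega_diff_sq omega_diff_nz by (simp_all add: sqrt_m3_def)

lemma klein_0_1': "t \<in> uhp \<Longrightarrow> klein 0 1 t = sqrt_m3 * klein_0_prod (ee (t / 3))"
  using klein_0_1 by (simp add: sqrt_m3_def)

lemma ee_third_in_ball: "t \<in> uhp \<Longrightarrow> norm (ee (t / 3)) < 1"
  by (simp add: norm_ee uhp_def)

lemma klein_1_nz: "t \<in> uhp \<Longrightarrow> klein 1 (int s) t \<noteq> 0"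
  unfolding klein_1 using klein_1_prod_nonzero[OF ee_third_in_ball] by simp

lemma klein_0_1_nz: "t \<in> uhp \<Longrightarrow> klein 0 1 t \<noteq> 0"
  using klein_0_1' klein_0_prod_nonzero[OF ee_third_in_ball] by simp

lemma holomorphic_klein: "klein r s holomorphic_on uhp"
  unfolding klein_def[abs_def] by (intro holomorphic_intros) auto

section \<open>Growth of Klein forms towards the cusps\<close>

lemma mod_3_cases:
  fixes r :: int assumes "\<not> 3 dvd r"
  obtains \<sigma> m where "\<sigma> = 1 \<or> \<sigma> = - 1" "r = \<sigma> * (1 + 3 * m)"
proof -
  have "r mod 3 = 1 \<or> r mod 3 = 2" using assms by presburger
  thus ?thesis
  proof
    assume "r mod 3 = 1"
    hence "r = 1 * (1 + 3 * (r div 3))" by presburger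
    thus ?thesis using that by blast
  next
    assume "r mod 3 = 2"
    hence "r = (- 1) * (1 + 3 * (- (r div 3) - 1))" by presburger
    thus ?thesis using that by blast
  qed
qed

lemma norm_omega_powi [simp]: "norm (omega powi k) = 1"
  by (simp add: norm_power_int)

lemma klein_sign:
  assumes "\<sigma> = 1 \<or> \<sigma> = - 1" "t \<in> uhp"
  shows "klein (\<sigma> * r) (\<sigma> * s) t = of_int \<sigma> * klein r s t"
  using assms klein_minus by auto

text \<open>Modulo 3 and up to sign every index with first entry prime to 3 is one of (1, 0), (1,
  1), (1, 2), so all estimates reduce to the three products \<open>klein_1_prod\<close>.\<close>

lemma klein_class_1:
  assumes "\<not> 3 dvd r"
  obtains e k where "norm e = 1" "k < 3" "\<And>t. t \<in> uhp \<Longrightarrow> klein r s t = e * klein 1 (int k) t"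
proof -
  obtain \<sigma> m where \<sigma>: "\<sigma> = 1 \<or> \<sigma> = - 1" "r = \<sigma> * (1 + 3 * m)" using mod_3_cases[OF assms] .
  define k where "k = nat (\<sigma> * s mod 3)"
  have k: "int k = \<sigma> * s mod 3" by (simp add: k_def)
  define n where "n = \<sigma> * s div 3"
  have s: "s = \<sigma> * (int k + 3 * n)" unfolding k n_def using \<sigma>(1) by auto
  show ?thesis
  proof (rule that)
    show "norm (of_int \<sigma> * omega powi (m * int k - n * 1)) = 1" using \<sigma>(1) by (auto simp: norm_mult)
    have "\<sigma> * s mod 3 < 3" by simp
    thus "k < 3" by (simp add: k_def nat_less_iff)
    fix t :: complex assume t: "t \<in> uhp"
    show "klein r s t = (of_int \<sigma> * omega powi (m * int k - n * 1)) * klein 1 (int k) t"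
      unfolding \<sigma>(2) s klein_sign[OF \<sigma>(1) t] klein_shift[OF t] by simp
  qed
qed

lemma klein_class_0:
  assumes "3 dvd r" "\<not> 3 dvd s"
  obtains e where "norm e = 1" "\<And>t. t \<in> uhp \<Longrightarrow> klein r s t = e * klein 0 1 t"
proof -
  obtain \<sigma> n where \<sigma>: "\<sigma> = 1 \<or> \<sigma> = - 1" "s = \<sigma> * (1 + 3 * n)" using mod_3_cases[OF assms(2)] .
  obtain m0 where "r = 3 * m0" using assms(1) by auto
  hence r: "r = \<sigma> * (0 + 3 * (\<sigma> * m0))" using \<sigma>(1) by auto
  show ?thesis
  proof (rule that)
    show "norm (of_int \<sigma> * omega powi (\<sigma> * m0 * 1 - n * 0)) = 1" using \<sigma>(1) by (auto simp: norm_mult)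
    fix t :: complex assume t: "t \<in> uhp"
    show "klein r s t = (of_int \<sigma> * omega powi (\<sigma> * m0 * 1 - n * 0)) * klein 0 1 t"
      unfolding \<sigma>(2) by (subst r, unfold klein_sign[OF \<sigma>(1) t] klein_shift[OF t]) simp
  qed
qed

lemma two_sided_bound:
  assumes "\<phi> holomorphic_on ball 0 1" "\<And>X. norm X < 1 \<Longrightarrow> \<phi> X \<noteq> 0"
  obtains c C :: real where "c > 0" "\<And>t. Im t \<ge> 1 / 2 \<Longrightarrow> c \<le> norm (\<phi> (ee (t / 3))) \<and> norm (\<phi> (ee (t / 3))) \<le> C"
proof -
  define r where "r = exp (- pi / 3)"
  have r: "0 \<le> r" "r < 1" by (simp_all add: r_def)
  have cont: "continuous_on (cball 0 r) (\<lambda>X. norm (\<phi> X))"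
    using assms(1) r by (intro continuous_on_norm)
      (auto intro!: holomorphic_on_imp_continuous_on intro: holomorphic_on_subset)
  have ne: "cball (0::complex) r \<noteq> {}" using r by simp
  have mem: "ee (t / 3) \<in> cball 0 r" if "Im t \<ge> 1 / 2" for t
    using that by (simp add: norm_ee r_def field_simps)
  obtain X where X: "X \<in> cball 0 r" "\<And>Y. Y \<in> cball 0 r \<Longrightarrow> norm (\<phi> X) \<le> norm (\<phi> Y)"
    using continuous_attains_inf[OF compact_cball ne cont] by blast
  obtain Z where Z: "Z \<in> cball 0 r" "\<And>Y. Y \<in> cball 0 r \<Longrightarrow> norm (\<phi> Y) \<le> norm (\<phi> Z)"
    using continuous_attains_sup[OF compact_cball ne cont] by blast
  show ?thesis
  proof (rule that)
    show "norm (\<phi> X) > 0" using assms(2)[of X] X(1) r by simp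
    show "norm (\<phi> X) \<le> norm (\<phi> (ee (t / 3))) \<and> norm (\<phi> (ee (t / 3))) \<le> norm (\<phi> Z)"
      if "Im t \<ge> 1 / 2" for t
      using X(2) Z(2) mem[OF that] by blast
  qed
qed

lemma half_uhp: "Im t \<ge> 1 / 2 \<Longrightarrow> t \<in> uhp"
  by (simp add: uhp_def)

lemma norm_ee_ninth: "norm (ee (- t / 9)) = exp (2 * pi / 9 * Im t)"
  by (simp add: norm_ee)

text \<open>A nonvanishing holomorphic function on the disc is bounded above and below near its
  centre, so the size is that of ee(-t/9). In \<open>klein_bound_0\<close> no such factor is
  present; this dichotomy decides at which cusps quotients of Klein forms have poles.\<close>

lemma klein_bound_1:
  assumes "\<not> 3 dvd r"
  obtains c C :: real where "c > 0" "C > 0" "\<And>t. Im t \<ge> 1 / 2 \<Longrightarrow>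
     c * exp (2 * pi / 9 * Im t) \<le> norm (klein r s t) \<and> norm (klein r s t) \<le> C * exp (2 * pi / 9 * Im t)"
proof -
  obtain e k where e: "norm e = 1" "\<And>t. t \<in> uhp \<Longrightarrow> klein r s t = e * klein 1 (int k) t"
    using klein_class_1[OF assms] by metis
  obtain c C where c: "c > 0" "\<And>t. Im t \<ge> 1 / 2 \<Longrightarrow> c \<le> norm (klein_1_prod k (ee (t / 3))) \<and> norm (klein_1_prod k (ee (t / 3))) \<le> C"
    using two_sided_bound[OF holomorphic_klein_1_prod klein_1_prod_nonzero] by metis
  have n: "norm (klein r s t) = norm (klein_1_prod k (ee (t / 3))) * exp (2 * pi / 9 * Im t)" if "Im t \<ge> 1 / 2" for t
  proof -
    have "norm (ee (- of_nat k / 9)) = 1" by (simp add: norm_ee)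
    thus ?thesis
      unfolding e(2)[OF half_uhp[OF that]] klein_1 norm_mult norm_minus_cancel norm_ee_ninth e(1) by simp
  qed
  show ?thesis
  proof (rule that[of c "\<bar>C\<bar> + 1"])
    fix t assume t: "Im t \<ge> 1 / 2"
    have "norm (klein_1_prod k (ee (t / 3))) \<le> \<bar>C\<bar> + 1" using c(2)[OF t] by linarith
    thus "c * exp (2 * pi / 9 * Im t) \<le> norm (klein r s t) \<and> norm (klein r s t) \<le> (\<bar>C\<bar> + 1) * exp (2 * pi / 9 * Im t)"
      unfolding n[OF t] using c(2)[OF t] by (intro conjI mult_right_mono) auto
  qed (use c in auto)
qed

lemma klein_bound_0:
  assumes "3 dvd r" "\<not> 3 dvd s"
  obtains c C :: real where "c > 0" "C > 0" "\<And>t. Im t \<ge> 1 / 2 \<Longrightarrow> c \<le> norm (klein r s t) \<and> norm (klein r s t) \<le> C"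
proof -
  obtain e where e: "norm e = 1" "\<And>t. t \<in> uhp \<Longrightarrow> klein r s t = e * klein 0 1 t"
    using klein_class_0[OF assms] by metis
  define \<phi> where "\<phi> = (\<lambda>X. sqrt_m3 * klein_0_prod X)"
  have "\<phi> holomorphic_on ball 0 1" unfolding \<phi>_def by (intro holomorphic_intros holomorphic_klein_0_prod)
  moreover have "\<phi> X \<noteq> 0" if "norm X < 1" for X using klein_0_prod_nonzero[OF that] by (simp add: \<phi>_def)
  ultimately obtain c C where c: "c > 0" "\<And>t. Im t \<ge> 1 / 2 \<Longrightarrow> c \<le> norm (\<phi> (ee (t / 3))) \<and> norm (\<phi> (ee (t / 3))) \<le> C"
    using two_sided_bound by metis
  show ?thesis
  proof (rule that[of c "\<bar>C\<bar> + 1"])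
    fix t assume t: "Im t \<ge> 1 / 2"
    have "norm (klein r s t) = norm (\<phi> (ee (t / 3)))"
      unfolding e(2)[OF half_uhp[OF t]] norm_mult e(1) klein_0_1'[OF half_uhp[OF t]] \<phi>_def by simp
    thus "c \<le> norm (klein r s t) \<and> norm (klein r s t) \<le> \<bar>C\<bar> + 1" using c(2)[OF t] by linarith
  qed (use c in auto)
qed

lemma klein_upper:
  assumes "\<not> (3 dvd r \<and> 3 dvd s)"
  obtains C :: real where "C > 0" "\<And>t. Im t \<ge> 1 / 2 \<Longrightarrow> norm (klein r s t) \<le> C * exp (2 * pi / 9 * Im t)"
proof (cases "3 dvd r")
  case True
  then obtain C where C: "C > 0" "\<And>t. Im t \<ge> 1 / 2 \<Longrightarrow> norm (klein r s t) \<le> C"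
    using klein_bound_0[of r s] assms by metis
  show ?thesis
  proof (rule that[OF C(1)])
    fix t :: complex assume t: "Im t \<ge> 1 / 2"
    have "C * 1 \<le> C * exp (2 * pi / 9 * Im t)" using C(1) t by (intro mult_left_mono) auto
    thus "norm (klein r s t) \<le> C * exp (2 * pi / 9 * Im t)" using C(2)[OF t] by linarith
  qed
next
  case False
  thus ?thesis using klein_bound_1[of r s] that by metis
qed

lemma klein_lower:
  assumes "\<not> (3 dvd r \<and> 3 dvd s)"
  obtains c :: real where "c > 0" "\<And>t. Im t \<ge> 1 / 2 \<Longrightarrow> c \<le> norm (klein r s t)"
proof (cases "3 dvd r")
  case True
  thus ?thesis using klein_bound_0[of r s] assms that by metis
next
  case False
  then obtain c where c: "c > 0" "\<And>t. Im t \<ge> 1 / 2 \<Longrightarrow> c * exp (2 * pi / 9 * Im t) \<le> norm (klein r s t)"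
    using klein_bound_1[of r s] by metis
  show ?thesis
  proof (rule that[OF c(1)])
    fix t :: complex assume t: "Im t \<ge> 1 / 2"
    have "c * 1 \<le> c * exp (2 * pi / 9 * Im t)" using c(1) t by (intro mult_left_mono) auto
    thus "c \<le> norm (klein r s t)" using c(2)[OF t] by linarith
  qed
qed

text \<open>The four pairs are the images under the matrix of the indices (1, 0), (0, 1), (1, 1),
  (1, 2) that occur in W and F. A pair vanishing modulo 3 would contradict determinant 1.\<close>

lemma SL2Z_not_both:
  assumes "(a, b, c, d) \<in> SL2Z"
  shows "\<not> (3 dvd a \<and> 3 dvd b)" "\<not> (3 dvd c \<and> 3 dvd d)" "\<not> (3 dvd a + c \<and> 3 dvd b + d)"
    "\<not> (3 dvd a + 2 * c \<and> 3 dvd b + 2 * d)"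
proof -
  have det: "a * d - b * c = 1" using assms by (simp add: SL2Z_def)
  have 0: False if "3 dvd p" "3 dvd q" "p * x - q * y = 1" for p q x y :: int
  proof -
    have "3 dvd p * x - q * y" using that(1,2) by auto
    thus False using that(3) by simp
  qed
  show "\<not> (3 dvd a \<and> 3 dvd b)" using 0[of a b d c] det by auto
  show "\<not> (3 dvd c \<and> 3 dvd d)" using 0[of d c a b] det by (auto simp: mult.commute)
  show "\<not> (3 dvd a + c \<and> 3 dvd b + d)" using 0[of "a + c" "b + d" d c] det by (auto simp: algebra_simps)
  show "\<not> (3 dvd a + 2 * c \<and> 3 dvd b + 2 * d)" using 0[of "a + 2 * c" "b + 2 * d" d c] det by (auto simp: algebra_simps)
qed

lemma SL2Z_denom_nz: "(a, b, c, d) \<in> SL2Z \<Longrightarrow> t \<in> uhp \<Longrightarrow> of_int c * t + of_int d \<noteq> (0 :: complex)"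
  by (rule moeb_denom_nonzero[of a d b c]) (auto simp: SL2Z_def)

text \<open>As a function this is eta(t/3) / eta(3t). The constant makes the expansion start with
  exactly ee(-t/9).\<close>

definition W_fun :: "complex \<Rightarrow> complex" where
  "W_fun t = - sqrt_m3 * klein 1 0 t / klein 0 1 t"

text \<open>As a function this is eta(t)^4 / (eta(t/3) eta(3t)^3). The factor \<open>omega\<close>
  cancels the phases ee(-1/9) and ee(-2/9) of the two Klein forms, and -3 cancels the square of
  \<open>sqrt_m3\<close> coming from the denominator.\<close>

definition F_fun :: "complex \<Rightarrow> complex" where
  "F_fun t = - 3 * omega * (klein 1 1 t * klein 1 2 t) / klein 0 1 t ^ 2"

lemma klein_1_numeral: "klein 1 0 = klein 1 (int 0)" "klein 1 1 = klein 1 (int 1)" "klein 1 2 = klein 1 (int 2)"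
  by simp_all

lemma W_fun_nz: "t \<in> uhp \<Longrightarrow> W_fun t \<noteq> 0" and F_fun_nz: "t \<in> uhp \<Longrightarrow> F_fun t \<noteq> 0"
  unfolding W_fun_def F_fun_def using klein_1_nz[of t 0] klein_1_nz[of t 1] klein_1_nz[of t 2] klein_0_1_nz by simp_all

lemma holomorphic_W_fun: "W_fun holomorphic_on uhp" and holomorphic_F_fun: "F_fun holomorphic_on uhp"
  unfolding W_fun_def[abs_def] F_fun_def[abs_def]
  by (intro holomorphic_intros holomorphic_klein; simp add: klein_0_1_nz)+

lemma W_fun_expansion:
  assumes t: "t \<in> uhp"
  shows "W_fun t = ee (- t / 9) * (klein_1_prod 0 (ee (t / 3)) / klein_0_prod (ee (t / 3)))"
  unfolding W_fun_def klein_1_numeral klein_1 klein_0_1'[OF t] by simp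

lemma F_fun_expansion:
  assumes t: "t \<in> uhp"
  shows "F_fun t = ee (- t / 9) ^ 2 * (klein_1_prod 1 (ee (t / 3)) * klein_1_prod 2 (ee (t / 3)) / klein_0_prod (ee (t / 3)) ^ 2)"
proof -
  have "ee (- of_nat 1 / 9 + - of_nat 2 / 9 + 1 / 3) = ee 0" by (rule arg_cong[where f = ee]) simp
  hence e: "ee (- of_nat 1 / 9) * ee (- of_nat 2 / 9) * omega = 1" by (simp only: ee_add omega_def ee_0)
  have "F_fun t = - 3 * (ee (- of_nat 1 / 9) * ee (- of_nat 2 / 9) * omega) * ee (- t / 9) ^ 2 *
      (klein_1_prod 1 (ee (t / 3)) * klein_1_prod 2 (ee (t / 3))) / (sqrt_m3 ^ 2 * klein_0_prod (ee (t / 3)) ^ 2)"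
    unfolding F_fun_def klein_1_numeral klein_1 klein_0_1'[OF t] by (simp add: power2_eq_square mult_ac)
  thus ?thesis unfolding e sqrt_m3_sq by simp
qed

lemma W_fun_S:
  assumes t: "t \<in> uhp" shows "W_fun (- 1 / t) = 3 / W_fun t"
proof -
  have "klein 0 (- 1) t = - klein 0 1 t" using klein_minus[OF t, of 0 1] by simp
  hence "W_fun (- 1 / t) = sqrt_m3 * klein 0 1 t / klein 1 0 t"
    using klein_S[OF t, of 1 0] klein_S[OF t, of 0 1] uhp_nz[OF t] by (simp add: W_fun_def)
  also have "\<dots> = - (sqrt_m3 ^ 2) / W_fun t"
    by (simp add: W_fun_def power2_eq_square)
  finally show ?thesis unfolding sqrt_m3_sq by simp
qed

lemma klein_1_m1: assumes t: "t \<in> uhp" shows "klein 1 (- 1) t = omega * klein 1 2 t"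
  using klein_shift_snd[of 1 2 "-1" t] by simp

lemma klein_2_m1: assumes t: "t \<in> uhp" shows "klein 2 (- 1) t = - (omega ^ 2) * klein 1 1 t"
proof -
  have "klein 2 (- 1) t = omega powi (- 1) * klein (- 1) (- 1) t"
    using klein_shift_fst[OF t, of "-1" 1 "-1"] by simp
  also have "omega powi (- 1) = omega ^ 2"
  proof -
    have "omega powi (- 1) = omega powi 2" by (rule omega_powi_cong) simp
    thus ?thesis by (simp add: power_int_def)
  qed
  finally show ?thesis using klein_minus[OF t, of 1 1] by simp
qed

text \<open>The substitution exchanges the classes of (1, 1) and (1, 2) and sends (0, 1) to (1, 0).
  So the numerator is kept up to a constant, and the new denominator is the old one times a constant
  multiple of W^2.\<close>

lemma F_fun_S:
  assumes t: "t \<in> uhp" shows "F_fun (- 1 / t) = 3 * F_fun t / W_fun t ^ 2"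
proof -
  have t0: "t \<noteq> 0" using uhp_nz[OF t] .
  have "F_fun (- 1 / t) = - 3 * omega * ((omega * klein 1 2 t / t) * (- (omega ^ 2) * klein 1 1 t / t)) / (klein 1 0 t / t) ^ 2"
    unfolding F_fun_def using klein_S[OF t, of 1 1] klein_S[OF t, of 1 2] klein_S[OF t, of 0 1]
    by (simp add: klein_1_m1[OF t] klein_2_m1[OF t])
  also have "\<dots> = 3 * omega * omega ^ 3 * (klein 1 1 t * klein 1 2 t) / klein 1 0 t ^ 2"
    using t0 by (simp add: power2_eq_square power3_eq_cube mult_ac)
  also have "\<dots> = 3 * F_fun t / (sqrt_m3 ^ 2 * klein 1 0 t ^ 2 / klein 0 1 t ^ 2)"
    unfolding sqrt_m3_sq F_fun_def using klein_0_1_nz[OF t] by (simp add: field_simps)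
  also have "sqrt_m3 ^ 2 * klein 1 0 t ^ 2 / klein 0 1 t ^ 2 = W_fun t ^ 2"
    by (simp add: W_fun_def power_mult_distrib power_divide)
  finally show ?thesis .
qed

lemma klein_Gamma_3:
  assumes M: "(1 + 3 * m, 3 * b, 3 * c, 1 + 3 * n) \<in> SL2Z" and t: "t \<in> uhp"
  shows "klein r s (moeb (1 + 3 * m, 3 * b, 3 * c, 1 + 3 * n) t) =
    omega powi ((r * m + s * c) * s - (r * b + s * n) * r) * klein r s t / (of_int (3 * c) * t + of_int (1 + 3 * n))"
proof -
  have e: "r * (1 + 3 * m) + s * (3 * c) = r + 3 * (r * m + s * c)"
    "r * (3 * b) + s * (1 + 3 * n) = s + 3 * (r * b + s * n)"
    by (simp_all add: algebra_simps)
  show ?thesis using klein_moeb[OF M refl t, of r s] unfolding e klein_shift[OF t] .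
qed

lemma Gamma_3_E:
  assumes "M \<in> Gamma_3"
  obtains m b c n where "M = (1 + 3 * m, 3 * b, 3 * c, 1 + 3 * n)" "(1 + 3 * m, 3 * b, 3 * c, 1 + 3 * n) \<in> SL2Z"
proof -
  obtain a b c d where M: "M = (a, b, c, d)" by (cases M)
  hence *: "(a, b, c, d) \<in> SL2Z" "3 dvd a - 1" "3 dvd b" "3 dvd c" "3 dvd d - 1" using assms by (auto simp: Gamma_3_def)
  then obtain m b' c' n where "a - 1 = 3 * m" "b = 3 * b'" "c = 3 * c'" "d - 1 = 3 * n" by (auto elim!: dvdE)
  hence "a = 1 + 3 * m" "b = 3 * b'" "c = 3 * c'" "d = 1 + 3 * n" by simp_all
  thus ?thesis using that * M by blast
qed

text \<open>The indices (1, 0) and (0, 1) contribute the exponents -b and c. In particular the cube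
  of W is invariant under Gamma(3).\<close>

lemma W_fun_Gamma_3:
  assumes M: "(1 + 3 * m, 3 * b, 3 * c, 1 + 3 * n) \<in> SL2Z" and t: "t \<in> uhp"
  shows "W_fun (moeb (1 + 3 * m, 3 * b, 3 * c, 1 + 3 * n) t) = omega powi (- b - c) * W_fun t"
proof -
  have "W_fun (moeb (1 + 3 * m, 3 * b, 3 * c, 1 + 3 * n) t) = (omega powi (- b) / omega powi c) * W_fun t"
    unfolding W_fun_def klein_Gamma_3[OF M t] using SL2Z_denom_nz[OF M t] by (simp add: mult_ac)
  thus ?thesis by (simp add: power_int_diff)
qed

text \<open>Only b survives modulo 3: the exponents add up to b + 3 (m + c - b - n).\<close>

lemma F_fun_Gamma_3:
  assumes M: "(1 + 3 * m, 3 * b, 3 * c, 1 + 3 * n) \<in> SL2Z" and t: "t \<in> uhp"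
  shows "F_fun (moeb (1 + 3 * m, 3 * b, 3 * c, 1 + 3 * n) t) = omega powi b * F_fun t"
proof -
  define j where "j = of_int (3 * c) * t + (of_int (1 + 3 * n) :: complex)"
  have j: "j \<noteq> 0" unfolding j_def by (rule SL2Z_denom_nz[OF M t])
  have "F_fun (moeb (1 + 3 * m, 3 * b, 3 * c, 1 + 3 * n) t) =
     - 3 * omega * ((omega powi (m + c - (b + n)) * klein 1 1 t / j) * (omega powi ((m + 2 * c) * 2 - (b + 2 * n)) * klein 1 2 t / j)) /
       (omega powi c * klein 0 1 t / j) ^ 2"
    unfolding F_fun_def klein_Gamma_3[OF M t] j_def by simp
  also have "\<dots> = (omega powi (m + c - (b + n)) * omega powi ((m + 2 * c) * 2 - (b + 2 * n)) / (omega powi c * omega powi c)) * F_fun t"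
    unfolding F_fun_def using j by (simp add: power2_eq_square mult_ac)
  also have "omega powi (m + c - (b + n)) * omega powi ((m + 2 * c) * 2 - (b + 2 * n)) / (omega powi c * omega powi c) =
      omega powi (m + c - (b + n) + ((m + 2 * c) * 2 - (b + 2 * n)) - (c + c))"
    by (simp only: power_int_diff[OF disjI1[OF omega_nz]] power_int_add[OF disjI1[OF omega_nz]])
  also have "\<dots> = omega powi b" by (rule omega_powi_cong) (auto intro!: dvdI[of _ _ "m + c - b - n"] simp: algebra_simps)
  finally show ?thesis .
qed

text \<open>Up to sign the matrix is an element of Gamma(3) times a translation. Its cusp is
  therefore equivalent to infinity, and the behaviour there is read off from the expansion at
  infinity.\<close>

lemma Gamma_3_T:
  assumes "(a, b, c, d) \<in> SL2Z" "3 dvd c"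
  obtains G n where "G \<in> Gamma_3" "\<And>t. t \<in> uhp \<Longrightarrow> moeb (a, b, c, d) t = moeb G (t + of_int n)"
proof -
  have det: "a * d - b * c = 1" using assms by (simp add: SL2Z_def)
  have "\<not> 3 dvd a" using assms(2) det
    by (metis dvd_diff dvd_mult dvd_mult2 int_one_le_iff_zero_less linorder_not_le zdvd_not_zless zero_less_numeral numeral_One one_less_numeral_iff semiring_norm(77) zero_less_one)
  then obtain \<sigma> m where \<sigma>: "\<sigma> = 1 \<or> \<sigma> = - 1" "a = \<sigma> * (1 + 3 * m)" using mod_3_cases by metis
  have \<sigma>2: "\<sigma> * \<sigma> = 1" using \<sigma>(1) by auto
  obtain c' where c': "c = 3 * c'" using assms(2) by auto
  \<comment> \<open>Since a is congruent to \<sigma> modulo 3, this n makes b - n a divisible by 3;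
    multiplication by \<sigma> then turns the diagonal into 1 modulo 3.\<close>
  define n where "n = \<sigma> * b"
  define G where "G = (\<sigma> * a, \<sigma> * (b - n * a), \<sigma> * c, \<sigma> * (d - n * c))"
  have "(\<sigma> * a) * (\<sigma> * (d - n * c)) - (\<sigma> * (b - n * a)) * (\<sigma> * c) = (\<sigma> * \<sigma>) * (a * d - b * c)"
    by (simp add: algebra_simps)
  hence G1: "G \<in> SL2Z" by (simp add: G_def SL2Z_def det \<sigma>2)
  have "\<sigma> * a = (\<sigma> * \<sigma>) * (1 + 3 * m)" by (simp add: \<sigma>(2))
  hence sa: "\<sigma> * a = 1 + 3 * m" by (simp add: \<sigma>2)
  have "\<sigma> * (b - n * a) = \<sigma> * b - (\<sigma> * \<sigma>) * b * a" by (simp add: n_def algebra_simps)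
  also have "\<dots> = b * \<sigma> - b * (\<sigma> * (1 + 3 * m))" by (simp only: \<sigma>2) (simp add: \<sigma>(2) algebra_simps)
  finally have sb: "\<sigma> * (b - n * a) = 3 * (- b * \<sigma> * m)" by (simp add: algebra_simps)
  have "\<sigma> * (d - n * c) * (1 + 3 * m) = d * (\<sigma> * (1 + 3 * m)) - \<sigma> * n * c * (1 + 3 * m)" by (simp add: algebra_simps)
  also have "d * (\<sigma> * (1 + 3 * m)) = d * a" by (simp only: \<sigma>(2))
  also have "d * a = 1 + b * c" using det by (simp add: mult.commute)
  finally have "\<sigma> * (d - n * c) - 1 = 3 * (b * c' - \<sigma> * n * c' * (1 + 3 * m) - \<sigma> * (d - n * c) * m)"
    by (simp add: c' algebra_simps)
  hence "3 dvd \<sigma> * (d - n * c) - 1" by (metis dvd_triv_left)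
  hence "G \<in> Gamma_3" using G1 sb sa assms(2) by (simp add: Gamma_3_def G_def)
  moreover have "moeb (a, b, c, d) t = moeb G (t + of_int n)" if "t \<in> uhp" for t
    using \<sigma>(1) by (auto simp: G_def moeb_def moebius_def algebra_simps minus_divide_divide[symmetric, of "_ + _"])
  ultimately show ?thesis using that by blast
qed


lemma ball_upper_bound:
  assumes "\<phi> holomorphic_on ball 0 1"
  obtains C :: real where "\<And>t. Im t \<ge> 1 / 2 \<Longrightarrow> norm (\<phi> (ee (t / 3))) \<le> C"
proof -
  define r where "r = exp (- pi / 3)"
  have r: "0 \<le> r" "r < 1" by (simp_all add: r_def)
  have "bounded (\<phi> ` cball 0 r)"
    using assms r by (intro compact_imp_bounded compact_continuous_image)
      (auto intro!: holomorphic_on_imp_continuous_on intro: holomorphic_on_subset)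
  then obtain C where C: "\<forall>y\<in>\<phi> ` cball 0 r. norm y \<le> C" unfolding bounded_iff by blast
  have "norm (\<phi> X) \<le> C" if "X \<in> cball 0 r" for X using C that by (rule bspec[OF _ imageI])
  moreover have "ee (t / 3) \<in> cball 0 r" if "Im t \<ge> 1 / 2" for t
    using that by (simp add: norm_ee r_def field_simps)
  ultimately show ?thesis using that by blast
qed

lemma omega_powi_cube [simp]: "(omega powi k) ^ 3 = 1"
  by (simp add: omega_powi ee_power)

text \<open>The denominator is the transform of \<open>klein 0 1\<close>. When 3 does not divide c
  it grows at the fastest rate a Klein form can have, so it dominates every numerator.\<close>

lemma klein_ratio_bounded:
  assumes M: "(a, b, c, d) \<in> SL2Z" and c: "\<not> 3 dvd c" and rs: "\<not> (3 dvd r \<and> 3 dvd s)"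
  obtains C where "C > 0" "\<And>t. Im t \<ge> 1 / 2 \<Longrightarrow> norm (klein r s t / klein c d t) \<le> C"
proof -
  obtain C where C: "C > 0" "\<And>t. Im t \<ge> 1 / 2 \<Longrightarrow> norm (klein r s t) \<le> C * exp (2 * pi / 9 * Im t)"
    using klein_upper[OF rs] by metis
  obtain k where k: "k > 0" "\<And>t. Im t \<ge> 1 / 2 \<Longrightarrow> k * exp (2 * pi / 9 * Im t) \<le> norm (klein c d t)"
    using klein_bound_1[OF c] by metis
  show ?thesis
  proof (rule that[of "C / k"])
    show "C / k > 0" using C k by simp
    fix t :: complex assume t: "Im t \<ge> 1 / 2"
    have "norm (klein r s t) / norm (klein c d t) \<le> (C * exp (2 * pi / 9 * Im t)) / (k * exp (2 * pi / 9 * Im t))"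
      using C k t by (intro frac_le) auto
    also have "\<dots> = C / k" by simp
    finally show "norm (klein r s t / klein c d t) \<le> C / k" by (simp add: norm_divide)
  qed
qed

section \<open>The cubic relations between the four Klein forms\<close>

definition cube_ratio :: "complex \<Rightarrow> complex" where
  "cube_ratio t = (klein 1 1 t ^ 3 - omega ^ 2 * klein 1 0 t ^ 3) / klein 0 1 t ^ 3"

text \<open>Both cubes in the numerator have a simple pole in X = ee(t/3), with leading coefficients
  -omega^2 and -1; the weight omega^2 in \<open>cube_ratio\<close> is chosen to cancel it.\<close>

lemma cube_ratio_bounded:
  obtains C where "\<And>t. Im t \<ge> 1 / 2 \<Longrightarrow> norm (cube_ratio t) \<le> C"
proof -
  define \<psi> where "\<psi> = (\<lambda>X. klein_1_prod 1 X ^ 3 - klein_1_prod 0 X ^ 3)"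
  define g where "g = (\<lambda>X. if X = 0 then deriv \<psi> 0 else (\<psi> X - \<psi> 0) / (X - 0))"
  have "\<psi> holomorphic_on ball 0 1" unfolding \<psi>_def by (intro holomorphic_intros holomorphic_klein_1_prod)
  hence g: "g holomorphic_on ball 0 1" unfolding g_def by (rule pole_lemma) auto
  define \<phi> where "\<phi> = (\<lambda>X. - (omega ^ 2) * g X / (sqrt_m3 ^ 3 * klein_0_prod X ^ 3))"
  have "\<phi> holomorphic_on ball 0 1" unfolding \<phi>_def
    by (intro holomorphic_intros g holomorphic_klein_0_prod) (simp add: klein_0_prod_nonzero)
  then obtain C where C: "\<And>t. Im t \<ge> 1 / 2 \<Longrightarrow> norm (\<phi> (ee (t / 3))) \<le> C"
    using ball_upper_bound by metis
  have "cube_ratio t = \<phi> (ee (t / 3))" if "Im t \<ge> 1 / 2" for t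
  proof -
    have t: "t \<in> uhp" using half_uhp[OF that] .
    define X where "X = ee (t / 3)"
    have X: "X \<noteq> 0" by (simp add: X_def)
    have gX: "g X = (klein_1_prod 1 X ^ 3 - klein_1_prod 0 X ^ 3) / X" using X by (simp add: g_def \<psi>_def)
    have "ee (- t / 9) ^ 3 = ee (- (t / 3))"
      unfolding ee_power by (rule arg_cong[where f = ee]) simp
    hence e9: "ee (- t / 9) ^ 3 = 1 / X"
      by (simp only: X_def ee_minus inverse_eq_divide)
    have e1: "ee (- of_nat 1 / 9) ^ 3 = omega ^ 2"
    proof -
      have "ee (- of_nat 1 / 9) ^ 3 = ee (of_nat 2 * (1 / 3) - 1)"
        unfolding ee_power by (rule arg_cong[where f = ee]) simp
      thus ?thesis unfolding ee_diff ee_power[symmetric] omega_def by simp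
    qed
    have m3: "(- x * y * z) ^ 3 = - (x ^ 3) * y ^ 3 * z ^ 3" for x y z :: complex
      by (simp add: power_mult_distrib power_minus_odd)
    have "klein 1 1 t ^ 3 = - (omega ^ 2) / X * klein_1_prod 1 X ^ 3"
      unfolding klein_1_numeral klein_1 m3 X_def[symmetric] e9 e1 by simp
    moreover have "klein 1 0 t ^ 3 = - 1 / X * klein_1_prod 0 X ^ 3"
      unfolding klein_1_numeral klein_1 m3 X_def[symmetric] e9 by simp
    moreover have "klein 0 1 t ^ 3 = sqrt_m3 ^ 3 * klein_0_prod X ^ 3"
      by (simp add: klein_0_1'[OF t] X_def power_mult_distrib)
    ultimately have "cube_ratio t = (- (omega ^ 2) / X * klein_1_prod 1 X ^ 3 - omega ^ 2 * (- 1 / X * klein_1_prod 0 X ^ 3)) / (sqrt_m3 ^ 3 * klein_0_prod X ^ 3)"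
      by (simp only: cube_ratio_def)
    also have "\<dots> = \<phi> X" unfolding \<phi>_def gX using X by (simp add: field_simps)
    finally show ?thesis by (simp add: X_def)
  qed
  thus ?thesis using C that by metis
qed

lemma cube_quotient:
  "j \<noteq> 0 \<Longrightarrow> ((x / j) ^ 3 - w * (y / j) ^ 3) / (z / j) ^ 3 = (x / z) ^ 3 - w * (y / z) ^ 3" for j :: complex
  by (simp add: power_divide diff_divide_distrib[symmetric])

text \<open>At the cusps equivalent to infinity the pole has been cancelled, at all others the
  denominator dominates. Cubing kills the cube roots of unity of \<open>klein_Gamma_3\<close>, so
  \<open>modular_Liouville\<close> applies.\<close>

lemma cube_ratio_constant: obtains \<kappa> where "\<And>t. t \<in> uhp \<Longrightarrow> cube_ratio t = \<kappa>"
proof (rule modular_Liouville[of cube_ratio])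
  show "cube_ratio holomorphic_on uhp" unfolding cube_ratio_def[abs_def]
    by (intro holomorphic_intros holomorphic_klein) (simp add: klein_0_1_nz)
  show inv_hh: "cube_ratio (moeb M t) = cube_ratio t" if M: "M \<in> Gamma_3" and t: "t \<in> uhp" for M t
  proof -
    obtain m b c n where Me: "M = (1 + 3 * m, 3 * b, 3 * c, 1 + 3 * n)"
      and MS: "(1 + 3 * m, 3 * b, 3 * c, 1 + 3 * n) \<in> SL2Z" using Gamma_3_E[OF M] .
    have "klein r s (moeb M t) ^ 3 = klein r s t ^ 3 / (of_int (3 * c) * t + of_int (1 + 3 * n)) ^ 3" for r s
      unfolding Me klein_Gamma_3[OF MS t] power_divide power_mult_distrib omega_powi_cube by simp
    thus ?thesis using SL2Z_denom_nz[OF MS t]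
      unfolding cube_ratio_def by (simp only: diff_divide_distrib[symmetric] times_divide_eq_right) simp
  qed
  fix M assume M: "M \<in> SL2Z"
  obtain a b c d where Me: "M = (a, b, c, d)" by (cases M)
  note M' = M[unfolded Me]
  show "\<exists>C R. \<forall>t. R < Im t \<longrightarrow> norm (cube_ratio (moeb M t)) \<le> C"
  proof (cases "3 dvd c")
    case True
    then obtain G n where G: "G \<in> Gamma_3" "\<And>t. t \<in> uhp \<Longrightarrow> moeb (a, b, c, d) t = moeb G (t + of_int n)"
      using Gamma_3_T[OF M'] by metis
    obtain C where C: "\<And>t. Im t \<ge> 1 / 2 \<Longrightarrow> norm (cube_ratio t) \<le> C" using cube_ratio_bounded by metis
    have "norm (cube_ratio (moeb M t)) \<le> C" if "Im t > 1" for t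
    proof -
      have "t \<in> uhp" "t + of_int n \<in> uhp" using that by (simp_all add: uhp_def)
      hence "cube_ratio (moeb M t) = cube_ratio (t + of_int n)"
        unfolding Me using G(2) inv_hh[OF G(1)] by simp
      thus ?thesis using C[of "t + of_int n"] that by simp
    qed
    thus ?thesis by blast
  next
    case False
    obtain C1 where C1: "\<And>t. Im t \<ge> 1 / 2 \<Longrightarrow> norm (klein (a + c) (b + d) t / klein c d t) \<le> C1"
      using klein_ratio_bounded[OF M' False, of "a + c" "b + d"] SL2Z_not_both[OF M'] by metis
    obtain C2 where C2: "\<And>t. Im t \<ge> 1 / 2 \<Longrightarrow> norm (klein a b t / klein c d t) \<le> C2"
      using klein_ratio_bounded[OF M' False, of a b] SL2Z_not_both[OF M'] by metis
    have "norm (cube_ratio (moeb M t)) \<le> C1 ^ 3 + C2 ^ 3" if "Im t > 1" for t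
    proof -
      have t: "t \<in> uhp" using that by (simp add: uhp_def)
      define j where "j = of_int c * t + (of_int d :: complex)"
      have j: "j \<noteq> 0" unfolding j_def by (rule SL2Z_denom_nz[OF M' t])
      have "cube_ratio (moeb M t) = ((klein (a + c) (b + d) t / j) ^ 3 - omega ^ 2 * (klein a b t / j) ^ 3) / (klein c d t / j) ^ 3"
        unfolding cube_ratio_def Me klein_moeb[OF M' refl t] j_def by simp
      also have "\<dots> = (klein (a + c) (b + d) t / klein c d t) ^ 3 - omega ^ 2 * (klein a b t / klein c d t) ^ 3"
        using j by (rule cube_quotient)
      also have "norm \<dots> \<le> norm (klein (a + c) (b + d) t / klein c d t) ^ 3 + norm (klein a b t / klein c d t) ^ 3"
        by (rule norm_triangle_ineq4[THEN order_trans]) (simp add: norm_mult norm_power)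
      also have "\<dots> \<le> C1 ^ 3 + C2 ^ 3"
        using C1[of t] C2[of t] that by (intro add_mono power_mono) auto
      finally show ?thesis .
    qed
    thus ?thesis by blast
  qed
qed (use that in blast)

text \<open>The constant \<kappa> is found without a second coefficient of the expansion.
  Transforming the relation by t -> -1/t and by t -> t + 1 gives two formulas for the cube of
  \<open>klein 1 2\<close>. They agree only if \<kappa> = omega, or else if the cube of
  \<open>klein 1 0\<close> is -omega times that of \<open>klein 0 1\<close>, which growth
  excludes.\<close>

lemma klein_cube_relations:
  assumes t: "t \<in> uhp"
  shows "klein 1 1 t ^ 3 = omega ^ 2 * klein 1 0 t ^ 3 + omega * klein 0 1 t ^ 3"
    "klein 1 2 t ^ 3 = omega * klein 1 0 t ^ 3 - omega ^ 2 * klein 0 1 t ^ 3"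
proof -
  obtain \<kappa> where \<kappa>: "\<And>t. t \<in> uhp \<Longrightarrow> cube_ratio t = \<kappa>" using cube_ratio_constant by blast
  have 1: "klein 1 1 t ^ 3 = omega ^ 2 * klein 1 0 t ^ 3 + \<kappa> * klein 0 1 t ^ 3" if "t \<in> uhp" for t
    using \<kappa>[OF that] klein_0_1_nz[OF that] by (simp add: cube_ratio_def divide_eq_eq diff_eq_eq add.commute)
  have S: "klein 1 2 t ^ 3 = \<kappa> * klein 1 0 t ^ 3 - omega ^ 2 * klein 0 1 t ^ 3" if t: "t \<in> uhp" for t
  proof -
    have t0: "t \<noteq> 0" using uhp_nz[OF t] .
    have "klein 1 1 (- 1 / t) = omega * klein 1 2 t / t" "klein 1 0 (- 1 / t) = - klein 0 1 t / t"
      "klein 0 1 (- 1 / t) = klein 1 0 t / t"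
      using klein_S[OF t, of 1 1] klein_S[OF t, of 1 0] klein_S[OF t, of 0 1] klein_1_m1[OF t] klein_minus[OF t, of 0 1]
      by simp_all
    from 1[OF uhp_S[OF t], unfolded this] have
      "(omega ^ 3 * klein 1 2 t ^ 3) / t ^ 3 = (- (omega ^ 2) * klein 0 1 t ^ 3 + \<kappa> * klein 1 0 t ^ 3) / t ^ 3"
      by (simp add: power_divide power_mult_distrib add_divide_distrib diff_divide_distrib)
    thus ?thesis using t0 by simp
  qed
  have T: "klein 1 2 t ^ 3 = omega ^ 2 * klein 1 1 t ^ 3 + \<kappa> * klein 0 1 t ^ 3" if "t \<in> uhp" for t
  proof -
    have "t + 1 \<in> uhp" using that by (simp add: uhp_def)
    from 1[OF this] show ?thesis by (simp add: klein_T)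
  qed
  have "\<kappa> = omega"
  proof (rule ccontr)
    assume ne: "\<kappa> \<noteq> omega"
    have AB: "klein 1 0 t ^ 3 = - omega * klein 0 1 t ^ 3" if "t \<in> uhp" for t
    proof -
      have "(\<kappa> - omega) * (klein 1 0 t ^ 3 + omega * klein 0 1 t ^ 3) = 0"
        using 1[OF that] S[OF that] T[OF that] omega_sum omega_cube by algebra
      thus ?thesis using ne by (simp add: add_eq_0_iff)
    qed
    have n3: "\<not> (3 :: int) dvd 1" "(3 :: int) dvd 0" by simp_all
    obtain c where c: "c > 0" "\<And>t. Im t \<ge> 1 / 2 \<Longrightarrow> c * exp (2 * pi / 9 * Im t) \<le> norm (klein 1 0 t)"
      using klein_bound_1[OF n3(1), of 0] by metis
    obtain C where C: "C > 0" "\<And>t. Im t \<ge> 1 / 2 \<Longrightarrow> norm (klein 0 1 t) \<le> C"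
      using klein_bound_0[OF n3(2,1)] by metis
    \<comment> \<open>Large enough that 1 + (2 pi/9) y, a lower bound for the exponential, already
      exceeds C / c.\<close>
    define y where "y = max 1 (9 / (2 * pi) * (C / c))"
    define t where "t = of_real y * \<i>"
    have t: "t \<in> uhp" "Im t \<ge> 1 / 2" "Im t = y" by (simp_all add: t_def y_def uhp_def)
    have "norm (klein 1 0 t) ^ 3 = norm (klein 0 1 t) ^ 3"
      using arg_cong[OF AB[OF t(1)], of norm] by (simp add: norm_mult norm_power)
    hence "norm (klein 1 0 t) = norm (klein 0 1 t)" by (rule power_eq_imp_eq_base) auto
    hence "c * exp (2 * pi / 9 * y) \<le> C" using c(2)[OF t(2)] C(2)[OF t(2)] t(3) by simp
    hence "exp (2 * pi / 9 * y) \<le> C / c" using c(1) by (simp add: field_simps)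
    moreover have "1 + 2 * pi / 9 * y \<le> exp (2 * pi / 9 * y)" by (rule exp_ge_add_one_self)
    moreover have "2 * pi / 9 * y \<ge> 2 * pi / 9 * (9 / (2 * pi) * (C / c))"
      unfolding y_def by (intro mult_left_mono) auto
    moreover have "2 * pi / 9 * (9 / (2 * pi) * (C / c)) = C / c" by simp
    ultimately show False by linarith
  qed
  with 1[OF t] S[OF t] show "klein 1 1 t ^ 3 = omega ^ 2 * klein 1 0 t ^ 3 + omega * klein 0 1 t ^ 3"
    "klein 1 2 t ^ 3 = omega * klein 1 0 t ^ 3 - omega ^ 2 * klein 0 1 t ^ 3" by simp_all
qed

text \<open>With A and B the cubes of \<open>klein 1 0\<close> and \<open>klein 0 1\<close>, the
  product of the two cubic relations is A^2 - sqrt(-3) A B - B^2; the rest is rewriting A / B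
  through W^3.\<close>

lemma F_fun_cube:
  assumes t: "t \<in> uhp"
  shows "F_fun t ^ 3 = W_fun t ^ 6 + 9 * W_fun t ^ 3 + 27"
proof -
  define A where "A = klein 1 0 t ^ 3"
  define B where "B = klein 0 1 t ^ 3"
  have B: "B \<noteq> 0" using klein_0_1_nz[OF t] by (simp add: B_def)
  have W: "W_fun t ^ 3 = 3 * sqrt_m3 * A / B"
  proof -
    have "W_fun t ^ 3 = - (sqrt_m3 ^ 2 * sqrt_m3) * A / B"
      by (simp add: W_fun_def A_def B_def power_divide power_mult_distrib power_minus_odd power2_eq_square power3_eq_cube)
    thus ?thesis unfolding sqrt_m3_sq by simp
  qed
  have "F_fun t ^ 3 = - 27 * omega ^ 3 * (klein 1 1 t ^ 3 * klein 1 2 t ^ 3) / (klein 0 1 t ^ 3) ^ 2"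
    by (simp add: F_fun_def power_divide power_mult_distrib flip: power_mult)
  also have "\<dots> = - 27 * ((omega ^ 2 * A + omega * B) * (omega * A - omega ^ 2 * B)) / B ^ 2"
    unfolding klein_cube_relations[OF t] A_def B_def by simp
  also have "(omega ^ 2 * A + omega * B) * (omega * A - omega ^ 2 * B) = A ^ 2 - sqrt_m3 * A * B - B ^ 2"
    unfolding sqrt_m3_def using omega_cube by algebra
  also have "- 27 * (A ^ 2 - sqrt_m3 * A * B - B ^ 2) / B ^ 2 = 9 * sqrt_m3 ^ 2 * A ^ 2 / B ^ 2 + 27 * sqrt_m3 * A / B + 27"
    unfolding sqrt_m3_sq using B by (simp add: field_simps power2_eq_square)
  also have "\<dots> = (W_fun t ^ 3) ^ 2 + 9 * W_fun t ^ 3 + 27"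
    unfolding W by (simp add: power_divide power_mult_distrib)
  finally show ?thesis by (simp flip: power_mult)
qed

text \<open>Poles of W occur only at the cusps equivalent to infinity, where W^3 has a simple pole
  in the parameter ee(t/3).\<close>

lemma W_fun_bounded:
  assumes M: "(a, b, c, d) \<in> SL2Z" and c: "\<not> 3 dvd c"
  obtains C where "\<And>t. Im t \<ge> 1 / 2 \<Longrightarrow> norm (W_fun (moeb (a, b, c, d) t)) \<le> C"
proof -
  obtain C where C: "\<And>t. Im t \<ge> 1 / 2 \<Longrightarrow> norm (klein a b t / klein c d t) \<le> C"
    using klein_ratio_bounded[OF M c, of a b] SL2Z_not_both[OF M] by metis
  have "norm (W_fun (moeb (a, b, c, d) t)) \<le> norm sqrt_m3 * C" if "Im t \<ge> 1 / 2" for t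
  proof -
    have t: "t \<in> uhp" using half_uhp[OF that] .
    have "W_fun (moeb (a, b, c, d) t) = - sqrt_m3 * (klein a b t / klein c d t)"
      unfolding W_fun_def klein_moeb[OF M refl t] using SL2Z_denom_nz[OF M t] by simp
    hence "norm (W_fun (moeb (a, b, c, d) t)) = norm sqrt_m3 * norm (klein a b t / klein c d t)"
      by (simp only: norm_mult norm_minus_cancel)
    thus ?thesis using mult_left_mono[OF C[OF that] norm_ge_zero[of sqrt_m3]] by simp
  qed
  thus ?thesis using that by blast
qed

text \<open>Each Klein form in a numerator grows at most like exp(2 pi/9 Im t), and the denominator
  stays away from 0. This gives meromorphy at all cusps at once.\<close>

lemma W_fun_F_fun_growth:
  assumes M: "M \<in> SL2Z"
  obtains C :: real where "\<And>t. Im t \<ge> 1 / 2 \<Longrightarrow> norm (W_fun (moeb M t)) \<le> C * exp (2 * pi / 9 * Im t)"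
    "\<And>t. Im t \<ge> 1 / 2 \<Longrightarrow> norm (F_fun (moeb M t)) \<le> C * exp (4 * pi / 9 * Im t)"
proof -
  obtain a b c d where Me: "M = (a, b, c, d)" by (cases M)
  note M' = M[unfolded Me]
  obtain C0 where C0: "\<And>t. Im t \<ge> 1 / 2 \<Longrightarrow> norm (klein a b t) \<le> C0 * exp (2 * pi / 9 * Im t)"
    using klein_upper[of a b] SL2Z_not_both[OF M'] by metis
  obtain C1 where C1: "\<And>t. Im t \<ge> 1 / 2 \<Longrightarrow> norm (klein (a + c) (b + d) t) \<le> C1 * exp (2 * pi / 9 * Im t)"
    using klein_upper[of "a + c" "b + d"] SL2Z_not_both[OF M'] by metis
  obtain C2 where C2: "\<And>t. Im t \<ge> 1 / 2 \<Longrightarrow> norm (klein (a + 2 * c) (b + 2 * d) t) \<le> C2 * exp (2 * pi / 9 * Im t)"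
    using klein_upper[of "a + 2 * c" "b + 2 * d"] SL2Z_not_both[OF M'] by metis
  obtain k where k: "k > 0" "\<And>t. Im t \<ge> 1 / 2 \<Longrightarrow> k \<le> norm (klein c d t)"
    using klein_lower[of c d] SL2Z_not_both[OF M'] by metis
  define E where "E = (\<lambda>t. exp (2 * pi / 9 * Im t))"
  have E2: "E t * E t = exp (4 * pi / 9 * Im t)" for t
    by (simp add: E_def exp_add[symmetric] algebra_simps)
  have j: "of_int c * t + of_int d \<noteq> (0::complex)" if "Im t \<ge> 1 / 2" for t
    by (rule SL2Z_denom_nz[OF M' half_uhp[OF that]])
  have W: "norm (W_fun (moeb M t)) \<le> (norm sqrt_m3 * C0 / k) * E t" if t: "Im t \<ge> 1 / 2" for t
  proof -
    have "norm (W_fun (moeb M t)) = norm sqrt_m3 * norm (klein a b t) / norm (klein c d t)"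
      unfolding W_fun_def Me klein_moeb[OF M' refl half_uhp[OF t]] using j[OF t]
      by (simp add: norm_mult norm_divide)
    also have "\<dots> \<le> norm sqrt_m3 * (C0 * E t) / k"
      using C0[OF t] k(1) k(2)[OF t] unfolding E_def by (intro frac_le mult_left_mono) (auto intro: order_trans[OF norm_ge_zero] mult_nonneg_nonneg)
    finally show ?thesis by simp
  qed
  have F: "norm (F_fun (moeb M t)) \<le> (3 * (C1 * C2) / k ^ 2) * exp (4 * pi / 9 * Im t)" if t: "Im t \<ge> 1 / 2" for t
  proof -
    have "norm (F_fun (moeb M t)) = 3 * (norm (klein (a + c) (b + d) t) * norm (klein (a + 2 * c) (b + 2 * d) t)) / norm (klein c d t) ^ 2"
      unfolding F_fun_def Me klein_moeb[OF M' refl half_uhp[OF t]] using j[OF t]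
      by (simp add: norm_mult norm_divide norm_power power2_eq_square)
    also have "\<dots> \<le> 3 * ((C1 * E t) * (C2 * E t)) / k ^ 2"
    proof -
      have c1: "norm (klein (a + c) (b + d) t) \<le> C1 * E t" and c2: "norm (klein (a + 2 * c) (b + 2 * d) t) \<le> C2 * E t"
        unfolding E_def by (rule C1[OF t], rule C2[OF t])
      have n1: "0 \<le> C1 * E t" and n2: "0 \<le> C2 * E t"
        using order_trans[OF norm_ge_zero c1] order_trans[OF norm_ge_zero c2] .
      have m: "norm (klein (a + c) (b + d) t) * norm (klein (a + 2 * c) (b + 2 * d) t) \<le> (C1 * E t) * (C2 * E t)"
        by (rule mult_mono[OF c1 c2 n1 norm_ge_zero])
      have k2: "k ^ 2 \<le> norm (klein c d t) ^ 2" using k(1) k(2)[OF t] by (intro power_mono) simp_all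
      show ?thesis
        by (rule frac_le) (use m k2 k(1) mult_nonneg_nonneg[OF n1 n2] in simp_all)
    qed
    also have "\<dots> = (3 * (C1 * C2) / k ^ 2) * (E t * E t)" by simp
    finally show ?thesis unfolding E2 .
  qed
  define C where "C = max (norm sqrt_m3 * C0 / k) (3 * (C1 * C2) / k ^ 2)"
  show ?thesis
  proof (rule that[of C])
    fix t :: complex assume t: "Im t \<ge> 1 / 2"
    have "(norm sqrt_m3 * C0 / k) * E t \<le> C * E t" unfolding C_def E_def by (intro mult_right_mono) auto
    thus "norm (W_fun (moeb M t)) \<le> C * exp (2 * pi / 9 * Im t)" using W[OF t] by (simp only: E_def)
    have "(3 * (C1 * C2) / k ^ 2) * exp (4 * pi / 9 * Im t) \<le> C * exp (4 * pi / 9 * Im t)"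
      unfolding C_def by (intro mult_right_mono) auto
    thus "norm (F_fun (moeb M t)) \<le> C * exp (4 * pi / 9 * Im t)" using F[OF t] by linarith
  qed
qed

section \<open>Meromorphic functions on the upper half plane\<close>

lemma eval_mero_eqI: "(\<And>z. z \<in> uhp \<Longrightarrow> eval_mero f z = eval_mero g z) \<Longrightarrow> f = g"
  by (metis eval_mero_inject eval_mero_outside ext)

text \<open>Field operations agree with pointwise operations only off a sparse set, since
  representatives take the value 0 at poles. Regularity is the condition under which identities are
  evaluated at an individual point.\<close>

definition regular_at :: "mero_uhp \<Rightarrow> complex \<Rightarrow> bool" where
  "regular_at f z \<longleftrightarrow> eval_mero f analytic_on {z}"

text \<open>A representative is determined at z by its values near but off z, so agreement with an
  analytic function on a punctured neighbourhood gives both regularity and the value.\<close>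

lemma regular_atI:
  assumes z: "z \<in> uhp" and ev: "eventually (\<lambda>w. eval_mero f w = G w) (at z)" and G: "G analytic_on {z}"
  shows "regular_at f z" "eval_mero f z = G z"
proof -
  have "(is_pole (eval_mero f) z \<and> eval_mero f z = 0) \<or> eval_mero f \<midarrow>z\<rightarrow> eval_mero f z"
    using nicely_meromorphic_eval_mero[of f] z by (auto simp: nicely_meromorphic_on_def)
  hence "remove_sings (eval_mero f) z = eval_mero f z"
    by (metis remove_sings_at_pole remove_sings_eqI)
  moreover have "remove_sings (eval_mero f) z = remove_sings G z"
    by (intro remove_sings_cong ev refl)
  ultimately show eq: "eval_mero f z = G z" using G by simp
  have "(G \<longlongrightarrow> G z) (at z)" using G by (simp add: analytic_at_imp_isCont isContD)
  hence "(eval_mero f \<longlongrightarrow> G z) (at z)"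
    using tendsto_cong[OF ev, of "G z"] by simp
  hence "isCont (eval_mero f) z" by (simp add: isCont_def eq)
  moreover have "eval_mero f meromorphic_on {z}"
    by (rule meromorphic_on_subset[OF meromorphic_eval_mero]) (use z in auto)
  ultimately show "regular_at f z" unfolding regular_at_def by (intro meromorphic_at_isCont_imp_analytic)
qed

lemma ae_at: "(\<forall>\<^sub>\<approx>z\<in>uhp. P z) \<Longrightarrow> z \<in> uhp \<Longrightarrow> eventually P (at z)"
  by (simp add: eventually_cosparse_open_eq)

lemma regular_at_add:
  assumes "z \<in> uhp" "regular_at f z" "regular_at g z"
  shows "regular_at (f + g) z \<and> eval_mero (f + g) z = eval_mero f z + eval_mero g z"
proof -
  have "(\<lambda>z. eval_mero f z + eval_mero g z) analytic_on {z}"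
    using assms(2,3) unfolding regular_at_def by (rule analytic_on_add)
  from regular_atI[OF assms(1) ae_at[OF eval_mero_ops_ae(3) assms(1)] this] show ?thesis ..
qed

lemma regular_at_mult:
  assumes "z \<in> uhp" "regular_at f z" "regular_at g z"
  shows "regular_at (f * g) z \<and> eval_mero (f * g) z = eval_mero f z * eval_mero g z"
proof -
  have "(\<lambda>z. eval_mero f z * eval_mero g z) analytic_on {z}"
    using assms(2,3) unfolding regular_at_def by (rule analytic_on_mult)
  from regular_atI[OF assms(1) ae_at[OF eval_mero_ops_ae(6) assms(1)] this] show ?thesis ..
qed

lemma mero_holomorphic:
  assumes "h holomorphic_on uhp" "z \<in> uhp"
  shows "regular_at (mero h) z" "eval_mero (mero h) z = h z"
proof -
  have regular_at: "h analytic_on uhp" using assms(1) by (simp add: analytic_on_open)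
  have "h meromorphic_on uhp" using regular_at by (rule analytic_on_imp_meromorphic_on)
  note 1 = ae_at[OF eval_mero_mero_ae[OF this] assms(2)]
  have 2: "h analytic_on {z}" using regular_at assms(2) analytic_on_analytic_at by blast
  show "regular_at (mero h) z" "eval_mero (mero h) z = h z" by (rule regular_atI[OF assms(2) 1 2])+
qed

definition mconst :: "complex \<Rightarrow> mero_uhp" where
  "mconst c = mero (\<lambda>_. c)"

lemma regular_at_mconst: "z \<in> uhp \<Longrightarrow> regular_at (mconst c) z" and eval_mconst: "z \<in> uhp \<Longrightarrow> eval_mero (mconst c) z = c"
  unfolding mconst_def by (rule mero_holomorphic; simp)+

lemma mconst_add: "mconst (a + b) = mconst a + mconst b"
  by (rule eval_mero_eqI) (simp add: regular_at_add regular_at_mconst eval_mconst)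
lemma mconst_mult: "mconst (a * b) = mconst a * mconst b"
  by (rule eval_mero_eqI) (simp add: regular_at_mult regular_at_mconst eval_mconst)
lemma mconst_0 [simp]: "mconst 0 = 0" by (simp add: mconst_def zero_mero_uhp_def)
lemma mconst_1 [simp]: "mconst 1 = 1" by (simp add: mconst_def one_mero_uhp_def)
lemma mconst_minus: "mconst (- a) = - mconst a"
  using mconst_add[of a "- a"] by (simp add: add_eq_0_iff)
lemma mconst_inverse: "mconst (inverse a) = inverse (mconst a)"
proof (cases "a = 0")
  case False
  hence "mconst (inverse a) * mconst a = 1" by (simp flip: mconst_mult)
  thus ?thesis by (metis inverse_unique mult.commute)
qed auto
lemma mconst_of_nat [simp]: "mconst (of_nat n) = of_nat n" by (induction n) (auto simp: mconst_add)
lemma mconst_of_int [simp]: "mconst (of_int n) = of_int n"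
  by (cases n) (simp_all add: mconst_minus mconst_add del: of_nat_Suc)
lemma mconst_of_rat [simp]: "mconst (of_rat r) = of_rat r"
proof (cases r)
  case (Fract a b)
  thus ?thesis by (simp add: of_rat_rat divide_inverse mconst_mult mconst_inverse)
qed
lemma mconst_numeral [simp]: "mconst (numeral n) = numeral n" using mconst_of_nat[of "numeral n"] by simp
lemma mconst_power: "mconst (a ^ n) = mconst a ^ n" by (induction n) (auto simp: mconst_mult)

lemma regular_at_power: "z \<in> uhp \<Longrightarrow> regular_at f z \<Longrightarrow> regular_at (f ^ n) z \<and> eval_mero (f ^ n) z = eval_mero f z ^ n"
proof (induction n)
  case 0 thus ?case using regular_at_mconst[of z 1] eval_mconst[of z 1] by simp
qed (auto simp: regular_at_mult)

subsection \<open>Pullbacks\<close>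

lemma moeb_filterlim:
  assumes "a * d - b * c > 0" "z \<in> uhp"
  shows "filterlim (moeb (a, b, c, d)) (at (moeb (a, b, c, d) z)) (at z)"
proof -
  have "isCont (moeb (a, b, c, d)) z"
    using moeb_analytic[OF assms(1)] assms(2) by (metis analytic_at_imp_isCont analytic_on_analytic_at)
  moreover have "eventually (\<lambda>w. moeb (a, b, c, d) w \<noteq> moeb (a, b, c, d) z) (at z)"
    using eventually_at_in_open[OF open_uhp assms(2)]
    by eventually_elim (use moeb_inj[OF assms(1)] assms(2) in auto)
  ultimately show ?thesis by (auto simp: filterlim_at isCont_def)
qed

fun pos_det :: "mat2 \<Rightarrow> bool" where "pos_det (a, b, c, d) \<longleftrightarrow> a * d - b * c > 0"

lemma SL2Z_pos_det: "M \<in> SL2Z \<Longrightarrow> pos_det M" by (cases M) (auto simp: SL2Z_def)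

lemma pos_det_moeb_uhp: "pos_det M \<Longrightarrow> z \<in> uhp \<Longrightarrow> moeb M z \<in> uhp"
  by (cases M) (auto intro: moeb_in_uhp)

lemma eval_pullback: "pos_det M \<Longrightarrow> z \<in> uhp \<Longrightarrow> eval_mero (pullback M f) z = eval_mero f (moeb M z)"
  by (cases M) (auto intro: eval_mero_pullback)

text \<open>A Moebius map is injective and continuous, so it maps punctured neighbourhoods into
  punctured neighbourhoods and exceptional sets stay sparse. This makes pullback a homomorphism of
  fields.\<close>

lemma pullback_ae:
  assumes "pos_det M" "\<forall>\<^sub>\<approx>z\<in>uhp. P z"
  shows "\<forall>\<^sub>\<approx>z\<in>uhp. P (moeb M z)"
proof -
  obtain a b c d where M: "M = (a, b, c, d)" by (cases M)
  show ?thesis unfolding eventually_cosparse_open_eq[OF open_uhp]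
  proof
    fix z assume z: "z \<in> uhp"
    have "filterlim (moeb M) (at (moeb M z)) (at z)"
      using moeb_filterlim[OF _ z] assms(1) by (simp add: M)
    thus "eventually (\<lambda>z. P (moeb M z)) (at z)"
      using ae_at[OF assms(2) pos_det_moeb_uhp[OF assms(1) z]] by (simp add: filterlim_iff)
  qed
qed

lemma uhp_ae: "\<forall>\<^sub>\<approx>z\<in>uhp. z \<in> uhp"
  by (simp add: eventually_in_cosparse)

lemma pullback_add:
  assumes "pos_det M"
  shows "pullback M (f + g) = pullback M f + pullback M g"
proof (rule mero_uhp_eqI_ae)
  from pullback_ae[OF assms eval_mero_ops_ae(3)[of f g]] eval_mero_ops_ae(3)[of "pullback M f" "pullback M g"] uhp_ae
  show "\<forall>\<^sub>\<approx>z\<in>uhp. eval_mero (pullback M (f + g)) z = eval_mero (pullback M f + pullback M g) z"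
    by eventually_elim (simp add: eval_pullback assms)
qed

lemma pullback_mult:
  assumes "pos_det M"
  shows "pullback M (f * g) = pullback M f * pullback M g"
proof (rule mero_uhp_eqI_ae)
  from pullback_ae[OF assms eval_mero_ops_ae(6)[of f g]] eval_mero_ops_ae(6)[of "pullback M f" "pullback M g"] uhp_ae
  show "\<forall>\<^sub>\<approx>z\<in>uhp. eval_mero (pullback M (f * g)) z = eval_mero (pullback M f * pullback M g) z"
    by eventually_elim (simp add: eval_pullback assms)
qed

lemma pullback_minus:
  assumes "pos_det M"
  shows "pullback M (- f) = - pullback M f"
proof (rule mero_uhp_eqI_ae)
  from pullback_ae[OF assms eval_mero_ops_ae(5)[of f]] eval_mero_ops_ae(5)[of "pullback M f"] uhp_ae
  show "\<forall>\<^sub>\<approx>z\<in>uhp. eval_mero (pullback M (- f)) z = eval_mero (- pullback M f) z"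
    by eventually_elim (simp add: eval_pullback assms)
qed

lemma pullback_inverse:
  assumes "pos_det M"
  shows "pullback M (inverse f) = inverse (pullback M f)"
proof (rule mero_uhp_eqI_ae)
  from pullback_ae[OF assms eval_mero_ops_ae(7)[of f]] eval_mero_ops_ae(7)[of "pullback M f"] uhp_ae
  show "\<forall>\<^sub>\<approx>z\<in>uhp. eval_mero (pullback M (inverse f)) z = eval_mero (inverse (pullback M f)) z"
    by eventually_elim (simp add: eval_pullback assms)
qed

lemma pullback_mconst: "pos_det M \<Longrightarrow> pullback M (mconst c) = mconst c"
  by (rule eval_mero_eqI) (simp add: eval_pullback eval_mconst pos_det_moeb_uhp)
lemma pullback_power: "pos_det M \<Longrightarrow> pullback M (f ^ n) = pullback M f ^ n"
  using pullback_mconst[of M 1] by (induction n) (auto simp: pullback_mult)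
lemma pullback_divide: "pos_det M \<Longrightarrow> pullback M (f / g) = pullback M f / pullback M g"
  by (simp add: divide_inverse pullback_mult pullback_inverse)
lemma pullback_diff: "pos_det M \<Longrightarrow> pullback M (f - g) = pullback M f - pullback M g"
  using pullback_add[of M f "- g"] by (simp add: pullback_minus)

lemma pullback_pullback:
  assumes "pos_det M" "pos_det N" "\<And>z. z \<in> uhp \<Longrightarrow> moeb M (moeb N z) = moeb L z" "pos_det L"
  shows "pullback N (pullback M f) = pullback L f"
  by (rule eval_mero_eqI) (use assms in \<open>simp add: eval_pullback pos_det_moeb_uhp\<close>)

lemma pullback_mat_mul:
  assumes "M \<in> SL2Z" "N \<in> SL2Z"
  shows "pullback N (pullback M f) = pullback (mat_mul M N) f"
  by (rule pullback_pullback) (use assms in \<open>auto simp: SL2Z_pos_det moeb_mat_mul mat_mul_SL2Z\<close>)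

lemma pullback_regular_at:
  assumes "pos_det M" "z \<in> uhp" "regular_at f (moeb M z)"
  shows "regular_at (pullback M f) z"
proof (rule regular_atI(1)[OF assms(2)])
  obtain a b c d where M: "M = (a, b, c, d)" by (cases M)
  show "eventually (\<lambda>w. eval_mero (pullback M f) w = (eval_mero f \<circ> moeb M) w) (at z)"
    using eventually_at_in_open'[OF open_uhp assms(2)]
    by eventually_elim (simp add: eval_pullback assms(1))
  have "moeb M analytic_on {z}"
    using moeb_analytic[of a d b c] assms(1,2) by (auto simp: M intro: analytic_on_subset)
  thus "(eval_mero f \<circ> moeb M) analytic_on {z}"
    by (rule analytic_on_compose) (use assms(3) in \<open>simp add: regular_at_def\<close>)
qed

lemma pullback_regular_at_iff:
  assumes "M \<in> SL2Z" "z \<in> uhp"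
  shows "regular_at (pullback M f) z \<longleftrightarrow> regular_at f (moeb M z)"
proof
  assume *: "regular_at (pullback M f) z"
  have "mat_mul M (mat_inv M) = (1, 0, 0, 1)"
    using assms(1) by (cases M) (auto simp: SL2Z_def algebra_simps)
  hence "pullback (mat_inv M) (pullback M f) = f"
    using pullback_mat_mul[OF assms(1) mat_inv_SL2Z[OF assms(1)], of f]
    by (intro eval_mero_eqI) (simp add: eval_pullback)
  moreover have "regular_at (pullback (mat_inv M) (pullback M f)) (moeb M z)"
    by (rule pullback_regular_at) (use assms * in \<open>auto simp: SL2Z_pos_det mat_inv_SL2Z moeb_uhp moeb_mat_inv\<close>)
  ultimately show "regular_at f (moeb M z)" by simp
qed (rule pullback_regular_at[OF SL2Z_pos_det[OF assms(1)] assms(2)])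

subsection \<open>Growth at the cusps\<close>

text \<open>Meromorphy at infinity expressed without a period. In this form it is stable under
  pullback by upper triangular integer matrices, which change the width of the cusp. For periodic
  functions it is equivalent to having an expansion (\<open>has_q_exp_growth\<close>,
  \<open>exp_growth_has_q\<close>).\<close>

definition exp_growth :: "mero_uhp \<Rightarrow> bool" where
  "exp_growth f \<longleftrightarrow> (\<exists>R C k. \<forall>t. Im t > R \<longrightarrow> regular_at f t \<and> norm (eval_mero f t) \<le> C * exp (k * Im t))"

lemma exp_growth_normal:
  assumes "exp_growth f"
  obtains R C k :: real where "R \<ge> 1" "C \<ge> 0" "k \<ge> 0"
    "\<And>t. Im t > R \<Longrightarrow> regular_at f t \<and> norm (eval_mero f t) \<le> C * exp (k * Im t)"
proof -
  obtain R C k where *: "\<And>t. Im t > R \<Longrightarrow> regular_at f t \<and> norm (eval_mero f t) \<le> C * exp (k * Im t)"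
    using assms unfolding exp_growth_def by blast
  show ?thesis
  proof (rule that[of "max 1 R" "\<bar>C\<bar>" "\<bar>k\<bar>"])
    fix t assume t: "Im t > max 1 R"
    have "C * exp (k * Im t) \<le> \<bar>C\<bar> * exp (\<bar>k\<bar> * Im t)"
      using t by (intro mult_mono) (auto intro!: mult_right_mono)
    thus "regular_at f t \<and> norm (eval_mero f t) \<le> \<bar>C\<bar> * exp (\<bar>k\<bar> * Im t)" using *[of t] t by simp
  qed auto
qed

lemma exp_growth_mconst: "exp_growth (mconst c)"
  unfolding exp_growth_def
  by (rule exI[of _ 0], rule exI[of _ "norm c"], rule exI[of _ 0]) (simp add: regular_at_mconst eval_mconst uhp_def)

lemma exp_growth_add:
  assumes "exp_growth f" "exp_growth g" shows "exp_growth (f + g)"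
proof -
  obtain R C k where 1: "R \<ge> 1" "C \<ge> 0" "k \<ge> 0"
    "\<And>t. Im t > R \<Longrightarrow> regular_at f t \<and> norm (eval_mero f t) \<le> C * exp (k * Im t)" using exp_growth_normal[OF assms(1)] by metis
  obtain R' C' k' where 2: "R' \<ge> 1" "C' \<ge> 0" "k' \<ge> 0"
    "\<And>t. Im t > R' \<Longrightarrow> regular_at g t \<and> norm (eval_mero g t) \<le> C' * exp (k' * Im t)" using exp_growth_normal[OF assms(2)] by metis
  have "regular_at (f + g) t \<and> norm (eval_mero (f + g) t) \<le> (C + C') * exp ((k + k') * Im t)" if t: "Im t > max R R'" for t
  proof -
    have u: "t \<in> uhp" using t 1 by (simp add: uhp_def)
    have "C * exp (k * Im t) \<le> C * exp ((k + k') * Im t)" "C' * exp (k' * Im t) \<le> C' * exp ((k + k') * Im t)"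
      using t 1 2 by (auto intro!: mult_left_mono mult_right_mono)
    thus ?thesis using regular_at_add[OF u, of f g] 1(4)[of t] 2(4)[of t] t
        norm_triangle_ineq[of "eval_mero f t" "eval_mero g t"] by (simp add: algebra_simps)
  qed
  thus ?thesis unfolding exp_growth_def by blast
qed

lemma exp_growth_mult:
  assumes "exp_growth f" "exp_growth g" shows "exp_growth (f * g)"
proof -
  obtain R C k where 1: "R \<ge> 1" "C \<ge> 0" "k \<ge> 0"
    "\<And>t. Im t > R \<Longrightarrow> regular_at f t \<and> norm (eval_mero f t) \<le> C * exp (k * Im t)" using exp_growth_normal[OF assms(1)] by metis
  obtain R' C' k' where 2: "R' \<ge> 1" "C' \<ge> 0" "k' \<ge> 0"
    "\<And>t. Im t > R' \<Longrightarrow> regular_at g t \<and> norm (eval_mero g t) \<le> C' * exp (k' * Im t)" using exp_growth_normal[OF assms(2)] by metis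
  have "regular_at (f * g) t \<and> norm (eval_mero (f * g) t) \<le> (C * C') * exp ((k + k') * Im t)" if t: "Im t > max R R'" for t
  proof -
    have u: "t \<in> uhp" using t 1 by (simp add: uhp_def)
    have "norm (eval_mero f t) * norm (eval_mero g t) \<le> (C * exp (k * Im t)) * (C' * exp (k' * Im t))"
      using 1(4)[of t] 2(4)[of t] t 1(2) 2(2) by (intro mult_mono) auto
    also have "\<dots> = (C * C') * exp ((k + k') * Im t)" by (simp add: ring_distribs exp_add)
    finally show ?thesis using regular_at_mult[OF u, of f g] 1(4)[of t] 2(4)[of t] t by (simp add: norm_mult)
  qed
  thus ?thesis unfolding exp_growth_def by blast
qed

definition exp_growth_cusps :: "mero_uhp \<Rightarrow> bool" where
  "exp_growth_cusps f \<longleftrightarrow> (\<forall>M\<in>SL2Z. exp_growth (pullback M f))"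

lemma exp_growth_cusps_mconst: "exp_growth_cusps (mconst c)"
  by (simp add: exp_growth_cusps_def pullback_mconst SL2Z_pos_det exp_growth_mconst)
lemma exp_growth_cusps_add: "exp_growth_cusps f \<Longrightarrow> exp_growth_cusps g \<Longrightarrow> exp_growth_cusps (f + g)"
  by (simp add: exp_growth_cusps_def pullback_add SL2Z_pos_det exp_growth_add)
lemma exp_growth_cusps_mult: "exp_growth_cusps f \<Longrightarrow> exp_growth_cusps g \<Longrightarrow> exp_growth_cusps (f * g)"
  by (simp add: exp_growth_cusps_def pullback_mult SL2Z_pos_det exp_growth_mult)
lemma exp_growth_cusps_power: "exp_growth_cusps f \<Longrightarrow> exp_growth_cusps (f ^ n)"
  using exp_growth_cusps_mconst[of 1] by (induction n) (auto simp: exp_growth_cusps_mult)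
lemma exp_growth_cusps_pullback: "exp_growth_cusps f \<Longrightarrow> M \<in> SL2Z \<Longrightarrow> exp_growth_cusps (pullback M f)"
  by (simp add: exp_growth_cusps_def pullback_mat_mul mat_mul_SL2Z)
definition W_mero :: mero_uhp where "W_mero = mero W_fun"
definition F_mero :: mero_uhp where "F_mero = mero F_fun"

lemma regular_at_W_mero: "t \<in> uhp \<Longrightarrow> regular_at W_mero t" and eval_W_mero: "t \<in> uhp \<Longrightarrow> eval_mero W_mero t = W_fun t"
  unfolding W_mero_def using mero_holomorphic[OF holomorphic_W_fun] by auto
lemma regular_at_F_mero: "t \<in> uhp \<Longrightarrow> regular_at F_mero t" and eval_F_mero: "t \<in> uhp \<Longrightarrow> eval_mero F_mero t = F_fun t"
  unfolding F_mero_def using mero_holomorphic[OF holomorphic_F_fun] by auto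

lemma exp_growth_cusps_W_mero: "exp_growth_cusps W_mero" and exp_growth_cusps_F_mero: "exp_growth_cusps F_mero"
proof -
  have "exp_growth (pullback M W_mero) \<and> exp_growth (pullback M F_mero)" if M: "M \<in> SL2Z" for M
  proof -
    obtain C where C: "\<And>t. Im t \<ge> 1 / 2 \<Longrightarrow> norm (W_fun (moeb M t)) \<le> C * exp (2 * pi / 9 * Im t)"
      "\<And>t. Im t \<ge> 1 / 2 \<Longrightarrow> norm (F_fun (moeb M t)) \<le> C * exp (4 * pi / 9 * Im t)"
      using W_fun_F_fun_growth[OF M] by metis
    have "regular_at (pullback M W_mero) t \<and> norm (eval_mero (pullback M W_mero) t) \<le> C * exp (2 * pi / 9 * Im t)"
      "regular_at (pullback M F_mero) t \<and> norm (eval_mero (pullback M F_mero) t) \<le> C * exp (4 * pi / 9 * Im t)" if t: "Im t > 1 / 2" for t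
      using C[of t] t half_uhp[of t] SL2Z_pos_det[OF M] moeb_uhp[OF M, of t]
      by (simp_all add: pullback_regular_at eval_pullback regular_at_W_mero eval_W_mero regular_at_F_mero eval_F_mero)
    thus ?thesis unfolding exp_growth_def by blast
  qed
  thus "exp_growth_cusps W_mero" "exp_growth_cusps F_mero" by (auto simp: exp_growth_cusps_def)
qed

lemma W_mero_nz: "W_mero \<noteq> 0" and F_mero_nz: "F_mero \<noteq> 0"
  using eval_W_mero[OF ii_in_uhp] W_fun_nz[OF ii_in_uhp] eval_F_mero[OF ii_in_uhp] F_fun_nz[OF ii_in_uhp]
    eval_mconst[OF ii_in_uhp, of 0] by auto

lemma F_mero_cube: "F_mero ^ 3 = W_mero ^ 6 + 9 * W_mero ^ 3 + 27"
proof (rule eval_mero_eqI)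
  fix z assume z: "z \<in> uhp"
  have "regular_at (mconst 9 * W_mero ^ 3) z \<and> eval_mero (mconst 9 * W_mero ^ 3) z = 9 * W_fun z ^ 3"
    using z by (simp add: regular_at_mult regular_at_mconst regular_at_power regular_at_W_mero eval_mconst eval_W_mero del: mconst_numeral)
  hence "eval_mero (W_mero ^ 6 + mconst 9 * W_mero ^ 3 + mconst 27) z = W_fun z ^ 6 + 9 * W_fun z ^ 3 + 27"
    using z by (simp add: regular_at_add regular_at_mconst regular_at_power regular_at_W_mero eval_mconst eval_W_mero del: mconst_numeral)
  thus "eval_mero (F_mero ^ 3) z = eval_mero (W_mero ^ 6 + 9 * W_mero ^ 3 + 27) z"
    using z F_fun_cube[OF z] by (simp add: regular_at_power regular_at_F_mero eval_F_mero)
qed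

lemma W_mero_S: "pullback (0, - 1, 1, 0) W_mero = 3 / W_mero"
proof -
  have "pullback (0, - 1, 1, 0) W_mero * W_mero = mconst 3"
  proof (rule eval_mero_eqI)
    fix z assume z: "z \<in> uhp"
    have m: "moeb (0, - 1, 1, 0) z = - 1 / z" by (simp add: moeb_def moebius_def)
    have "regular_at (pullback (0, - 1, 1, 0) W_mero) z"
      by (rule pullback_regular_at) (use z uhp_S[OF z] in \<open>auto simp: m regular_at_W_mero\<close>)
    thus "eval_mero (pullback (0, - 1, 1, 0) W_mero * W_mero) z = eval_mero (mconst 3) z"
      using z uhp_S[OF z] W_fun_nz[OF z] W_fun_S[OF z]
      by (simp add: regular_at_mult regular_at_W_mero eval_pullback eval_W_mero m eval_mconst del: mconst_numeral)
  qed
  thus ?thesis using W_mero_nz by (simp add: eq_divide_eq)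
qed

lemma F_mero_S: "pullback (0, - 1, 1, 0) F_mero = 3 * F_mero / W_mero ^ 2"
proof -
  have "pullback (0, - 1, 1, 0) F_mero * W_mero ^ 2 = mconst 3 * F_mero"
  proof (rule eval_mero_eqI)
    fix z assume z: "z \<in> uhp"
    have m: "moeb (0, - 1, 1, 0) z = - 1 / z" by (simp add: moeb_def moebius_def)
    have "regular_at (pullback (0, - 1, 1, 0) F_mero) z"
      by (rule pullback_regular_at) (use z uhp_S[OF z] in \<open>auto simp: m regular_at_F_mero\<close>)
    thus "eval_mero (pullback (0, - 1, 1, 0) F_mero * W_mero ^ 2) z = eval_mero (mconst 3 * F_mero) z"
      using z uhp_S[OF z] W_fun_nz[OF z] F_fun_S[OF z]
      by (simp add: regular_at_mult regular_at_power regular_at_W_mero regular_at_F_mero regular_at_mconst eval_pullback eval_W_mero eval_F_mero m eval_mconst del: mconst_numeral)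
  qed
  thus ?thesis using W_mero_nz by (simp add: eq_divide_eq)
qed

lemma W_mero_Gamma_3:
  assumes M: "(1 + 3 * m, 3 * b, 3 * c, 1 + 3 * n) \<in> SL2Z"
  shows "pullback (1 + 3 * m, 3 * b, 3 * c, 1 + 3 * n) W_mero = mconst (omega powi (- b - c)) * W_mero"
    "pullback (1 + 3 * m, 3 * b, 3 * c, 1 + 3 * n) F_mero = mconst (omega powi b) * F_mero"
  using M W_fun_Gamma_3[OF M] F_fun_Gamma_3[OF M]
  by (auto intro!: eval_mero_eqI simp: eval_pullback SL2Z_pos_det regular_at_mult regular_at_mconst regular_at_W_mero regular_at_F_mero eval_mconst eval_W_mero eval_F_mero moeb_uhp
      simp del: pos_det.simps)

subsection \<open>Generated complex algebras\<close>

inductive_set complex_algebra :: "mero_uhp set \<Rightarrow> mero_uhp set" for S where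
  const: "mconst c \<in> complex_algebra S"
| gen: "s \<in> S \<Longrightarrow> s \<in> complex_algebra S"
| add: "a \<in> complex_algebra S \<Longrightarrow> b \<in> complex_algebra S \<Longrightarrow> a + b \<in> complex_algebra S"
| mult: "a \<in> complex_algebra S \<Longrightarrow> b \<in> complex_algebra S \<Longrightarrow> a * b \<in> complex_algebra S"

lemma complex_algebra_0: "0 \<in> complex_algebra S" and complex_algebra_1: "1 \<in> complex_algebra S"
  using complex_algebra.const[of 0 S] complex_algebra.const[of 1 S] by auto
lemma complex_algebra_minus: "a \<in> complex_algebra S \<Longrightarrow> - a \<in> complex_algebra S"
  using complex_algebra.mult[OF complex_algebra.const[of "- 1"], of a S] by (simp add: mconst_minus)
lemma complex_algebra_power: "a \<in> complex_algebra S \<Longrightarrow> a ^ n \<in> complex_algebra S"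
  by (induction n) (auto intro: complex_algebra.mult complex_algebra_1)
lemma complex_algebra_diff: "a \<in> complex_algebra S \<Longrightarrow> b \<in> complex_algebra S \<Longrightarrow> a - b \<in> complex_algebra S"
  using complex_algebra.add[OF _ complex_algebra_minus, of a S b] by simp
lemma complex_algebra_prod: "(\<And>x. x \<in> A \<Longrightarrow> f x \<in> complex_algebra S) \<Longrightarrow> prod f A \<in> complex_algebra S"
  by (induction A rule: infinite_finite_induct) (auto intro: complex_algebra.mult complex_algebra_1)
lemma complex_algebra_mono_gen: "a \<in> complex_algebra S \<Longrightarrow> S \<subseteq> complex_algebra S' \<Longrightarrow> a \<in> complex_algebra S'"
  by (induction rule: complex_algebra.induct) (auto intro: complex_algebra.intros)

definition complex_field :: "mero_uhp set \<Rightarrow> mero_uhp set" where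
  "complex_field S = {a / b | a b. a \<in> complex_algebra S \<and> b \<in> complex_algebra S \<and> b \<noteq> 0}"

lemma complex_fieldI: "b * f = a \<Longrightarrow> a \<in> complex_algebra S \<Longrightarrow> b \<in> complex_algebra S \<Longrightarrow> b \<noteq> 0 \<Longrightarrow> f \<in> complex_field S"
  unfolding complex_field_def by (intro CollectI exI[of _ a] exI[of _ b]) auto

lemma complex_field_ring: "a \<in> complex_algebra S \<Longrightarrow> a \<in> complex_field S"
  by (rule complex_fieldI[of 1]) (auto intro: complex_algebra_1)
lemma complex_field_add: "f \<in> complex_field S \<Longrightarrow> g \<in> complex_field S \<Longrightarrow> f + g \<in> complex_field S"
proof -
  assume "f \<in> complex_field S" "g \<in> complex_field S"
  then obtain a b c d where "a \<in> complex_algebra S" "b \<in> complex_algebra S" "b \<noteq> 0" "f = a / b" "c \<in> complex_algebra S" "d \<in> complex_algebra S" "d \<noteq> 0" "g = c / d"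
    unfolding complex_field_def by blast
  thus ?thesis by (intro complex_fieldI[of "b * d" _ "a * d + c * b"] complex_algebra.add complex_algebra.mult) (auto simp: field_simps)
qed
lemma complex_field_mult: "f \<in> complex_field S \<Longrightarrow> g \<in> complex_field S \<Longrightarrow> f * g \<in> complex_field S"
proof -
  assume "f \<in> complex_field S" "g \<in> complex_field S"
  then obtain a b c d where "a \<in> complex_algebra S" "b \<in> complex_algebra S" "b \<noteq> 0" "f = a / b" "c \<in> complex_algebra S" "d \<in> complex_algebra S" "d \<noteq> 0" "g = c / d"
    unfolding complex_field_def by blast
  thus ?thesis by (intro complex_fieldI[of "b * d" _ "a * c"] complex_algebra.mult) (auto simp: field_simps)
qed
lemma complex_field_inverse: "f \<in> complex_field S \<Longrightarrow> inverse f \<in> complex_field S"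
proof -
  assume "f \<in> complex_field S"
  then obtain a b where "a \<in> complex_algebra S" "b \<in> complex_algebra S" "b \<noteq> 0" "f = a / b" unfolding complex_field_def by blast
  thus ?thesis by (cases "a = 0") (auto intro: complex_fieldI[of a _ b] complex_field_ring complex_algebra_0)
qed

section \<open>The function field of the principal congruence subgroup of level three\<close>

lemma regular_at_minus:
  assumes "z \<in> uhp" "regular_at f z"
  shows "regular_at (- f) z \<and> eval_mero (- f) z = - eval_mero f z"
proof -
  have "(\<lambda>z. - eval_mero f z) analytic_on {z}"
    using assms(2) unfolding regular_at_def by (rule analytic_on_neg)
  from regular_atI[OF assms(1) ae_at[OF eval_mero_ops_ae(5) assms(1)] this] show ?thesis ..
qed

text \<open>A coordinate on the genus zero curve X(3), with a simple pole at infinity in the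
  parameter ee(t/3).\<close>

definition hauptmodul :: mero_uhp where "hauptmodul = W_mero ^ 3"

lemma regular_at_hauptmodul: "t \<in> uhp \<Longrightarrow> regular_at hauptmodul t" and eval_hauptmodul: "t \<in> uhp \<Longrightarrow> eval_mero hauptmodul t = W_fun t ^ 3"
  unfolding hauptmodul_def by (simp_all add: regular_at_power regular_at_W_mero eval_W_mero)

lemma hauptmodul_Gamma_3: "M \<in> Gamma_3 \<Longrightarrow> pullback M hauptmodul = hauptmodul"
proof -
  assume M: "M \<in> Gamma_3"
  obtain m b c n where Me: "M = (1 + 3 * m, 3 * b, 3 * c, 1 + 3 * n)"
    and MS: "(1 + 3 * m, 3 * b, 3 * c, 1 + 3 * n) \<in> SL2Z" using Gamma_3_E[OF M] .
  have "pullback M hauptmodul = pullback M W_mero ^ 3"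
    unfolding hauptmodul_def by (rule pullback_power[OF SL2Z_pos_det[OF Gamma_3_SL2Z[OF M]]])
  also have "pullback M W_mero = mconst (omega powi (- b - c)) * W_mero"
    unfolding Me by (rule W_mero_Gamma_3(1)[OF MS])
  finally have "pullback M hauptmodul = (mconst (omega powi (- b - c)) * W_mero) ^ 3" .
  thus ?thesis by (simp add: power_mult_distrib hauptmodul_def flip: mconst_power)
qed

lemma exp_growth_cusps_hauptmodul: "exp_growth_cusps hauptmodul" unfolding hauptmodul_def by (rule exp_growth_cusps_power[OF exp_growth_cusps_W_mero])

definition at_cusp :: "complex filter" where "at_cusp = filtercomap Im at_top"

lemma at_cusp_gt: "eventually (\<lambda>t. Im t > R) at_cusp"
  unfolding at_cusp_def by (rule eventually_filtercomapI) (rule eventually_gt_at_top)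

lemma at_cusp_nontrivial: "at_cusp \<noteq> bot"
proof
  assume "at_cusp = bot"
  hence "eventually (\<lambda>t. False) at_cusp" by simp
  then obtain P where P: "eventually P at_top" "\<forall>t. P (Im t) \<longrightarrow> False"
    unfolding at_cusp_def eventually_filtercomap by blast
  obtain y where "P y" using eventually_happens'[OF trivial_limit_at_top_linorder P(1)] by blast
  thus False using P(2) by (metis complex.sel(2))
qed

lemma ee_tendsto_0:
  assumes "n > 0" shows "((\<lambda>t. ee (t / of_nat n)) \<longlongrightarrow> 0) at_cusp"
proof (rule tendsto_norm_zero_cancel)
  have Im: "filterlim Im at_top at_cusp" unfolding at_cusp_def by (rule filterlim_filtercomap)
  have 1: "norm (ee (t / of_nat n)) = exp (- (2 * pi / n * Im t))" for t
    using assms by (simp add: norm_ee Im_divide power2_eq_square)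
  have "filterlim (\<lambda>t. 2 * pi / n * Im t) at_top at_cusp"
    by (rule filterlim_tendsto_pos_mult_at_top[OF tendsto_const _ Im]) (use assms in simp)
  hence "filterlim (\<lambda>t. - (2 * pi / n * Im t)) at_bot at_cusp"
    by (simp add: filterlim_uminus_at_bot)
  hence "((\<lambda>t. exp (- (2 * pi / n * Im t))) \<longlongrightarrow> 0) at_cusp"
    by (rule filterlim_compose[OF exp_at_bot])
  thus "((\<lambda>t. norm (ee (t / of_nat n))) \<longlongrightarrow> 0) at_cusp" by (simp only: 1)
qed

lemma tendsto_third:
  assumes "\<phi> holomorphic_on ball 0 1"
  shows "((\<lambda>t. \<phi> (ee (t / 3))) \<longlongrightarrow> \<phi> 0) at_cusp"
proof -
  have "isCont \<phi> 0" using holomorphic_on_imp_continuous_on[OF assms]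
    by (simp add: continuous_on_eq_continuous_at)
  moreover have "((\<lambda>t. ee (t / 3)) \<longlongrightarrow> 0) at_cusp" using ee_tendsto_0[of 3] by simp
  ultimately show ?thesis by (rule isCont_tendsto_compose)
qed

lemma W_fun_asymp: "((\<lambda>t. W_fun t * ee (t / 9)) \<longlongrightarrow> 1) at_cusp"
proof -
  have "((\<lambda>t. klein_1_prod 0 (ee (t / 3)) / klein_0_prod (ee (t / 3))) \<longlongrightarrow> klein_1_prod 0 0 / klein_0_prod 0) at_cusp"
    by (intro tendsto_divide tendsto_third holomorphic_klein_1_prod holomorphic_klein_0_prod) simp
  moreover have "eventually (\<lambda>t. klein_1_prod 0 (ee (t / 3)) / klein_0_prod (ee (t / 3)) = W_fun t * ee (t / 9)) at_cusp"
    using at_cusp_gt[of 0]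
    by eventually_elim (simp add: W_fun_expansion uhp_def ee_minus)
  ultimately show ?thesis by (simp add: tendsto_cong)
qed

lemma F_fun_asymp: "((\<lambda>t. F_fun t * ee (t / 9) ^ 2) \<longlongrightarrow> 1) at_cusp"
proof -
  have "((\<lambda>t. klein_1_prod 1 (ee (t / 3)) * klein_1_prod 2 (ee (t / 3)) / klein_0_prod (ee (t / 3)) ^ 2) \<longlongrightarrow> klein_1_prod 1 0 * klein_1_prod 2 0 / klein_0_prod 0 ^ 2) at_cusp"
    by (intro tendsto_divide tendsto_mult tendsto_power tendsto_third holomorphic_klein_1_prod holomorphic_klein_0_prod) simp
  moreover have "eventually (\<lambda>t. klein_1_prod 1 (ee (t / 3)) * klein_1_prod 2 (ee (t / 3)) / klein_0_prod (ee (t / 3)) ^ 2 = F_fun t * ee (t / 9) ^ 2) at_cusp"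
    using at_cusp_gt[of 0]
    by eventually_elim (simp add: F_fun_expansion uhp_def ee_minus power_inverse[symmetric] field_simps)
  ultimately show ?thesis by (simp add: tendsto_cong)
qed

lemma W_fun_at_infinity: "filterlim W_fun at_infinity at_cusp"
proof -
  have 0: "filterlim (\<lambda>t. ee (t / 9)) (at 0) at_cusp"
    using ee_tendsto_0[of 9] by (simp add: filterlim_at)
  have "filterlim (\<lambda>t. (W_fun t * ee (t / 9)) / ee (t / 9)) at_infinity at_cusp"
    by (rule filterlim_divide_at_infinity[OF W_fun_asymp 0]) simp
  thus ?thesis by simp
qed

text \<open>W grows without bound towards infinity. The lemma guarantees that the denominators built
  below from powers of such differences are nonzero.\<close>

lemma hauptmodul_not_const: "hauptmodul - mconst c \<noteq> 0"
proof
  assume "hauptmodul - mconst c = 0"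
  hence e: "W_fun t ^ 3 = c" if "t \<in> uhp" for t using eval_hauptmodul[OF that] eval_mconst[OF that, of c] by simp
  have "eventually (\<lambda>t. norm (W_fun t) > max 1 (norm c)) at_cusp"
    using filterlim_at_infinity_imp_norm_at_top[OF W_fun_at_infinity] unfolding filterlim_at_top_dense by blast
  with at_cusp_gt[of 0] have "eventually (\<lambda>t. False) at_cusp"
  proof eventually_elim
    case (elim t)
    have "norm (W_fun t) ^ 3 = norm c" using e[of t] elim by (simp add: uhp_def flip: norm_power)
    moreover have "norm (W_fun t) ^ 1 \<le> norm (W_fun t) ^ 3" using elim by (intro power_increasing) auto
    ultimately show ?case using elim by simp
  qed
  thus False using at_cusp_nontrivial by simp
qed

lemma regular_at_complex_algebra: "a \<in> complex_algebra S \<Longrightarrow> (\<And>s. s \<in> S \<Longrightarrow> regular_at s t) \<Longrightarrow> t \<in> uhp \<Longrightarrow> regular_at a t"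
  by (induction rule: complex_algebra.induct) (auto simp: regular_at_mconst regular_at_add regular_at_mult)

lemma exp_growth_cusps_complex_algebra: "a \<in> complex_algebra S \<Longrightarrow> (\<And>s. s \<in> S \<Longrightarrow> exp_growth_cusps s) \<Longrightarrow> exp_growth_cusps a"
  by (induction rule: complex_algebra.induct) (auto simp: exp_growth_cusps_mconst exp_growth_cusps_add exp_growth_cusps_mult)

lemma inv_complex_algebra: "a \<in> complex_algebra S \<Longrightarrow> pos_det M \<Longrightarrow> (\<And>s. s \<in> S \<Longrightarrow> pullback M s = s) \<Longrightarrow> pullback M a = a"
  by (induction rule: complex_algebra.induct) (auto simp: pullback_mconst pullback_add pullback_mult)

lemma regular_at_complex_algebra_hauptmodul: "a \<in> complex_algebra {hauptmodul} \<Longrightarrow> t \<in> uhp \<Longrightarrow> regular_at a t"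
  using regular_at_complex_algebra[of a "{hauptmodul}"] regular_at_hauptmodul by auto

lemma zero_factor:
  assumes "\<psi> holomorphic_on ball 0 1" "\<psi> 0 = 0"
  obtains g where "g holomorphic_on ball 0 1" "\<And>X. X \<in> ball 0 1 \<Longrightarrow> \<psi> X = X * g X"
proof -
  define g where "g = (\<lambda>X. if X = 0 then deriv \<psi> 0 else (\<psi> X - \<psi> 0) / (X - 0))"
  have "g holomorphic_on ball 0 1" unfolding g_def by (rule pole_lemma[OF assms(1)]) auto
  thus ?thesis by (rule that) (use assms(2) in \<open>simp add: g_def\<close>)
qed

lemma norm_third: "norm (ee (t / 3)) = exp (- (2 * pi / 3 * Im t))"
  by (simp add: norm_ee)

text \<open>Induction on a bound n for the pole order at infinity in the parameter ee(t/3).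
  Subtracting a multiple of a power of the hauptmodul lowers the bound by one and keeps the function
  bounded at the other cusps; for n = 0 the function is constant by
  \<open>modular_Liouville\<close>.\<close>

lemma Gamma_3_polynomial:
  assumes "H holomorphic_on uhp"
    and "\<And>M t. M \<in> Gamma_3 \<Longrightarrow> t \<in> uhp \<Longrightarrow> H (moeb M t) = H t"
    and "\<And>a b c d. (a, b, c, d) \<in> SL2Z \<Longrightarrow> \<not> 3 dvd c \<Longrightarrow> \<exists>C R. \<forall>t. Im t > R \<longrightarrow> norm (H (moeb (a, b, c, d) t)) \<le> C"
    and "\<And>t. Im t > R \<Longrightarrow> norm (H t) \<le> C * exp (2 * pi / 3 * of_nat n * Im t)"
  shows "\<exists>a\<in>complex_algebra {hauptmodul}. \<forall>t\<in>uhp. eval_mero a t = H t"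
  using assms
proof (induction n arbitrary: H C R)
  case (0 H C R)
  have "\<exists>C R. \<forall>t. Im t > R \<longrightarrow> norm (H (moeb M t)) \<le> C" if M: "M \<in> SL2Z" for M
  proof -
    obtain a b c d where Me: "M = (a, b, c, d)" by (cases M)
    show ?thesis
    proof (cases "3 dvd c")
      case True
      then obtain G n where G: "G \<in> Gamma_3" "\<And>t. t \<in> uhp \<Longrightarrow> moeb (a, b, c, d) t = moeb G (t + of_int n)"
        using Gamma_3_T M Me by metis
      have "norm (H (moeb M t)) \<le> C" if "Im t > max 0 R" for t
      proof -
        have u: "t \<in> uhp" "t + of_int n \<in> uhp" using that by (simp_all add: uhp_def)
        have "H (moeb M t) = H (t + of_int n)" unfolding Me G(2)[OF u(1)] by (rule 0(2)[OF G(1) u(2)])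
        thus ?thesis using 0(4)[of "t + of_int n"] that by simp
      qed
      thus ?thesis by blast
    next
      case False
      thus ?thesis using 0(3) M Me by blast
    qed
  qed
  then obtain c where "\<And>t. t \<in> uhp \<Longrightarrow> H t = c" using modular_Liouville[OF 0(1,2)] by metis
  thus ?case by (intro bexI[of _ "mconst c"] complex_algebra.const) (simp add: eval_mconst)
next
  case (Suc n H C R)
  have per: "H (t + 3) = H t" if "t \<in> uhp" for t
  proof -
    have "(1, 3, 0, 1) \<in> Gamma_3" by (simp add: Gamma_3_def SL2Z_def)
    from Suc.prems(2)[OF this that] show ?thesis by (simp add: moeb_T)
  qed
  \<comment> \<open>Multiplication by this power of the local parameter removes the pole; the value
    of the extension at the centre is the coefficient to be subtracted.\<close>
  define G where "G = (\<lambda>t. H t * ee (t / 3) ^ Suc n)"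
  have Ghol: "G holomorphic_on {t. Im t > 0}"
    unfolding G_def using Suc.prems(1) unfolding uhp_def by (intro holomorphic_intros) auto
  have Gper: "G (t + of_nat 3) = G t" if "Im t > 0" for t
  proof -
    have "ee ((t + 3) / 3) = ee (t / 3)" using ee_plus_1[of "t / 3"] by (simp add: add_divide_distrib)
    thus ?thesis using per[of t] that by (simp add: G_def uhp_def)
  qed
  have Gbdd: "norm (G t) \<le> C" if "Im t > R" for t
  proof -
    have "norm (G t) = norm (H t) * exp (- (2 * pi / 3 * Im t)) ^ Suc n"
      by (simp only: G_def norm_mult norm_power norm_third)
    also have "exp (- (2 * pi / 3 * Im t)) ^ Suc n = exp (- (2 * pi / 3 * of_nat (Suc n) * Im t))"
      by (simp only: exp_of_nat_mult[symmetric]) (simp add: algebra_simps)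
    also have "norm (H t) * exp (- (2 * pi / 3 * of_nat (Suc n) * Im t)) \<le>
        (C * exp (2 * pi / 3 * of_nat (Suc n) * Im t)) * exp (- (2 * pi / 3 * of_nat (Suc n) * Im t))"
      by (rule mult_right_mono[OF Suc.prems(4)[OF that]]) simp
    also have "\<dots> = C" by (simp add: mult.assoc exp_add[symmetric] del: of_nat_Suc)
    finally show ?thesis .
  qed
  obtain \<phi> where \<phi>': "\<phi> holomorphic_on ball 0 (exp (- 2 * pi * 0 / real 3))"
      "\<And>t. Im t > 0 \<Longrightarrow> G t = \<phi> (ee (t / of_nat 3))"
    using periodic_extension[OF _ Ghol Gper Gbdd] by (metis zero_less_numeral of_nat_numeral)
  hence \<phi>: "\<phi> holomorphic_on ball 0 1" "\<And>t. t \<in> uhp \<Longrightarrow> H t * ee (t / 3) ^ Suc n = \<phi> (ee (t / 3))"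
    by (simp_all add: G_def uhp_def)
  define \<upsilon> where "\<upsilon> = (\<lambda>X. (klein_1_prod 0 X / klein_0_prod X) ^ 3)"
  have \<upsilon>: "\<upsilon> holomorphic_on ball 0 1" unfolding \<upsilon>_def
    by (intro holomorphic_intros holomorphic_klein_1_prod holomorphic_klein_0_prod) (simp add: klein_0_prod_nonzero)
  have W: "W_fun t ^ 3 * ee (t / 3) = \<upsilon> (ee (t / 3))" if "t \<in> uhp" for t
  proof -
    have "ee (- t / 9) ^ 3 * ee (t / 3) = ee (of_nat 3 * (- t / 9) + t / 3)" by (simp only: ee_power ee_add)
    also have "\<dots> = 1" by simp
    finally show ?thesis unfolding \<upsilon>_def W_fun_expansion[OF that] power_mult_distrib by (simp add: mult_ac)
  qed
  define \<psi> where "\<psi> = (\<lambda>X. \<phi> X - \<phi> 0 * \<upsilon> X ^ Suc n)"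
  have "\<psi> holomorphic_on ball 0 1" unfolding \<psi>_def by (intro holomorphic_intros \<phi> \<upsilon>)
  moreover have "\<psi> 0 = 0" by (simp add: \<psi>_def \<upsilon>_def)
  ultimately obtain g where g: "g holomorphic_on ball 0 1" "\<And>X. X \<in> ball 0 1 \<Longrightarrow> \<psi> X = X * g X"
    using zero_factor by metis
  obtain C' where C': "\<And>t. Im t \<ge> 1 / 2 \<Longrightarrow> norm (g (ee (t / 3))) \<le> C'" using ball_upper_bound[OF g(1)] by metis
  define H' where "H' = (\<lambda>t. H t - \<phi> 0 * (W_fun t ^ 3) ^ Suc n)"
  have H': "H' t * ee (t / 3) ^ n = g (ee (t / 3))" if t: "t \<in> uhp" for t
  proof -
    have "H' t * ee (t / 3) ^ Suc n = \<phi> (ee (t / 3)) - \<phi> 0 * (W_fun t ^ 3 * ee (t / 3)) ^ Suc n"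
      unfolding H'_def \<phi>(2)[OF t, symmetric] power_mult_distrib by (simp add: algebra_simps)
    also have "\<dots> = ee (t / 3) * g (ee (t / 3))"
      unfolding W[OF t] using g(2)[of "ee (t / 3)"] ee_third_in_ball[OF t] by (simp add: \<psi>_def)
    finally show ?thesis by simp
  qed
  have "\<exists>a\<in>complex_algebra {hauptmodul}. \<forall>t\<in>uhp. eval_mero a t = H' t"
  proof (rule Suc.IH)
    show "H' holomorphic_on uhp" unfolding H'_def
      by (intro holomorphic_intros Suc.prems(1) holomorphic_W_fun)
    show "H' (moeb M t) = H' t" if "M \<in> Gamma_3" "t \<in> uhp" for M t
    proof -
      have "W_fun (moeb M t) ^ 3 = eval_mero (pullback M hauptmodul) t"
        using that by (simp add: eval_pullback SL2Z_pos_det Gamma_3_SL2Z eval_hauptmodul moeb_uhp)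
      also have "\<dots> = W_fun t ^ 3" using that by (simp add: hauptmodul_Gamma_3 eval_hauptmodul)
      finally show ?thesis using Suc.prems(2)[OF that] by (simp only: H'_def)
    qed
    show "\<exists>C R. \<forall>t. Im t > R \<longrightarrow> norm (H' (moeb (a, b, c, d) t)) \<le> C"
      if M: "(a, b, c, d) \<in> SL2Z" and c: "\<not> 3 dvd c" for a b c d
    proof -
      obtain C1 R1 where 1: "\<And>t. Im t > R1 \<Longrightarrow> norm (H (moeb (a, b, c, d) t)) \<le> C1"
        using Suc.prems(3)[OF M c] by blast
      obtain C2 where 2: "\<And>t. Im t \<ge> 1 / 2 \<Longrightarrow> norm (W_fun (moeb (a, b, c, d) t)) \<le> C2"
        using W_fun_bounded[OF M c] by metis
      have "norm (H' (moeb (a, b, c, d) t)) \<le> C1 + norm (\<phi> 0) * (C2 ^ 3) ^ Suc n" if "Im t > max 1 R1" for t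
      proof -
        have "norm (H' (moeb (a, b, c, d) t)) \<le> norm (H (moeb (a, b, c, d) t)) + norm (\<phi> 0) * (norm (W_fun (moeb (a, b, c, d) t)) ^ 3) ^ Suc n"
          unfolding H'_def by (rule order_trans[OF norm_triangle_ineq4]) (simp add: norm_mult norm_power)
        also have "\<dots> \<le> C1 + norm (\<phi> 0) * (C2 ^ 3) ^ Suc n"
          using 1[of t] 2[of t] that by (intro add_mono mult_left_mono power_mono) auto
        finally show ?thesis .
      qed
      thus ?thesis by blast
    qed
    fix t :: complex assume t: "Im t > 1 / 2"
    have "norm (H' t) * exp (- (2 * pi / 3 * Im t)) ^ n = norm (g (ee (t / 3)))"
      using arg_cong[OF H'[OF half_uhp], of t norm] t by (simp only: norm_mult norm_power norm_third less_imp_le)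
    also have "\<dots> \<le> C'" using C'[of t] t by simp
    also have "exp (- (2 * pi / 3 * Im t)) ^ n = inverse (exp (2 * pi / 3 * of_nat n * Im t))"
      by (simp only: exp_of_nat_mult[symmetric] exp_minus[symmetric]) (simp add: algebra_simps)
    finally show "norm (H' t) \<le> C' * exp (2 * pi / 3 * of_nat n * Im t)"
      by (simp add: field_simps)
  qed
  then obtain a where a: "a \<in> complex_algebra {hauptmodul}" "\<And>t. t \<in> uhp \<Longrightarrow> eval_mero a t = H' t" by blast
  show ?case
  proof (rule bexI[of _ "a + mconst (\<phi> 0) * hauptmodul ^ Suc n"])
    show "a + mconst (\<phi> 0) * hauptmodul ^ Suc n \<in> complex_algebra {hauptmodul}"
      by (intro complex_algebra.add a(1) complex_algebra.mult complex_algebra.const complex_algebra_power complex_algebra.gen) simp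
    show "\<forall>t\<in>uhp. eval_mero (a + mconst (\<phi> 0) * hauptmodul ^ Suc n) t = H t"
    proof
      fix t assume t: "t \<in> uhp"
      show "eval_mero (a + mconst (\<phi> 0) * hauptmodul ^ Suc n) t = H t"
        using t regular_at_complex_algebra_hauptmodul[OF a(1) t] a(2)[OF t]
        by (simp add: regular_at_add regular_at_mult regular_at_power regular_at_mconst regular_at_hauptmodul eval_mconst eval_hauptmodul H'_def del: power_Suc)
    qed
  qed
qed

section \<open>Clearing poles in the half plane and at the cusps\<close>

lemma remove_pole:
  assumes p: "p \<in> uhp"
  obtains m where "regular_at ((hauptmodul - mconst (eval_mero hauptmodul p)) ^ m * f) p"
proof (cases "regular_at f p")
  case True
  hence "regular_at ((hauptmodul - mconst (eval_mero hauptmodul p)) ^ 0 * f) p" by simp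
  thus ?thesis using that by blast
next
  case False
  have mer: "eval_mero f nicely_meromorphic_on uhp" by (rule nicely_meromorphic_eval_mero)
  have pole: "is_pole (eval_mero f) p"
    using nicely_meromorphic_on_imp_analytic_at[OF mer p] False by (auto simp: regular_at_def)
  have "isolated_singularity_at (eval_mero f) p"
    using meromorphic_on_isolated_singularity[OF meromorphic_on_subset[OF meromorphic_eval_mero]] p by auto
  then obtain S where S: "open S" "p \<in> S" "eval_mero f holomorphic_on S - {p}"
    using isolated_singularity_at_iff_analytic_nhd analytic_imp_holomorphic by metis
  obtain n g r where g: "r > 0" "g holomorphic_on cball p r" "\<And>w. w \<in> cball p r - {p} \<Longrightarrow> eval_mero f w = g w / (w - p) ^ n"
    using zorder_exist_pole[OF S(3,1,2) pole] by metis
  define u where "u = (\<lambda>t. W_fun t ^ 3)"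
  have u: "u holomorphic_on uhp" unfolding u_def by (intro holomorphic_intros holomorphic_W_fun)
  \<comment> \<open>The divided difference of W^3 at p: the hauptmodul minus its value at p is (z -
    p) v(z), so its n-th power cancels a pole of order n, whether or not v vanishes at p.\<close>
  define v where "v = (\<lambda>z. if z = p then deriv u p else (u z - u p) / (z - p))"
  have v: "v holomorphic_on uhp" unfolding v_def by (rule pole_lemma_open[OF u open_uhp])
  define U where "U = hauptmodul - mconst (eval_mero hauptmodul p)"
  have U: "regular_at U w \<and> eval_mero U w = u w - u p" if "w \<in> uhp" for w
    using regular_at_add[OF that regular_at_hauptmodul regular_at_mconst, of "- u p"] that p
    by (simp add: U_def mconst_minus regular_at_minus regular_at_mconst eval_hauptmodul eval_mconst u_def)
  have "regular_at (U ^ n * f) p"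
  proof (rule regular_atI(1)[OF p])
    show "(\<lambda>w. v w ^ n * g w) analytic_on {p}"
    proof (intro analytic_intros)
      show "v analytic_on {p}"
        using v unfolding analytic_on_open[OF open_uhp, symmetric] by (rule analytic_on_subset) (use p in simp)
      have "g holomorphic_on ball p r" by (rule holomorphic_on_subset[OF g(2) ball_subset_cball])
      hence "g analytic_on ball p r" by (simp add: analytic_on_open)
      thus "g analytic_on {p}" by (rule analytic_on_subset) (use g(1) in simp)
    qed
    have "eventually (\<lambda>w. w \<in> ball p r \<inter> uhp - {p}) (at p)"
      by (rule eventually_at_in_open) (use g(1) p in auto)
    moreover have "eventually (\<lambda>w. eval_mero (U ^ n * f) w = eval_mero (U ^ n) w * eval_mero f w) (at p)"
      by (rule ae_at[OF eval_mero_ops_ae(6) p])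
    ultimately show "eventually (\<lambda>w. eval_mero (U ^ n * f) w = v w ^ n * g w) (at p)"
    proof eventually_elim
      case (elim w)
      hence "eval_mero (U ^ n) w = (v w * (w - p)) ^ n"
        using U regular_at_power[of w U n] by (auto simp: v_def)
      moreover have "eval_mero f w = g w / (w - p) ^ n" using g(3)[of w] elim by auto
      ultimately show ?case using elim by (simp add: power_mult_distrib)
    qed
  qed
  thus ?thesis using that U_def by blast
qed

lemma regular_at_hauptmodul_diff: "t \<in> uhp \<Longrightarrow> regular_at ((hauptmodul - mconst c) ^ m) t"
  using regular_at_complex_algebra_hauptmodul[of "(hauptmodul - mconst c) ^ m" t]
  by (auto intro: complex_algebra_power complex_algebra_diff complex_algebra.gen complex_algebra.const)

lemma remove_poles_finite:
  assumes "finite P" "P \<subseteq> uhp"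
  shows "\<exists>b\<in>complex_algebra {hauptmodul}. b \<noteq> 0 \<and> (\<forall>p\<in>P. regular_at (b * f) p)"
  using assms
proof (induction rule: finite_induct)
  case empty
  show ?case by (rule bexI[of _ 1]) (auto simp: complex_algebra_1)
next
  case (insert p P)
  then obtain b where b: "b \<in> complex_algebra {hauptmodul}" "b \<noteq> 0" "\<And>q. q \<in> P \<Longrightarrow> regular_at (b * f) q" by auto
  define U where "U = hauptmodul - mconst (eval_mero hauptmodul p)"
  obtain m where m: "regular_at (U ^ m * f) p" using remove_pole[of p f] insert.prems unfolding U_def by auto
  have U: "U ^ m \<in> complex_algebra {hauptmodul}" unfolding U_def
    by (intro complex_algebra_power complex_algebra_diff complex_algebra.gen complex_algebra.const) simp
  show ?case
  proof (rule bexI[of _ "U ^ m * b"], intro conjI ballI)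
    show "U ^ m * b \<noteq> 0" using b(2) hauptmodul_not_const by (simp add: U_def)
    show "U ^ m * b \<in> complex_algebra {hauptmodul}" by (intro complex_algebra.mult U b)
    fix q assume q: "q \<in> insert p P"
    hence qu: "q \<in> uhp" using insert.prems by auto
    show "regular_at (U ^ m * b * f) q"
    proof (cases "q = p")
      case True
      have "regular_at (b * (U ^ m * f)) q" using m regular_at_complex_algebra_hauptmodul[OF b(1) qu] regular_at_mult[OF qu] True by blast
      thus ?thesis by (simp add: mult_ac)
    next
      case False
      have "regular_at (U ^ m * (b * f)) q" using b(3)[of q] q False regular_at_complex_algebra_hauptmodul[OF U qu] regular_at_mult[OF qu] by blast
      thus ?thesis by (simp add: mult_ac)
    qed
  qed
qed

text \<open>Poles do not accumulate inside the half plane, so a compact set contains only finitely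
  many.\<close>

lemma remove_poles_compact:
  assumes "compact K" "K \<subseteq> uhp"
  shows "\<exists>b\<in>complex_algebra {hauptmodul}. b \<noteq> 0 \<and> (\<forall>p\<in>K. regular_at (b * f) p)"
proof -
  define P where "P = K \<inter> {z. \<not> regular_at f z}"
  have "finite P" unfolding P_def
  proof (rule finite_not_islimpt_in_compact[OF assms(1)])
    fix z assume "z \<in> K"
    thus "\<not> z islimpt {z. \<not> regular_at f z}"
      using meromorphic_on_imp_not_islimpt_singularities[OF meromorphic_eval_mero, of z f] assms(2) by (auto simp: regular_at_def)
  qed
  moreover have "P \<subseteq> uhp" using assms(2) by (auto simp: P_def)
  ultimately obtain b where b: "b \<in> complex_algebra {hauptmodul}" "b \<noteq> 0" "\<And>p. p \<in> P \<Longrightarrow> regular_at (b * f) p"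
    using remove_poles_finite[of P f] by blast
  have "regular_at (b * f) p" if p: "p \<in> K" for p
  proof (cases "p \<in> P")
    case False
    hence "regular_at f p" using p by (simp add: P_def)
    thus ?thesis using regular_at_mult[of p b f] regular_at_complex_algebra_hauptmodul[OF b(1), of p] p assms(2) by blast
  qed (rule b(3))
  thus ?thesis using b by blast
qed


lemma complex_algebra_hauptmodul_bounded:
  assumes "a \<in> complex_algebra {hauptmodul}" "(p, q, c, d) \<in> SL2Z" "\<not> 3 dvd c"
  shows "\<exists>C\<ge>0. \<forall>t. Im t \<ge> 1 / 2 \<longrightarrow> norm (eval_mero a (moeb (p, q, c, d) t)) \<le> C"
  using assms(1)
proof (induction rule: complex_algebra.induct)
  case (const x)
  show ?case by (rule exI[of _ "norm x"]) (auto simp: eval_mconst moeb_uhp[OF assms(2) half_uhp])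
next
  case (gen s)
  obtain C where C: "\<And>t. Im t \<ge> 1 / 2 \<Longrightarrow> norm (W_fun (moeb (p, q, c, d) t)) \<le> C"
    using W_fun_bounded[OF assms(2,3)] by metis
  have "C \<ge> 0" using C[of "\<i>"] norm_ge_zero order_trans by (metis div_by_1 half_bounded_equal imaginary_unit.sel(2) le_numeral_extra(4) linorder_linear numeral_le_one_iff zero_neq_one field_sum_of_halves less_eq_real_def zero_less_one add_less_same_cancel1)
  moreover have "norm (eval_mero s (moeb (p, q, c, d) t)) \<le> C ^ 3" if "Im t \<ge> 1 / 2" for t
    using gen C[OF that] by (simp add: eval_hauptmodul moeb_uhp[OF assms(2) half_uhp[OF that]] norm_power power_mono)
  ultimately show ?case by (intro exI[of _ "C ^ 3"]) auto
next
  case (add a b)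
  then obtain C1 C2 where "C1 \<ge> 0" "C2 \<ge> 0"
    "\<And>t. Im t \<ge> 1 / 2 \<Longrightarrow> norm (eval_mero a (moeb (p, q, c, d) t)) \<le> C1"
    "\<And>t. Im t \<ge> 1 / 2 \<Longrightarrow> norm (eval_mero b (moeb (p, q, c, d) t)) \<le> C2" by blast
  moreover have "norm (eval_mero (a + b) (moeb (p, q, c, d) t)) \<le> norm (eval_mero a (moeb (p, q, c, d) t)) + norm (eval_mero b (moeb (p, q, c, d) t))" if "Im t \<ge> 1 / 2" for t
    using moeb_uhp[OF assms(2) half_uhp[OF that]] add regular_at_complex_algebra_hauptmodul by (simp add: regular_at_add norm_triangle_ineq)
  ultimately show ?case by (intro exI[of _ "C1 + C2"]) (fastforce intro: order_trans add_mono)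
next
  case (mult a b)
  then obtain C1 C2 where C: "C1 \<ge> 0" "C2 \<ge> 0"
    "\<And>t. Im t \<ge> 1 / 2 \<Longrightarrow> norm (eval_mero a (moeb (p, q, c, d) t)) \<le> C1"
    "\<And>t. Im t \<ge> 1 / 2 \<Longrightarrow> norm (eval_mero b (moeb (p, q, c, d) t)) \<le> C2" by blast
  moreover have "norm (eval_mero (a * b) (moeb (p, q, c, d) t)) \<le> C1 * C2" if "Im t \<ge> 1 / 2" for t
    using moeb_uhp[OF assms(2) half_uhp[OF that]] mult regular_at_complex_algebra_hauptmodul C(1) C(3,4)[OF that]
    by (simp add: regular_at_mult norm_mult mult_mono)
  ultimately show ?case by (intro exI[of _ "C1 * C2"]) auto
qed

text \<open>At a cusp not equivalent to infinity the hauptmodul is finite, and subtracting its value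
  leaves a function divisible by the local parameter ee(t/3). Powers of it do at such cusps what
  \<open>remove_pole\<close> does at interior points.\<close>

lemma bounded_vanishing_factor:
  assumes M: "(a, b, c, d) \<in> SL2Z" and c: "\<not> 3 dvd c"
  obtains v C where "C \<ge> 0"
    "\<And>t. Im t \<ge> 1 / 2 \<Longrightarrow> norm (eval_mero (hauptmodul - mconst v) (moeb (a, b, c, d) t)) \<le> C * exp (- (2 * pi / 3 * Im t))"
proof -
  let ?M = "(a, b, c, d)"
  define h where "h = (\<lambda>t. eval_mero (pullback ?M hauptmodul) t)"
  have regular_at: "regular_at (pullback ?M hauptmodul) t" if "t \<in> uhp" for t
    by (rule pullback_regular_at[OF SL2Z_pos_det[OF M] that]) (rule regular_at_hauptmodul[OF moeb_uhp[OF M that]])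
  have h: "h t = W_fun (moeb ?M t) ^ 3" if "t \<in> uhp" for t
    using that by (simp add: h_def eval_pullback[OF SL2Z_pos_det[OF M]] eval_hauptmodul moeb_uhp[OF M])
  have hol: "h holomorphic_on {t. Im t > 0}"
    using regular_at by (auto simp: h_def regular_at_def uhp_def[symmetric] analytic_on_open[symmetric] analytic_on_analytic_at[of _ uhp])
  obtain C where C: "\<And>t. Im t \<ge> 1 / 2 \<Longrightarrow> norm (W_fun (moeb ?M t)) \<le> C" using W_fun_bounded[OF M c] by metis
  obtain G where G: "G \<in> Gamma_3" "mat_mul ?M (1, 3, 0, 1) = mat_mul G ?M" using Gamma_3_conj_T[OF M] .
  have T3: "(1, 3, 0, 1) \<in> SL2Z" by (simp add: SL2Z_def)
  have "pullback (1, 3, 0, 1) (pullback ?M hauptmodul) = pullback ?M hauptmodul"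
    unfolding pullback_mat_mul[OF M T3] G(2) pullback_mat_mul[OF Gamma_3_SL2Z[OF G(1)] M, symmetric] hauptmodul_Gamma_3[OF G(1)] ..
  hence per: "h (t + of_nat 3) = h t" if "Im t > 0" for t
    using eval_pullback[OF SL2Z_pos_det[OF T3], of t "pullback ?M hauptmodul"] that by (simp add: h_def moeb_T uhp_def)
  have bd: "norm (h t) \<le> C ^ 3" if "Im t > 1 / 2" for t
    using C[of t] that h[OF half_uhp, of t] by (simp add: norm_power power_mono)
  obtain \<phi> where "\<phi> holomorphic_on ball 0 (exp (- 2 * pi * 0 / real 3))"
      "\<And>t. Im t > 0 \<Longrightarrow> h t = \<phi> (ee (t / of_nat 3))"
    using periodic_extension[OF _ hol per bd] by (metis zero_less_numeral of_nat_numeral)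
  hence \<phi>: "\<phi> holomorphic_on ball 0 1" "\<And>t. t \<in> uhp \<Longrightarrow> h t = \<phi> (ee (t / 3))"
    by (simp_all add: uhp_def)
  have "(\<lambda>X. \<phi> X - \<phi> 0) holomorphic_on ball 0 1" by (intro holomorphic_intros \<phi>(1))
  then obtain g where g: "g holomorphic_on ball 0 1" "\<And>X. X \<in> ball 0 1 \<Longrightarrow> \<phi> X - \<phi> 0 = X * g X"
    using zero_factor[of "\<lambda>X. \<phi> X - \<phi> 0"] by auto
  obtain D where D: "\<And>t. Im t \<ge> 1 / 2 \<Longrightarrow> norm (g (ee (t / 3))) \<le> D" using ball_upper_bound[OF g(1)] by metis
  show ?thesis
  proof (rule that[of "\<bar>D\<bar>" "\<phi> 0"])
    fix t :: complex assume t: "Im t \<ge> 1 / 2"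
    have u: "t \<in> uhp" "moeb ?M t \<in> uhp" using half_uhp[OF t] moeb_uhp[OF M] by auto
    have "eval_mero (hauptmodul - mconst (\<phi> 0)) (moeb ?M t) = W_fun (moeb ?M t) ^ 3 - \<phi> 0"
      using u(2) regular_at_add[of "moeb ?M t" hauptmodul "- mconst (\<phi> 0)"] by (simp add: regular_at_hauptmodul regular_at_minus regular_at_mconst eval_hauptmodul eval_mconst)
    also have "\<dots> = ee (t / 3) * g (ee (t / 3))"
      using h[OF u(1)] \<phi>(2)[OF u(1)] g(2)[of "ee (t / 3)"] ee_third_in_ball[OF u(1)] by simp
    finally have "norm (eval_mero (hauptmodul - mconst (\<phi> 0)) (moeb ?M t)) = exp (- (2 * pi / 3 * Im t)) * norm (g (ee (t / 3)))"
      by (simp only: norm_mult norm_third)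
    also have "\<dots> \<le> exp (- (2 * pi / 3 * Im t)) * \<bar>D\<bar>" using D[OF t] by (intro mult_left_mono) auto
    finally show "norm (eval_mero (hauptmodul - mconst (\<phi> 0)) (moeb ?M t)) \<le> \<bar>D\<bar> * exp (- (2 * pi / 3 * Im t))"
      by (simp only: mult.commute)
  qed simp
qed

lemma Gamma_3_mat_mul_lower:
  assumes "(a, b, c, d) \<in> Gamma_3" "mat_mul (a, b, c, d) (a', b', c', d') = (p, q, r, s)" "\<not> 3 dvd r"
  shows "\<not> 3 dvd c'"
  using assms by (auto simp: Gamma_3_def)

lemma translate_to_strip:
  assumes t: "t \<in> uhp"
  obtains M where "M \<in> SL2Z" "Im (moeb M t) \<ge> 1 / 2" "\<bar>Re (moeb M t)\<bar> \<le> 2"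
proof -
  obtain M where M: "M \<in> SL2Z" "Im (moeb M t) \<ge> 1 / 2" using fundamental_domain[OF t] .
  define n where "n = round (Re (moeb M t))"
  have T: "(1, - n, 0, 1) \<in> SL2Z" by (simp add: SL2Z_def)
  have "moeb (mat_mul (1, - n, 0, 1) M) t = moeb M t - of_int n"
    unfolding moeb_mat_mul[OF M(1) t] by (simp add: moeb_T)
  moreover have "\<bar>Re (moeb M t) - of_int n\<bar> \<le> 1 / 2"
    using of_int_round_abs_le[of "Re (moeb M t)"] by (simp add: n_def abs_minus_commute)
  ultimately show ?thesis using that[OF mat_mul_SL2Z[OF T M(1)]] M(2) by simp
qed

text \<open>Above some height R every f o N is regular, N running over the coset representatives.
  The part of the strip below R is a compact rectangle, and its finitely many translates meet every
  Gamma(3)-orbit of poles.\<close>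

lemma clear_poles:
  assumes inv: "\<And>M. M \<in> Gamma_3 \<Longrightarrow> pullback M f = f" and grow: "exp_growth_cusps f"
  obtains b where "b \<in> complex_algebra {hauptmodul}" "b \<noteq> 0" "\<And>t. t \<in> uhp \<Longrightarrow> regular_at (b * f) t"
proof -
  obtain Rep where Rep: "finite Rep" "Rep \<subseteq> SL2Z"
    "\<And>M. M \<in> SL2Z \<Longrightarrow> \<exists>N\<in>Rep. \<exists>G\<in>Gamma_3. M = mat_mul G N" using finite_representatives by metis
  have "\<exists>R. \<forall>t. Im t > R \<longrightarrow> regular_at (pullback N f) t" if "N \<in> Rep" for N
    using grow Rep(2) that unfolding exp_growth_cusps_def exp_growth_def by blast
  then obtain Rf where Rf: "\<And>N t. N \<in> Rep \<Longrightarrow> Im t > Rf N \<Longrightarrow> regular_at (pullback N f) t" by metis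
  define R where "R = Max (insert 1 (Rf ` Rep))"
  have R: "Rf N \<le> R" if "N \<in> Rep" for N unfolding R_def using Rep(1) that by (intro Max_ge) auto
  define K where "K = cbox (Complex (- 2) (1 / 2)) (Complex 2 R)"
  have K: "t \<in> K \<longleftrightarrow> \<bar>Re t\<bar> \<le> 2 \<and> 1 / 2 \<le> Im t \<and> Im t \<le> R" for t
    by (auto simp: K_def in_cbox_complex_iff)
  have Ku: "K \<subseteq> uhp" using half_uhp K by blast
  define K' where "K' = (\<Union>N\<in>Rep. moeb N ` K)"
  have "compact (moeb N ` K)" if "N \<in> Rep" for N
  proof -
    obtain a b c d where N: "N = (a, b, c, d)" by (cases N)
    have "moeb N holomorphic_on uhp"
      using that Rep(2) by (auto simp: N SL2Z_def intro!: analytic_imp_holomorphic moeb_analytic)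
    hence "continuous_on K (moeb N)"
      by (rule holomorphic_on_imp_continuous_on[OF holomorphic_on_subset]) (rule Ku)
    thus ?thesis by (rule compact_continuous_image) (simp add: K_def)
  qed
  hence "compact K'" unfolding K'_def using Rep(1) by (intro compact_UN)
  moreover have "K' \<subseteq> uhp" using Ku Rep(2) moeb_uhp unfolding K'_def by blast
  ultimately obtain b where b: "b \<in> complex_algebra {hauptmodul}" "b \<noteq> 0" "\<And>p. p \<in> K' \<Longrightarrow> regular_at (b * f) p"
    using remove_poles_compact[of K' f] by blast
  show ?thesis
  proof (rule that[OF b(1,2)])
    fix t assume t: "t \<in> uhp"
    obtain M where M: "M \<in> SL2Z" "Im (moeb M t) \<ge> 1 / 2" "\<bar>Re (moeb M t)\<bar> \<le> 2"
      using translate_to_strip[OF t] .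
    define s where "s = moeb M t"
    have s: "s \<in> uhp" unfolding s_def by (rule moeb_uhp[OF M(1) t])
    obtain N G where NG: "N \<in> Rep" "G \<in> Gamma_3" "mat_inv M = mat_mul G N" using Rep(3)[OF mat_inv_SL2Z[OF M(1)]] by blast
    have N: "N \<in> SL2Z" using NG(1) Rep(2) by blast
    have "pullback G (b * f) = b * f"
      using inv[OF NG(2)] inv_complex_algebra[OF b(1) SL2Z_pos_det[OF Gamma_3_SL2Z[OF NG(2)]]] hauptmodul_Gamma_3[OF NG(2)]
      by (simp add: pullback_mult SL2Z_pos_det Gamma_3_SL2Z NG(2))
    hence e: "pullback (mat_inv M) (b * f) = pullback N (b * f)"
      unfolding NG(3) pullback_mat_mul[OF Gamma_3_SL2Z[OF NG(2)] N, symmetric] by simp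
    have "regular_at (pullback N (b * f)) s"
    proof (cases "Im s \<le> R")
      case True
      hence "moeb N s \<in> K'" using M(2,3) NG(1) K by (auto simp: K'_def s_def)
      thus ?thesis using b(3) pullback_regular_at[OF SL2Z_pos_det[OF N] s] by blast
    next
      case False
      hence "regular_at (pullback N f) s" using Rf[OF NG(1), of s] R[OF NG(1)] by simp
      moreover have "regular_at (pullback N b) s"
        by (rule pullback_regular_at[OF SL2Z_pos_det[OF N] s]) (rule regular_at_complex_algebra_hauptmodul[OF b(1) moeb_uhp[OF N s]])
      ultimately show ?thesis using regular_at_mult[OF s] by (simp add: pullback_mult SL2Z_pos_det N)
    qed
    hence "regular_at (pullback (mat_inv M) (b * f)) s" unfolding e .
    hence "regular_at (b * f) (moeb (mat_inv M) s)"
      using pullback_regular_at_iff[OF mat_inv_SL2Z[OF M(1)] s] by blast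
    thus "regular_at (b * f) t" by (simp add: s_def moeb_mat_inv[OF M(1) t])
  qed
qed

text \<open>One vanishing factor is taken for each representative of a cusp not equivalent to
  infinity. At such a cusp its own factor beats the growth of f while the others stay bounded. The
  cusps equivalent to infinity are left alone, since a pole there is allowed in
  \<open>Gamma_3_polynomial\<close>.\<close>

lemma clear_cusps:
  assumes inv: "\<And>M. M \<in> Gamma_3 \<Longrightarrow> pullback M f = f" and grow: "exp_growth_cusps f" and regular_at: "\<And>t. t \<in> uhp \<Longrightarrow> regular_at f t"
  obtains e where "e \<in> complex_algebra {hauptmodul}" "e \<noteq> 0"
    "\<And>a b c d. (a, b, c, d) \<in> SL2Z \<Longrightarrow> \<not> 3 dvd c \<Longrightarrow>
       \<exists>C R. \<forall>t. Im t > R \<longrightarrow> norm (eval_mero (e * f) (moeb (a, b, c, d) t)) \<le> C"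
proof -
  obtain Rep where Rep: "finite Rep" "Rep \<subseteq> SL2Z"
    "\<And>M. M \<in> SL2Z \<Longrightarrow> \<exists>N\<in>Rep. \<exists>G\<in>Gamma_3. M = mat_mul G N" using finite_representatives by metis
  define lower :: "mat2 \<Rightarrow> int" where "lower = (\<lambda>(a, b, c, d). c)"
  define Rep' where "Rep' = {N \<in> Rep. \<not> 3 dvd lower N}"
  have fin: "finite Rep'" using Rep(1) by (simp add: Rep'_def)
  have ex: "\<exists>v m. \<exists>C R. \<forall>t. Im t > R \<longrightarrow> norm (eval_mero ((hauptmodul - mconst v) ^ m * f) (moeb N t)) \<le> C" if "N \<in> Rep'" for N
  proof -
    obtain a b c d where Ne: "N = (a, b, c, d)" by (cases N)
    have N: "N \<in> SL2Z" "\<not> 3 dvd c" using that Rep(2) by (auto simp: Rep'_def Ne lower_def)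
    obtain v C where C: "C \<ge> 0"
      "\<And>t. Im t \<ge> 1 / 2 \<Longrightarrow> norm (eval_mero (hauptmodul - mconst v) (moeb N t)) \<le> C * exp (- (2 * pi / 3 * Im t))"
      using bounded_vanishing_factor[OF _ N(2)] N(1) unfolding Ne by metis
    obtain R D k where D: "R \<ge> 1" "D \<ge> 0" "k \<ge> 0"
      "\<And>t. Im t > R \<Longrightarrow> regular_at (pullback N f) t \<and> norm (eval_mero (pullback N f) t) \<le> D * exp (k * Im t)"
      using grow N(1) exp_growth_normal unfolding exp_growth_cusps_def by metis
    \<comment> \<open>Each factor decays like exp(-2 pi/3 Im t) and 2 pi/3 > 1, so k rounded up is a
      sufficient exponent.\<close>
    define m where "m = nat \<lceil>k\<rceil>"
    have m: "k \<le> of_nat m" unfolding m_def by linarith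
    have "norm (eval_mero ((hauptmodul - mconst v) ^ m * f) (moeb N t)) \<le> C ^ m * D" if t: "Im t > R" for t
    proof -
      have u: "t \<in> uhp" "moeb N t \<in> uhp" using t D(1) moeb_uhp[OF N(1)] by (auto simp: uhp_def)
      have anU: "regular_at (hauptmodul - mconst v) (moeb N t)" using regular_at_hauptmodul_diff[OF u(2), of v 1] by simp
      have "norm (eval_mero ((hauptmodul - mconst v) ^ m * f) (moeb N t)) =
          norm (eval_mero (hauptmodul - mconst v) (moeb N t)) ^ m * norm (eval_mero (pullback N f) t)"
        using regular_at_mult[OF u(2) regular_at_hauptmodul_diff[OF u(2)] regular_at[OF u(2)], of v m] regular_at_power[OF u(2) anU, of m]
        by (simp add: norm_mult norm_power eval_pullback SL2Z_pos_det N(1) u(1))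
      also have "\<dots> \<le> (C * exp (- (2 * pi / 3 * Im t))) ^ m * (D * exp (k * Im t))"
        using C(1) C(2)[of t] D(4)[OF t] t D(1) by (intro mult_mono power_mono) auto
      also have "\<dots> = (C ^ m * D) * exp (k * Im t - of_nat m * (2 * pi / 3) * Im t)"
      proof -
        have E: "exp (- (2 * pi / 3 * Im t)) ^ m = exp (- (of_nat m * (2 * pi / 3) * Im t))"
          by (simp only: exp_of_nat_mult[symmetric]) (simp add: algebra_simps)
        show ?thesis unfolding power_mult_distrib E
          by (simp only: diff_conv_add_uminus exp_add mult_ac)
      qed
      also have "\<dots> \<le> (C ^ m * D) * 1"
      proof (rule mult_left_mono)
        have "of_nat m * 1 \<le> of_nat m * (2 * pi / 3)" using pi_gt3 by (intro mult_left_mono) auto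
        hence "k * Im t \<le> of_nat m * (2 * pi / 3) * Im t" using m u(1) by (intro mult_right_mono) (auto simp: uhp_def)
        thus "exp (k * Im t - of_nat m * (2 * pi / 3) * Im t) \<le> 1" by simp
        show "0 \<le> C ^ m * D" using C(1) D(2) by simp
      qed
      finally show ?thesis by simp
    qed
    thus ?thesis by blast
  qed
  then obtain v m where vm: "\<And>N. N \<in> Rep' \<Longrightarrow> \<exists>C R. \<forall>t. Im t > R \<longrightarrow> norm (eval_mero ((hauptmodul - mconst (v N)) ^ (m N) * f) (moeb N t)) \<le> C"
    by metis
  define U where "U = (\<lambda>N. (hauptmodul - mconst (v N)) ^ (m N))"
  have U: "U N \<in> complex_algebra {hauptmodul}" for N unfolding U_def by (intro complex_algebra_power complex_algebra_diff complex_algebra.gen complex_algebra.const) simp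
  define e where "e = (\<Prod>N\<in>Rep'. U N)"
  show ?thesis
  proof (rule that)
    show ecr: "e \<in> complex_algebra {hauptmodul}" unfolding e_def by (intro complex_algebra_prod U)
    show "e \<noteq> 0" unfolding e_def using fin hauptmodul_not_const by (simp add: prod_zero_iff U_def)
    fix a b c d assume M: "(a, b, c, d) \<in> SL2Z" and c: "\<not> 3 dvd c"
    obtain N G where NG: "N \<in> Rep" "G \<in> Gamma_3" "(a, b, c, d) = mat_mul G N" using Rep(3)[OF M] by blast
    obtain p q r s where Ne: "N = (p, q, r, s)" by (cases N)
    obtain g1 g2 g3 g4 where Ge: "G = (g1, g2, g3, g4)" by (cases G)
    have r: "\<not> 3 dvd r"
      using Gamma_3_mat_mul_lower[of g1 g2 g3 g4 p q r s a b c d] NG(2) NG(3)[symmetric] c unfolding Ge Ne by blast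
    have N': "N \<in> Rep'" using NG(1) r by (simp add: Rep'_def lower_def Ne)
    have N: "N \<in> SL2Z" using NG(1) Rep(2) by blast
    obtain C R where C: "\<And>t. Im t > R \<Longrightarrow> norm (eval_mero (U N * f) (moeb N t)) \<le> C" using vm[OF N'] unfolding U_def by blast
    define e' where "e' = (\<Prod>N\<in>Rep' - {N}. U N)"
    have e': "e' \<in> complex_algebra {hauptmodul}" unfolding e'_def by (intro complex_algebra_prod U)
    have ee': "e = e' * U N" unfolding e_def e'_def using prod.remove[OF fin N', of U] by (simp add: mult.commute)
    obtain D where D: "D \<ge> 0" "\<And>t. Im t \<ge> 1 / 2 \<Longrightarrow> norm (eval_mero e' (moeb N t)) \<le> D"
      using complex_algebra_hauptmodul_bounded[OF e' N[unfolded Ne] r] unfolding Ne by blast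
    have inve: "pullback G (e * f) = e * f"
      using inv[OF NG(2)] inv_complex_algebra[OF ecr SL2Z_pos_det[OF Gamma_3_SL2Z[OF NG(2)]]] hauptmodul_Gamma_3[OF NG(2)]
      by (simp add: pullback_mult SL2Z_pos_det Gamma_3_SL2Z NG(2))
    have "norm (eval_mero (e * f) (moeb (a, b, c, d) t)) \<le> D * C" if t: "Im t > max 1 R" for t
    proof -
      have u: "t \<in> uhp" "moeb N t \<in> uhp" using t moeb_uhp[OF N] by (auto simp: uhp_def)
      have "eval_mero (e * f) (moeb (a, b, c, d) t) = eval_mero (e * f) (moeb G (moeb N t))"
        unfolding NG(3) moeb_mat_mul[OF N u(1)] ..
      also have "\<dots> = eval_mero (e * f) (moeb N t)"
        using eval_pullback[OF SL2Z_pos_det[OF Gamma_3_SL2Z[OF NG(2)]] u(2), of "e * f"] by (simp add: inve)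
      also have "\<dots> = eval_mero e' (moeb N t) * eval_mero (U N * f) (moeb N t)"
        unfolding ee' mult.assoc using regular_at_mult[OF u(2) regular_at_complex_algebra_hauptmodul[OF e' u(2)]] regular_at_mult[OF u(2) regular_at_complex_algebra_hauptmodul[OF U u(2)] regular_at[OF u(2)]]
        by blast
      also have "norm \<dots> \<le> D * C"
        unfolding norm_mult using D(1) D(2)[of t] C[of t] t by (intro mult_mono) auto
      finally show ?thesis .
    qed
    thus "\<exists>C R. \<forall>t. Im t > R \<longrightarrow> norm (eval_mero (e * f) (moeb (a, b, c, d) t)) \<le> C" by blast
  qed
qed

text \<open>After multiplication by two polynomials in the hauptmodul, f is regular in the half
  plane and bounded at the cusps not equivalent to infinity, hence itself such a polynomial.\<close>

theorem Gamma_3_field: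
  assumes inv: "\<And>M. M \<in> Gamma_3 \<Longrightarrow> pullback M f = f" and grow: "exp_growth_cusps f"
  shows "f \<in> complex_field {hauptmodul}"
proof -
  have inv_mult: "pullback M (b * h) = b * h"
    if "b \<in> complex_algebra {hauptmodul}" "M \<in> Gamma_3" "pullback M h = h" for b h M
    using that inv_complex_algebra[OF that(1) SL2Z_pos_det[OF Gamma_3_SL2Z[OF that(2)]]] hauptmodul_Gamma_3[OF that(2)]
    by (simp add: pullback_mult SL2Z_pos_det Gamma_3_SL2Z)
  obtain b where b: "b \<in> complex_algebra {hauptmodul}" "b \<noteq> 0" "\<And>t. t \<in> uhp \<Longrightarrow> regular_at (b * f) t"
    using clear_poles[OF inv grow] by metis
  have Mb: "exp_growth_cusps (b * f)" using exp_growth_cusps_mult[OF exp_growth_cusps_complex_algebra[OF b(1)] grow] exp_growth_cusps_hauptmodul by auto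
  obtain e where e: "e \<in> complex_algebra {hauptmodul}" "e \<noteq> 0"
    "\<And>a' b' c d. (a', b', c, d) \<in> SL2Z \<Longrightarrow> \<not> 3 dvd c \<Longrightarrow>
       \<exists>C R. \<forall>t. Im t > R \<longrightarrow> norm (eval_mero (e * (b * f)) (moeb (a', b', c, d) t)) \<le> C"
    using clear_cusps[of "b * f"] inv_mult[OF b(1) _ inv] Mb b(3) by metis
  define h where "h = e * (b * f)"
  have anh: "regular_at h t" if "t \<in> uhp" for t
    unfolding h_def using regular_at_mult[OF that regular_at_complex_algebra_hauptmodul[OF e(1) that] b(3)[OF that]] by blast
  have "exp_growth_cusps h" unfolding h_def using exp_growth_cusps_mult[OF exp_growth_cusps_complex_algebra[OF e(1)] Mb] exp_growth_cusps_hauptmodul by auto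
  moreover have I: "(1, 0, 0, 1) \<in> SL2Z" by (simp add: SL2Z_def)
  moreover have "pullback (1, 0, 0, 1) h = h" by (rule eval_mero_eqI) (simp add: eval_pullback)
  ultimately have "exp_growth h" unfolding exp_growth_cusps_def by metis
  then obtain R C k where C: "R \<ge> 1" "C \<ge> 0" "k \<ge> 0"
    "\<And>t. Im t > R \<Longrightarrow> regular_at h t \<and> norm (eval_mero h t) \<le> C * exp (k * Im t)" using exp_growth_normal by metis
  define n where "n = nat \<lceil>k\<rceil>"
  have "\<exists>a\<in>complex_algebra {hauptmodul}. \<forall>t\<in>uhp. eval_mero a t = eval_mero h t"
  proof (rule Gamma_3_polynomial)
    show "eval_mero h holomorphic_on uhp"
      using anh analytic_on_analytic_at[of "eval_mero h" uhp] by (auto simp: regular_at_def analytic_imp_holomorphic)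
    show "eval_mero h (moeb M t) = eval_mero h t" if "M \<in> Gamma_3" "t \<in> uhp" for M t
      using eval_pullback[OF SL2Z_pos_det[OF Gamma_3_SL2Z[OF that(1)]] that(2), of h]
        inv_mult[OF e(1) that(1) inv_mult[OF b(1) that(1) inv[OF that(1)]]] by (simp add: h_def)
    show "\<exists>C R. \<forall>t. Im t > R \<longrightarrow> norm (eval_mero h (moeb (a', b', c, d) t)) \<le> C"
      if "(a', b', c, d) \<in> SL2Z" "\<not> 3 dvd c" for a' b' c d
      using e(3)[OF that] by (simp add: h_def)
    fix t :: complex assume t: "Im t > R"
    have "k \<le> 1 * of_nat n" unfolding n_def by linarith
    also have "\<dots> \<le> 2 * pi / 3 * of_nat n" using pi_gt3 by (intro mult_right_mono) auto
    finally have "exp (k * Im t) \<le> exp (2 * pi / 3 * of_nat n * Im t)" using t C(1) by (simp add: mult_right_mono)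
    hence "C * exp (k * Im t) \<le> C * exp (2 * pi / 3 * of_nat n * Im t)" using C(2) by (rule mult_left_mono)
    thus "norm (eval_mero h t) \<le> C * exp (2 * pi / 3 * of_nat n * Im t)" using C(4)[OF t] by linarith
  qed
  then obtain a where a: "a \<in> complex_algebra {hauptmodul}" "\<And>t. t \<in> uhp \<Longrightarrow> eval_mero a t = eval_mero h t" by blast
  have "a = h" by (rule eval_mero_eqI) (rule a(2))
  hence "(e * b) * f = a" by (simp add: h_def mult.assoc)
  thus ?thesis by (rule complex_fieldI) (use a e b in \<open>auto intro: complex_algebra.mult\<close>)
qed

section \<open>Adjoining the cube roots\<close>

definition Gamma_9_9 :: "mat2 set" where
  "Gamma_9_9 = {(a, b, c, d). (a, b, c, d) \<in> SL2Z \<and> 9 dvd b \<and> 9 dvd c}"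

lemma Gamma_9_9_SL2Z: "M \<in> Gamma_9_9 \<Longrightarrow> M \<in> SL2Z" by (auto simp: Gamma_9_9_def)

lemma pullback_neg: "pullback (- a, - b, - c, - d) f = pullback (a, b, c, d) f"
proof -
  have "moeb (- a, - b, - c, - d) = moeb (a, b, c, d)"
  proof
    fix z
    have 1: "of_int (- a) * z + of_int (- b) = - (of_int a * z + (of_int b :: complex))"
      "of_int (- c) * z + of_int (- d) = - (of_int c * z + (of_int d :: complex))"
      by simp_all
    show "moeb (- a, - b, - c, - d) z = moeb (a, b, c, d) z"
      by (simp only: moeb_def moebius_def prod.case 1 minus_divide_divide)
  qed
  thus ?thesis by (simp add: pullback_def)
qed

text \<open>From a d = 1 modulo 3 either a or -a is 1 modulo 3, and a change of all signs does not
  affect pullbacks. The second factor 3 in b and c makes the multipliers of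
  \<open>W_mero_Gamma_3\<close> trivial.\<close>

lemma W_mero_F_mero_Gamma_9_9:
  assumes "M \<in> Gamma_9_9"
  shows "pullback M W_mero = W_mero" "pullback M F_mero = F_mero"
proof -
  obtain a b c d where M: "M = (a, b, c, d)" by (cases M)
  have S: "(a, b, c, d) \<in> SL2Z" and "9 dvd b" "9 dvd c" using assms by (auto simp: Gamma_9_9_def M)
  obtain b' c' where bc: "b = 9 * b'" "c = 9 * c'"
    using \<open>9 dvd b\<close> \<open>9 dvd c\<close> by (auto elim!: dvdE)
  have det: "a * d - b * c = 1" using S by (simp add: SL2Z_def)
  have *: "pullback (a, b, c, d) W_mero = W_mero \<and> pullback (a, b, c, d) F_mero = F_mero"
    if S: "(a, b, c, d) \<in> SL2Z" and bc: "b = 9 * b'" "c = 9 * c'" and a: "3 dvd a - 1" for a b c d b' c'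
  proof -
    have det: "a * d - b * c = 1" using S by (simp add: SL2Z_def)
    obtain m where m: "a - 1 = 3 * m" using a by auto
    hence m': "a = 1 + 3 * m" by simp
    have "d = 1 + 3 * (3 * (9 * b' * c') - m * d)" using det unfolding m' bc by (simp add: algebra_simps)
    then obtain n where n: "d = 1 + 3 * n" by blast
    have e: "(a, b, c, d) = (1 + 3 * m, 3 * (3 * b'), 3 * (3 * c'), 1 + 3 * n)" by (simp add: m' n bc)
    have "omega powi (- (3 * b') - 3 * c') = omega powi 0" "omega powi (3 * b') = omega powi 0"
      by (rule omega_powi_cong; simp)+
    thus ?thesis using W_mero_Gamma_3[of m "3 * b'" "3 * c'" n] S unfolding e by simp
  qed
  have "3 dvd a - 1 \<or> 3 dvd - a - 1"
  proof -
    have "\<not> 3 dvd a"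
    proof
      assume "3 dvd a"
      then obtain k where "a = 3 * k" by auto
      hence "3 * (k * d - 27 * b' * c') = 1" using det unfolding bc by (simp add: algebra_simps)
      thus False by presburger
    qed
    thus ?thesis by presburger
  qed
  thus "pullback M W_mero = W_mero" "pullback M F_mero = F_mero"
    using *[OF S bc] *[of "- a" "- b" "- c" "- d" "- b'" "- c'"] S bc unfolding M
    by (auto simp: pullback_neg SL2Z_def)
qed

lemma omega_mconst_sum: "1 + mconst (omega powi (- 1)) + mconst (omega powi (- 1)) ^ 2 = 0"
proof -
  have "omega powi (- 1) = omega powi 2" by (rule omega_powi_cong) simp
  hence e: "omega powi (- 1) = omega ^ 2" by (simp add: power_int_def)
  have "1 + omega ^ 2 + (omega ^ 2) ^ 2 = 0" using omega_sum by algebra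
  hence "mconst (1 + omega ^ 2 + (omega ^ 2) ^ 2) = mconst 0" by (rule arg_cong)
  thus ?thesis unfolding e by (simp only: mconst_add mconst_power mconst_0 mconst_1)
qed

text \<open>Projection to the eigenspaces of an automorphism of order three.\<close>

lemma eigen_decomposition:
  fixes P :: "mero_uhp \<Rightarrow> mero_uhp"
  assumes V: "V \<noteq> 0" "P V = z * V" "1 + z + z ^ 2 = 0"
    and P: "\<And>f g. P (f + g) = P f + P g" "\<And>f g. P (f * g) = P f * P g" "P z = z" and f: "P (P (P f)) = f"
    and h: "\<And>j. h j = f * V ^ j + P (f * V ^ j) + P (P (f * V ^ j))"
  shows "P (h j) = h j" "3 * f = h 0 + h 1 / V + h 2 / V ^ 2"
proof -
  have z3: "z ^ 3 = 1"
  proof -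
    have "z ^ 3 - 1 = (z - 1) * (1 + z + z ^ 2)" by algebra
    thus ?thesis using V(3) by simp
  qed
  have P1: "P 1 = 1"
  proof -
    have "P V * P 1 = P V * 1" using P(2)[of V 1] by simp
    moreover have "P V \<noteq> 0" using V z3 by auto
    ultimately show ?thesis by simp
  qed
  have Pp: "P (f ^ n) = P f ^ n" for f n by (induction n) (auto simp: P P1)
  have PV: "P (V ^ j) = z ^ j * V ^ j" for j by (simp add: Pp V power_mult_distrib)
  have Pz: "P (z ^ j) = z ^ j" for j by (simp add: Pp P)
  have PPP: "P (P (P (f * V ^ j))) = f * V ^ j" for j
  proof -
    have 1: "P (f * V ^ j) = P f * (z ^ j * V ^ j)" by (simp only: P(2) PV)
    have 2: "P (P (f * V ^ j)) = P (P f) * (z ^ j * (z ^ j * V ^ j))" by (simp only: 1 P(2) PV Pz)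
    have "P (P (P (f * V ^ j))) = P (P (P f)) * (z ^ j * (z ^ j * (z ^ j * V ^ j)))" by (simp only: 2 P(2) PV Pz)
    hence "P (P (P (f * V ^ j))) = f * ((z ^ 3) ^ j * V ^ j)"
      unfolding f by (simp add: power3_eq_cube power_mult_distrib mult_ac)
    thus ?thesis by (simp add: z3)
  qed
  show "P (h j) = h j" unfolding h by (simp only: P(1) PPP add_ac)
  \<comment> \<open>The bracket is three times the projection of f to one eigenspace. Adding the
    three brackets gives 3 f because 1 + z + z^2 = 0.\<close>
  have hj: "h j = (f + z ^ j * P f + (z ^ j) ^ 2 * P (P f)) * V ^ j" for j
    unfolding h by (simp add: P PV Pz power2_eq_square algebra_simps)
  have e: "h 0 + h 1 / V + h 2 / V ^ 2 = (f + P f + P (P f)) + (f + z * P f + z ^ 2 * P (P f)) + (f + z ^ 2 * P f + (z ^ 2) ^ 2 * P (P f))"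
    unfolding hj using V(1) by simp
  have "(f + P f + P (P f)) + (f + z * P f + z ^ 2 * P (P f)) + (f + z ^ 2 * P f + (z ^ 2) ^ 2 * P (P f)) = 3 * f"
    using V(3) by algebra
  thus "3 * f = h 0 + h 1 / V + h 2 / V ^ 2" using e by simp
qed

text \<open>Both choices of K normalise the group: conjugation changes the corner entry by 3 (d - a)
  up to sign and multiples of 9, and d is congruent to a modulo 3 because a d is 1 modulo 3.\<close>

lemma Gamma_9_9_conj:
  assumes "M \<in> Gamma_9_9" "K = (1, 3, 0, 1) \<or> K = (1, 0, 3, 1)"
  obtains N where "N \<in> Gamma_9_9" "mat_mul K M = mat_mul N K"
proof -
  obtain a b c d where M: "M = (a, b, c, d)" by (cases M)
  have S: "a * d - b * c = 1" and "9 dvd b" "9 dvd c" using assms(1) by (auto simp: Gamma_9_9_def M SL2Z_def)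
  obtain b' c' where bc: "b = 9 * b'" "c = 9 * c'"
    using \<open>9 dvd b\<close> \<open>9 dvd c\<close> by (auto elim!: dvdE)
  have ad: "3 dvd d - a"
  proof -
    have "a * d = 1 + 3 * (27 * b' * c')" using S by (simp add: bc)
    then obtain y where "a * d = 1 + 3 * y" by blast
    hence "(a * d) mod 3 = 1" by presburger
    hence "((a mod 3) * (d mod 3)) mod 3 = 1" by (simp add: mod_mult_eq)
    moreover have "a mod 3 = 0 \<or> a mod 3 = 1 \<or> a mod 3 = 2" "d mod 3 = 0 \<or> d mod 3 = 1 \<or> d mod 3 = 2" by presburger+
    ultimately have "a mod 3 = d mod 3" by auto
    thus ?thesis by presburger
  qed
  then obtain k where k: "d = a + 3 * k" by (auto elim!: dvdE simp: algebra_simps)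
  from assms(2) show ?thesis
  proof
    assume K: "K = (1, 3, 0, 1)"
    define N where "N = (a + 3 * c, b + 3 * d - 3 * (a + 3 * c), c, d - 3 * c)"
    have e: "b + 3 * d - 3 * (a + 3 * c) = 9 * (b' + k - 9 * c')" by (simp add: bc k)
    have 1: "9 dvd b + 3 * d - 3 * (a + 3 * c)" unfolding e by simp
    have 2: "(a + 3 * c) * (d - 3 * c) - (b + 3 * d - 3 * (a + 3 * c)) * c = 1"
      using S by (simp add: algebra_simps)
    have "N \<in> Gamma_9_9" unfolding N_def Gamma_9_9_def SL2Z_def
      by (simp only: mem_Collect_eq prod.case) (intro conjI 1 2 \<open>9 dvd c\<close>)
    moreover have "mat_mul K M = mat_mul N K" by (simp add: K M N_def)
    ultimately show ?thesis using that by blast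
  next
    assume K: "K = (1, 0, 3, 1)"
    define N where "N = (a - 3 * b, b, c + 3 * a - 3 * (d + 3 * b), d + 3 * b)"
    have e: "c + 3 * a - 3 * (d + 3 * b) = 9 * (c' - k - 9 * b')" by (simp add: bc k)
    have 1: "9 dvd c + 3 * a - 3 * (d + 3 * b)" unfolding e by simp
    have 2: "(a - 3 * b) * (d + 3 * b) - b * (c + 3 * a - 3 * (d + 3 * b)) = 1"
      using S by (simp add: algebra_simps)
    have "N \<in> Gamma_9_9" unfolding N_def Gamma_9_9_def SL2Z_def
      by (simp only: mem_Collect_eq prod.case) (intro conjI 1 2 \<open>9 dvd b\<close>)
    moreover have "mat_mul K M = mat_mul N K" by (simp add: K M N_def)
    ultimately show ?thesis using that by blast
  qed
qed

lemma Gamma_9_9_inv_conj: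
  assumes "\<And>M. M \<in> Gamma_9_9 \<Longrightarrow> pullback M f = f" "K = (1, 3, 0, 1) \<or> K = (1, 0, 3, 1)" "M \<in> Gamma_9_9"
  shows "pullback M (pullback K f) = pullback K f"
proof -
  have K: "K \<in> SL2Z" using assms(2) by (auto simp: SL2Z_def)
  obtain N where N: "N \<in> Gamma_9_9" "mat_mul K M = mat_mul N K" using Gamma_9_9_conj[OF assms(3,2)] .
  have "pullback M (pullback K f) = pullback K (pullback N f)"
    using pullback_mat_mul[OF K Gamma_9_9_SL2Z[OF assms(3)]] pullback_mat_mul[OF Gamma_9_9_SL2Z[OF N(1)] K] N(2) by simp
  thus ?thesis by (simp add: assms(1) N(1))
qed

lemma T3_SL2Z: "(1, 3, 0, 1) \<in> SL2Z" and L3_SL2Z: "(1, 0, 3, 1) \<in> SL2Z"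
  by (simp_all add: SL2Z_def)

lemma pullback_cube:
  assumes "\<And>M. M \<in> Gamma_9_9 \<Longrightarrow> pullback M f = f" "K = (1, 3, 0, 1) \<or> K = (1, 0, 3, 1)"
  shows "pullback K (pullback K (pullback K f)) = f"
proof -
  have K: "K \<in> SL2Z" using assms(2) by (auto simp: SL2Z_def)
  have "mat_mul (mat_mul K K) K \<in> Gamma_9_9" using assms(2) by (auto simp: Gamma_9_9_def SL2Z_def)
  thus ?thesis using assms(1) pullback_mat_mul[OF K K, of f] pullback_mat_mul[OF mat_mul_SL2Z[OF K K] K, of f]
    by simp
qed

text \<open>The commutator of (1, 0, 3, 1) and (1, 3, 0, 1) is (- 8, 27, - 27, 91), an element of
  \<open>Gamma_9_9\<close>. So the two pullbacks commute on invariant functions, and invariance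
  under the second matrix survives averaging over the first.\<close>

lemma Gamma_9_9_T3_L3_inv:
  assumes f: "\<And>M. M \<in> Gamma_9_9 \<Longrightarrow> pullback M f = f" and T: "pullback (1, 3, 0, 1) f = f"
    and M: "M \<in> Gamma_9_9 \<or> M = (1, 3, 0, 1)"
  shows "pullback M (pullback (1, 0, 3, 1) f) = pullback (1, 0, 3, 1) f"
  using M
proof
  assume "M = (1, 3, 0, 1)"
  moreover have "(- 8, 27, - 27, 91) \<in> Gamma_9_9" by (simp add: Gamma_9_9_def SL2Z_def)
  moreover have "mat_mul (1, 0, 3, 1) (1, 3, 0, 1) = mat_mul (mat_mul (- 8, 27, - 27, 91) (1, 3, 0, 1)) (1, 0, 3, 1)" by simp
  ultimately show ?thesis
    using pullback_mat_mul[OF L3_SL2Z T3_SL2Z, of f] pullback_mat_mul[OF mat_mul_SL2Z[OF Gamma_9_9_SL2Z T3_SL2Z] L3_SL2Z, of "(- 8, 27, - 27, 91)" f]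
      pullback_mat_mul[OF Gamma_9_9_SL2Z T3_SL2Z, of "(- 8, 27, - 27, 91)" f] f T by (simp del: mat_mul.simps)
qed (rule Gamma_9_9_inv_conj[OF f], auto)

lemma pullback_int_power:
  assumes "pullback (1, 3, 0, 1) f = f" "pullback (1, 0, 3, 1) f = f"
  shows "pullback (1, 3 * n, 0, 1) f = f" "pullback (1, 0, 3 * n, 1) f = f"
proof -
  have I: "pullback (1, 0, 0, 1) f = f" by (rule eval_mero_eqI) (simp add: eval_pullback)
  have *: "pullback (K (n::int)) f = f"
    if K: "\<And>n. K n \<in> SL2Z" "\<And>n m. mat_mul (K n) (K m) = K (n + m)" "pullback (K 1) f = f" "pullback (K 0) f = f" for K n
  proof (induction n rule: int_induct[where k = 0])
    case (step1 i) thus ?case using pullback_mat_mul[OF K(1) K(1), of 1 i f] K by (simp add: add.commute)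
  next
    case (step2 i)
    have "pullback (K (i - 1)) (pullback (K 1) f) = pullback (K i) f"
      using pullback_mat_mul[OF K(1) K(1), of "i - 1" 1 f] K by simp
    thus ?case using K step2 by simp
  qed (use K in simp)
  show "pullback (1, 3 * n, 0, 1) f = f"
    by (rule *[of "\<lambda>n. (1, 3 * n, 0, 1)"]) (use assms I in \<open>auto simp: SL2Z_def algebra_simps\<close>)
  show "pullback (1, 0, 3 * n, 1) f = f"
    by (rule *[of "\<lambda>n. (1, 0, 3 * n, 1)"]) (use assms I in \<open>auto simp: SL2Z_def algebra_simps\<close>)
qed

text \<open>Every element of Gamma(3) is a product of an upper unipotent matrix with entry 3b, a
  lower one with entry 3c, and a matrix in \<open>Gamma_9_9\<close>: stripping off the first two
  from the left makes the off-diagonal entries divisible by 9.\<close>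

lemma Gamma_3_from_Gamma_9_9:
  assumes f: "\<And>M. M \<in> Gamma_9_9 \<Longrightarrow> pullback M f = f" and T: "pullback (1, 3, 0, 1) f = f" and L: "pullback (1, 0, 3, 1) f = f"
    and M: "M \<in> Gamma_3"
  shows "pullback M f = f"
proof -
  obtain m b c n where Me: "M = (1 + 3 * m, 3 * b, 3 * c, 1 + 3 * n)"
    and MS: "(1 + 3 * m, 3 * b, 3 * c, 1 + 3 * n) \<in> SL2Z" using Gamma_3_E[OF M] .
  define N where "N = mat_mul (1, 0, - 3 * c, 1) (mat_mul (1, - 3 * b, 0, 1) M)"
  have K: "(1, 3 * b, 0, 1) \<in> SL2Z" "(1, 0, 3 * c, 1) \<in> SL2Z" "(1, 0, - 3 * c, 1) \<in> SL2Z" "(1, - 3 * b, 0, 1) \<in> SL2Z"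
    by (simp_all add: SL2Z_def)
  have NS: "N \<in> SL2Z" unfolding N_def by (intro mat_mul_SL2Z K Gamma_3_SL2Z[OF M])
  have "N = (1 + 3 * m - 9 * b * c, 9 * (- b * n), 9 * (3 * b * c * c - c * m), 1 + 3 * n + 27 * b * c * n)"
    by (simp add: N_def Me algebra_simps)
  hence N: "N \<in> Gamma_9_9" using NS by (simp add: Gamma_9_9_def)
  have "mat_mul (mat_mul (1, 3 * b, 0, 1) (1, 0, 3 * c, 1)) N = M"
    by (simp add: N_def Me algebra_simps)
  moreover have "pullback N (pullback (1, 0, 3 * c, 1) (pullback (1, 3 * b, 0, 1) f)) =
      pullback (mat_mul (mat_mul (1, 3 * b, 0, 1) (1, 0, 3 * c, 1)) N) f"
    using pullback_mat_mul[OF mat_mul_SL2Z[OF K(1,2)] NS, of f] pullback_mat_mul[OF K(1,2), of f] by simp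
  ultimately show ?thesis by (simp add: pullback_int_power[OF T L] f N)
qed

text \<open>Two successive decompositions, each under an operator of order three. An eigenvector
  with known eigenvalue turns each component into an invariant function, so after both steps only
  functions on X(3) remain.\<close>

theorem Gamma_9_9_field:
  assumes f: "\<And>M. M \<in> Gamma_9_9 \<Longrightarrow> pullback M f = f" and grow: "exp_growth_cusps f"
  shows "f \<in> complex_field {W_mero, F_mero}"
proof -
  let ?T = "(1, 3, 0, 1) :: mat2" and ?L = "(1, 0, 3, 1) :: mat2"
  note pT = SL2Z_pos_det[OF T3_SL2Z] and pL = SL2Z_pos_det[OF L3_SL2Z]
  define z where "z = mconst (omega powi (- 1))"
  \<comment> \<open>Along (1, 3, 0, 1) the eigenvector is W itself. Along (1, 0, 3, 1) the product W
    F takes its place: it has the same eigenvalue as W there but is fixed by (1, 3, 0, 1), so the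
    invariance already gained is kept.\<close>
  define V where "V = W_mero * F_mero"
  have z: "1 + z + z ^ 2 = 0" unfolding z_def by (rule omega_mconst_sum)
  have TW: "pullback ?T W_mero = z * W_mero" and TF: "pullback ?T F_mero = mconst (omega powi 1) * F_mero"
    using W_mero_Gamma_3[of 0 1 0 0] by (simp_all add: z_def SL2Z_def)
  have LW: "pullback ?L W_mero = z * W_mero" and LF: "pullback ?L F_mero = F_mero"
    using W_mero_Gamma_3[of 0 0 1 0] by (simp_all add: z_def SL2Z_def)
  have TV: "pullback ?T V = V"
  proof -
    have "omega powi (- 1) * omega powi 1 = 1" by (subst power_int_add[symmetric]) auto
    hence "z * mconst (omega powi 1) = 1" unfolding z_def by (simp only: mconst_mult[symmetric] mconst_1)
    thus ?thesis unfolding V_def pullback_mult[OF pT] TW TF by (simp add: mult_ac)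
  qed
  have LV: "pullback ?L V = z * V" unfolding V_def pullback_mult[OF pL] LW LF by simp
  have GV: "pullback M V = V" if "M \<in> Gamma_9_9" for M
    unfolding V_def pullback_mult[OF SL2Z_pos_det[OF Gamma_9_9_SL2Z[OF that]]] W_mero_F_mero_Gamma_9_9[OF that] ..
  have V0: "V \<noteq> 0" using W_mero_nz F_mero_nz by (simp add: V_def)
  have MV: "exp_growth_cusps V" unfolding V_def by (rule exp_growth_cusps_mult[OF exp_growth_cusps_W_mero exp_growth_cusps_F_mero])
  have UF: "a \<in> complex_field {hauptmodul} \<Longrightarrow> a \<in> complex_field {W_mero, F_mero}" for a
  proof -
    assume "a \<in> complex_field {hauptmodul}"
    moreover have "{hauptmodul} \<subseteq> complex_algebra {W_mero, F_mero}" unfolding hauptmodul_def by (auto intro: complex_algebra_power complex_algebra.gen)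
    ultimately show ?thesis using complex_algebra_mono_gen unfolding complex_field_def by blast
  qed
  have gens: "W_mero \<in> complex_field {W_mero, F_mero}" "V \<in> complex_field {W_mero, F_mero}" "mconst c \<in> complex_field {W_mero, F_mero}" for c
  proof -
    have 1: "W_mero \<in> complex_algebra {W_mero, F_mero}" "F_mero \<in> complex_algebra {W_mero, F_mero}" by (rule complex_algebra.gen, simp)+
    show "W_mero \<in> complex_field {W_mero, F_mero}" "V \<in> complex_field {W_mero, F_mero}" "mconst c \<in> complex_field {W_mero, F_mero}"
      unfolding V_def by (rule complex_field_ring, rule 1, rule complex_field_ring, rule complex_algebra.mult[OF 1], rule complex_field_ring, rule complex_algebra.const)
  qed
  have divc: "a \<in> complex_field {W_mero, F_mero} \<Longrightarrow> b \<in> complex_field {W_mero, F_mero} \<Longrightarrow> a / b \<in> complex_field {W_mero, F_mero}" for a b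
    by (simp add: divide_inverse complex_field_mult complex_field_inverse)
  have pw: "a \<in> complex_field {W_mero, F_mero} \<Longrightarrow> a ^ n \<in> complex_field {W_mero, F_mero}" for a n
    by (induction n) (auto intro: complex_field_mult complex_field_ring complex_algebra_1)
  have third: "3 * a \<in> complex_field {W_mero, F_mero} \<Longrightarrow> a \<in> complex_field {W_mero, F_mero}" for a
    using divc[of "3 * a" "mconst 3"] gens(3)[of 3] by simp
  have step2: "h \<in> complex_field {W_mero, F_mero}"
    if h: "\<And>M. M \<in> Gamma_9_9 \<Longrightarrow> pullback M h = h" "pullback ?T h = h" "exp_growth_cusps h" for h
  proof -
    define k where "k = (\<lambda>j. h * V ^ j + pullback ?L (h * V ^ j) + pullback ?L (pullback ?L (h * V ^ j)))"
    have k: "pullback ?L (k j) = k j" "3 * h = k 0 + k 1 / V + k 2 / V ^ 2" for j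
      by (rule eigen_decomposition[where P = "pullback ?L" and z = z and V = V and h = k and f = h,
            OF V0 LV z pullback_add[OF pL] pullback_mult[OF pL] _ pullback_cube[OF h(1)]];
          simp add: z_def pullback_mconst pL k_def del: pos_det.simps)+
    have "k j \<in> complex_field {W_mero, F_mero}" for j
    proof (rule UF, rule Gamma_3_field)
      have hV: "pullback M (h * V ^ j) = h * V ^ j" if "M \<in> Gamma_9_9 \<or> M = ?T" for M
      proof -
        have "pos_det M" using that pT SL2Z_pos_det Gamma_9_9_SL2Z by blast
        moreover have "pullback M h = h" "pullback M V = V" using that h GV TV by blast+
        ultimately show ?thesis by (simp add: pullback_mult pullback_power)
      qed
      have 1: "pullback M (pullback ?L (h * V ^ j)) = pullback ?L (h * V ^ j)" if "M \<in> Gamma_9_9 \<or> M = ?T" for M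
        by (rule Gamma_9_9_T3_L3_inv[OF _ _ that]; rule hV) simp_all
      have 2: "pullback M (pullback ?L (pullback ?L (h * V ^ j))) = pullback ?L (pullback ?L (h * V ^ j))"
        if "M \<in> Gamma_9_9 \<or> M = ?T" for M
        by (rule Gamma_9_9_T3_L3_inv[OF _ _ that]; rule 1) simp_all
      have kinv: "pullback M (k j) = k j" if M: "M \<in> Gamma_9_9 \<or> M = ?T" for M
      proof -
        have pM: "pos_det M" using M pT SL2Z_pos_det Gamma_9_9_SL2Z by blast
        show ?thesis unfolding k_def pullback_add[OF pM] hV[OF M] 1[OF M] 2[OF M] ..
      qed
      show "pullback M (k j) = k j" if "M \<in> Gamma_3" for M
        by (rule Gamma_3_from_Gamma_9_9[OF kinv kinv k(1) that]) auto
      show "exp_growth_cusps (k j)" unfolding k_def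
        by (intro exp_growth_cusps_add exp_growth_cusps_pullback[OF _ L3_SL2Z] exp_growth_cusps_mult exp_growth_cusps_power h(3) MV)
    qed
    hence "3 * h \<in> complex_field {W_mero, F_mero}" unfolding k(2) by (intro complex_field_add divc pw gens)
    thus ?thesis by (rule third)
  qed
  define k where "k = (\<lambda>j. f * W_mero ^ j + pullback ?T (f * W_mero ^ j) + pullback ?T (pullback ?T (f * W_mero ^ j)))"
  have k: "pullback ?T (k j) = k j" "3 * f = k 0 + k 1 / W_mero + k 2 / W_mero ^ 2" for j
    by (rule eigen_decomposition[where P = "pullback ?T" and z = z and V = W_mero and h = k and f = f,
          OF W_mero_nz TW z pullback_add[OF pT] pullback_mult[OF pT] _ pullback_cube[OF f]];
        simp add: z_def pullback_mconst pT k_def del: pos_det.simps)+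
  have "k j \<in> complex_field {W_mero, F_mero}" for j
  proof (rule step2)
    have fW: "pullback M (f * W_mero ^ j) = f * W_mero ^ j" if "M \<in> Gamma_9_9" for M
      using that f W_mero_F_mero_Gamma_9_9(1) by (simp add: pullback_mult pullback_power SL2Z_pos_det Gamma_9_9_SL2Z)
    have 1: "pullback M (pullback ?T (f * W_mero ^ j)) = pullback ?T (f * W_mero ^ j)" if "M \<in> Gamma_9_9" for M
      by (rule Gamma_9_9_inv_conj[OF fW _ that]) simp_all
    have 2: "pullback M (pullback ?T (pullback ?T (f * W_mero ^ j))) = pullback ?T (pullback ?T (f * W_mero ^ j))" if "M \<in> Gamma_9_9" for M
      by (rule Gamma_9_9_inv_conj[OF 1 _ that]) simp_all
    show "pullback M (k j) = k j" if M: "M \<in> Gamma_9_9" for M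
      unfolding k_def pullback_add[OF SL2Z_pos_det[OF Gamma_9_9_SL2Z[OF M]]] fW[OF M] 1[OF M] 2[OF M] ..
    show "pullback ?T (k j) = k j" by (rule k(1))
    show "exp_growth_cusps (k j)" unfolding k_def
      by (intro exp_growth_cusps_add exp_growth_cusps_pullback[OF _ T3_SL2Z] exp_growth_cusps_mult exp_growth_cusps_power grow exp_growth_cusps_W_mero)
  qed
  hence "3 * f \<in> complex_field {W_mero, F_mero}" unfolding k(2) by (intro complex_field_add divc pw gens)
  thus ?thesis by (rule third)
qed

section \<open>Growth under integer matrices of positive determinant\<close>

lemma hermite_form:
  assumes "pos_det (a, b, c, d)"
  obtains G \<alpha> \<beta> \<delta> where "G \<in> SL2Z" "\<alpha> > 0" "\<delta> > 0"
    "\<And>z. z \<in> uhp \<Longrightarrow> moeb (a, b, c, d) z = moeb G (moeb (\<alpha>, \<beta>, 0, \<delta>) z)" "pos_det (\<alpha>, \<beta>, 0, \<delta>)"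
proof -
  have det: "a * d - b * c > 0" using assms by simp
  define g where "g = gcd a c"
  have g: "g > 0" using det by (auto simp: g_def)
  obtain p r where pr: "a = g * p" "c = g * r" by (metis g_def gcd_dvd1 gcd_dvd2 dvdE)
  obtain u v where "u * a + v * c = g" using bezout_int unfolding g_def by blast
  hence "g * (u * p + v * r) = g * 1" by (simp add: pr algebra_simps)
  hence uv: "u * p + v * r = 1" using g by simp
  define G where "G = (p, - v, r, u)"
  define \<beta> where "\<beta> = u * b + v * d"
  define \<delta> where "\<delta> = p * d - r * b"
  have G: "G \<in> SL2Z" using uv by (simp add: G_def SL2Z_def algebra_simps)
  have "g * \<delta> = a * d - b * c" by (simp add: \<delta>_def pr algebra_simps)
  hence gd: "g * \<delta> > 0" using det by simp
  hence \<delta>: "\<delta> > 0" using g by (simp add: zero_less_mult_iff)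
  have "b = p * \<beta> + (- v) * \<delta>"
  proof -
    have "p * \<beta> - v * \<delta> = (u * p + v * r) * b" by (simp add: \<beta>_def \<delta>_def algebra_simps)
    thus ?thesis by (simp add: uv)
  qed
  moreover have "d = r * \<beta> + u * \<delta>"
  proof -
    have "r * \<beta> + u * \<delta> = (u * p + v * r) * d" by (simp add: \<beta>_def \<delta>_def algebra_simps)
    thus ?thesis by (simp add: uv)
  qed
  ultimately have "moeb (a, b, c, d) z = moeb G (moeb (g, \<beta>, 0, \<delta>) z)" if "z \<in> uhp" for z
    unfolding G_def using gd that by (intro moeb_mult[where k = 1]) (auto simp: pr mult.commute)
  thus ?thesis using that[OF G g \<delta>] gd by simp
qed

lemma exp_growth_affine:
  assumes "exp_growth f" "\<alpha> > 0" "\<delta> > 0"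
  shows "exp_growth (pullback (\<alpha>, \<beta>, 0, \<delta>) f)"
proof -
  obtain R C k where C: "R \<ge> 1" "C \<ge> 0" "k \<ge> 0"
    "\<And>t. Im t > R \<Longrightarrow> regular_at f t \<and> norm (eval_mero f t) \<le> C * exp (k * Im t)" using exp_growth_normal[OF assms(1)] by metis
  have p: "pos_det (\<alpha>, \<beta>, 0, \<delta>)" using assms by simp
  have Im: "Im (moeb (\<alpha>, \<beta>, 0, \<delta>) t) = of_int \<alpha> / of_int \<delta> * Im t" for t
    by (simp add: moeb_def moebius_def Im_divide power2_eq_square)
  have pos: "of_int \<alpha> / of_int \<delta> > (0 :: real)" using assms by simp
  have "regular_at (pullback (\<alpha>, \<beta>, 0, \<delta>) f) t \<and> norm (eval_mero (pullback (\<alpha>, \<beta>, 0, \<delta>) f) t) \<le> C * exp ((k * (of_int \<alpha> / of_int \<delta>)) * Im t)"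
    if t: "Im t > max 0 (R / (of_int \<alpha> / of_int \<delta>))" for t
  proof -
    have u: "t \<in> uhp" using t by (simp add: uhp_def)
    have "R / (of_int \<alpha> / of_int \<delta>) < Im t" using t by (simp only: max_less_iff_conj)
    hence "R < of_int \<alpha> / of_int \<delta> * Im t" using pos by (simp only: pos_divide_less_eq mult.commute)
    hence "R < Im (moeb (\<alpha>, \<beta>, 0, \<delta>) t)" unfolding Im .
    from C(4)[OF this] show ?thesis
      using pullback_regular_at[OF p u] by (simp add: eval_pullback[OF p u] Im mult.assoc)
  qed
  thus ?thesis unfolding exp_growth_def by blast
qed

text \<open>The matrix is an element of SL2(Z) times an upper triangular one, and the latter only
  rescales the height. This is needed because z -> 9z and its inverse are not in SL2(Z).\<close>

lemma exp_growth_hermite: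
  assumes "\<And>G. G \<in> SL2Z \<Longrightarrow> exp_growth (pullback G f)" "pos_det M"
  shows "exp_growth (pullback M f)"
proof -
  obtain a b c d where Me: "M = (a, b, c, d)" by (cases M)
  obtain G \<alpha> \<beta> \<delta> where G: "G \<in> SL2Z" "\<alpha> > 0" "\<delta> > 0"
    "\<And>z. z \<in> uhp \<Longrightarrow> moeb (a, b, c, d) z = moeb G (moeb (\<alpha>, \<beta>, 0, \<delta>) z)" "pos_det (\<alpha>, \<beta>, 0, \<delta>)"
    using hermite_form assms(2) unfolding Me by metis
  have "pullback M f = pullback (\<alpha>, \<beta>, 0, \<delta>) (pullback G f)"
    by (rule pullback_pullback[symmetric]) (use G assms(2) SL2Z_pos_det in \<open>simp_all add: Me del: pos_det.simps\<close>)
  thus ?thesis using exp_growth_affine[OF assms(1)[OF G(1)] G(2,3)] by simp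
qed

section \<open>Expansions at the cusps\<close>

lemma eventually_at_cusp: "eventually P at_cusp \<longleftrightarrow> (\<exists>R. \<forall>z. Im z > R \<longrightarrow> P z)"
proof
  assume "eventually P at_cusp"
  then obtain Q where Q: "eventually Q at_top" "\<forall>t. Q (Im t) \<longrightarrow> P t"
    unfolding at_cusp_def eventually_filtercomap by blast
  then obtain R where "\<And>y. y > R \<Longrightarrow> Q y" unfolding eventually_at_top_dense by blast
  thus "\<exists>R. \<forall>z. Im z > R \<longrightarrow> P z" using Q(2) by blast
next
  assume "\<exists>R. \<forall>z. Im z > R \<longrightarrow> P z"
  then obtain R where R: "\<forall>z. Im z > R \<longrightarrow> P z" by blast
  show "eventually P at_cusp" using at_cusp_gt[of R] by eventually_elim (use R in blast)
qed

lemma has_q_iff: "has_q_expansion h f L \<longleftrightarrow>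
    fls_conv_radius L > 0 \<and> eventually (\<lambda>z. eval_mero f z = eval_fls L (ee (z / of_nat h))) at_cusp"
  unfolding has_q_expansion_def at_cusp_def ee_def by simp

lemma q_filter: "h > 0 \<Longrightarrow> filterlim (\<lambda>z. ee (z / of_nat h)) (at 0) at_cusp"
  using ee_tendsto_0[of h] by (simp add: filterlim_at)

lemma has_qI:
  assumes h: "h > 0" and g: "g has_laurent_expansion L" and ev: "eventually (\<lambda>z. eval_mero f z = g (ee (z / of_nat h))) at_cusp"
  shows "has_q_expansion h f L"
proof -
  have r: "fls_conv_radius L > 0" and e: "eventually (\<lambda>q. eval_fls L q = g q) (at 0)"
    using g by (auto simp: has_laurent_expansion_def)
  have "eventually (\<lambda>z. eval_fls L (ee (z / of_nat h)) = g (ee (z / of_nat h))) at_cusp"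
    using filterlim_iff[THEN iffD1, OF q_filter[OF h]] e by blast
  with ev have "eventually (\<lambda>z. eval_mero f z = eval_fls L (ee (z / of_nat h))) at_cusp"
    by eventually_elim simp
  with r show ?thesis by (simp add: has_q_iff)
qed

text \<open>The Laurent series converges on a punctured disc, so the function is analytic near the
  cusp. This is what justifies pointwise evaluation of sums and products there.\<close>

lemma has_q_regular_at:
  assumes "h > 0" "has_q_expansion h f L"
  shows "eventually (\<lambda>z. regular_at f z) at_cusp"
proof -
  have r: "fls_conv_radius L > 0" and ev: "eventually (\<lambda>z. eval_mero f z = eval_fls L (ee (z / of_nat h))) at_cusp"
    using assms(2) by (auto simp: has_q_iff)
  obtain \<rho> :: real where \<rho>: "\<rho> > 0" "ereal \<rho> < fls_conv_radius L"
    using ereal_dense2[OF r] by auto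
  have "eventually (\<lambda>q :: complex. norm q < \<rho>) (at 0)"
    using eventually_at_in_open[of "ball 0 \<rho>" "0 :: complex"] \<rho>(1) by (auto elim!: eventually_mono)
  hence "eventually (\<lambda>z. norm (ee (z / of_nat h)) < \<rho>) at_cusp"
    using filterlim_iff[THEN iffD1, OF q_filter[OF assms(1)]] by blast
  with ev at_cusp_gt[of 0]
  have "eventually (\<lambda>z. Im z > 0 \<and> eval_mero f z = eval_fls L (ee (z / of_nat h)) \<and> norm (ee (z / of_nat h)) < \<rho>) at_cusp"
    by eventually_elim simp
  then obtain R where R: "\<And>z. Im z > R \<Longrightarrow> Im z > 0 \<and> eval_mero f z = eval_fls L (ee (z / of_nat h)) \<and> norm (ee (z / of_nat h)) < \<rho>"
    unfolding eventually_at_cusp by blast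
  have "regular_at f z" if z: "Im z > R" for z
  proof (rule regular_atI(1))
    show "z \<in> uhp" using R[OF z] by (simp add: uhp_def)
    have "eventually (\<lambda>w. w \<in> {w. Im w > R}) (at z)"
      by (rule eventually_at_in_open') (use z in \<open>auto intro: open_halfspace_Im_gt\<close>)
    thus "eventually (\<lambda>w. eval_mero f w = eval_fls L (ee (w / of_nat h))) (at z)"
      by eventually_elim (use R in blast)
    have "norm (ee (z / of_nat h)) < \<rho>" using R[OF z] by blast
    hence "ereal (norm (ee (z / of_nat h))) < fls_conv_radius L" using \<rho>(2) by (meson ereal_less_le less_ereal.simps(1) less_trans)
    thus "(\<lambda>w. eval_fls L (ee (w / of_nat h))) analytic_on {z}"
      unfolding ee_def using assms(1) by (intro analytic_intros) (auto simp: in_eball_iff ee_def)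
  qed
  thus ?thesis unfolding eventually_at_cusp by blast
qed

text \<open>A nonzero element vanishes only on a sparse set, not on a whole half plane. Hence
  expansions determine functions.\<close>

lemma mero_eq_0_cusp:
  assumes "eventually (\<lambda>z. eval_mero f z = 0) at_cusp"
  shows "f = 0"
proof (rule ccontr)
  assume "f \<noteq> 0"
  obtain R where R: "\<And>z. Im z > R \<Longrightarrow> eval_mero f z = 0" using assms unfolding eventually_at_cusp by blast
  define z where "z = Complex 0 (max 1 (R + 1))"
  have z: "z \<in> uhp" "Im z > R" by (auto simp: z_def uhp_def)
  have "eventually (\<lambda>w. eval_mero f w \<noteq> 0) (at z)" by (rule ae_at[OF eval_mero_nonzero_ae[OF \<open>f \<noteq> 0\<close>] z(1)])
  moreover have "eventually (\<lambda>w. w \<in> {w. Im w > R}) (at z)"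
    by (rule eventually_at_in_open') (use z in \<open>auto intro: open_halfspace_Im_gt\<close>)
  ultimately have "eventually (\<lambda>w. False) (at z)" by eventually_elim (use R in blast)
  thus False by simp
qed

lemma has_q_add:
  assumes "h > 0" "has_q_expansion h f L" "has_q_expansion h g M"
  shows "has_q_expansion h (f + g) (L + M)"
proof (rule has_qI[OF assms(1)])
  show "(\<lambda>q. eval_fls L q + eval_fls M q) has_laurent_expansion L + M"
    by (intro has_laurent_expansion_add eval_fls_has_laurent_expansion) (use assms in \<open>auto simp: has_q_iff\<close>)
  have "eventually (\<lambda>z. eval_mero f z = eval_fls L (ee (z / of_nat h))) at_cusp"
    "eventually (\<lambda>z. eval_mero g z = eval_fls M (ee (z / of_nat h))) at_cusp" using assms by (auto simp: has_q_iff)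
  with has_q_regular_at[OF assms(1,2)] has_q_regular_at[OF assms(1,3)] at_cusp_gt[of 0]
  show "eventually (\<lambda>z. eval_mero (f + g) z = eval_fls L (ee (z / of_nat h)) + eval_fls M (ee (z / of_nat h))) at_cusp"
    by eventually_elim (simp add: regular_at_add uhp_def)
qed

lemma has_q_mult:
  assumes "h > 0" "has_q_expansion h f L" "has_q_expansion h g M"
  shows "has_q_expansion h (f * g) (L * M)"
proof (rule has_qI[OF assms(1)])
  show "(\<lambda>q. eval_fls L q * eval_fls M q) has_laurent_expansion L * M"
    by (intro has_laurent_expansion_mult eval_fls_has_laurent_expansion) (use assms in \<open>auto simp: has_q_iff\<close>)
  have "eventually (\<lambda>z. eval_mero f z = eval_fls L (ee (z / of_nat h))) at_cusp"
    "eventually (\<lambda>z. eval_mero g z = eval_fls M (ee (z / of_nat h))) at_cusp" using assms by (auto simp: has_q_iff)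
  with has_q_regular_at[OF assms(1,2)] has_q_regular_at[OF assms(1,3)] at_cusp_gt[of 0]
  show "eventually (\<lambda>z. eval_mero (f * g) z = eval_fls L (ee (z / of_nat h)) * eval_fls M (ee (z / of_nat h))) at_cusp"
    by eventually_elim (simp add: regular_at_mult uhp_def)
qed

lemma has_q_const: "h > 0 \<Longrightarrow> has_q_expansion h (mconst c) (fls_const c)"
  by (rule has_qI[where g = "\<lambda>_. c"]) (auto intro: eventually_mono[OF at_cusp_gt[of 0]] simp: eval_mconst uhp_def)

lemma has_q_cmult: "h > 0 \<Longrightarrow> has_q_expansion h f L \<Longrightarrow> has_q_expansion h (mconst c * f) (fls_const c * L)"
  by (intro has_q_mult has_q_const)

lemma eval_inverse:
  assumes "z \<in> uhp" "regular_at f z" "eval_mero f z \<noteq> 0"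
  shows "eval_mero (inverse f) z = inverse (eval_mero f z)"
proof -
  have "(\<lambda>z. inverse (eval_mero f z)) analytic_on {z}"
    using assms(2,3) unfolding regular_at_def by (intro analytic_on_inverse) auto
  from regular_atI(2)[OF assms(1) ae_at[OF eval_mero_ops_ae(7) assms(1)] this] show ?thesis .
qed

lemma has_q_nonzero:
  assumes "h > 0" "has_q_expansion h f L" "L \<noteq> 0"
  shows "eventually (\<lambda>z. eval_mero f z \<noteq> 0) at_cusp"
proof -
  have r: "fls_conv_radius L > 0" and ev: "eventually (\<lambda>z. eval_mero f z = eval_fls L (ee (z / of_nat h))) at_cusp"
    using assms(2) by (auto simp: has_q_iff)
  have "eventually (\<lambda>q. eval_fls L q \<noteq> 0) (at 0)"
    by (rule has_laurent_expansion_nonzero_imp_eventually_nonzero[OF eval_fls_has_laurent_expansion[OF r] assms(3)])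
  hence "eventually (\<lambda>z. eval_fls L (ee (z / of_nat h)) \<noteq> 0) at_cusp"
    using filterlim_iff[THEN iffD1, OF q_filter[OF assms(1)]] by blast
  with ev show ?thesis by eventually_elim simp
qed

lemma has_q_zero:
  assumes "has_q_expansion h f 0" shows "f = 0"
  using assms by (intro mero_eq_0_cusp) (simp add: has_q_iff)

lemma has_q_inverse:
  assumes "h > 0" "has_q_expansion h f L"
  shows "has_q_expansion h (inverse f) (inverse L)"
proof (cases "L = 0")
  case True
  hence "f = 0" using assms has_q_zero by blast
  thus ?thesis using has_q_const[OF assms(1), of 0] True by simp
next
  case False
  have r: "fls_conv_radius L > 0" and ev: "eventually (\<lambda>z. eval_mero f z = eval_fls L (ee (z / of_nat h))) at_cusp"
    using assms(2) by (auto simp: has_q_iff)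
  show ?thesis
  proof (rule has_qI[OF assms(1)])
    show "(\<lambda>q. inverse (eval_fls L q)) has_laurent_expansion inverse L"
      by (intro has_laurent_expansion_inverse eval_fls_has_laurent_expansion r)
    show "eventually (\<lambda>z. eval_mero (inverse f) z = inverse (eval_fls L (ee (z / of_nat h)))) at_cusp"
      using ev has_q_nonzero[OF assms False] has_q_regular_at[OF assms] at_cusp_gt[of 0]
      by eventually_elim (simp add: eval_inverse uhp_def)
  qed
qed

lemma has_q_of_0:
  assumes "h > 0" "has_q_expansion h 0 L" shows "L = 0"
proof (rule ccontr)
  assume "L \<noteq> 0"
  have "eventually (\<lambda>z. False) at_cusp"
    using has_q_nonzero[OF assms \<open>L \<noteq> 0\<close>] at_cusp_gt[of 0]
    by eventually_elim (use eval_mconst[of _ 0] in \<open>auto simp: uhp_def\<close>)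
  thus False using at_cusp_nontrivial by simp
qed

lemma has_q_exp_growth:
  assumes "h > 0" "has_q_expansion h f L" shows "exp_growth f"
proof -
  have r: "fls_conv_radius L > 0" and ev: "eventually (\<lambda>z. eval_mero f z = eval_fls L (ee (z / of_nat h))) at_cusp"
    using assms(2) by (auto simp: has_q_iff)
  define p where "p = fls_base_factor_to_fps L"
  define d where "d = fls_subdegree L"
  have "(\<lambda>q. eval_fps p q) analytic_on {0}"
    using r unfolding p_def fls_conv_radius_altdef
    by (intro analytic_intros) (simp add: zero_ereal_def[symmetric])
  hence "isCont (eval_fps p) 0" by (rule analytic_at_imp_isCont)
  hence "(eval_fps p \<longlongrightarrow> eval_fps p 0) (at 0)" by (simp add: isCont_def)
  hence "eventually (\<lambda>q. dist (eval_fps p q) (eval_fps p 0) < 1) (at 0)" by (rule tendstoD) simp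
  hence "eventually (\<lambda>z. dist (eval_fps p (ee (z / of_nat h))) (eval_fps p 0) < 1) at_cusp"
    using filterlim_iff[THEN iffD1, OF q_filter[OF assms(1)]] by blast
  with ev has_q_regular_at[OF assms]
  have "eventually (\<lambda>z. regular_at f z \<and> norm (eval_mero f z) \<le> (norm (eval_fps p 0) + 1) * exp ((- 2 * pi / h * d) * Im z)) at_cusp"
  proof eventually_elim
    case (elim z)
    have "norm (eval_fps p (ee (z / of_nat h))) \<le> norm (eval_fps p 0) + 1"
      using elim(3) norm_triangle_ineq2[of "eval_fps p (ee (z / of_nat h))" "eval_fps p 0"] by (simp add: dist_norm)
    moreover have "norm (ee (z / of_nat h)) powi d = exp ((- 2 * pi / h * d) * Im z)"
      using assms(1) by (simp add: norm_ee Im_divide power2_eq_square exp_power_int mult_ac)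
    moreover have "norm (eval_mero f z) = norm (eval_fps p (ee (z / of_nat h))) * norm (ee (z / of_nat h)) powi d"
      using elim(1) by (simp add: eval_fls_def p_def d_def norm_mult norm_power_int)
    ultimately show ?case using elim(2) by (simp add: mult_right_mono)
  qed
  thus ?thesis unfolding exp_growth_def eventually_at_cusp by blast
qed

text \<open>Converse of \<open>has_q_exp_growth\<close> for functions of period h: after
  multiplication by a power of the parameter the function is bounded and extends to the centre of
  the disc.\<close>

lemma exp_growth_has_q:
  assumes h: "h > 0" and f: "exp_growth f" and per: "pullback (1, int h, 0, 1) f = f"
  shows "\<exists>L. has_q_expansion h f L"
proof -
  obtain R C k where C: "R \<ge> 1" "C \<ge> 0" "k \<ge> 0"
    "\<And>t. Im t > R \<Longrightarrow> regular_at f t \<and> norm (eval_mero f t) \<le> C * exp (k * Im t)" using exp_growth_normal[OF f] by metis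
  \<comment> \<open>Large enough for the n-th power of |ee(t/h)| to absorb exp(k Im t).\<close>
  define n where "n = nat \<lceil>k * h / (2 * pi)\<rceil>"
  have "k * h / (2 * pi) \<le> n" unfolding n_def by linarith
  hence n: "k \<le> 2 * pi / h * n" using h by (simp add: field_simps)
  define G where "G = (\<lambda>t. eval_mero f t * ee (t / of_nat h) ^ n)"
  have p: "pos_det (1, int h, 0, 1)" by simp
  have hol: "G holomorphic_on {t. Im t > R}"
  proof -
    have "eval_mero f analytic_on {t. Im t > R}" using C(4) by (subst analytic_on_analytic_at) (auto simp: regular_at_def)
    thus ?thesis unfolding G_def using h by (intro holomorphic_intros analytic_imp_holomorphic) auto
  qed
  have perG: "G (t + of_nat h) = G t" if "Im t > R" for t
  proof -
    have "eval_mero f (t + of_nat h) = eval_mero f t"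
      using eval_pullback[OF p, of t f] that C(1) unfolding per by (simp add: moeb_T uhp_def)
    moreover have "ee ((t + of_nat h) / of_nat h) = ee (t / of_nat h)"
      using h ee_plus_1[of "t / of_nat h"] by (simp add: add_divide_distrib)
    ultimately show ?thesis by (simp add: G_def)
  qed
  have bdd: "norm (G t) \<le> C" if t: "Im t > R" for t
  proof -
    have "norm (ee (t / of_nat h)) ^ n = exp (- (2 * pi / h * n * Im t))"
      using h by (simp add: norm_ee Im_divide power2_eq_square exp_of_nat_mult[symmetric] mult_ac)
    hence "norm (G t) = norm (eval_mero f t) * exp (- (2 * pi / h * n * Im t))"
      by (simp add: G_def norm_mult norm_power)
    also have "\<dots> \<le> (C * exp (k * Im t)) * exp (- (2 * pi / h * n * Im t))"
      using C(4)[OF t] by (intro mult_right_mono) auto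
    also have "\<dots> = C * exp (k * Im t - 2 * pi / h * n * Im t)" by (simp add: exp_diff exp_minus field_simps)
    also have "\<dots> \<le> C * 1"
    proof (rule mult_left_mono[OF _ C(2)])
      have "k * Im t \<le> 2 * pi / h * n * Im t" using n t C(1) by (intro mult_right_mono) auto
      thus "exp (k * Im t - 2 * pi / h * n * Im t) \<le> 1" by simp
    qed
    finally show ?thesis by simp
  qed
  obtain \<phi> where \<phi>: "\<phi> holomorphic_on ball 0 (exp (- 2 * pi * R / h))" "\<And>t. Im t > R \<Longrightarrow> G t = \<phi> (ee (t / of_nat h))"
    using periodic_extension[OF h hol perG bdd] by metis
  have "\<phi> analytic_on {0}" using \<phi>(1)
    by (rule analytic_on_subset[OF analytic_on_open[THEN iffD2, OF open_ball]]) simp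
  hence "\<phi> has_laurent_expansion fps_to_fls (fps_expansion \<phi> 0)"
    by (intro has_laurent_expansion_fps analytic_at_imp_has_fps_expansion_0)
  hence "(\<lambda>q. \<phi> q / q ^ n) has_laurent_expansion fps_to_fls (fps_expansion \<phi> 0) / fls_X_intpow (int n)"
    by (intro has_laurent_expansion_divide has_laurent_expansion_fps_X_power)
  moreover have "eventually (\<lambda>z. eval_mero f z = \<phi> (ee (z / of_nat h)) / ee (z / of_nat h) ^ n) at_cusp"
    using at_cusp_gt[of R] by eventually_elim (simp add: \<phi>(2)[symmetric] G_def)
  ultimately show ?thesis using has_qI[OF h] by blast
qed

subsection \<open>Rational coefficients\<close>

definition rat_fls :: "complex fls \<Rightarrow> bool" where
  "rat_fls L \<longleftrightarrow> (\<forall>n. fls_nth L n \<in> \<rat>)"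

lemma rat_fls_add: "rat_fls L \<Longrightarrow> rat_fls M \<Longrightarrow> rat_fls (L + M)"
  by (simp add: rat_fls_def)
lemma rat_fls_mult: "rat_fls L \<Longrightarrow> rat_fls M \<Longrightarrow> rat_fls (L * M)"
  by (auto simp: rat_fls_def fls_times_nth(2) intro!: Rats_sum Rats_mult)
lemma rat_fls_const: "c \<in> \<rat> \<Longrightarrow> rat_fls (fls_const c)"
  by (simp add: rat_fls_def)

text \<open>The coefficients of the inverse satisfy a recursion in which the constant term is the
  only divisor.\<close>

lemma rat_fps_inverse:
  fixes F :: "complex fps"
  assumes "\<And>n. fps_nth F n \<in> \<rat>" "fps_nth F 0 \<noteq> 0"
  shows "fps_nth (inverse F) n \<in> \<rat>"
proof (induction n rule: less_induct)
  case (less n)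
  show ?case
  proof (cases n)
    case 0
    thus ?thesis using assms by simp
  next
    case (Suc m)
    have "0 = fps_nth (inverse F * F) n" using assms(2) by (simp add: inverse_mult_eq_1 Suc)
    also have "\<dots> = (\<Sum>i=0..m. fps_nth (inverse F) i * fps_nth F (n - i)) + fps_nth (inverse F) n * fps_nth F 0"
      unfolding fps_mult_nth Suc by (subst sum.atLeast0_atMost_Suc) simp
    finally have "fps_nth (inverse F) n = - (\<Sum>i=0..m. fps_nth (inverse F) i * fps_nth F (n - i)) / fps_nth F 0"
      using assms(2) by (simp add: field_simps add_eq_0_iff)
    moreover have "(\<Sum>i=0..m. fps_nth (inverse F) i * fps_nth F (n - i)) \<in> \<rat>"
      by (intro Rats_sum Rats_mult assms less) (auto simp: Suc)
    ultimately show ?thesis using assms(1) by simp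
  qed
qed

lemma rat_fls_inverse: "rat_fls L \<Longrightarrow> rat_fls (inverse L)"
proof (cases "L = 0")
  case False
  assume L: "rat_fls L"
  have "fps_nth (inverse (fls_base_factor_to_fps L)) n \<in> \<rat>" for n
    by (rule rat_fps_inverse) (use L False in \<open>auto simp: rat_fls_def\<close>)
  thus ?thesis unfolding rat_fls_def fls_inverse_def by simp
qed (simp add: rat_fls_def)

definition rational_laurent :: "(complex \<Rightarrow> complex) \<Rightarrow> bool" where
  "rational_laurent g \<longleftrightarrow> (\<exists>L. g has_laurent_expansion L \<and> rat_fls L)"

lemma rational_laurent_mult: "rational_laurent f \<Longrightarrow> rational_laurent g \<Longrightarrow> rational_laurent (\<lambda>q. f q * g q)"
  unfolding rational_laurent_def using has_laurent_expansion_mult rat_fls_mult by blast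
lemma rational_laurent_divide: "rational_laurent f \<Longrightarrow> rational_laurent g \<Longrightarrow> rational_laurent (\<lambda>q. f q / g q)"
  unfolding rational_laurent_def divide_inverse using has_laurent_expansion_mult has_laurent_expansion_inverse rat_fls_mult rat_fls_inverse by blast
lemma rational_laurent_power: "rational_laurent f \<Longrightarrow> rational_laurent (\<lambda>q. f q ^ n)"
proof (induction n)
  case 0
  have "rat_fls (fls_const 1)" by (rule rat_fls_const) simp
  thus ?case unfolding rational_laurent_def using has_laurent_expansion_const[of 1] by auto
qed (auto intro: rational_laurent_mult)
lemma rational_laurent_id: "rational_laurent (\<lambda>q. q)"
  unfolding rational_laurent_def by (intro exI[of _ fls_X] conjI has_laurent_expansion_fps_X) (simp add: rat_fls_def)
lemma rational_laurent_cong: "rational_laurent f \<Longrightarrow> eventually (\<lambda>q. f q = g q) (at 0) \<Longrightarrow> rational_laurent g"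
  unfolding rational_laurent_def using has_laurent_expansion_cong[of f g] by blast

text \<open>The partial products have integer coefficients. Uniform convergence gives convergence of
  each Taylor coefficient, and the integers are closed in the complex numbers.\<close>

lemma rational_laurent_qprod:
  assumes i: "i > 0" and j: "j > 0"
  shows "rational_laurent (\<lambda>q. qprod (q ^ i) (q ^ j))"
proof -
  let ?f = "\<lambda>q. qprod (q ^ i) (q ^ j)"
  let ?P = "\<lambda>N q :: complex. \<Prod>n<N. 1 - q ^ i * (q ^ j) ^ n"
  have hol: "?f holomorphic_on ball 0 1"
    by (intro holomorphic_intros) (use j in \<open>auto intro: norm_power_less_1\<close>)
  hence "?f analytic_on {0}"
    by (intro analytic_on_subset[OF analytic_on_open[THEN iffD2, OF open_ball]]) auto
  hence F: "?f has_fps_expansion fps_expansion ?f 0" by (rule analytic_at_imp_has_fps_expansion_0)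
  have "uniform_limit (cball 0 (1 / 2)) ?P ?f sequentially"
    by (rule uniform_limit_qprod) (use j in \<open>auto intro!: continuous_intros norm_power_less_1\<close>)
  hence ul: "uniform_limit (ball 0 (1 / 2)) ?P ?f sequentially"
    by (rule uniform_limit_on_subset) auto
  have int: "fps_nth (fps_expansion ?f 0) m \<in> \<int>" for m
  proof -
    have lim: "(\<lambda>N. (deriv ^^ m) (?P N) 0) \<longlonglongrightarrow> (deriv ^^ m) ?f 0"
      by (rule higher_deriv_complex_uniform_limit[OF ul]) (auto intro!: holomorphic_intros always_eventually)
    have "(\<lambda>N. (deriv ^^ m) (?P N) 0 / fact m) \<longlonglongrightarrow> (deriv ^^ m) ?f 0 / fact m"
      by (intro tendsto_divide lim tendsto_const) simp
    moreover have "(deriv ^^ m) (?P N) 0 / fact m \<in> \<int>" for N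
    proof -
      define Q where "Q = (\<Prod>n<N. 1 - fps_X ^ i * (fps_X ^ j) ^ n :: complex fps)"
      have "?P N has_fps_expansion Q" unfolding Q_def by (intro fps_expansion_intros)
      hence "(deriv ^^ m) (?P N) 0 / fact m = fps_nth Q m" by (rule fps_nth_fps_expansion[symmetric])
      moreover have "\<forall>m. fps_nth Q m \<in> \<int>" unfolding Q_def
      proof (induction N)
        case (Suc N)
        have e: "1 - fps_X ^ i * (fps_X ^ j) ^ N = 1 - (fps_X ^ (i + j * N) :: complex fps)"
          by (simp add: power_add power_mult)
        show ?case unfolding prod.lessThan_Suc e fps_mult_nth
          by (intro allI Ints_sum Ints_mult Suc[rule_format]) auto
      qed auto
      ultimately show ?thesis by simp
    qed
    ultimately have "(deriv ^^ m) ?f 0 / fact m \<in> \<int>"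
      by (rule closed_sequentially[OF closed_Ints, rotated])
    thus ?thesis by (simp add: fps_nth_fps_expansion[OF F])
  qed
  have "rat_fls (fps_to_fls (fps_expansion ?f 0))"
    using int Ints_subset_Rats by (auto simp: rat_fls_def)
  thus ?thesis using has_laurent_expansion_fps[OF F] unfolding rational_laurent_def by blast
qed

text \<open>The factors with \<open>omega\<close> are completed to full triples and collapsed by
  \<open>qprod_cube\<close>; what remains involves powers of X only.\<close>

lemma klein_1_prod_klein_0_prod_products:
  assumes X: "norm X < 1"
  shows "klein_1_prod 0 X / klein_0_prod X = qprod (X ^ 2) (X ^ 3) * qprod X (X ^ 3) * qprod (X ^ 3) (X ^ 3) / qprod (X ^ 9) (X ^ 9)"
    "klein_1_prod 1 X * klein_1_prod 2 X / klein_0_prod X ^ 2 = qprod (X ^ 6) (X ^ 9) * qprod (X ^ 3) (X ^ 9) * qprod (X ^ 3) (X ^ 3) ^ 2 /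
       (qprod (X ^ 2) (X ^ 3) * qprod X (X ^ 3) * qprod (X ^ 9) (X ^ 9) ^ 2)"
proof -
  have q: "norm (X ^ 3) < 1" using X by (rule norm_power_less_1) simp
  have nz: "qprod (X ^ 3) (X ^ 3) \<noteq> 0" "qprod X (X ^ 3) \<noteq> 0" "qprod (X ^ 2) (X ^ 3) \<noteq> 0"
    "qprod (omega * X ^ 3) (X ^ 3) \<noteq> 0" "qprod (omega ^ 2 * X ^ 3) (X ^ 3) \<noteq> 0"
    using X q norm_power_less_1[OF X, of 2] norm_omega_power_less_1[OF X, of 3 1] norm_omega_power_less_1[OF X, of 3 2]
    by (simp_all add: qprod_nonzero')
  note cube = qprod_cube[OF q omega_neq_1 omega_cube]
  have p: "(X ^ 3) ^ 3 = X ^ 9" "(X ^ 2) ^ 3 = X ^ 6" by (simp_all flip: power_mult)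
  have "omega ^ (2 * 2) = omega ^ (3 + 1)" by simp
  hence o4: "omega ^ (2 * 2) = omega" by (simp only: power_add omega_cube power_one_right mult_1_left)
  have c3: "qprod (X ^ 9) (X ^ 9) = qprod (X ^ 3) (X ^ 3) * qprod (omega * X ^ 3) (X ^ 3) * qprod (omega ^ 2 * X ^ 3) (X ^ 3)"
    using cube[of "X ^ 3"] by (simp add: p)
  have c1: "qprod (X ^ 3) (X ^ 9) = qprod X (X ^ 3) * qprod (omega * X) (X ^ 3) * qprod (omega ^ 2 * X) (X ^ 3)"
    using cube[of X] by (simp add: p)
  have c2: "qprod (X ^ 6) (X ^ 9) = qprod (X ^ 2) (X ^ 3) * qprod (omega * X ^ 2) (X ^ 3) * qprod (omega ^ 2 * X ^ 2) (X ^ 3)"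
    using cube[of "X ^ 2"] by (simp add: p)
  show "klein_1_prod 0 X / klein_0_prod X = qprod (X ^ 2) (X ^ 3) * qprod X (X ^ 3) * qprod (X ^ 3) (X ^ 3) / qprod (X ^ 9) (X ^ 9)"
    unfolding klein_1_prod_def klein_0_prod_def c3 using nz by simp
  show "klein_1_prod 1 X * klein_1_prod 2 X / klein_0_prod X ^ 2 = qprod (X ^ 6) (X ^ 9) * qprod (X ^ 3) (X ^ 9) * qprod (X ^ 3) (X ^ 3) ^ 2 /
       (qprod (X ^ 2) (X ^ 3) * qprod X (X ^ 3) * qprod (X ^ 9) (X ^ 9) ^ 2)"
    unfolding klein_1_prod_def klein_0_prod_def c1 c2 c3 o4 using nz by (simp add: field_simps power2_eq_square)
qed

text \<open>At 9z the parameter X = ee(9z/3) is q^3 with q = ee z, and the prefactor ee(- 9z/9) is 1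
  / q, so no fractional powers of q are left.\<close>

lemma rational_laurent_WF:
  "rational_laurent (\<lambda>q. klein_1_prod 0 (q ^ 3) / klein_0_prod (q ^ 3) / q)" "rational_laurent (\<lambda>q. klein_1_prod 1 (q ^ 3) * klein_1_prod 2 (q ^ 3) / klein_0_prod (q ^ 3) ^ 2 / q ^ 2)"
proof -
  have ev: "eventually (\<lambda>q :: complex. norm (q ^ 3) < 1) (at 0)"
    using eventually_at_in_open[of "ball 0 1" "0 :: complex"] by (auto elim!: eventually_mono intro: norm_power_less_1)
  have qpr: "rational_laurent (\<lambda>q. qprod ((q ^ 3) ^ i) ((q ^ 3) ^ j))" if "i > 0" "j > 0" for i j
    using rational_laurent_qprod[of "3 * i" "3 * j"] that by (simp add: power_mult)
  have qpr1: "rational_laurent (\<lambda>q. qprod (q ^ 3) ((q ^ 3) ^ j))" if "j > 0" for j using qpr[of 1 j] that by simp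
  show "rational_laurent (\<lambda>q. klein_1_prod 0 (q ^ 3) / klein_0_prod (q ^ 3) / q)"
  proof (rule rational_laurent_cong)
    show "rational_laurent (\<lambda>q. (qprod ((q ^ 3) ^ 2) ((q ^ 3) ^ 3) * qprod (q ^ 3) ((q ^ 3) ^ 3) * qprod ((q ^ 3) ^ 3) ((q ^ 3) ^ 3) / qprod ((q ^ 3) ^ 9) ((q ^ 3) ^ 9)) / q)"
      by (intro rational_laurent_divide rational_laurent_mult rational_laurent_id qpr qpr1) simp_all
    show "eventually (\<lambda>q. (qprod ((q ^ 3) ^ 2) ((q ^ 3) ^ 3) * qprod (q ^ 3) ((q ^ 3) ^ 3) * qprod ((q ^ 3) ^ 3) ((q ^ 3) ^ 3) / qprod ((q ^ 3) ^ 9) ((q ^ 3) ^ 9)) / q =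
        klein_1_prod 0 (q ^ 3) / klein_0_prod (q ^ 3) / q) (at 0)"
      using ev by eventually_elim (simp only: klein_1_prod_klein_0_prod_products)
  qed
  show "rational_laurent (\<lambda>q. klein_1_prod 1 (q ^ 3) * klein_1_prod 2 (q ^ 3) / klein_0_prod (q ^ 3) ^ 2 / q ^ 2)"
  proof (rule rational_laurent_cong)
    show "rational_laurent (\<lambda>q. (qprod ((q ^ 3) ^ 6) ((q ^ 3) ^ 9) * qprod ((q ^ 3) ^ 3) ((q ^ 3) ^ 9) * qprod ((q ^ 3) ^ 3) ((q ^ 3) ^ 3) ^ 2 /
       (qprod ((q ^ 3) ^ 2) ((q ^ 3) ^ 3) * qprod (q ^ 3) ((q ^ 3) ^ 3) * qprod ((q ^ 3) ^ 9) ((q ^ 3) ^ 9) ^ 2)) / q ^ 2)"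
      by (intro rational_laurent_divide rational_laurent_mult rational_laurent_power rational_laurent_id qpr qpr1) simp_all
    show "eventually (\<lambda>q. (qprod ((q ^ 3) ^ 6) ((q ^ 3) ^ 9) * qprod ((q ^ 3) ^ 3) ((q ^ 3) ^ 9) * qprod ((q ^ 3) ^ 3) ((q ^ 3) ^ 3) ^ 2 /
       (qprod ((q ^ 3) ^ 2) ((q ^ 3) ^ 3) * qprod (q ^ 3) ((q ^ 3) ^ 3) * qprod ((q ^ 3) ^ 9) ((q ^ 3) ^ 9) ^ 2)) / q ^ 2 =
        klein_1_prod 1 (q ^ 3) * klein_1_prod 2 (q ^ 3) / klein_0_prod (q ^ 3) ^ 2 / q ^ 2) (at 0)"
      using ev by eventually_elim (simp only: klein_1_prod_klein_0_prod_products)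
  qed
qed

section \<open>The function field of \<open>X\<^sub>0(81)\<close>\<close>

lemma Gamma0_SL2Z: "M \<in> Gamma0 N \<Longrightarrow> M \<in> SL2Z"
  by (auto simp: Gamma0_def)

lemma X0C_const: "mconst c \<in> X0_functions_C 81"
  using has_q_const[of 81] by (auto simp: X0_functions_C_def pullback_mconst SL2Z_pos_det Gamma0_SL2Z)
lemma X0C_add: "f \<in> X0_functions_C 81 \<Longrightarrow> g \<in> X0_functions_C 81 \<Longrightarrow> f + g \<in> X0_functions_C 81"
  using has_q_add[of 81] by (fastforce simp: X0_functions_C_def pullback_add SL2Z_pos_det Gamma0_SL2Z)
lemma X0C_mult: "f \<in> X0_functions_C 81 \<Longrightarrow> g \<in> X0_functions_C 81 \<Longrightarrow> f * g \<in> X0_functions_C 81"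
  using has_q_mult[of 81] by (fastforce simp: X0_functions_C_def pullback_mult SL2Z_pos_det Gamma0_SL2Z)
lemma X0C_inverse: "f \<in> X0_functions_C 81 \<Longrightarrow> inverse f \<in> X0_functions_C 81"
  using has_q_inverse[of 81] by (fastforce simp: X0_functions_C_def pullback_inverse SL2Z_pos_det Gamma0_SL2Z)

lemma X0Q_iff: "f \<in> X0_functions_Q 81 \<longleftrightarrow> f \<in> X0_functions_C 81 \<and> (\<exists>L. has_q_expansion 1 f L \<and> rat_fls L)"
  by (simp add: X0_functions_Q_def rat_fls_def)

lemma X0Q_of_rat: "of_rat c \<in> X0_functions_Q 81"
  using X0C_const[of "of_rat c"] has_q_const[of 1 "of_rat c"] rat_fls_const[of "of_rat c"]
  by (auto simp: X0Q_iff)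
lemma X0Q_add: "f \<in> X0_functions_Q 81 \<Longrightarrow> g \<in> X0_functions_Q 81 \<Longrightarrow> f + g \<in> X0_functions_Q 81"
  unfolding X0Q_iff using X0C_add has_q_add[of 1] rat_fls_add by (meson zero_less_one)
lemma X0Q_mult: "f \<in> X0_functions_Q 81 \<Longrightarrow> g \<in> X0_functions_Q 81 \<Longrightarrow> f * g \<in> X0_functions_Q 81"
  unfolding X0Q_iff using X0C_mult has_q_mult[of 1] rat_fls_mult by (meson zero_less_one)
lemma X0Q_inverse: "f \<in> X0_functions_Q 81 \<Longrightarrow> inverse f \<in> X0_functions_Q 81"
  unfolding X0Q_iff using X0C_inverse has_q_inverse[of 1] rat_fls_inverse by (meson zero_less_one)
lemma X0Q_minus: "f \<in> X0_functions_Q 81 \<Longrightarrow> - f \<in> X0_functions_Q 81"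
  using X0Q_mult[OF X0Q_of_rat[of "- 1"], of f] by (simp add: of_rat_minus)

lemma rat_adjoin_X0Q: "S \<subseteq> X0_functions_Q 81 \<Longrightarrow> rat_adjoin S \<subseteq> X0_functions_Q 81"
proof
  fix f assume S: "S \<subseteq> X0_functions_Q 81" and "f \<in> rat_adjoin S"
  from this(2) show "f \<in> X0_functions_Q 81"
    by (induction rule: rat_adjoin.induct)
       (use S in \<open>auto intro: X0Q_of_rat X0Q_add X0Q_mult X0Q_inverse X0Q_minus\<close>)
qed

section \<open>Passing between level 81 and the conjugate group\<close>

lemma pullback_comp:
  assumes "pos_det M" "pos_det N"
  shows "pos_det (mat_mul M N)" "pullback N (pullback M f) = pullback (mat_mul M N) f"
proof -
  obtain a b c d where M: "M = (a, b, c, d)" by (cases M)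
  obtain a' b' c' d' where N: "N = (a', b', c', d')" by (cases N)
  have "(a * d - b * c) * (a' * d' - b' * c') > 0" using assms by (simp add: M N)
  moreover have "(a * a' + b * c') * (c * b' + d * d') - (a * b' + b * d') * (c * a' + d * c') = (a * d - b * c) * (a' * d' - b' * c')"
    by (simp add: algebra_simps)
  ultimately show p: "pos_det (mat_mul M N)" by (simp add: M N)
  show "pullback N (pullback M f) = pullback (mat_mul M N) f"
  proof (rule pullback_pullback[OF assms _ p])
    fix z assume "z \<in> uhp"
    thus "moeb M (moeb N z) = moeb (mat_mul M N) z"
      unfolding M N mat_mul.simps using assms(2) by (intro moeb_mult[where k = 1, symmetric]) (simp_all add: N)
  qed
qed

lemma moeb_9: "moeb (9, 0, 0, 1) z = 9 * z" and moeb_9': "moeb (1, 0, 0, 9) z = z / 9"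
  by (simp_all add: moeb_def moebius_def)

text \<open>Conjugation by z -> 9z multiplies b by 9 and divides c by 9, which maps Gamma0(81) to
  \<open>Gamma_9_9\<close>. For the expansions the period 81 is used at every cusp.\<close>

lemma pullback_9_X0C:
  assumes "\<And>M. M \<in> Gamma_9_9 \<Longrightarrow> pullback M f = f" "exp_growth_cusps f"
  shows "pullback (9, 0, 0, 1) f \<in> X0_functions_C 81"
proof -
  let ?f = "pullback (9, 0, 0, 1) f"
  have inv: "pullback M ?f = ?f" if M: "M \<in> Gamma0 81" for M
  proof -
    obtain a b c d where Me: "M = (a, b, c, d)" by (cases M)
    have det: "a * d - b * c = 1" and "81 dvd c" using M by (auto simp: Me Gamma0_def SL2Z_def)
    then obtain c' where c: "c = 81 * c'" by auto
    define N where "N = (a, 9 * b, 9 * c', d)"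
    have N: "N \<in> Gamma_9_9" using det by (simp add: N_def Gamma_9_9_def SL2Z_def c)
    have p: "pos_det (9, 0, 0, 1)" by simp
    have "pullback M ?f = pullback (mat_mul (9, 0, 0, 1) M) f"
      by (rule pullback_comp(2)[OF p SL2Z_pos_det[OF Gamma0_SL2Z[OF M]]])
    also have "mat_mul (9, 0, 0, 1) M = mat_mul N (9, 0, 0, 1)" by (simp add: Me N_def c)
    also have "pullback (mat_mul N (9, 0, 0, 1)) f = pullback (9, 0, 0, 1) (pullback N f)"
      by (rule pullback_comp(2)[OF SL2Z_pos_det[OF Gamma_9_9_SL2Z[OF N]] p, symmetric])
    finally show ?thesis by (simp add: assms(1)[OF N])
  qed
  have "\<exists>L. has_q_expansion 81 (pullback M ?f) L" if M: "M \<in> SL2Z" for M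
  proof (rule exp_growth_has_q)
    obtain a b c d where Me: "M = (a, b, c, d)" by (cases M)
    have det: "a * d - b * c = 1" using M by (auto simp: Me SL2Z_def)
    have p: "pos_det (9, 0, 0, 1)" by simp
    have "pullback M ?f = pullback (mat_mul (9, 0, 0, 1) M) f"
      by (rule pullback_comp(2)[OF p SL2Z_pos_det[OF M]])
    thus "exp_growth (pullback M ?f)"
      using exp_growth_hermite[OF _ pullback_comp(1)[OF p SL2Z_pos_det[OF M]], of f] assms(2) by (simp add: exp_growth_cusps_def del: mat_mul.simps)
    have T: "(1, 81, 0, 1) \<in> SL2Z" by (simp add: SL2Z_def)
    \<comment> \<open>This is M T^81 M^(-1), an element of Gamma0(81) for every M in SL2(Z).\<close>
    define G where "G = (1 - 81 * a * c, 81 * a * a, - (81 * c * c), 1 + 81 * a * c)"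
    have "(1 - 81 * a * c) * (1 + 81 * a * c) - (81 * a * a) * (- (81 * c * c)) = 1" by (simp add: algebra_simps)
    hence G: "G \<in> Gamma0 81" unfolding Gamma0_def SL2Z_def G_def by simp
    have e: "mat_mul M (1, 81, 0, 1) = mat_mul G M"
    proof -
      have "(1 - 81 * a * c) * a + 81 * a * a * c = a" "(1 - 81 * a * c) * b + 81 * a * a * d = b + 81 * a * (a * d - b * c)"
        "- (81 * c * c) * a + (1 + 81 * a * c) * c = c" "- (81 * c * c) * b + (1 + 81 * a * c) * d = d + 81 * c * (a * d - b * c)"
        by (simp_all add: algebra_simps)
      thus ?thesis unfolding det by (simp add: Me G_def algebra_simps)
    qed
    have "pullback (1, 81, 0, 1) (pullback M ?f) = pullback M (pullback G ?f)"
      unfolding pullback_mat_mul[OF M T] e pullback_mat_mul[OF Gamma0_SL2Z[OF G] M] ..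
    thus "pullback (1, int 81, 0, 1) (pullback M ?f) = pullback M ?f" by (simp add: inv[OF G])
  qed simp
  with inv show ?thesis by (simp add: X0_functions_C_def)
qed

lemma X0C_pullback:
  assumes "f \<in> X0_functions_C 81"
  shows "pullback (1, 0, 0, 9) f \<in> complex_field {W_mero, F_mero}"
proof (rule Gamma_9_9_field)
  let ?f = "pullback (1, 0, 0, 9) f"
  have inv: "\<And>M. M \<in> Gamma0 81 \<Longrightarrow> pullback M f = f" and q: "\<And>M. M \<in> SL2Z \<Longrightarrow> \<exists>L. has_q_expansion 81 (pullback M f) L"
    using assms by (auto simp: X0_functions_C_def)
  show "pullback M ?f = ?f" if M: "M \<in> Gamma_9_9" for M
  proof -
    obtain a b c d where Me: "M = (a, b, c, d)" by (cases M)
    have det: "a * d - b * c = 1" and "9 dvd b" "9 dvd c" using M by (auto simp: Me Gamma_9_9_def SL2Z_def)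
    then obtain b' c' where bc: "b = 9 * b'" "c = 9 * c'" by (auto elim!: dvdE)
    define N where "N = (a, b', 81 * c', d)"
    have N: "N \<in> Gamma0 81" using det by (simp add: N_def Gamma0_def SL2Z_def bc)
    have p: "pos_det (1, 0, 0, 9)" by simp
    have "pullback M ?f = pullback (mat_mul (1, 0, 0, 9) M) f"
      by (rule pullback_comp(2)[OF p SL2Z_pos_det[OF Gamma_9_9_SL2Z[OF M]]])
    also have "mat_mul (1, 0, 0, 9) M = mat_mul N (1, 0, 0, 9)" by (simp add: Me N_def bc)
    also have "pullback (mat_mul N (1, 0, 0, 9)) f = pullback (1, 0, 0, 9) (pullback N f)"
      by (rule pullback_comp(2)[OF SL2Z_pos_det[OF Gamma0_SL2Z[OF N]] p, symmetric])
    finally show ?thesis by (simp add: inv[OF N])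
  qed
  show "exp_growth_cusps ?f" unfolding exp_growth_cusps_def
  proof
    fix M assume M: "M \<in> SL2Z"
    have p: "pos_det (1, 0, 0, 9)" by simp
    have "pullback M ?f = pullback (mat_mul (1, 0, 0, 9) M) f"
      by (rule pullback_comp(2)[OF p SL2Z_pos_det[OF M]])
    moreover have "exp_growth (pullback G f)" if "G \<in> SL2Z" for G
      using q[OF that] has_q_exp_growth[of 81] by auto
    ultimately show "exp_growth (pullback M ?f)" using exp_growth_hermite[OF _ pullback_comp(1)[OF p SL2Z_pos_det[OF M]], of f] by (simp del: mat_mul.simps)
  qed
qed

text \<open>In eta quotients \<open>W_81\<close> is eta(3z) / eta(27z), and \<open>F_81\<close> is
  eta(9z)^4 / (eta(3z) eta(27z)^3).\<close>

definition W_81 :: mero_uhp where "W_81 = pullback (9, 0, 0, 1) W_mero"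
definition F_81 :: mero_uhp where "F_81 = pullback (9, 0, 0, 1) F_mero"

lemma W_81_X0Q: "W_81 \<in> X0_functions_Q 81" and F_81_X0Q: "F_81 \<in> X0_functions_Q 81"
proof -
  have e: "ee (9 * z / 3) = ee z ^ 3" "ee (- (9 * z) / 9) = 1 / ee z" for z
    by (simp_all add: ee_power ee_minus inverse_eq_divide)
  have evW: "eventually (\<lambda>z. eval_mero W_81 z = klein_1_prod 0 (ee (z / of_nat 1) ^ 3) / klein_0_prod (ee (z / of_nat 1) ^ 3) / ee (z / of_nat 1)) at_cusp"
    using at_cusp_gt[of 0]
  proof eventually_elim
    case (elim z)
    hence z: "z \<in> uhp" "9 * z \<in> uhp" by (simp_all add: uhp_def)
    show ?case using z e[of z] by (simp add: W_81_def eval_pullback moeb_9 eval_W_mero W_fun_expansion)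
  qed
  have evF: "eventually (\<lambda>z. eval_mero F_81 z = klein_1_prod 1 (ee (z / of_nat 1) ^ 3) * klein_1_prod 2 (ee (z / of_nat 1) ^ 3) / klein_0_prod (ee (z / of_nat 1) ^ 3) ^ 2 / ee (z / of_nat 1) ^ 2) at_cusp"
    using at_cusp_gt[of 0]
  proof eventually_elim
    case (elim z)
    hence z: "z \<in> uhp" "9 * z \<in> uhp" by (simp_all add: uhp_def)
    show ?case using z e[of z] by (simp add: F_81_def eval_pullback moeb_9 eval_F_mero F_fun_expansion power_one_over)
  qed
  have "\<exists>L. has_q_expansion 1 W_81 L \<and> rat_fls L" "\<exists>L. has_q_expansion 1 F_81 L \<and> rat_fls L"
    using rational_laurent_WF has_qI[OF zero_less_one _ evW] has_qI[OF zero_less_one _ evF] unfolding rational_laurent_def by blast+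
  moreover have "W_81 \<in> X0_functions_C 81" "F_81 \<in> X0_functions_C 81"
    unfolding W_81_def F_81_def by (intro pullback_9_X0C W_mero_F_mero_Gamma_9_9 exp_growth_cusps_W_mero exp_growth_cusps_F_mero; assumption)+
  ultimately show "W_81 \<in> X0_functions_Q 81" "F_81 \<in> X0_functions_Q 81" by (simp_all add: X0Q_iff)
qed

lemma X0C_complex_field: "f \<in> X0_functions_C 81 \<Longrightarrow> f \<in> complex_field {W_81, F_81}"
proof -
  assume f: "f \<in> X0_functions_C 81"
  have p: "pos_det (9, 0, 0, 1)" by simp
  have *: "pullback (9, 0, 0, 1) a \<in> complex_algebra {W_81, F_81}" if "a \<in> complex_algebra {W_mero, F_mero}" for a
    using that
  proof (induction rule: complex_algebra.induct)
    case (gen s)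
    thus ?case by (auto simp: W_81_def F_81_def intro: complex_algebra.gen)
  qed (simp_all add: pullback_mconst pullback_add pullback_mult complex_algebra.intros del: pos_det.simps add: p)
  obtain a b where ab: "a \<in> complex_algebra {W_mero, F_mero}" "b \<in> complex_algebra {W_mero, F_mero}" "b \<noteq> 0" "pullback (1, 0, 0, 9) f = a / b"
    using X0C_pullback[OF f] unfolding complex_field_def by blast
  have inverse9: "pullback (9, 0, 0, 1) (pullback (1, 0, 0, 9) g) = g" "pullback (1, 0, 0, 9) (pullback (9, 0, 0, 1) g) = g" for g
    by (rule eval_mero_eqI; simp add: eval_pullback pos_det_moeb_uhp moeb_9 moeb_9' uhp_def)+
  have "f = pullback (9, 0, 0, 1) a / pullback (9, 0, 0, 1) b"
    using inverse9(1)[of f] unfolding ab(4) by (simp add: pullback_divide)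
  moreover have "pullback (9, 0, 0, 1) b \<noteq> 0"
    using inverse9(2)[of b] ab(3) pullback_mconst[of "(1, 0, 0, 9)" 0] by auto
  ultimately show ?thesis using *[OF ab(1)] *[OF ab(2)] unfolding complex_field_def by blast
qed

section \<open>Descent to the rational numbers\<close>

text \<open>Over the rationals {c} is independent in the complex numbers, and a linear functional
  can be prescribed on an independent set. The normalisation at c keeps a denominator nonzero in
  \<open>descent\<close>.\<close>

lemma rational_functional:
  assumes "c \<noteq> (0 :: complex)"
  obtains lam :: "complex \<Rightarrow> rat" where "\<And>u v. lam (u + v) = lam u + lam v"
    "\<And>r u. lam (of_rat r * u) = r * lam u" "lam c = 1"
proof -
  interpret V: vector_space_pair "\<lambda>(r::rat) (u::complex). of_rat r * u" "(*) :: rat \<Rightarrow> rat \<Rightarrow> rat"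
    by unfold_locales (auto simp: algebra_simps of_rat_add of_rat_mult)
  have ind: "V.vs1.independent {c}" using assms by simp
  define lam where "lam = V.construct {c} (\<lambda>_. 1)"
  have lin: "Vector_Spaces.linear (\<lambda>(r::rat) (u::complex). of_rat r * u) (*) lam"
    unfolding lam_def by (rule V.linear_construct[OF ind])
  show ?thesis
  proof (rule that)
    show "lam (u + v) = lam u + lam v" for u v by (rule V.linear_add[OF lin])
    show "lam (of_rat r * u) = r * lam u" for r u by (rule V.linear_scale[OF lin])
    show "lam c = 1" unfolding lam_def by (rule V.construct_basis[OF ind]) simp
  qed
qed

text \<open>A rational functional is applied to the coefficients of a linear combination of elements of \<open>B\<close>.\<close>

inductive twisted :: "(complex \<Rightarrow> rat) \<Rightarrow> mero_uhp set \<Rightarrow> mero_uhp \<Rightarrow> mero_uhp \<Rightarrow> bool" for lam B where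
  zero: "twisted lam B 0 0"
| step: "m \<in> B \<Longrightarrow> twisted lam B a a' \<Longrightarrow> twisted lam B (mconst c * m + a) (of_rat (lam c) * m + a')"

lemma twisted_add:
  "twisted lam B a a' \<Longrightarrow> twisted lam B b b' \<Longrightarrow> twisted lam B (a + b) (a' + b')"
  by (induction rule: twisted.induct) (auto simp: add.assoc intro: twisted.intros)

lemma twisted_mult:
  assumes "twisted lam B a a'" "\<And>m. m \<in> B \<Longrightarrow> f * m \<in> B'"
  shows "twisted lam B' (f * a) (f * a')"
  using assms(1)
proof (induction rule: twisted.induct)
  case (step m a a' c)
  have "twisted lam B' (mconst c * (f * m) + f * a) (of_rat (lam c) * (f * m) + f * a')"
    by (rule twisted.step[OF assms(2)]) (use step in auto)
  thus ?case by (simp add: algebra_simps)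
qed (simp add: twisted.zero)

lemma twisted_cmult:
  assumes "twisted lam B a a'" shows "\<exists>b'. twisted lam B (mconst d * a) b'"
  using assms
proof (induction rule: twisted.induct)
  case (step m a a' c)
  then obtain b' where "twisted lam B (mconst d * a) b'" by blast
  from twisted.step[OF step(1) this, of "d * c"]
  have "twisted lam B (mconst (d * c) * m + mconst d * a) (of_rat (lam (d * c)) * m + b')" .
  thus ?case by (auto simp: mconst_mult algebra_simps)
qed (auto intro: twisted.zero)

text \<open>\<open>twisted\<close> is a relation because an element can be written as a combination
  in several ways. The functional is not multiplicative, so for a product one factor is expanded and
  the coefficients are collected anew.\<close>

lemma complex_algebra_twisted:
  assumes "a \<in> complex_algebra S" shows "\<exists>a'. twisted lam (rat_adjoin S) a a'"
  using assms
proof (induction rule: complex_algebra.induct)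
  case (const c)
  have "1 \<in> rat_adjoin S" using rat_adjoin.rat[of 1 S] by simp
  from twisted.step[OF this twisted.zero, of lam c] show ?case by auto
next
  case (gen s)
  from twisted.step[OF rat_adjoin.gen[OF gen] twisted.zero, of lam 1] show ?case by auto
next
  case (add a b)
  thus ?case using twisted_add by blast
next
  case (mult a b)
  then obtain a' b' where ab: "twisted lam (rat_adjoin S) a a'" "twisted lam (rat_adjoin S) b b'" by blast
  from ab(1) show ?case
  proof (induction rule: twisted.induct)
    case (step m a a' c)
    then obtain e where "twisted lam (rat_adjoin S) (a * b) e" by blast
    moreover have "twisted lam (rat_adjoin S) (m * b) (m * b')"
      by (rule twisted_mult[OF ab(2)]) (auto intro: rat_adjoin.mult step(1))
    then obtain e' where "twisted lam (rat_adjoin S) (mconst c * (m * b)) e'" using twisted_cmult by blast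
    ultimately have "twisted lam (rat_adjoin S) (mconst c * (m * b) + a * b) (e' + e)" by (intro twisted_add)
    thus ?case by (auto simp: algebra_simps)
  qed (auto intro: twisted.zero)
qed

lemma twisted_rat_adjoin: "twisted lam (rat_adjoin S) a a' \<Longrightarrow> a' \<in> rat_adjoin S"
proof (induction rule: twisted.induct)
  case zero
  show ?case using rat_adjoin.rat[of 0 S] by simp
qed (auto intro: rat_adjoin.intros)

text \<open>The elements of B have rational expansions, so the functional, being linear over the
  rationals, acts on the complex coefficients alone. On expansions the twist is thus coefficientwise
  and does not depend on the chosen combination.\<close>

lemma twisted_expansion:
  assumes "twisted lam B a a'" "B \<subseteq> X0_functions_Q 81"
    and lam: "\<And>u v. lam (u + v) = lam u + lam v" "\<And>r u. lam (of_rat r * u) = r * lam u"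
  shows "\<exists>L L'. has_q_expansion 1 a L \<and> has_q_expansion 1 a' L' \<and> (\<forall>n. fls_nth L' n = of_rat (lam (fls_nth L n)))"
  using assms(1)
proof (induction rule: twisted.induct)
  case zero
  have "lam 0 = 0" using lam(2)[of 0 0] by simp
  thus ?case using has_q_const[of 1 0] by (intro exI[of _ 0]) auto
next
  case (step m a a' c)
  obtain L L' where L: "has_q_expansion 1 a L" "has_q_expansion 1 a' L'" "\<And>n. fls_nth L' n = of_rat (lam (fls_nth L n))"
    using step.IH by blast
  obtain M where M: "has_q_expansion 1 m M" "rat_fls M" using step.hyps(1) assms(2) X0Q_iff by blast
  show ?case
  proof (intro exI conjI allI)
    show "has_q_expansion 1 (mconst c * m + a) (fls_const c * M + L)"
      by (intro has_q_add has_q_cmult L M) simp_all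
    show "has_q_expansion 1 (of_rat (lam c) * m + a') (fls_const (of_rat (lam c)) * M + L')"
      using has_q_add[OF _ has_q_cmult[OF _ M(1), of "of_rat (lam c)"] L(2)] by simp
    fix n
    obtain r where r: "fls_nth M n = of_rat r" using M(2) by (auto simp: rat_fls_def Rats_def)
    have "lam (c * of_rat r + fls_nth L n) = r * lam c + lam (fls_nth L n)"
      using lam(1)[of "of_rat r * c"] lam(2)[of r c] by (simp add: mult.commute)
    thus "fls_nth (fls_const (of_rat (lam c)) * M + L') n = of_rat (lam (fls_nth (fls_const c * M + L) n))"
      by (simp add: r L(3) fls_mult_const_nth of_rat_add of_rat_mult)
  qed
qed

text \<open>With f = a / b, the relation f b - a = 0 is a combination, with complex coefficients, of
  elements f m and m that have rational expansions. The functional turns it into f b' - a' = 0, and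
  b' is nonzero because one coefficient of b is sent to 1.\<close>

theorem descent:
  assumes f: "f \<in> X0_functions_Q 81" "f \<in> complex_field S" and S: "S \<subseteq> X0_functions_Q 81"
  shows "f \<in> rat_adjoin S"
proof -
  let ?B = "rat_adjoin S"
  have B: "?B \<subseteq> X0_functions_Q 81" by (rule rat_adjoin_X0Q[OF S])
  obtain a b where ab: "a \<in> complex_algebra S" "b \<in> complex_algebra S" "b \<noteq> 0" "f = a / b" using f(2) unfolding complex_field_def by blast
  \<comment> \<open>The zero functional: only the expansion of b supplied by
    \<open>twisted_expansion\<close> is wanted here, in order to pick a nonzero coefficient.\<close>
  obtain b0 where "twisted (\<lambda>_. 0) ?B b b0" using complex_algebra_twisted[OF ab(2)] by blast
  from twisted_expansion[OF this B] obtain L where L: "has_q_expansion 1 b L" by auto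
  have "L \<noteq> 0" using L has_q_zero ab(3) by auto
  then obtain n where n: "fls_nth L n \<noteq> 0" using fls_eqI[of L 0] by auto
  obtain lam where lam: "\<And>u v. lam (u + v) = lam u + lam v" "\<And>r u. lam (of_rat r * u) = r * lam u" "lam (fls_nth L n) = 1"
    using rational_functional[OF n] by metis
  obtain a' b' where ab': "twisted lam ?B a a'" "twisted lam ?B b b'" using complex_algebra_twisted ab by blast
  have b'0: "b' \<noteq> 0"
  proof
    assume "b' = 0"
    from twisted_expansion[OF ab'(2) B lam(1,2)] obtain M M' where M: "has_q_expansion 1 b M" "has_q_expansion 1 b' M'"
      "\<And>n. fls_nth M' n = of_rat (lam (fls_nth M n))" by blast
    have "has_q_expansion 1 (b + mconst (- 1) * b) (M + fls_const (- 1) * L)"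
      by (intro has_q_add has_q_cmult M L) simp_all
    moreover have "b + mconst (- 1) * b = 0" by (simp add: mconst_minus)
    ultimately have "has_q_expansion 1 0 (M + fls_const (- 1) * L)" by (simp only:)
    hence "M + fls_const (- 1) * L = 0" by (rule has_q_of_0[rotated]) simp
    hence "fls_nth (M + fls_const (- 1) * L) n = 0" by simp
    hence "fls_nth M n = fls_nth L n" by (simp add: fls_mult_const_nth)
    hence "fls_nth M' n = 1" using M(3) lam(3) by simp
    moreover have "M' = 0" using M(2) has_q_of_0[of 1] \<open>b' = 0\<close> by simp
    ultimately show False by simp
  qed
  have fB: "f * m \<in> X0_functions_Q 81" if "m \<in> ?B" for m using X0Q_mult[OF f(1)] that B by blast
  have "twisted lam (X0_functions_Q 81) (f * b) (f * b')" by (rule twisted_mult[OF ab'(2) fB])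
  moreover have "twisted lam (X0_functions_Q 81) ((- 1) * a) ((- 1) * a')"
    by (rule twisted_mult[OF ab'(1)]) (use B X0Q_minus in auto)
  ultimately have "twisted lam (X0_functions_Q 81) (f * b + (- 1) * a) (f * b' + (- 1) * a')" by (rule twisted_add)
  moreover have "f * b + (- 1) * a = 0" using ab by simp
  ultimately have "twisted lam (X0_functions_Q 81) 0 (f * b' + (- 1) * a')" by simp
  from twisted_expansion[OF this order.refl lam(1,2)] obtain M M' where M: "has_q_expansion 1 0 M"
    "has_q_expansion 1 (f * b' + (- 1) * a') M'" "\<And>n. fls_nth M' n = of_rat (lam (fls_nth M n))" by blast
  have "M = 0" using M(1) has_q_of_0[of 1] by simp
  moreover have "lam 0 = 0" using lam(2)[of 0 0] by simp
  ultimately have "M' = 0" using M(3) by (intro fls_eqI) simp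
  hence "f * b' + (- 1) * a' = 0" using M(2) has_q_zero by blast
  hence "f = a' * inverse b'" using b'0 by (simp add: field_simps)
  thus ?thesis using twisted_rat_adjoin[OF ab'(1)] twisted_rat_adjoin[OF ab'(2)]
    by (auto intro: rat_adjoin.intros)
qed

section \<open>The equations\<close>

text \<open>Since g^2 + g p + p^2 = 3 (x + 1), factoring g^3 - p^3 = 9 (1 - p) gives the second
  identity. Substituting g = p (x - 1) - y + 1 into it gives the third, so that p and g are
  recovered from x and y.\<close>

lemma elliptic_identity:
  fixes p g x y :: "'a :: field_char_0"
  assumes g: "g ^ 3 = p ^ 3 - 9 * p + 9" and x: "3 * x = g ^ 2 + g * p + p ^ 2 - 3"
    and y: "3 * y = p * (3 * x + 3) - 6 * p - 3 * g + 3"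
  shows "y ^ 2 + y = x ^ 3" "g * (x + 1) = p * (x + 1) + 3 * (1 - p)" "p * (x ^ 2 - x + 1) = (y - 1) * (x + 1) + 3"
proof -
  have c: "3 * u = 3 * v \<Longrightarrow> u = v" "27 * u = 27 * v \<Longrightarrow> u = v" for u v :: 'a by simp_all
  have y': "y = p * (x - 1) - g + 1"
  proof -
    have "3 * y = 3 * (p * (x - 1) - g + 1)" unfolding y by (simp add: algebra_simps)
    thus ?thesis by (rule c)
  qed
  have 1: "3 * (g * (x + 1)) = 3 * (p * (x + 1) + 3 * (1 - p))" using g x by algebra
  thus 2: "g * (x + 1) = p * (x + 1) + 3 * (1 - p)" by (rule c)
  show 3: "p * (x ^ 2 - x + 1) = (y - 1) * (x + 1) + 3" using 2 unfolding y' by algebra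
  have "27 * (y ^ 2 + y) = 27 * x ^ 3" using g x unfolding y' by algebra
  thus "y ^ 2 + y = x ^ 3" by (rule c)
qed

text \<open>Multiplication by (x^2 - x + 1)^2 turns p into a polynomial in x and y, after which the
  claim is an identity modulo the Weierstrass equation.\<close>

lemma quadratic_identity:
  fixes p x y :: "'a :: field_char_0"
  assumes y: "y ^ 2 + y = x ^ 3" and p: "p * (x ^ 2 - x + 1) = (y - 1) * (x + 1) + 3" and D: "x ^ 2 - x + 1 \<noteq> 0"
  shows "(p ^ 2 - 12) * (- 11 - 2 * x + 6 * x ^ 2 - 5 * x ^ 3 + x ^ 4 + (- 12 + 15 * x - 3 * x ^ 2) * y) ^ 2 =
     - 968 + 132 * x + 837 * x^2 - 3213 * x^3 + 4107 * x^4 - 2223 * x^5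
            + 510 * x^6 - 21 * x^7 - 9 * x^8 + x^9
            - 3 * (- 1 + x) * (- 29 + 27 * x - 9 * x^2 + x^3)
                * (11 + 24 * x - 15 * x^2 + 2 * x^3) * y" (is "_ * ?h ^ 2 = ?R")
proof -
  have e: "d ^ 2 * ((p ^ 2 - 12) * k ^ 2) = ((p * d) ^ 2 - 12 * d ^ 2) * k ^ 2" for d k :: 'a by algebra
  have "(x ^ 2 - x + 1) ^ 2 * ((p ^ 2 - 12) * ?h ^ 2) = ((p * (x ^ 2 - x + 1)) ^ 2 - 12 * (x ^ 2 - x + 1) ^ 2) * ?h ^ 2"
    by (rule e)
  also have "\<dots> = (x ^ 2 - x + 1) ^ 2 * ?R"
    unfolding p using y by algebra
  finally show ?thesis using D by simp
qed

subsection \<open>Evaluation of polynomials\<close>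

lemma poly_map_hom:
  fixes h :: "'a :: comm_ring_1 \<Rightarrow> 'b :: comm_ring_1"
  assumes h: "h 0 = 0" "\<And>a b. h (a + b) = h a + h b" "\<And>a b. h (a * b) = h a * h b"
  shows "poly (map_poly h (p + q)) v = poly (map_poly h p) v + poly (map_poly h q) v"
    "poly (map_poly h (p * q)) v = poly (map_poly h p) v * poly (map_poly h q) v"
proof -
  have add: "poly (map_poly h (p + q)) v = poly (map_poly h p) v + poly (map_poly h q) v" for p q
  proof -
    have "map_poly h (p + q) = map_poly h p + map_poly h q"
      by (rule poly_eqI) (simp add: coeff_map_poly h)
    thus ?thesis by simp
  qed
  show "poly (map_poly h (p + q)) v = poly (map_poly h p) v + poly (map_poly h q) v" by (rule add)
  have smult: "poly (map_poly h (smult c q)) v = h c * poly (map_poly h q) v" for c q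
  proof -
    have "map_poly h (smult c q) = smult (h c) (map_poly h q)"
      by (rule poly_eqI) (simp add: coeff_map_poly h)
    thus ?thesis by simp
  qed
  show "poly (map_poly h (p * q)) v = poly (map_poly h p) v * poly (map_poly h q) v"
  proof (induction p)
    case (pCons c p)
    have "poly (map_poly h (pCons 0 (p * q))) v = v * poly (map_poly h (p * q)) v"
      by (subst map_poly_pCons) (simp_all add: h)
    thus ?case unfolding mult_pCons_left add smult using pCons
      by (simp add: map_poly_pCons h algebra_simps)
  qed simp
qed

text \<open>\<open>eval3\<close> consists of three nested evaluations, each a ring homomorphism
  because the inner one is. The third formula evaluates the normal forms a(X) + b(X) Y.\<close>

lemma eval3_hom:
  "eval3 x y t (P + Q) = eval3 x y t P + eval3 x y t Q"
  "eval3 x y t (P * Q) = eval3 x y t P * eval3 x y t Q"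
  "eval3 x y t [:[:a, b:]:] = poly (map_poly of_rat a) x + poly (map_poly of_rat b) x * y"
proof -
  define e1 where "e1 = (\<lambda>r. poly (map_poly of_rat r) x)"
  have e1: "e1 0 = 0" "e1 (a + b) = e1 a + e1 b" "e1 (a * b) = e1 a * e1 b" for a b
    unfolding e1_def by (simp, (rule poly_map_hom; simp add: of_rat_add of_rat_mult)+)
  define e2 where "e2 = (\<lambda>p. poly (map_poly e1 p) y)"
  have e2: "e2 0 = 0" "e2 (a + b) = e2 a + e2 b" "e2 (a * b) = e2 a * e2 b" for a b
    unfolding e2_def by (simp, (rule poly_map_hom; simp add: e1)+)
  have e3: "eval3 x y t P = poly (map_poly e2 P) t" for P
    unfolding eval3_def e2_def e1_def ..
  show "eval3 x y t (P + Q) = eval3 x y t P + eval3 x y t Q" "eval3 x y t (P * Q) = eval3 x y t P * eval3 x y t Q"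
    unfolding e3 by (rule poly_map_hom; simp add: e2)+
  have "eval3 x y t [:[:a, b:]:] = e1 a + y * e1 b"
    unfolding e3 by (subst map_poly_pCons; simp add: e2) (simp add: e2_def map_poly_pCons e1)
  thus "eval3 x y t [:[:a, b:]:] = poly (map_poly of_rat a) x + poly (map_poly of_rat b) x * y"
    by (simp add: e1_def mult.commute)
qed

lemma eval3_1: "eval3 x y t 1 = 1"
  using eval3_hom(3)[of x y t 1 0] by (simp add: one_pCons map_poly_pCons)

lemma eval3_0: "eval3 x y t 0 = 0"
  using eval3_hom(3)[of x y t 0 0] by simp

lemma eval3_minus: "eval3 x y t (- P) = - eval3 x y t P"
  using eval3_hom(1)[of x y t P "- P"] by (simp add: eval3_0 add_eq_0_iff)

lemma eval3_diff: "eval3 x y t (P - Q) = eval3 x y t P - eval3 x y t Q"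
  using eval3_hom(1)[of x y t P "- Q"] by (simp add: eval3_minus)

lemma eval3_power: "eval3 x y t (P ^ n) = eval3 x y t P ^ n"
  by (induction n) (simp_all add: eval3_1 eval3_hom)

lemma eval3_of_nat: "eval3 x y t (of_nat n) = of_nat n"
  by (induction n) (simp_all add: eval3_0 eval3_1 eval3_hom)

lemma eval3_numeral: "eval3 x y t (numeral n) = numeral n"
  using eval3_of_nat[of x y t "numeral n"] by simp

lemmas eval3_simps = eval3_hom(1,2) eval3_diff eval3_minus eval3_power eval3_numeral eval3_1 eval3_0

subsection \<open>Normal forms modulo the two equations\<close>

abbreviation elliptic_poly :: rat_poly3 where "elliptic_poly \<equiv> Y3^2 + Y3 - X3^3"

lemma ideal2_0: "0 \<in> ideal_generated2 E F"
  unfolding ideal_generated2_def by (intro CollectI exI[of _ 0]) simp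
lemma ideal2_add:
  assumes "P \<in> ideal_generated2 E F" "Q \<in> ideal_generated2 E F"
  shows "P + Q \<in> ideal_generated2 E F"
proof -
  obtain U V U' V' where "P = U * E + V * F" "Q = U' * E + V' * F"
    using assms unfolding ideal_generated2_def by blast
  hence "P + Q = (U + U') * E + (V + V') * F" by (simp add: algebra_simps)
  thus ?thesis unfolding ideal_generated2_def by blast
qed
lemma ideal2_mult:
  assumes "P \<in> ideal_generated2 E F" shows "Q * P \<in> ideal_generated2 E F"
proof -
  obtain U V where "P = U * E + V * F" using assms unfolding ideal_generated2_def by blast
  hence "Q * P = (Q * U) * E + (Q * V) * F" by (simp add: algebra_simps)
  thus ?thesis unfolding ideal_generated2_def by blast
qed
lemma ideal2_gen: "E \<in> ideal_generated2 E F" "F \<in> ideal_generated2 E F"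
  unfolding ideal_generated2_def
  by (intro CollectI exI[of _ 1] exI[of _ 0], simp, intro CollectI exI[of _ 0] exI[of _ 1], simp)

text \<open>The brackets encode a(X) + b(X) Y, constant in T: the remainders of division by the
  Weierstrass polynomial, which is monic of degree 2 in Y.\<close>

definition linear_mod :: "rat_poly3 set \<Rightarrow> rat_poly3 set" where
  "linear_mod I = {P. \<exists>a b. P - [:[:a, b:]:] \<in> I}"

context
  fixes F :: rat_poly3 and I :: "rat_poly3 set"
  defines "I \<equiv> ideal_generated2 elliptic_poly F"
begin

lemma I_rules: "0 \<in> I" "P \<in> I \<Longrightarrow> Q \<in> I \<Longrightarrow> P + Q \<in> I" "P \<in> I \<Longrightarrow> R * P \<in> I" "elliptic_poly \<in> I" "F \<in> I"
  unfolding I_def by (rule ideal2_0, erule (1) ideal2_add, erule ideal2_mult, rule ideal2_gen, rule ideal2_gen)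

lemma linear_mod_const: "[:[:a, b:]:] \<in> linear_mod I"
  unfolding linear_mod_def using I_rules(1) by (metis (mono_tags, lifting) diff_self mem_Collect_eq)

lemma linear_mod_add: "P \<in> linear_mod I \<Longrightarrow> Q \<in> linear_mod I \<Longrightarrow> P + Q \<in> linear_mod I"
proof -
  assume "P \<in> linear_mod I" "Q \<in> linear_mod I"
  then obtain a b c d where "P - [:[:a, b:]:] \<in> I" "Q - [:[:c, d:]:] \<in> I" unfolding linear_mod_def by blast
  hence "(P - [:[:a, b:]:]) + (Q - [:[:c, d:]:]) \<in> I" by (rule I_rules)
  moreover have "(P - [:[:a, b:]:]) + (Q - [:[:c, d:]:]) = (P + Q) - [:[:a + c, b + d:]:]"
    by (simp add: algebra_simps)
  ultimately show ?thesis unfolding linear_mod_def by auto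
qed

lemma const_Y: "[:[:a, b:]:] = [:[:a:]:] + [:[:b:]:] * Y3"
  by (simp add: Y3_def)

lemma linear_mod_mult: "P \<in> linear_mod I \<Longrightarrow> Q \<in> linear_mod I \<Longrightarrow> P * Q \<in> linear_mod I"
proof -
  assume "P \<in> linear_mod I" "Q \<in> linear_mod I"
  then obtain a b c d where ab: "P - [:[:a, b:]:] \<in> I" and cd: "Q - [:[:c, d:]:] \<in> I" unfolding linear_mod_def by blast
  let ?x = "[:0, 1:] :: rat poly"
  \<comment> \<open>The product (a + b Y)(c + d Y) with Y^2 replaced by X^3 - Y.\<close>
  let ?R = "[:[:a * c + b * d * ?x ^ 3, a * d + b * c - b * d:]:] :: rat_poly3"
  have X: "[:[:?x ^ 3:]:] = X3 ^ 3" by (simp add: X3_def power3_eq_cube)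
  have R: "?R = [:[:a:]:] * [:[:c:]:] + [:[:b:]:] * [:[:d:]:] * X3 ^ 3 +
      ([:[:a:]:] * [:[:d:]:] + [:[:b:]:] * [:[:c:]:] - [:[:b:]:] * [:[:d:]:]) * Y3"
    unfolding X[symmetric] Y3_def by simp
  have "Q * (P - [:[:a, b:]:]) + ([:[:a, b:]:] * (Q - [:[:c, d:]:]) + ([:[:b:]:] * [:[:d:]:]) * elliptic_poly) \<in> I"
    by (intro I_rules ab cd)
  also have "Q * (P - [:[:a, b:]:]) + ([:[:a, b:]:] * (Q - [:[:c, d:]:]) + ([:[:b:]:] * [:[:d:]:]) * elliptic_poly) = P * Q - ?R"
    unfolding R const_Y[of a b] const_Y[of c d] by algebra
  finally show ?thesis unfolding linear_mod_def by blast
qed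

lemma linear_mod_numeral: "numeral n \<in> linear_mod I" and linear_mod_1: "1 \<in> linear_mod I"
  using linear_mod_const[of "numeral n" 0] linear_mod_const[of 1 0] by (simp_all add: numeral_poly one_pCons)
lemma linear_mod_X: "X3 \<in> linear_mod I" and linear_mod_Y: "Y3 \<in> linear_mod I"
  using linear_mod_const[of "[:0, 1:]" 0] linear_mod_const[of 0 1] by (simp_all add: X3_def Y3_def one_pCons)
lemma linear_mod_minus: "P \<in> linear_mod I \<Longrightarrow> - P \<in> linear_mod I"
proof -
  assume "P \<in> linear_mod I"
  hence "[:[:- 1, 0:]:] * P \<in> linear_mod I" by (rule linear_mod_mult[OF linear_mod_const])
  moreover have "([:[:- 1, 0:]:] :: rat_poly3) = - 1" by (simp add: one_pCons)
  ultimately show ?thesis by (simp only: mult_minus1)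
qed
lemma linear_mod_diff: "P \<in> linear_mod I \<Longrightarrow> Q \<in> linear_mod I \<Longrightarrow> P - Q \<in> linear_mod I"
  using linear_mod_add[OF _ linear_mod_minus] by fastforce
lemma linear_mod_power: "P \<in> linear_mod I \<Longrightarrow> P ^ n \<in> linear_mod I"
  by (induction n) (simp_all add: linear_mod_1 linear_mod_mult)

lemma linear_mod_pconst: "[:\<alpha>:] \<in> linear_mod I"
proof (induction \<alpha>)
  case 0
  show ?case using linear_mod_const[of 0 0] by simp
next
  case (pCons r \<beta>)
  have "[:pCons r \<beta>:] = [:[:r, 0:]:] + Y3 * [:\<beta>:]" by (simp add: Y3_def)
  thus ?case using linear_mod_add[OF linear_mod_const linear_mod_mult[OF linear_mod_Y pCons(2)], of r 0] by simp
qed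

lemmas linear_mod_intros = linear_mod_add linear_mod_mult linear_mod_minus linear_mod_diff linear_mod_power linear_mod_numeral linear_mod_1 linear_mod_X linear_mod_Y

text \<open>Division by F, monic of degree 2 in T, followed by reduction of the two coefficients
  modulo the Weierstrass polynomial.\<close>

lemma normal_form:
  assumes F: "F = T3 ^ 2 - R" and R: "R \<in> linear_mod I"
  shows "\<exists>a b c d. P - ([:[:a, b:]:] + [:[:c, d:]:] * T3) \<in> I"
proof -
  have "\<exists>A\<in>linear_mod I. \<exists>B\<in>linear_mod I. P - (A + B * T3) \<in> I"
  proof (induction P)
    case 0
    show ?case using I_rules(1) linear_mod_const[of 0 0] by (intro bexI[of _ 0]) auto
  next
    case (pCons \<alpha> Q)
    then obtain A B where AB: "A \<in> linear_mod I" "B \<in> linear_mod I" "Q - (A + B * T3) \<in> I" by blast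
    have e: "pCons \<alpha> Q = [:\<alpha>:] + T3 * Q" by (simp add: T3_def)
    \<comment> \<open>The product T (A + B T) equals A T + B T^2, and T^2 becomes R modulo
      F.\<close>
    have "T3 * (Q - (A + B * T3)) + B * F \<in> I" by (intro I_rules AB)
    also have "T3 * (Q - (A + B * T3)) + B * F = pCons \<alpha> Q - (([:\<alpha>:] + B * R) + A * T3)"
      unfolding e F by algebra
    finally show ?case using AB R by (intro bexI[of _ "[:\<alpha>:] + B * R"] bexI[of _ A] linear_mod_add linear_mod_mult linear_mod_pconst)
  qed
  then obtain A B where AB: "A \<in> linear_mod I" "B \<in> linear_mod I" "P - (A + B * T3) \<in> I" by blast
  then obtain a b c d where "A - [:[:a, b:]:] \<in> I" "B - [:[:c, d:]:] \<in> I" unfolding linear_mod_def by blast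
  hence "(P - (A + B * T3)) + ((A - [:[:a, b:]:]) + T3 * (B - [:[:c, d:]:])) \<in> I" by (intro I_rules AB)
  also have "(P - (A + B * T3)) + ((A - [:[:a, b:]:]) + T3 * (B - [:[:c, d:]:])) = P - ([:[:a, b:]:] + [:[:c, d:]:] * T3)"
    by algebra
  finally show ?thesis by blast
qed

text \<open>A polynomial in the kernel has a normal form in the kernel, and independence makes that
  form zero. So the kernel is exactly the ideal, whose primality comes out as a consequence.\<close>

theorem function_field:
  fixes x y t :: "'a :: field_char_0"
  assumes F: "F = T3 ^ 2 - R" and R: "R \<in> linear_mod I" and y: "y ^ 2 + y = x ^ 3" and t: "t ^ 2 = eval3 x y t R"
    and indep: "\<And>a b c d. (poly (map_poly of_rat a) x + poly (map_poly of_rat b) x * y) +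
       (poly (map_poly of_rat c) x + poly (map_poly of_rat d) x * y) * t = 0 \<Longrightarrow> a = 0 \<and> b = 0 \<and> c = 0 \<and> d = 0"
  shows "is_function_field_via (eval3 x y t) I (rat_adjoin {x, y, t})"
proof -
  let ?e = "eval3 x y t"
  have EF: "?e elliptic_poly = 0" "?e F = 0" using y t by (simp_all add: F eval3_simps)
  have I0: "?e P = 0" if "P \<in> I" for P
    using that EF unfolding I_def ideal_generated2_def by (auto simp: eval3_hom simp del: eval3_variables)
  have "{P. ?e P = 0} = I"
  proof (intro equalityI subsetI)
    fix P assume "P \<in> {P. ?e P = 0}"
    hence P: "?e P = 0" by simp
    obtain a b c d where r: "P - ([:[:a, b:]:] + [:[:c, d:]:] * T3) \<in> I" using normal_form[OF F R] by blast
    have "?e ([:[:a, b:]:] + [:[:c, d:]:] * T3) = 0" using I0[OF r] P by (simp add: eval3_diff)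
    hence "a = 0 \<and> b = 0 \<and> c = 0 \<and> d = 0"
      unfolding eval3_hom eval3_variables by (rule indep)
    thus "P \<in> I" using r by simp
  qed (use I0 in simp)
  moreover have "rat_adjoin {x, y, t} = {?e P / ?e Q | P Q. ?e Q \<noteq> 0}"
  proof (intro equalityI subsetI)
    fix f assume "f \<in> rat_adjoin {x, y, t}"
    thus "f \<in> {?e P / ?e Q | P Q. ?e Q \<noteq> 0}"
    proof (induction rule: rat_adjoin.induct)
      case (rat c)
      have "?e [:[:[:c:], 0:]:] = of_rat c" unfolding eval3_hom(3) by (simp add: map_poly_pCons)
      thus ?case by (intro CollectI exI[of _ "[:[:[:c:], 0:]:]"] exI[of _ 1]) (simp add: eval3_1)
    next
      case (gen s)
      then obtain P where "?e P = s" by (auto intro: eval3_variables)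
      thus ?case by (intro CollectI exI[of _ P] exI[of _ 1]) (simp add: eval3_1)
    next
      case (add a b)
      then obtain P Q P' Q' where "a = ?e P / ?e Q" "?e Q \<noteq> 0" "b = ?e P' / ?e Q'" "?e Q' \<noteq> 0" by blast
      hence "a + b = ?e (P * Q' + P' * Q) / ?e (Q * Q') \<and> ?e (Q * Q') \<noteq> 0"
        by (simp add: eval3_hom add_frac_eq)
      thus ?case by blast
    next
      case (uminus a)
      then obtain P Q where "a = ?e P / ?e Q" "?e Q \<noteq> 0" by blast
      thus ?case by (intro CollectI exI[of _ "- P"] exI[of _ Q]) (simp add: eval3_minus)
    next
      case (mult a b)
      then obtain P Q P' Q' where "a = ?e P / ?e Q" "?e Q \<noteq> 0" "b = ?e P' / ?e Q'" "?e Q' \<noteq> 0" by blast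
      thus ?case by (intro CollectI exI[of _ "P * P'"] exI[of _ "Q * Q'"]) (simp add: eval3_hom)
    next
      case (inverse a)
      then obtain P Q where PQ: "a = ?e P / ?e Q" "?e Q \<noteq> 0" by blast
      show ?case
      proof (cases "?e P = 0")
        case True
        thus ?thesis using PQ by (intro CollectI exI[of _ 0] exI[of _ 1]) (simp add: eval3_0 eval3_1)
      next
        case False
        thus ?thesis using PQ by (intro CollectI exI[of _ Q] exI[of _ P]) simp
      qed
    qed
  next
    fix f assume "f \<in> {?e P / ?e Q | P Q. ?e Q \<noteq> 0}"
    then obtain P Q where f: "f = ?e P * inverse (?e Q)" by (auto simp: divide_inverse)
    have ra0: "0 \<in> rat_adjoin S" for S :: "'a set" using rat_adjoin.rat[of 0 S] by simp
    have p1: "poly (map_poly of_rat r) x \<in> rat_adjoin {x, y, t}" for r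
    proof (induction r)
      case (pCons a r)
      have "of_rat a + x * poly (map_poly of_rat r) x \<in> rat_adjoin {x, y, t}"
        by (intro rat_adjoin.add rat_adjoin.rat rat_adjoin.mult pCons rat_adjoin.gen) simp
      thus ?case by (simp add: map_poly_pCons)
    qed (simp add: ra0)
    have "?e P \<in> rat_adjoin {x, y, t}" for P
    proof -
      obtain a b c d where r: "P - ([:[:a, b:]:] + [:[:c, d:]:] * T3) \<in> I" using normal_form[OF F R] by blast
      have "?e P = ?e ([:[:a, b:]:] + [:[:c, d:]:] * T3)" using I0[OF r] by (simp add: eval3_diff)
      also have "\<dots> \<in> rat_adjoin {x, y, t}" unfolding eval3_hom eval3_variables
        by (intro rat_adjoin.add rat_adjoin.mult p1 rat_adjoin.gen) simp_all
      finally show ?thesis .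
    qed
    thus "f \<in> rat_adjoin {x, y, t}" unfolding f by (intro rat_adjoin.mult rat_adjoin.inverse)
  qed
  ultimately show ?thesis
    unfolding is_function_field_via_def by (simp add: eval3_hom eval3_1)
qed

end

section \<open>The coordinates\<close>

definition p81 :: mero_uhp where "p81 = W_81 + 3 / W_81"
definition g81 :: mero_uhp where "g81 = F_81 / W_81"
text \<open>On the cubic relating p and g, x has a double pole at the point at infinity where g / p
  is 1 and is regular at the two others. \<open>y81\<close> equals p (x - 1) - g + 1; the poles of
  its terms cancel at the two others, leaving a triple pole at the first. These are Weierstrass
  coordinates.\<close>

definition x81 :: mero_uhp where "x81 = (g81 ^ 2 + g81 * p81 + p81 ^ 2 - 3) / 3"
definition y81 :: mero_uhp where "y81 = (p81 * (3 * x81 + 3) - 6 * p81 - 3 * g81 + 3) / 3"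
text \<open>Away from the origin of the elliptic curve, p has poles at the two points with x^2 - x +
  1 = 0 and y = -x. This polynomial vanishes at both, so the square of \<open>t81\<close> has no
  denominator in x and y; its other zeros are dictated by the prescribed equation for t.\<close>

definition h81 :: mero_uhp where
  "h81 = - 11 - 2 * x81 + 6 * x81 ^ 2 - 5 * x81 ^ 3 + x81 ^ 4 + (- 12 + 15 * x81 - 3 * x81 ^ 2) * y81"
definition t81 :: mero_uhp where "t81 = (W_81 - 3 / W_81) * h81"

lemma pullback_const [simp]:
  assumes "pos_det M"
  shows "pullback M 0 = 0" "pullback M 1 = 1" "pullback M (numeral n) = numeral n" "pullback M (of_rat r) = of_rat r"
  using pullback_mconst[OF assms, of 0] pullback_mconst[OF assms, of 1] pullback_mconst[OF assms, of "numeral n"]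
    pullback_mconst[OF assms, of "of_rat r"] by simp_all

lemmas pullback_hom = pullback_add pullback_mult pullback_minus pullback_diff pullback_divide pullback_power pullback_inverse

lemma W_81_nz: "W_81 \<noteq> 0"
proof
  assume "W_81 = 0"
  hence "pullback (1, 0, 0, 9) W_81 = 0" by simp
  moreover have "pullback (1, 0, 0, 9) W_81 = pullback (9, 0, 0, 9) W_mero"
    unfolding W_81_def by (subst pullback_comp(2)) simp_all
  moreover have "pullback (9, 0, 0, 9) W_mero = W_mero"
    by (rule eval_mero_eqI) (simp add: eval_pullback moeb_def moebius_def)
  ultimately show False using W_mero_nz by simp
qed

lemma F_81_cube: "F_81 ^ 3 = W_81 ^ 6 + 9 * W_81 ^ 3 + 27"
  using arg_cong[OF F_mero_cube, of "pullback (9, 0, 0, 1)"] by (simp add: W_81_def F_81_def pullback_hom)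

text \<open>Nine times -1/(81 z) is -1/(9 z), which is -1/t at t = 9z; the common factor 9 of the
  matrix entries acts trivially.\<close>

lemma fricke_W_81: "pullback (0, - 1, 81, 0) W_81 = 3 / W_81"
  and fricke_F_81: "pullback (0, - 1, 81, 0) F_81 = 3 * F_81 / W_81 ^ 2"
proof -
  have e: "pullback (0, - 1, 81, 0) (pullback (9, 0, 0, 1) f) = pullback (9, 0, 0, 1) (pullback (0, - 1, 1, 0) f)" for f
  proof -
    have "pullback (0, - 1, 81, 0) (pullback (9, 0, 0, 1) f) = pullback (0, - 9, 81, 0) f"
      by (subst pullback_comp(2)) simp_all
    also have "\<dots> = pullback (0, - 1, 9, 0) f"
      by (rule eval_mero_eqI) (simp add: eval_pullback moeb_def moebius_def)
    also have "\<dots> = pullback (9, 0, 0, 1) (pullback (0, - 1, 1, 0) f)"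
      by (subst pullback_comp(2)) simp_all
    finally show ?thesis .
  qed
  show "pullback (0, - 1, 81, 0) W_81 = 3 / W_81" "pullback (0, - 1, 81, 0) F_81 = 3 * F_81 / W_81 ^ 2"
    unfolding W_81_def F_81_def e by (simp_all add: W_mero_S F_mero_S pullback_hom)
qed

lemma g81_cube: "g81 ^ 3 = p81 ^ 3 - 9 * p81 + 9"
  using F_81_cube W_81_nz unfolding g81_def p81_def by (simp add: field_simps power2_eq_square power3_eq_cube eval_nat_numeral)

lemma y81_eq: "y81 ^ 2 + y81 = x81 ^ 3"
  and g81_eq: "g81 * (x81 + 1) = p81 * (x81 + 1) + 3 * (1 - p81)"
  and p81_eq: "p81 * (x81 ^ 2 - x81 + 1) = (y81 - 1) * (x81 + 1) + 3"
  using elliptic_identity[OF g81_cube, of x81 y81] by (simp_all add: x81_def y81_def)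

lemma fricke:
  "pullback (0, - 1, 81, 0) p81 = p81" "pullback (0, - 1, 81, 0) g81 = g81"
  "pullback (0, - 1, 81, 0) x81 = x81" "pullback (0, - 1, 81, 0) y81 = y81"
  "pullback (0, - 1, 81, 0) t81 = - t81"
proof -
  show p: "pullback (0, - 1, 81, 0) p81 = p81"
    using W_81_nz by (simp add: p81_def pullback_hom fricke_W_81 add.commute)
  show g: "pullback (0, - 1, 81, 0) g81 = g81"
    using W_81_nz by (simp add: g81_def pullback_hom fricke_W_81 fricke_F_81 power2_eq_square)
  show x: "pullback (0, - 1, 81, 0) x81 = x81"
    by (simp add: x81_def pullback_hom p g)
  show y: "pullback (0, - 1, 81, 0) y81 = y81"
    by (simp add: y81_def pullback_hom p g x)
  have "pullback (0, - 1, 81, 0) h81 = h81"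
    by (simp add: h81_def pullback_hom x y)
  thus "pullback (0, - 1, 81, 0) t81 = - t81"
    using W_81_nz by (simp add: t81_def pullback_hom fricke_W_81 algebra_simps)
qed

lemma fricke_rat_adjoin: "f \<in> rat_adjoin {x81, y81} \<Longrightarrow> pullback (0, - 1, 81, 0) f = f"
  by (induction rule: rat_adjoin.induct) (auto simp: pullback_hom fricke)

lemma atkin_lehner_81: "f \<in> X0_functions_C 81 \<Longrightarrow> atkin_lehner 81 81 f = pullback (0, - 1, 81, 0) f"
  by (rule atkin_lehner_eq)
     (auto simp: atkin_lehner_matrices_def intro!: exI[of _ 0] exI[of _ "- 1"] exI[of _ 1])

lemma rat_adjoin_0: "0 \<in> rat_adjoin S" and rat_adjoin_1: "1 \<in> rat_adjoin S"
  and rat_adjoin_numeral: "numeral n \<in> rat_adjoin S"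
  using rat_adjoin.rat[of 0 S] rat_adjoin.rat[of 1 S] rat_adjoin.rat[of "numeral n" S] by simp_all
lemma rat_adjoin_diff: "a \<in> rat_adjoin S \<Longrightarrow> b \<in> rat_adjoin S \<Longrightarrow> a - b \<in> rat_adjoin S"
  unfolding diff_conv_add_uminus by (intro rat_adjoin.add rat_adjoin.uminus)
lemma rat_adjoin_divide: "a \<in> rat_adjoin S \<Longrightarrow> b \<in> rat_adjoin S \<Longrightarrow> a / b \<in> rat_adjoin S"
  unfolding divide_inverse by (intro rat_adjoin.mult rat_adjoin.inverse)
lemma rat_adjoin_power: "a \<in> rat_adjoin S \<Longrightarrow> a ^ n \<in> rat_adjoin S"
  by (induction n) (auto intro: rat_adjoin_1 rat_adjoin.mult)

lemmas rat_adjoin_rules = rat_adjoin.add rat_adjoin.mult rat_adjoin.uminus rat_adjoin.inverse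
  rat_adjoin_0 rat_adjoin_1 rat_adjoin_numeral rat_adjoin_diff rat_adjoin_divide rat_adjoin_power

lemma rat_adjoin_subset: "S \<subseteq> rat_adjoin T \<Longrightarrow> rat_adjoin S \<subseteq> rat_adjoin T"
proof
  fix f assume S: "S \<subseteq> rat_adjoin T" and "f \<in> rat_adjoin S"
  from this(2) show "f \<in> rat_adjoin T"
    by (induction rule: rat_adjoin.induct) (use S in \<open>auto intro: rat_adjoin.intros\<close>)
qed

lemma X0Q_W_81_F_81: "X0_functions_Q 81 = rat_adjoin {W_81, F_81}"
proof
  show "X0_functions_Q 81 \<subseteq> rat_adjoin {W_81, F_81}"
    using descent[of _ "{W_81, F_81}"] X0C_complex_field W_81_X0Q F_81_X0Q by (auto simp: X0Q_iff)
  show "rat_adjoin {W_81, F_81} \<subseteq> X0_functions_Q 81"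
    by (rule rat_adjoin_X0Q) (use W_81_X0Q F_81_X0Q in simp)
qed

lemma coords_X0Q: "x81 \<in> X0_functions_Q 81" "y81 \<in> X0_functions_Q 81" "t81 \<in> X0_functions_Q 81"
proof -
  have "W_81 \<in> rat_adjoin {W_81, F_81}" "F_81 \<in> rat_adjoin {W_81, F_81}" by (auto intro: rat_adjoin.gen)
  thus "x81 \<in> X0_functions_Q 81" "y81 \<in> X0_functions_Q 81" "t81 \<in> X0_functions_Q 81"
    unfolding X0Q_W_81_F_81 t81_def h81_def y81_def x81_def g81_def p81_def by - (intro rat_adjoin_rules; assumption)+
qed

subsection \<open>Transcendence\<close>

lemma regular_at_inverse:
  assumes "z \<in> uhp" "regular_at f z" "eval_mero f z \<noteq> 0"
  shows "regular_at (inverse f) z"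
proof -
  have "(\<lambda>z. inverse (eval_mero f z)) analytic_on {z}"
    using assms(2,3) unfolding regular_at_def by (intro analytic_on_inverse) auto
  from regular_atI(1)[OF assms(1) ae_at[OF eval_mero_ops_ae(7) assms(1)] this] show ?thesis .
qed

lemma filterlim_9_at_cusp: "filterlim (\<lambda>z. 9 * z) at_cusp at_cusp"
  unfolding filterlim_def le_filter_def eventually_filtermap eventually_at_cusp
proof (intro allI impI)
  fix P assume "\<exists>R. \<forall>z. R < Im z \<longrightarrow> P z"
  then obtain R where "\<forall>z. R < Im z \<longrightarrow> P z" by blast
  thus "\<exists>R. \<forall>z. R < Im z \<longrightarrow> P (9 * z)" by (intro exI[of _ "R / 9"]) simp
qed

text \<open>W and F at 9z behave like q^(-1) and q^(-2), so each of g^2, g p and p^2 behaves like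
  q^(-2), and so does \<open>x81\<close> with leading coefficient (1 + 1 + 1) / 3 = 1.\<close>

lemma x81_at_cusp:
  "eventually (\<lambda>z. regular_at x81 z) at_cusp" "filterlim (eval_mero x81) at_infinity at_cusp"
proof -
  let ?W = "\<lambda>z. W_fun (9 * z)" and ?F = "\<lambda>z. F_fun (9 * z)"
  let ?N = "\<lambda>z. ?F z ^ 2 + ?F z * (?W z ^ 2 + 3) + (?W z ^ 2 + 3) ^ 2"
  have W: "((\<lambda>z. ?W z * ee (9 * z / 9)) \<longlongrightarrow> 1) at_cusp"
    by (rule filterlim_compose[OF W_fun_asymp filterlim_9_at_cusp])
  have F: "((\<lambda>z. ?F z * ee (9 * z / 9) ^ 2) \<longlongrightarrow> 1) at_cusp"
    by (rule filterlim_compose[OF F_fun_asymp filterlim_9_at_cusp])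
  have q: "(ee \<longlongrightarrow> 0) at_cusp" using ee_tendsto_0[of 1] by simp
  have Wnz: "eventually (\<lambda>z. ?W z * ee (9 * z / 9) \<noteq> 0) at_cusp"
    by (rule tendsto_imp_eventually_ne[OF W]) simp
  have x: "x81 = ((F_81 ^ 2 + F_81 * (W_81 ^ 2 + mconst 3) + (W_81 ^ 2 + mconst 3) ^ 2) * inverse (W_81 ^ 2) ) * mconst (inverse 3) + mconst (- 1)"
    using W_81_nz unfolding mconst_inverse mconst_minus mconst_numeral mconst_1 x81_def g81_def p81_def
    by (simp add: field_simps power2_eq_square)
  have ev: "eventually (\<lambda>z. regular_at x81 z \<and> eval_mero x81 z = ?N z / ?W z ^ 2 / 3 - 1) at_cusp"
    using Wnz at_cusp_gt[of 0]
  proof eventually_elim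
    case (elim z)
    hence z: "z \<in> uhp" "9 * z \<in> uhp" by (simp_all add: uhp_def)
    have W: "regular_at W_81 z" "eval_mero W_81 z = ?W z"
      unfolding W_81_def using z by (auto intro!: pullback_regular_at regular_at_W_mero simp: eval_pullback moeb_9 eval_W_mero)
    have F: "regular_at F_81 z" "eval_mero F_81 z = ?F z"
      unfolding F_81_def using z by (auto intro!: pullback_regular_at regular_at_F_mero simp: eval_pullback moeb_9 eval_F_mero)
    note m = regular_at_mconst[OF z(1)] eval_mconst[OF z(1)]
    note ops = regular_at_add[OF z(1)] regular_at_mult[OF z(1)] regular_at_power[OF z(1)]
    have W2: "regular_at (W_81 ^ 2) z \<and> eval_mero (W_81 ^ 2) z = ?W z ^ 2" using ops(3)[OF W(1), of 2] W(2) by simp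
    hence I: "regular_at (inverse (W_81 ^ 2)) z \<and> eval_mero (inverse (W_81 ^ 2)) z = inverse (?W z ^ 2)"
      using eval_inverse[OF z(1)] regular_at_inverse[OF z(1)] elim(1) by auto
    have W3: "regular_at (W_81 ^ 2 + mconst 3) z \<and> eval_mero (W_81 ^ 2 + mconst 3) z = ?W z ^ 2 + 3"
      using ops(1)[OF conjunct1[OF W2] m(1)[of 3]] W2 m(2)[of 3] by simp
    have N: "regular_at (F_81 ^ 2 + F_81 * (W_81 ^ 2 + mconst 3) + (W_81 ^ 2 + mconst 3) ^ 2) z \<and>
        eval_mero (F_81 ^ 2 + F_81 * (W_81 ^ 2 + mconst 3) + (W_81 ^ 2 + mconst 3) ^ 2) z = ?N z"
      using W3 F by (simp add: ops del: mconst_numeral)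
    note B = ops(2)[OF conjunct1[OF N] conjunct1[OF I]]
    note C = ops(2)[OF conjunct1[OF B] m(1)[of "inverse 3"]]
    note D = ops(1)[OF conjunct1[OF C] m(1)[of "- 1"]]
    have "eval_mero x81 z = ?N z * inverse (?W z ^ 2) * inverse 3 + - 1"
      unfolding x conjunct2[OF D] conjunct2[OF C] conjunct2[OF B] conjunct2[OF N] conjunct2[OF I] m(2) ..
    moreover have "regular_at x81 z" unfolding x by (rule conjunct1[OF D])
    ultimately show ?case by (simp only: divide_inverse add_uminus_conv_diff simp_thms)
  qed
  show "eventually (\<lambda>z. regular_at x81 z) at_cusp" using ev by eventually_elim simp
  let ?f = "\<lambda>z. ((?F z * ee z ^ 2) ^ 2 + ?F z * ee z ^ 2 * ((?W z * ee z) ^ 2 + 3 * ee z ^ 2) + ((?W z * ee z) ^ 2 + 3 * ee z ^ 2) ^ 2) / (?W z * ee z) ^ 2 / 3 - ee z ^ 2"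
  have "(?f \<longlongrightarrow> (1 ^ 2 + 1 * (1 ^ 2 + 3 * 0 ^ 2) + (1 ^ 2 + 3 * 0 ^ 2) ^ 2) / 1 ^ 2 / 3 - 0 ^ 2) at_cusp"
    using W F q by (intro tendsto_intros) simp_all
  also have "(1 ^ 2 + 1 * (1 ^ 2 + 3 * 0 ^ 2) + (1 ^ 2 + 3 * 0 ^ 2) ^ 2) / 1 ^ 2 / 3 - 0 ^ 2 = (1 :: complex)" by simp
  finally have L: "(?f \<longlongrightarrow> 1) at_cusp" .
  have c: "((f * e ^ 2) ^ 2 + f * e ^ 2 * ((w * e) ^ 2 + 3 * e ^ 2) + ((w * e) ^ 2 + 3 * e ^ 2) ^ 2) / (w * e) ^ 2 / 3 - e ^ 2 =
      ((f ^ 2 + f * (w ^ 2 + 3) + (w ^ 2 + 3) ^ 2) / w ^ 2 / 3 - 1) * e ^ 2" if "e \<noteq> 0" "w \<noteq> 0" for e f w :: complex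
    using that by (simp add: field_simps power2_eq_square)
  have "eventually (\<lambda>z. ?f z = eval_mero x81 z * ee z ^ 2) at_cusp"
    using ev Wnz by eventually_elim (simp only: c ee_nz simp_thms mult_eq_0_iff de_Morgan_disj not_False_eq_True)
  hence "((\<lambda>z. eval_mero x81 z * ee z ^ 2) \<longlongrightarrow> 1) at_cusp" using L by (rule tendsto_cong[THEN iffD1])
  moreover have "filterlim (\<lambda>z. ee z ^ 2) (at 0) at_cusp"
    using tendsto_power[OF q, of 2] by (simp add: filterlim_at)
  ultimately have "filterlim (\<lambda>z. eval_mero x81 z * ee z ^ 2 / ee z ^ 2) at_infinity at_cusp"
    by (rule filterlim_divide_at_infinity) simp
  thus "filterlim (eval_mero x81) at_infinity at_cusp" by simp
qed

text \<open>The roots of a nonzero polynomial are bounded, while \<open>x81\<close> is unbounded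
  near the cusp.\<close>

lemma x81_transcendental:
  assumes "poly (map_poly of_rat P) x81 = 0"
  shows "P = 0"
proof (rule ccontr)
  assume P: "P \<noteq> 0"
  let ?c = "of_rat :: rat \<Rightarrow> complex"
  have ev: "regular_at (poly (map_poly of_rat Q) x81) z \<and> eval_mero (poly (map_poly of_rat Q) x81) z = poly (map_poly of_rat Q) (eval_mero x81 z)"
    if z: "z \<in> uhp" "regular_at x81 z" for Q z
  proof (induction Q)
    case 0
    show ?case using regular_at_mconst[OF z(1), of 0] eval_mconst[OF z(1), of 0] by simp
  next
    case (pCons a Q)
    note m = regular_at_mult[OF z(1) z(2) conjunct1[OF pCons(2)]]
    show ?case using regular_at_add[OF z(1) regular_at_mconst[OF z(1), of "of_rat a"] conjunct1[OF m]] m pCons(2)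
      by (simp add: map_poly_pCons eval_mconst[OF z(1), of "of_rat a", simplified])
  qed
  let ?P = "map_poly ?c P"
  have "?P \<noteq> 0" using P by (simp add: map_poly_eq_0_iff)
  hence "finite {w. poly ?P w = 0}" by (rule poly_roots_finite)
  then obtain C where C: "norm w \<le> C" if "poly ?P w = 0" for w
    using finite_imp_bounded[of "{w. poly ?P w = 0}"] unfolding bounded_iff by blast
  have "eventually (\<lambda>z. norm (eval_mero x81 z) > C) at_cusp"
    using filterlim_at_infinity_imp_norm_at_top[OF x81_at_cusp(2)] unfolding filterlim_at_top_dense by blast
  with x81_at_cusp(1) at_cusp_gt[of 0] have "eventually (\<lambda>z. False) at_cusp"
  proof eventually_elim
    case (elim z)
    hence "z \<in> uhp" by (simp add: uhp_def)
    hence "poly ?P (eval_mero x81 z) = 0" using ev[of z P] elim(1) assms eval_mconst[of z 0] by simp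
    thus ?case using C[of "eval_mero x81 z"] elim(3) by simp
  qed
  thus False using at_cusp_nontrivial by simp
qed

text \<open>Eliminating y gives the polynomial identity a (a - b) = b^2 X^3. If b is nonzero the
  degree on the right is odd, while on the left it is even or too small.\<close>

lemma x81_y81_independent:
  assumes "poly (map_poly of_rat a) x81 + poly (map_poly of_rat b) x81 * y81 = 0"
  shows "a = 0 \<and> b = 0"
proof -
  let ?e = "\<lambda>p. poly (map_poly of_rat p) x81"
  have add: "?e (p + q) = ?e p + ?e q" and mult: "?e (p * q) = ?e p * ?e q" for p q
    by (rule poly_map_hom; simp add: of_rat_add of_rat_mult)+
  have X: "?e [:0, 1:] = x81" by (simp add: map_poly_pCons)
  have "?e a * ?e a = ?e a * ?e b + (?e b * ?e b) * (x81 * (x81 * x81))"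
  proof -
    have a: "?e a = - (?e b * y81)" using assms by (simp add: eq_neg_iff_add_eq_0)
    have "x81 * (x81 * x81) = y81 ^ 2 + y81" using y81_eq by (simp add: power3_eq_cube mult.assoc)
    thus ?thesis unfolding a by algebra
  qed
  hence "?e (a * a) = ?e (a * b + (b * b) * ([:0, 1:] * ([:0, 1:] * [:0, 1:])))"
    by (simp only: add mult X)
  hence "?e (a * a + [:- 1:] * (a * b + (b * b) * ([:0, 1:] * ([:0, 1:] * [:0, 1:])))) = 0"
    unfolding add[of "a * a"] mult[of "[:- 1:]"] by (simp add: map_poly_pCons of_rat_minus del: mult_pCons_left mult_pCons_right)
  from x81_transcendental[OF this] have "a * a + [:- 1:] * (a * b + (b * b) * ([:0, 1:] * ([:0, 1:] * [:0, 1:]))) = 0" .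
  moreover have "[:- 1:] * u = - u" for u :: "rat poly" by simp
  moreover have "[:0, 1:] * ([:0, 1:] * [:0, 1:]) = ([:0, 0, 0, 1:] :: rat poly)" by simp
  ultimately have "a * a - (a * b + (b * b) * [:0, 0, 0, 1:]) = 0"
    by (simp only: add_uminus_conv_diff)
  hence "a * a = a * b + (b * b) * [:0, 0, 0, 1:]" by (simp only: right_minus_eq)
  hence eq: "a * (a - b) = (b * b) * [:0, 0, 0, 1:]" by (simp only: right_diff_distrib add_diff_cancel_left')
  have "b = 0"
  proof (rule ccontr)
    assume b: "b \<noteq> 0"
    hence d: "degree ((b * b) * [:0, 0, 0, 1:]) = 2 * degree b + 3" by (simp add: degree_mult_eq del: mult_pCons_right)
    show False
    proof (cases "degree a \<le> degree b")
      case True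
      have "degree (a * (a - b)) \<le> degree a + degree (a - b)" by (rule degree_mult_le)
      also have "\<dots> \<le> degree b + degree b" using degree_diff_le[of a "degree b" b] True by simp
      finally show False using eq d by simp
    next
      case False
      hence "degree (a - b) = degree a" using degree_add_eq_left[of "- b" a] by simp
      moreover have "a \<noteq> 0" "a - b \<noteq> 0" using False by auto
      ultimately have "degree (a * (a - b)) = 2 * degree a" by (simp add: degree_mult_eq)
      hence "2 * degree a = 2 * degree b + 3" using eq d by simp
      thus False by presburger
    qed
  qed
  thus ?thesis using eq by simp
qed

lemma x81_y81_nonzero: "x81 + 1 \<noteq> 0" "x81 ^ 2 - x81 + 1 \<noteq> 0" "h81 \<noteq> 0" "p81 ^ 2 - 12 \<noteq> 0"
proof -
  show "x81 + 1 \<noteq> 0" using x81_y81_independent[of "[:1, 1:]" 0] by (auto simp: map_poly_pCons add.commute)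
  show D: "x81 ^ 2 - x81 + 1 \<noteq> 0"
    using x81_y81_independent[of "[:1, - 1, 1:]" 0] by (auto simp: map_poly_pCons algebra_simps power2_eq_square of_rat_minus)
  show "h81 \<noteq> 0"
    using x81_y81_independent[of "[:- 11, - 2, 6, - 5, 1:]" "[:- 12, 15, - 3:]"]
    by (auto simp: h81_def map_poly_pCons algebra_simps eval_nat_numeral of_rat_minus)
  show "p81 ^ 2 - 12 \<noteq> 0"
  proof
    assume "p81 ^ 2 - 12 = 0"
    \<comment> \<open>This is (x^2 - x + 1)^2 (p^2 - 12) written as a combination of 1 and y over
      the polynomials in x.\<close>
    hence "x81 * (x81 * (x81 * (x81 * (x81 - 10) + 25) - 35) + 20) - 8 + (x81 * (x81 * - 3) + 3) * y81 = 0"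
      using p81_eq y81_eq by algebra
    thus False using x81_y81_independent[of "[:- 8, 20, - 35, 25, - 10, 1:]" "[:3, 0, - 3:]"]
      by (auto simp: map_poly_pCons algebra_simps of_rat_minus)
  qed
qed

lemma t81_sq: "t81 ^ 2 = (p81 ^ 2 - 12) * h81 ^ 2" and t81_nz: "t81 \<noteq> 0"
proof -
  have "(W_81 - 3 / W_81) ^ 2 = p81 ^ 2 - 12"
    using W_81_nz by (simp add: p81_def field_simps power2_eq_square)
  thus "t81 ^ 2 = (p81 ^ 2 - 12) * h81 ^ 2" by (simp add: t81_def power_mult_distrib)
  thus "t81 \<noteq> 0" using x81_y81_nonzero by auto
qed

lemma t81_equation: "t81 ^ 2 =
     - 968 + 132 * x81 + 837 * x81^2 - 3213 * x81^3 + 4107 * x81^4 - 2223 * x81^5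
            + 510 * x81^6 - 21 * x81^7 - 9 * x81^8 + x81^9
            - 3 * (- 1 + x81) * (- 29 + 27 * x81 - 9 * x81^2 + x81^3)
                * (11 + 24 * x81 - 15 * x81^2 + 2 * x81^3) * y81"
  unfolding t81_sq h81_def by (rule quadratic_identity[OF y81_eq p81_eq x81_y81_nonzero(2)])

text \<open>The coordinates are inverted step by step: p from x and y, then g, then W from W + 3 / W
  = p and W - 3 / W = t / h, finally F = g W.\<close>

lemma X0Q_coords: "X0_functions_Q 81 = rat_adjoin {x81, y81, t81}"
proof
  let ?K = "rat_adjoin {x81, y81, t81}"
  have gen: "x81 \<in> ?K" "y81 \<in> ?K" "t81 \<in> ?K" by (auto intro: rat_adjoin.gen)
  have p: "p81 = ((y81 - 1) * (x81 + 1) + 3) / (x81 ^ 2 - x81 + 1)"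
    using p81_eq x81_y81_nonzero(2) by (simp add: eq_divide_eq)
  have g: "g81 = p81 + 3 * (1 - p81) / (x81 + 1)"
    using g81_eq x81_y81_nonzero(1) by (simp add: field_simps)
  have W: "W_81 = (p81 + t81 / h81) / 2"
    using x81_y81_nonzero(3) by (simp add: p81_def t81_def)
  have F: "F_81 = g81 * W_81" using W_81_nz by (simp add: g81_def)
  have "p81 \<in> ?K" unfolding p by (intro rat_adjoin_rules gen)
  moreover from this have "g81 \<in> ?K" unfolding g by (intro rat_adjoin_rules gen)
  moreover have "h81 \<in> ?K" unfolding h81_def by (intro rat_adjoin_rules gen)
  ultimately have "W_81 \<in> ?K" "g81 \<in> ?K" unfolding W by - (intro rat_adjoin_rules gen; assumption)+
  hence "{W_81, F_81} \<subseteq> ?K" unfolding F by (auto intro: rat_adjoin.mult)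
  thus "X0_functions_Q 81 \<subseteq> ?K" unfolding X0Q_W_81_F_81 by (rule rat_adjoin_subset)
  show "?K \<subseteq> X0_functions_Q 81" by (rule rat_adjoin_X0Q) (use coords_X0Q in auto)
qed

text \<open>The functions a + b t over Q(x, y) are closed under products because t^2 lies in Q(x,
  y), and under inverses by means of the conjugate a - b t.\<close>

lemma X0Q_decompose:
  assumes "f \<in> X0_functions_Q 81"
  obtains a b where "a \<in> rat_adjoin {x81, y81}" "b \<in> rat_adjoin {x81, y81}" "f = a + b * t81"
proof -
  let ?K = "rat_adjoin {x81, y81}"
  have gen: "x81 \<in> ?K" "y81 \<in> ?K" by (auto intro: rat_adjoin.gen)
  have t2: "t81 ^ 2 \<in> ?K" unfolding t81_equation by (intro rat_adjoin_rules gen)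
  have "\<exists>a\<in>?K. \<exists>b\<in>?K. f = a + b * t81"
    using assms unfolding X0Q_coords
  proof (induction rule: rat_adjoin.induct)
    case (rat c)
    show ?case by (intro bexI[of _ "of_rat c"] bexI[of _ 0]) (simp_all add: rat_adjoin.rat rat_adjoin_0)
  next
    case (gen s)
    show ?case
    proof (cases "s = t81")
      case True
      thus ?thesis by (intro bexI[of _ 0] bexI[of _ 1]) (simp_all add: rat_adjoin_0 rat_adjoin_1)
    next
      case False
      thus ?thesis using gen by (intro bexI[of _ s] bexI[of _ 0]) (auto simp: rat_adjoin_0 intro: rat_adjoin.gen)
    qed
  next
    case (add f g)
    then obtain a b c d where K: "a \<in> ?K" "b \<in> ?K" "c \<in> ?K" "d \<in> ?K" and fg: "f = a + b * t81" "g = c + d * t81" by blast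
    show ?case
      by (intro bexI[of _ "a + c"] bexI[of _ "b + d"] rat_adjoin.add K) (simp add: fg algebra_simps)
  next
    case (uminus f)
    then obtain a b where K: "a \<in> ?K" "b \<in> ?K" and f: "f = a + b * t81" by blast
    show ?case
      by (intro bexI[of _ "- a"] bexI[of _ "- b"] rat_adjoin.uminus K) (simp add: f)
  next
    case (mult f g)
    then obtain a b c d where K: "a \<in> ?K" "b \<in> ?K" "c \<in> ?K" "d \<in> ?K" and fg: "f = a + b * t81" "g = c + d * t81" by blast
    show ?case
      by (intro bexI[of _ "a * c + b * d * t81 ^ 2"] bexI[of _ "a * d + b * c"] rat_adjoin.add rat_adjoin.mult t2 K)
         (simp add: fg algebra_simps power2_eq_square)
  next
    case (inverse f)
    then obtain a b where K: "a \<in> ?K" "b \<in> ?K" and f: "f = a + b * t81" by blast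
    show ?case
    proof (cases "f = 0")
      case True
      thus ?thesis by (intro bexI[of _ 0]) (simp_all add: rat_adjoin_0)
    next
      case False
      \<comment> \<open>The involution carries the conjugate to f, so the conjugate vanishes only if
        f does. This takes the place of an irreducibility argument for the equation of t.\<close>
      have fc: "pullback (0, - 1, 81, 0) (a - b * t81) = f"
        by (simp add: f pullback_hom fricke fricke_rat_adjoin K)
      have conj: "a - b * t81 \<noteq> 0"
      proof
        assume "a - b * t81 = 0"
        thus False using fc False by simp
      qed
      have n: "f * (a - b * t81) = a ^ 2 - b ^ 2 * t81 ^ 2" by (simp add: f algebra_simps power2_eq_square)
      have "inverse f = (a - b * t81) / (a ^ 2 - b ^ 2 * t81 ^ 2)"
        unfolding n[symmetric] using conj False by (simp add: field_simps)
      also have "\<dots> = a / (a ^ 2 - b ^ 2 * t81 ^ 2) + (- b / (a ^ 2 - b ^ 2 * t81 ^ 2)) * t81"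
        by (simp add: diff_divide_distrib)
      finally show ?thesis
        by (intro bexI[of _ "a / (a ^ 2 - b ^ 2 * t81 ^ 2)"] bexI[of _ "- b / (a ^ 2 - b ^ 2 * t81 ^ 2)"] rat_adjoin_rules K t2)
    qed
  qed
  thus ?thesis using that by blast
qed

lemma X0Q_fixed: "{f \<in> X0_functions_Q 81. pullback (0, - 1, 81, 0) f = f} = rat_adjoin {x81, y81}"
proof (intro equalityI subsetI)
  fix f assume "f \<in> {f \<in> X0_functions_Q 81. pullback (0, - 1, 81, 0) f = f}"
  hence f: "f \<in> X0_functions_Q 81" "pullback (0, - 1, 81, 0) f = f" by auto
  from f(1) obtain a b where K: "a \<in> rat_adjoin {x81, y81}" "b \<in> rat_adjoin {x81, y81}" "f = a + b * t81"
    by (rule X0Q_decompose)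
  have "pullback (0, - 1, 81, 0) f = a - b * t81"
    by (simp add: K pullback_hom fricke fricke_rat_adjoin)
  hence "b * t81 = 0" using f(2) K(3) t81_nz by auto
  thus "f \<in> rat_adjoin {x81, y81}" using K t81_nz by auto
next
  fix f assume f: "f \<in> rat_adjoin {x81, y81}"
  moreover have "rat_adjoin {x81, y81} \<subseteq> X0_functions_Q 81"
    by (rule rat_adjoin_X0Q) (use coords_X0Q in auto)
  ultimately show "f \<in> {f \<in> X0_functions_Q 81. pullback (0, - 1, 81, 0) f = f}"
    using fricke_rat_adjoin by auto
qed

text \<open>The involution separates the part without t from the part with t, and each is settled by
  \<open>x81_y81_independent\<close>.\<close>

lemma coords_independent:
  assumes "(poly (map_poly of_rat a) x81 + poly (map_poly of_rat b) x81 * y81) +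
       (poly (map_poly of_rat c) x81 + poly (map_poly of_rat d) x81 * y81) * t81 = 0" (is "?A + ?B * t81 = 0")
  shows "a = 0 \<and> b = 0 \<and> c = 0 \<and> d = 0"
proof -
  have e: "pullback (0, - 1, 81, 0) (poly (map_poly of_rat p) x81) = poly (map_poly of_rat p) x81" for p
    by (induction p) (simp_all add: map_poly_pCons pullback_hom fricke)
  have "pullback (0, - 1, 81, 0) (?A + ?B * t81) = ?A - ?B * t81"
    by (simp add: pullback_hom fricke e)
  hence "?A = 0" "?B = 0" using assms t81_nz by (simp_all add: eq_neg_iff_add_eq_0)
  thus ?thesis using x81_y81_independent by blast
qed

theorem mainTheorem18:
  shows "\<exists>x \<in> X0_functions_Q 81. \<exists>y \<in> X0_functions_Q 81. \<exists>t \<in> X0_functions_Q 81.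
    X0_functions_Q 81 = rat_adjoin {x, y, t} \<and>
    {f \<in> X0_functions_Q 81. atkin_lehner 81 81 f = f} = rat_adjoin {x, y} \<and>
    atkin_lehner 81 81 t = - t \<and>
    y^2 + y = x^3 \<and>
    t^2 = - 968 + 132 * x + 837 * x^2 - 3213 * x^3 + 4107 * x^4 - 2223 * x^5
            + 510 * x^6 - 21 * x^7 - 9 * x^8 + x^9
            - 3 * (- 1 + x) * (- 29 + 27 * x - 9 * x^2 + x^3)
                * (11 + 24 * x - 15 * x^2 + 2 * x^3) * y \<and>
    is_function_field_via (eval3 x y t)
      (ideal_generated2
        (Y3^2 + Y3 - X3^3)
        (T3^2 - (- 968 + 132 * X3 + 837 * X3^2 - 3213 * X3^3 + 4107 * X3^4 - 2223 * X3^5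
            + 510 * X3^6 - 21 * X3^7 - 9 * X3^8 + X3^9
            - 3 * (- 1 + X3) * (- 29 + 27 * X3 - 9 * X3^2 + X3^3)
                * (11 + 24 * X3 - 15 * X3^2 + 2 * X3^3) * Y3)))
      (X0_functions_Q 81)"
proof (rule bexI[of _ x81], rule bexI[of _ y81], rule bexI[of _ t81], intro conjI)
  have C: "f \<in> X0_functions_C 81" if "f \<in> X0_functions_Q 81" for f using that by (simp add: X0Q_iff)
  show "{f \<in> X0_functions_Q 81. atkin_lehner 81 81 f = f} = rat_adjoin {x81, y81}"
    unfolding X0Q_fixed[symmetric] using atkin_lehner_81 C by auto
  show "atkin_lehner 81 81 t81 = - t81"
    using atkin_lehner_81[OF C[OF coords_X0Q(3)]] fricke(5) by simp
  show "is_function_field_via (eval3 x81 y81 t81)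
      (ideal_generated2
        (Y3^2 + Y3 - X3^3)
        (T3^2 - (- 968 + 132 * X3 + 837 * X3^2 - 3213 * X3^3 + 4107 * X3^4 - 2223 * X3^5
            + 510 * X3^6 - 21 * X3^7 - 9 * X3^8 + X3^9
            - 3 * (- 1 + X3) * (- 29 + 27 * X3 - 9 * X3^2 + X3^3)
                * (11 + 24 * X3 - 15 * X3^2 + 2 * X3^3) * Y3)))
      (X0_functions_Q 81)"
    unfolding X0Q_coords
    \<comment> \<open>The right-hand side for T^2 is built from \<open>X3\<close>, \<open>Y3\<close>
      and numerals, so the closure rules of \<open>linear_mod\<close> put it into the form a(X) +
      b(X) Y.\<close>
    by (rule function_field[OF refl _ y81_eq _ coords_independent])
      (intro linear_mod_intros, simp_all only: eval3_simps eval3_variables t81_equation)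
qed (fact X0Q_coords y81_eq t81_equation coords_X0Q)+

end
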